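(* Let $d\ge3$, $T>0$, let the collision kernel $B$ satisfy the standing assumption on $B$ with exponent $\gamma\in(-\infty,1]$, and let $\Psi,\Psi^*,\theta$ satisfy the structural assumptions listed in the context. Let $(f_t)_{t\in[0,T]}$ be any curve of probability densities on $\mathbb{R}^d$ with $\mathcal{H}(f_0)<\infty$ and bounded moment of order $2+\max(0,\gamma)$, i.e. $\sup_{t\in[0,T]}\int|v|^{2+\max(0,\gamma)}f_t(v)\,\mathrm{d}v<\infty$, and let $(U_t)_{t\in[0,T]}$ be such that the collision rate equation holds for $(f_t,U_t)_{t\in[0,T]}$. Then $$\mathcal{L}_T(f,U):=\mathcal{H}(f_T)-\mathcal{H}(f_0)+\int_0^T\big[D_{\Psi^*}(f_t)+\mathcal{R}(f_t,U_t)\big]\mathrm{d}t\ \ge\ 0 .$$ Moreover, $\mathcal{L}_T(f,U)=0$ if and only if $(f_t)$ is a solution to the homogeneous Boltzmann equation and $U_t=(ff_*-f'f'_* )B$ (with $f=f_t$).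
   Context: Collisions. For $v,v_*\in\mathbb{R}^d$, $\omega\in S^{d-1}$: $v'=v-\langle v-v_*,\omega\rangle\omega$, $v'_*=v_*+\langle v-v_*,\omega\rangle\omega$; $f=f(v)$, $f_*=f(v_* )$, $f'=f(v')$, $f'_*=f(v'_* )$; $\bar\nabla\varphi=\varphi(v')+\varphi(v'_* )-\varphi(v)-\varphi(v_* )$. $\Omega=\mathbb{R}^d\times\mathbb{R}^d\times S^{d-1}$; $\mathrm{d}\omega$ is the surface measure on $S^{d-1}$; $\langle k\rangle=\sqrt{1+|k|^2}$; $B$ under an integral over $\Omega$ means $B(v-v_*,\omega)$. Standing assumption on $B$. $B:\mathbb{R}^d\times S^{d-1}\to\mathbb{R}_+$ is measurable, continuous in the first variable, satisfies $B(v'-v'_*,\omega)=B(v-v_*,\omega)$, and there are $\gamma\in(-\infty,1]$, $c_B>0$ with $c_B^{-1}\langle k\rangle^\gamma\le B(k,\omega)\le c_B\langle k\rangle^\gamma$ for all $k,\omega$. Entropy. $\mathcal{H}(f)=\int f\log f\,\mathrm{d}v$ if $\max(f\log f,0)$ is integrable; $+\infty$ otherwise. Collision rate equation. $(f_t,U_t)_{t\in[0,T]}$ satisfies the collision rate equation if $t\mapsto f_t(v)\,\mathrm{d}v$ is weakly continuous in the space of probability measures, $U_t:\Omega\to\mathbb{R}$ depends measurably on $t$ with $\int_0^T\int_\Omega|U_t|\,\mathrm{d}v\,\mathrm{d}v_*\,\mathrm{d}\omega\,\mathrm{d}t<\infty$, and for all bounded continuous $\varphi$ on $\mathbb{R}^d$,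 in the sense of distributions in time, $\frac{\mathrm{d}}{\mathrm{d}t}\int\varphi f_t\,\mathrm{d}v=\frac14\int_\Omega\bar\nabla\varphi\,U_t\,\mathrm{d}v\,\mathrm{d}v_*\,\mathrm{d}\omega$. Structural assumptions. (1) $\Psi^*:\mathbb{R}\to[0,\infty)$ is convex, differentiable, superlinear and even with $\Psi^*(0)=0$; $\Psi$ is the convex conjugate of $\Psi^*$ (so $\Psi$ is even with $\Psi(0)=0$). (2) $\theta:[0,\infty)^2\to[0,\infty)$ is continuous, concave, not identically $0$, symmetric, positively $1$-homogeneous, and $\theta(0,t)=0$ for all $t\ge0$. (3) $(\Psi^* )'(\log s-\log t)\,\theta(s,t)=s-t$ for all $s,t>0$; and there is a convex lower semicontinuous function $G_{\Psi^*}:[0,\infty)^2\to[0,\infty)$ with $\frac14\Psi^*(\log t-\log s)\theta(s,t)=G_{\Psi^*}(s,t)$ for all $s,t>0$ and with $G_{\Psi^*}(s,t)=0$ if and only if $s=t$. Dissipation potentials. Write $\theta(f)=\theta(ff_*,f'f'_* )$. Then $$\mathcal{R}(f,U)=\frac14\int_\Omega\Psi\Big(\frac{U}{\theta(f)B}\Big)\theta(f)B\,\mathrm{d}v\,\mathrm{d}v_*\,\mathrm{d}\omega,$$ where on $\{\theta(f)=0\}$ the integrand is $0$ if $U=0$ and $+\infty$ if $U\ne0$; and $$D_{\Psi^*}(f)=\frac14\int_\Omega\Psi^*(-\bar\nabla\log f)\,\theta(f)B\,\mathrm{d}v\,\mathrm{d}v_*\,\mathrm{d}\omega,$$ where $\frac14\Psi^*(-\bar\nabla\log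 f)\theta(f)$ is understood as $G_{\Psi^*}(ff_*,f'f'_* )$ (also where $ff_*$ or $f'f'_*$ vanishes). Solution. A solution to the homogeneous Boltzmann equation $\partial_tf=\int_{\mathbb{R}^d}\int_{S^{d-1}}[f'f'_*-ff_*]B(v-v_*,\omega)\,\mathrm{d}v_*\,\mathrm{d}\omega$ on $[0,T]$ is a family of probability densities $f\in C([0,T];L^1(\mathbb{R}^d))\cap L^\infty([0,T];L^1_2(\mathbb{R}^d))$, $L^1_2=\{f:\int\langle v\rangle^2|f|\,\mathrm{d}v<\infty\}$, such that for all $\varphi\in C_c^\infty(\mathbb{R}^d)$, in the sense of distributions in time, $\frac{\mathrm{d}}{\mathrm{d}t}\int\varphi f_t\,\mathrm{d}v=-\frac14\int_\Omega\bar\nabla\varphi\,(f'f'_*-ff_* )B\,\mathrm{d}v\,\mathrm{d}v_*\,\mathrm{d}\omega$. *)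

theory Defs
  imports "HOL-Analysis.Analysis"
begin

text \<open>
  The surface measure on the unit sphere, given by polar coordinates: a Borel set \<open>A\<close> of the
  sphere has measure \<open>d\<close> times the Lebesgue measure of the cone \<open>{r x | 0 < r < 1, x \<in> A}\<close>.
\<close>

definition sphere_measure :: "'a::euclidean_space measure" where
  "sphere_measure =
     scale_measure (ennreal (real DIM('a)))
       (distr (restrict_space lborel (ball 0 1 - {0})) (restrict_space borel (sphere 0 1))
         (\<lambda>x. x /\<^sub>R norm x))"

lemma space_sphere_measure: "space (sphere_measure :: 'a::euclidean_space measure) = sphere 0 1"
  by (simp add: sphere_measure_def space_scale_measure space_restrict_space)

lemma sets_sphere_measure:
  "sets (sphere_measure :: 'a::euclidean_space measure) = sets (restrict_space borel (sphere 0 1))"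
  by (simp add: sphere_measure_def)

lemma emeasure_sphere_measure:
  fixes A :: "'a::euclidean_space set"
  assumes "A \<in> sets borel" "A \<subseteq> sphere 0 1"
  shows "emeasure sphere_measure A =
    ennreal (real DIM('a)) * emeasure lborel {x \<in> ball 0 1 - {0}. x /\<^sub>R norm x \<in> A}"
proof -
  let ?M = "restrict_space lborel (ball 0 1 - {0}) :: 'a measure"
  have 1: "(\<lambda>x. x /\<^sub>R norm x) \<in> measurable ?M (restrict_space borel (sphere 0 1))"
    by (intro measurable_restrict_space2 measurable_restrict_space1)
       (auto simp: space_restrict_space)
  have 2: "A \<in> sets (restrict_space borel (sphere 0 1))"
    using assms by (auto simp: sets_restrict_space)
  have "(\<lambda>x. x /\<^sub>R norm x) -` A \<inter> space ?M = {x \<in> ball 0 1 - {0}. x /\<^sub>R norm x \<in> A}"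
    by (auto simp: space_restrict_space)
  then show ?thesis
    using 1 2 by (simp add: sphere_measure_def emeasure_distr)
      (subst emeasure_restrict_space; auto)
qed

definition Omega :: "('a::euclidean_space \<times> 'a \<times> 'a) measure" where
  "Omega = lborel \<Otimes>\<^sub>M (lborel \<Otimes>\<^sub>M sphere_measure)"

definition post :: "'a::euclidean_space \<Rightarrow> 'a \<Rightarrow> 'a \<Rightarrow> 'a" where
  "post v vs \<omega> = v - ((v - vs) \<bullet> \<omega>) *\<^sub>R \<omega>"

definition post_star :: "'a::euclidean_space \<Rightarrow> 'a \<Rightarrow> 'a \<Rightarrow> 'a" where
  "post_star v vs \<omega> = vs + ((v - vs) \<bullet> \<omega>) *\<^sub>R \<omega>"

definition coll_grad :: "('a::euclidean_space \<Rightarrow> real) \<Rightarrow> 'a \<times> 'a \<times> 'a \<Rightarrow> real" where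
  "coll_grad \<phi> = (\<lambda>(v, vs, \<omega>). \<phi> (post v vs \<omega>) + \<phi> (post_star v vs \<omega>) - \<phi> v - \<phi> vs)"

definition pre_prod :: "('a::euclidean_space \<Rightarrow> real) \<Rightarrow> 'a \<times> 'a \<times> 'a \<Rightarrow> real" where
  "pre_prod f = (\<lambda>(v, vs, \<omega>). f v * f vs)"

definition post_prod :: "('a::euclidean_space \<Rightarrow> real) \<Rightarrow> 'a \<times> 'a \<times> 'a \<Rightarrow> real" where
  "post_prod f = (\<lambda>(v, vs, \<omega>). f (post v vs \<omega>) * f (post_star v vs \<omega>))"

definition kern :: "('a::euclidean_space \<Rightarrow> 'a \<Rightarrow> real) \<Rightarrow> 'a \<times> 'a \<times> 'a \<Rightarrow> real" where
  "kern B = (\<lambda>(v, vs, \<omega>). B (v - vs) \<omega>)"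

definition japanese :: "'a::euclidean_space \<Rightarrow> real" where
  "japanese k = sqrt (1 + (norm k)\<^sup>2)"

text \<open>\<open>B\<close> is only relevant for second argument in the unit sphere.\<close>

definition collision_kernel :: "real \<Rightarrow> ('a::euclidean_space \<Rightarrow> 'a \<Rightarrow> real) \<Rightarrow> bool" where
  "collision_kernel \<gamma> B \<longleftrightarrow>
     (\<lambda>(k, \<omega>). B k \<omega>) \<in> borel_measurable (borel \<Otimes>\<^sub>M restrict_space borel (sphere 0 1)) \<and>
     (\<forall>k. \<forall>\<omega>\<in>sphere 0 1. 0 \<le> B k \<omega>) \<and>
     (\<forall>\<omega>\<in>sphere 0 1. continuous_on UNIV (\<lambda>k. B k \<omega>)) \<and>
     (\<forall>v vs. \<forall>\<omega>\<in>sphere 0 1. B (post v vs \<omega> - post_star v vs \<omega>) \<omega> = B (v - vs) \<omega>) \<and>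
     \<gamma> \<le> 1 \<and>
     (\<exists>c>0. \<forall>k. \<forall>\<omega>\<in>sphere 0 1.
        inverse c * japanese k powr \<gamma> \<le> B k \<omega> \<and> B k \<omega> \<le> c * japanese k powr \<gamma>)"

definition prob_density :: "('a::euclidean_space \<Rightarrow> real) \<Rightarrow> bool" where
  "prob_density f \<longleftrightarrow>
     f \<in> borel_measurable borel \<and> (\<forall>v. 0 \<le> f v) \<and> (\<integral>\<^sup>+v. ennreal (f v) \<partial>lborel) = 1"

text \<open>
  If the positive part of \<open>f log f\<close> is integrable, the integral is taken in the extended sense
  (it is \<open>-\<infinity>\<close> when the negative part is not integrable).
\<close>

definition entropy :: "('a::euclidean_space \<Rightarrow> real) \<Rightarrow> ereal" where
  "entropy f =
     (if integrable lborel (\<lambda>v. max (f v * ln (f v)) 0)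
      then enn2ereal (\<integral>\<^sup>+v. ennreal (f v * ln (f v)) \<partial>lborel)
         - enn2ereal (\<integral>\<^sup>+v. ennreal (- (f v * ln (f v))) \<partial>lborel)
      else \<infinity>)"

primrec Ck_fun :: "nat \<Rightarrow> ('a::euclidean_space \<Rightarrow> real) \<Rightarrow> bool" where
  "Ck_fun 0 = (\<lambda>\<phi>. continuous_on UNIV \<phi>)"
| "Ck_fun (Suc k) = (\<lambda>\<phi>. (\<forall>x. \<phi> differentiable (at x)) \<and>
     (\<forall>b\<in>Basis. Ck_fun k (\<lambda>x. frechet_derivative \<phi> (at x) b)))"

definition test_fun :: "'a::euclidean_space set \<Rightarrow> ('a \<Rightarrow> real) \<Rightarrow> bool" where
  "test_fun S \<phi> \<longleftrightarrow> (\<forall>k. Ck_fun k \<phi>) \<and> (\<exists>K\<subseteq>S. compact K \<and> (\<forall>x. x \<notin> K \<longrightarrow> \<phi> x = 0))"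

text \<open>
  \<open>d/dt g = h\<close> in the sense of distributions on \<open>(0,T)\<close>, for locally integrable \<open>g\<close>, \<open>h\<close>.
\<close>

definition has_dist_deriv :: "real \<Rightarrow> (real \<Rightarrow> real) \<Rightarrow> (real \<Rightarrow> real) \<Rightarrow> bool" where
  "has_dist_deriv T g h \<longleftrightarrow>
     (\<forall>a b. 0 < a \<and> b < T \<longrightarrow>
        set_integrable lborel {a..b} g \<and> set_integrable lborel {a..b} h) \<and>
     (\<forall>\<eta>. test_fun {0<..<T} \<eta> \<longrightarrow>
        - (LBINT t:{0<..<T}. deriv \<eta> t * g t) = (LBINT t:{0<..<T}. \<eta> t * h t))"

definition collision_rate_equation ::
  "real \<Rightarrow> (real \<Rightarrow> 'a::euclidean_space \<Rightarrow> real) \<Rightarrow> (real \<Rightarrow> 'a \<times> 'a \<times> 'a \<Rightarrow> real) \<Rightarrow> bool" where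
  "collision_rate_equation T f U \<longleftrightarrow>
     (\<forall>t\<in>{0..T}. prob_density (f t)) \<and>
     (\<forall>\<phi>. continuous_on UNIV \<phi> \<and> bounded (range \<phi>) \<longrightarrow>
        continuous_on {0..T} (\<lambda>t. \<integral>v. \<phi> v * f t v \<partial>lborel)) \<and>
     (\<lambda>(t, x). U t x) \<in> borel_measurable (restrict_space lborel {0..T} \<Otimes>\<^sub>M Omega) \<and>
     (\<integral>\<^sup>+t\<in>{0..T}. (\<integral>\<^sup>+x. ennreal \<bar>U t x\<bar> \<partial>Omega) \<partial>lborel) < \<infinity> \<and>
     (\<forall>\<phi>. continuous_on UNIV \<phi> \<and> bounded (range \<phi>) \<longrightarrow>
        has_dist_deriv T
          (\<lambda>t. \<integral>v. \<phi> v * f t v \<partial>lborel)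
          (\<lambda>t. 1/4 * (\<integral>x. coll_grad \<phi> x * U t x \<partial>Omega)))"

definition boltzmann_solution ::
  "('a::euclidean_space \<Rightarrow> 'a \<Rightarrow> real) \<Rightarrow> real \<Rightarrow> (real \<Rightarrow> 'a \<Rightarrow> real) \<Rightarrow> bool" where
  "boltzmann_solution B T f \<longleftrightarrow>
     (\<forall>t\<in>{0..T}. prob_density (f t)) \<and>
     (\<forall>s\<in>{0..T}. ((\<lambda>t. \<integral>v. \<bar>f t v - f s v\<bar> \<partial>lborel) \<longlongrightarrow> 0) (at s within {0..T})) \<and>
     (\<exists>C. AE t in lborel. t \<in> {0..T} \<longrightarrow>
        (\<integral>\<^sup>+v. ennreal ((japanese v)\<^sup>2 * f t v) \<partial>lborel) \<le> ennreal C) \<and>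
     (\<forall>\<phi>. test_fun UNIV \<phi> \<longrightarrow>
        has_dist_deriv T
          (\<lambda>t. \<integral>v. \<phi> v * f t v \<partial>lborel)
          (\<lambda>t. - (1/4) *
             (\<integral>x. coll_grad \<phi> x * (post_prod (f t) x - pre_prod (f t) x) * kern B x \<partial>Omega)))"

text \<open>
  The supremum is taken in the reals; it is bounded above whenever \<open>F\<close> is continuous and
  superlinear.
\<close>

definition convex_conjugate :: "(real \<Rightarrow> real) \<Rightarrow> real \<Rightarrow> real" where
  "convex_conjugate F x = (SUP y. x * y - F y)"

definition lsc_on :: "'a::topological_space set \<Rightarrow> ('a \<Rightarrow> real) \<Rightarrow> bool" where
  "lsc_on S g \<longleftrightarrow> (\<forall>x\<in>S. \<forall>c<g x. eventually (\<lambda>y. c < g y) (at x within S))"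

definition structural_assumptions ::
  "(real \<Rightarrow> real) \<Rightarrow> (real \<Rightarrow> real) \<Rightarrow> (real \<Rightarrow> real \<Rightarrow> real) \<Rightarrow> (real \<Rightarrow> real \<Rightarrow> real) \<Rightarrow> bool" where
  "structural_assumptions \<Psi> \<Psi>s \<theta> G \<longleftrightarrow>
     (\<forall>x. 0 \<le> \<Psi>s x) \<and> convex_on UNIV \<Psi>s \<and> \<Psi>s differentiable_on UNIV \<and>
     filterlim (\<lambda>x. \<Psi>s x / \<bar>x\<bar>) at_top at_infinity \<and>
     (\<forall>x. \<Psi>s (- x) = \<Psi>s x) \<and> \<Psi>s 0 = 0 \<and>
     \<Psi> = convex_conjugate \<Psi>s \<and>
     (\<forall>s\<ge>0. \<forall>t\<ge>0. 0 \<le> \<theta> s t) \<and>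
     continuous_on ({0..} \<times> {0..}) (\<lambda>(s, t). \<theta> s t) \<and>
     concave_on ({0..} \<times> {0..}) (\<lambda>(s, t). \<theta> s t) \<and>
     (\<exists>s\<ge>0. \<exists>t\<ge>0. \<theta> s t \<noteq> 0) \<and>
     (\<forall>s\<ge>0. \<forall>t\<ge>0. \<theta> s t = \<theta> t s) \<and>
     (\<forall>r>0. \<forall>s\<ge>0. \<forall>t\<ge>0. \<theta> (r * s) (r * t) = r * \<theta> s t) \<and>
     (\<forall>t\<ge>0. \<theta> 0 t = 0) \<and>
     (\<forall>s>0. \<forall>t>0. deriv \<Psi>s (ln s - ln t) * \<theta> s t = s - t) \<and>
     (\<forall>s\<ge>0. \<forall>t\<ge>0. 0 \<le> G s t) \<and>
     convex_on ({0..} \<times> {0..}) (\<lambda>(s, t). G s t) \<and>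
     lsc_on ({0..} \<times> {0..}) (\<lambda>(s, t). G s t) \<and>
     (\<forall>s>0. \<forall>t>0. 1/4 * \<Psi>s (ln t - ln s) * \<theta> s t = G s t) \<and>
     (\<forall>s\<ge>0. \<forall>t\<ge>0. G s t = 0 \<longleftrightarrow> s = t)"

definition dual_integrand ::
  "(real \<Rightarrow> real) \<Rightarrow> (real \<Rightarrow> real \<Rightarrow> real) \<Rightarrow> ('a::euclidean_space \<Rightarrow> 'a \<Rightarrow> real) \<Rightarrow>
   ('a \<Rightarrow> real) \<Rightarrow> ('a \<times> 'a \<times> 'a \<Rightarrow> real) \<Rightarrow> 'a \<times> 'a \<times> 'a \<Rightarrow> ennreal" where
  "dual_integrand \<Psi> \<theta> B f U x =
     (let m = \<theta> (pre_prod f x) (post_prod f x) in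
      if m = 0 then (if U x = 0 then 0 else \<infinity>)
      else ennreal (\<Psi> (U x / (m * kern B x)) * m * kern B x))"

definition dissipation_R ::
  "(real \<Rightarrow> real) \<Rightarrow> (real \<Rightarrow> real \<Rightarrow> real) \<Rightarrow> ('a::euclidean_space \<Rightarrow> 'a \<Rightarrow> real) \<Rightarrow>
   ('a \<Rightarrow> real) \<Rightarrow> ('a \<times> 'a \<times> 'a \<Rightarrow> real) \<Rightarrow> ennreal" where
  "dissipation_R \<Psi> \<theta> B f U = ennreal (1/4) * (\<integral>\<^sup>+x. dual_integrand \<Psi> \<theta> B f U x \<partial>Omega)"

text \<open>
  \<open>G\<close> already contains the factor \<open>1/4\<close>: it is the extension of
  \<open>(s, t) \<mapsto> 1/4 \<Psi>\<^sup>*(log t - log s) \<theta>(s, t)\<close> to the closed quadrant.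
\<close>

definition dissipation_D ::
  "(real \<Rightarrow> real \<Rightarrow> real) \<Rightarrow> ('a::euclidean_space \<Rightarrow> 'a \<Rightarrow> real) \<Rightarrow> ('a \<Rightarrow> real) \<Rightarrow> ennreal" where
  "dissipation_D G B f =
     (\<integral>\<^sup>+x. ennreal (G (pre_prod f x) (post_prod f x) * kern B x) \<partial>Omega)"

definition L_functional ::
  "(real \<Rightarrow> real) \<Rightarrow> (real \<Rightarrow> real \<Rightarrow> real) \<Rightarrow> (real \<Rightarrow> real \<Rightarrow> real) \<Rightarrow>
   ('a::euclidean_space \<Rightarrow> 'a \<Rightarrow> real) \<Rightarrow> real \<Rightarrow> (real \<Rightarrow> 'a \<Rightarrow> real) \<Rightarrow>
   (real \<Rightarrow> 'a \<times> 'a \<times> 'a \<Rightarrow> real) \<Rightarrow> ereal" where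
  "L_functional \<Psi> \<theta> G B T f U =
     entropy (f T) - entropy (f 0) +
     enn2ereal (\<integral>\<^sup>+t\<in>{0..T}. (dissipation_D G B (f t) + dissipation_R \<Psi> \<theta> B (f t) (U t)) \<partial>lborel)"

end

theory Submission
  imports Defs
begin

text \<open>
  The chain rule for the entropy does not need a regularisation of \<open>(f, U)\<close>. Since the collision
  rate equation has an integrable flux, \<open>t \<mapsto> f\<^sub>t(v)\<close> is absolutely continuous for almost every \<open>v\<close>;
  hence the entropy in which the values of the logarithm are clamped to \<open>[- ln N, ln N]\<close> satisfies a
  chain rule, with the collision gradient of the clamped logarithm in place of the one of \<open>log f\<close>.
  By Young's inequality this gradient times \<open>U\<close> is dominated by the two dissipation densities plus
  an envelope made of terms such as \<open>f f\<^sub>*\<^sup>1\<^sup>-\<^sup>l (f')\<^sup>l\<close> with a small exponent \<open>l\<close>. The envelope is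
  integrable: averaging over \<open>\<omega>\<close> turns powers of \<open>f'\<close> into moments of \<open>f\<close>. Letting \<open>N \<rightarrow> \<infinity>\<close> represents
  \<open>\<L>\<^sub>T\<close> as the integral of the nonnegative defect in Young's inequality, which vanishes exactly where
  \<open>U = (f f\<^sub>* - f' f'\<^sub>*) B\<close>. Conversely, for this \<open>U\<close> the clamped gradient times \<open>U\<close> is bounded above by
  the envelope alone, and Fatou's lemma shows that the dissipation is finite.
\<close>

section \<open>Polar coordinates\<close>

text \<open>The obstacle: clamping does not respect the collision gradient. Where a density leaves
  [1/N, N], the clamped gradient D can exceed the difference of the logarithms of f' f'_* and f f_*,
  and then the term \<open>\<Psi>s\<close> of Young's inequality is not part of the dissipation. Two
  facts repair this. The identity linking \<open>\<Psi>s\<close> and \<open>\<theta>\<close> forces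
  \<open>\<Psi>s\<close> to grow at most exponentially, so that a small multiple of D costs at most
  f f_* exp (l D); and an excess of D bounds exp D by quotients of densities. The value l = 1 / (2 d
  + 1) is dictated by the average over \<omega>: at fixed v, powers of f' can be integrated in vs
  and \<omega> only with a weight |cos|^d, where cos belongs to the angle between v - vs and
  \<omega>. Young's inequality trades this weight for |cos|^(-1/2), which is integrable on the
  sphere. The same l balances a moment of order 2 + max 0 \<gamma> against an integrable weight of
  order -2 d in the velocity.\<close>

lemma nn_integral_lborel_translate:
  fixes f :: "'a::euclidean_space \<Rightarrow> ennreal"
  assumes [measurable]: "f \<in> borel_measurable borel"
  shows "(\<integral>\<^sup>+x. f (c + x) \<partial>lborel) = (\<integral>\<^sup>+x. f x \<partial>lborel)"
proof -
  have "(\<integral>\<^sup>+x. f x \<partial>lborel) = (\<integral>\<^sup>+x. f x \<partial>distr lborel borel ((+) c))"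
    by (simp add: lborel_distr_plus)
  also have "\<dots> = (\<integral>\<^sup>+x. f (c + x) \<partial>lborel)"
    by (subst nn_integral_distr) auto
  finally show ?thesis ..
qed

lemma nn_integral_lborel_scaleR:
  fixes f :: "'a::euclidean_space \<Rightarrow> ennreal"
  assumes [measurable]: "f \<in> borel_measurable borel" and c: "c \<noteq> 0"
  shows "(\<integral>\<^sup>+x. f x \<partial>lborel) = ennreal (\<bar>c\<bar> ^ DIM('a)) * (\<integral>\<^sup>+x. f (c *\<^sub>R x) \<partial>lborel)"
proof -
  have "(\<integral>\<^sup>+x. f x \<partial>lborel) =
    (\<integral>\<^sup>+x. f x \<partial>density (distr lborel borel (\<lambda>x. 0 + c *\<^sub>R x)) (\<lambda>_. ennreal (\<bar>c\<bar> ^ DIM('a))))"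
    by (subst lborel_affine[OF c, of 0]) simp
  also have "\<dots> = (\<integral>\<^sup>+x. ennreal (\<bar>c\<bar> ^ DIM('a)) * f (c *\<^sub>R x) \<partial>lborel)"
    by (subst nn_integral_density; simp add: nn_integral_distr)
  also have "\<dots> = ennreal (\<bar>c\<bar> ^ DIM('a)) * (\<integral>\<^sup>+x. f (c *\<^sub>R x) \<partial>lborel)"
    by (rule nn_integral_cmult) auto
  finally show ?thesis .
qed

text \<open>
  Uniqueness of translation invariant measures, in a form where the normalization is read off
  on the unit ball, so that the symmetry of the ball replaces the invariance under \<open>x \<mapsto> - x\<close>.
\<close>

lemma translation_invariant_eq_lborel:
  fixes M :: "'a::euclidean_space measure"
  assumes sets[measurable_cong, simp]: "sets M = sets borel"
    and fin: "sigma_finite_measure M"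
    and inv: "\<And>c. distr M borel ((+) c) = M"
    and ball: "emeasure M (ball 0 1) = emeasure lborel (ball (0::'a) 1)"
  shows "M = lborel"
proof (rule measure_eqI)
  fix A assume "A \<in> sets M"
  then have A[measurable]: "A \<in> sets borel" by simp
  interpret M: sigma_finite_measure M by fact
  interpret P: pair_sigma_finite M lborel ..
  have M_UNIV: "space M = UNIV" using sets_eq_imp_space_eq[OF sets] by simp
  let ?B = "ball (0::'a) 1"
  have [measurable]: "?B \<in> sets borel" by simp
  let ?I = "indicator :: 'a set \<Rightarrow> 'a \<Rightarrow> ennreal"
  have tr: "(\<integral>\<^sup>+x. f (c + x) \<partial>M) = (\<integral>\<^sup>+x. f x \<partial>M)" if [measurable]: "f \<in> borel_measurable borel" for f c
    by (subst (2) inv[of c, symmetric], subst nn_integral_distr) auto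
  \<comment> \<open>The double integral is sheared twice, each time in the variable of a translation
    invariant measure. Between the two shears the indicator of \<open>A\<close> changes hands from
    \<open>M\<close> to Lebesgue measure, and that of the ball goes the other way.\<close>
  have "emeasure M A * emeasure lborel ?B = (\<integral>\<^sup>+y. (\<integral>\<^sup>+x. ?I A x * ?I ?B y \<partial>M) \<partial>lborel)"
    by (simp add: nn_integral_multc nn_integral_cmult nn_integral_cmult_indicator)
  also have "\<dots> = (\<integral>\<^sup>+y. (\<integral>\<^sup>+x. ?I A (y + x) * ?I ?B y \<partial>M) \<partial>lborel)"
    by (rule nn_integral_cong, rule tr[symmetric]) measurable
  also have "\<dots> = (\<integral>\<^sup>+x. (\<integral>\<^sup>+y. ?I A (y + x) * ?I ?B y \<partial>lborel) \<partial>M)"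
    by (rule P.Fubini') measurable
  also have "\<dots> = (\<integral>\<^sup>+x. (\<integral>\<^sup>+y. ?I A y * ?I ?B (y - x) \<partial>lborel) \<partial>M)"
  proof (rule nn_integral_cong)
    fix x
    show "(\<integral>\<^sup>+y. ?I A (y + x) * ?I ?B y \<partial>lborel) = (\<integral>\<^sup>+y. ?I A y * ?I ?B (y - x) \<partial>lborel)"
      using nn_integral_lborel_translate[of "\<lambda>y. ?I A y * ?I ?B (y - x)" x] by (simp add: add.commute)
  qed
  also have "\<dots> = (\<integral>\<^sup>+y. (\<integral>\<^sup>+x. ?I A y * ?I ?B (y - x) \<partial>M) \<partial>lborel)"
    by (rule P.Fubini'[symmetric]) measurable
  also have "\<dots> = (\<integral>\<^sup>+y. (\<integral>\<^sup>+x. ?I A y * ?I ?B x \<partial>M) \<partial>lborel)"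
  proof (rule nn_integral_cong)
    fix y
    have "(\<integral>\<^sup>+x. ?I A y * ?I ?B (y - x) \<partial>M) = (\<integral>\<^sup>+x. ?I A y * ?I ?B (- y + x) \<partial>M)"
      by (intro nn_integral_cong) (auto simp: indicator_def dist_norm norm_minus_commute)
    also have "\<dots> = (\<integral>\<^sup>+x. ?I A y * ?I ?B x \<partial>M)"
      by (rule tr) measurable
    finally show "(\<integral>\<^sup>+x. ?I A y * ?I ?B (y - x) \<partial>M) = (\<integral>\<^sup>+x. ?I A y * ?I ?B x \<partial>M)" .
  qed
  also have "\<dots> = emeasure lborel A * emeasure M ?B"
    by (simp add: nn_integral_multc nn_integral_cmult nn_integral_cmult_indicator)
  finally have "emeasure M A * emeasure lborel ?B = emeasure lborel A * emeasure lborel ?B"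
    by (simp add: ball)
  moreover have "emeasure lborel ?B \<noteq> 0"
    using content_ball_pos[of 1 "0::'a"] by (auto simp: measure_def)
  moreover have "emeasure lborel ?B \<noteq> \<infinity>"
    using emeasure_lborel_ball_finite[of 0 1] by (metis infinity_ennreal_def less_irrefl)
  ultimately show "emeasure M A = emeasure lborel A"
    by (metis infinity_ennreal_def mult_divide_eq_ennreal)
qed simp

text \<open>A surjective linear map carries translations to translations, so the image measure is
  again translation invariant; isometry fixes the unit ball and hence the normalization. No
  determinant has to be computed.\<close>

lemma distr_lborel_orthogonal:
  fixes T :: "'a::euclidean_space \<Rightarrow> 'a"
  assumes T: "orthogonal_transformation T"
  shows "distr lborel borel T = lborel"
proof -
  have lin: "linear T" using T by (rule orthogonal_transformation_linear)
  have [measurable]: "T \<in> borel_measurable borel"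
    by (intro borel_measurable_continuous_onI linear_continuous_on lin linear_conv_bounded_linear[THEN iffD1])
  have ball_vimage: "T -` ball 0 r = ball 0 r" for r
    using orthogonal_transformation_norm[OF T] by (auto simp: dist_norm)
  show ?thesis
  proof (rule translation_invariant_eq_lborel)
    show "sigma_finite_measure (distr lborel borel T)"
    proof
      show "\<exists>A. countable A \<and> A \<subseteq> sets (distr lborel borel T) \<and> \<Union> A = space (distr lborel borel T) \<and>
          (\<forall>a\<in>A. emeasure (distr lborel borel T) a \<noteq> \<infinity>)"
      proof (intro exI[of _ "range (\<lambda>n::nat. ball 0 (real n))"] conjI)
        show "\<Union> (range (\<lambda>n::nat. ball 0 (real n))) = space (distr lborel borel T)"
          by (auto simp: dist_norm reals_Archimedean2)
        show "\<forall>a\<in>range (\<lambda>n::nat. ball 0 (real n)). emeasure (distr lborel borel T) a \<noteq> \<infinity>"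
          by (auto simp: emeasure_distr ball_vimage
              less_imp_neq[OF emeasure_lborel_ball_finite[unfolded infinity_ennreal_def]])
      qed auto
    qed
    show "distr (distr lborel borel T) borel ((+) c) = distr lborel borel T" for c
    proof -
      obtain b where b: "T b = c"
        using orthogonal_transformation_surj[OF T] by (metis surjD)
      have "distr (distr lborel borel T) borel ((+) c) = distr lborel borel (\<lambda>x. c + T x)"
        by (subst distr_distr) (auto simp: o_def)
      also have "\<dots> = distr lborel borel (T \<circ> (+) b)"
        by (simp add: o_def linear_add[OF lin] b)
      also have "\<dots> = distr (distr lborel borel ((+) b)) borel T"
        by (subst distr_distr) auto
      also have "\<dots> = distr lborel borel T"
        by (simp add: lborel_distr_plus)
      finally show ?thesis .
    qed
    show "emeasure (distr lborel borel T) (ball 0 1) = emeasure lborel (ball (0::'a) 1)"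
      by (simp add: emeasure_distr ball_vimage)
  qed simp
qed

section \<open>Integration over the sphere\<close>

lemma borel_sets_ball[measurable]: "ball (c::'a::metric_space) r \<in> sets borel"
  by simp

lemma nn_integral_sphere_measure:
  fixes h :: "'a::euclidean_space \<Rightarrow> ennreal"
  assumes h: "h \<in> borel_measurable sphere_measure"
  shows "(\<integral>\<^sup>+\<omega>. h \<omega> \<partial>sphere_measure) =
    ennreal DIM('a) * (\<integral>\<^sup>+x. h (x /\<^sub>R norm x) * indicator (ball 0 1 - {0}) x \<partial>lborel)"
proof -
  let ?M = "restrict_space lborel (ball 0 1 - {0}) :: 'a measure"
  have 1: "(\<lambda>x. x /\<^sub>R norm x) \<in> measurable ?M (restrict_space borel (sphere 0 1))"
    by (intro measurable_restrict_space2 measurable_restrict_space1)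
       (auto simp: space_restrict_space)
  have 2: "h \<in> borel_measurable (restrict_space borel (sphere 0 1))"
    using h by (simp add: sphere_measure_def cong: measurable_cong_sets)
  show ?thesis
    using 1 2 by (simp add: sphere_measure_def nn_integral_scale_measure nn_integral_distr nn_integral_restrict_space)
qed

lemma finite_sphere_measure: "finite_measure (sphere_measure :: 'a::euclidean_space measure)"
proof
  have "emeasure sphere_measure (space (sphere_measure :: 'a measure)) \<le>
      ennreal DIM('a) * emeasure lborel (ball (0::'a) 1)"
    by (auto simp: space_sphere_measure emeasure_sphere_measure intro!: mult_left_mono emeasure_mono)
  also have "\<dots> < \<infinity>"
    using emeasure_lborel_ball_finite[of "0::'a" 1] by (simp add: ennreal_mult_less_top)
  finally show "emeasure sphere_measure (space (sphere_measure :: 'a measure)) \<noteq> \<infinity>"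
    by simp
qed

interpretation sphere: finite_measure sphere_measure
  by (rule finite_sphere_measure)

lemma measurable_sphere_measure_borel:
  "f \<in> measurable M sphere_measure \<Longrightarrow> f \<in> measurable M borel"
  using measurable_restrict_space2_iff[of f M borel "sphere 0 1"]
  by (simp add: sets_sphere_measure cong: measurable_cong_sets)

lemma measurable_ident_sphere_borel: "(\<lambda>\<omega>. \<omega>) \<in> borel_measurable sphere_measure"
  by (rule measurable_sphere_measure_borel) simp

lemma nn_integral_inverse_power_tail:
  assumes a: "0 < a" and "d > 0"
  shows "(\<integral>\<^sup>+s. ennreal (real d / s ^ (d + 1)) * indicator {a<..} s \<partial>lborel) = ennreal (1 / a ^ d)"
proof -
  have "(\<integral>\<^sup>+s. ennreal (real d / s ^ (d + 1)) * indicator {a<..} s \<partial>lborel) =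
     (\<integral>\<^sup>+s. ennreal (real d / s ^ (d + 1)) * indicator {a..} s \<partial>lborel)"
    by (rule nn_integral_cong_AE, rule AE_mp[OF AE_lborel_singleton[of a]]) (auto simp: indicator_def)
  also have "\<dots> = ennreal (0 - (- (1 / a ^ d)))"
  proof (rule nn_integral_FTC_atLeast)
    fix x assume "a \<le> x"
    with a have x: "x > 0" by simp
    have "((\<lambda>s. - (inverse (s ^ d))) has_real_derivative (inverse (x ^ d) * (real d * x ^ (d - 1)) * inverse (x ^ d))) (at x)"
      using x by (auto intro!: derivative_eq_intros)
    also have "inverse (x ^ d) * (real d * x ^ (d - 1)) * inverse (x ^ d) = real d / x ^ (d + 1)"
      using x \<open>d > 0\<close> by (cases d) (simp_all add: field_simps)
    finally show "((\<lambda>s. - (1 / s ^ d)) has_real_derivative (real d / x ^ (d + 1))) (at x)"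
      by (simp add: inverse_eq_divide)
    show "0 \<le> real d / x ^ (d + 1)" using x by simp
  next
    have "((\<lambda>s::real. inverse (s ^ d)) \<longlongrightarrow> 0) at_top"
      using \<open>d > 0\<close> by (intro tendsto_inverse_0_at_top filterlim_pow_at_top filterlim_ident)
    from tendsto_minus[OF this] show "((\<lambda>s::real. - (1 / s ^ d)) \<longlongrightarrow> 0) at_top"
      by (simp add: inverse_eq_divide)
  qed simp
  finally show ?thesis by simp
qed

text \<open>The sphere measure is an image of Lebesgue measure on the ball, so the right-hand side
  is an integral over a point x of the ball and a radius r. The substitutions r = |x| s and y = s x
  bring the argument of \<open>h\<close> to y; what remains is the integral of d / s^(d+1) over s >
  |y|, and its value |y|^(-d) cancels the Jacobian factor |y|^d.\<close>

lemma nn_integral_polar: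
  fixes h :: "'a::euclidean_space \<Rightarrow> ennreal"
  assumes [measurable]: "h \<in> borel_measurable borel"
  shows "(\<integral>\<^sup>+y. h y \<partial>lborel) =
    (\<integral>\<^sup>+\<omega>. (\<integral>\<^sup>+r. ennreal (r ^ (DIM('a) - 1)) * indicator {0<..} r * h (r *\<^sub>R \<omega>) \<partial>lborel) \<partial>sphere_measure)"
proof -
  define d where "d = DIM('a)"
  have d: "d > 0" by (simp add: d_def)
  have radial: "(\<integral>\<^sup>+r. ennreal (r ^ (d - 1)) * indicator {0<..} r * h (r *\<^sub>R (x /\<^sub>R norm x)) \<partial>lborel) =
      (\<integral>\<^sup>+s. ennreal (norm x ^ d) * (ennreal (s ^ (d - 1)) * indicator {0<..} s * h (s *\<^sub>R x)) \<partial>lborel)"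
    if "x \<noteq> 0" for x
  proof -
    have x: "norm x > 0" using that by simp
    have "(\<integral>\<^sup>+r. ennreal (r ^ (d - 1)) * indicator {0<..} r * h (r *\<^sub>R (x /\<^sub>R norm x)) \<partial>lborel) =
       ennreal (\<bar>norm x\<bar> ^ DIM(real)) *
       (\<integral>\<^sup>+s. ennreal ((norm x *\<^sub>R s) ^ (d - 1)) * indicator {0<..} (norm x *\<^sub>R s) * h ((norm x *\<^sub>R s) *\<^sub>R (x /\<^sub>R norm x)) \<partial>lborel)"
      using x by (intro nn_integral_lborel_scaleR) auto
    also have "\<dots> = (\<integral>\<^sup>+s. ennreal (norm x) *
        (ennreal ((norm x *\<^sub>R s) ^ (d - 1)) * indicator {0<..} (norm x *\<^sub>R s) * h ((norm x *\<^sub>R s) *\<^sub>R (x /\<^sub>R norm x))) \<partial>lborel)"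
      by (subst nn_integral_cmult) auto
    also have "\<dots> = (\<integral>\<^sup>+s. ennreal (norm x ^ d) * (ennreal (s ^ (d - 1)) * indicator {0<..} s * h (s *\<^sub>R x)) \<partial>lborel)"
    proof (rule nn_integral_cong)
      fix s :: real
      show "ennreal (norm x) * (ennreal ((norm x *\<^sub>R s) ^ (d - 1)) * indicator {0<..} (norm x *\<^sub>R s) * h ((norm x *\<^sub>R s) *\<^sub>R (x /\<^sub>R norm x)))
        = ennreal (norm x ^ d) * (ennreal (s ^ (d - 1)) * indicator {0<..} s * h (s *\<^sub>R x))"
      proof (cases "s > 0")
        case True
        have "norm x * (norm x * s) ^ (d - 1) = norm x ^ d * s ^ (d - 1)"
          using d by (cases d) (auto simp: power_mult_distrib)
        then have "ennreal (norm x) * ennreal ((norm x * s) ^ (d - 1)) = ennreal (norm x ^ d) * ennreal (s ^ (d - 1))"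
          using True x by (simp add: ennreal_mult[symmetric])
        moreover have "h ((norm x *\<^sub>R s) *\<^sub>R (x /\<^sub>R norm x)) = h (s *\<^sub>R x)"
        proof -
          have "norm x * s * inverse (norm x) = s" using x by simp
          then show ?thesis by (simp only: real_scaleR_def scaleR_scaleR)
        qed
        ultimately show ?thesis using True x
          by (simp only: real_scaleR_def) (simp add: mult.assoc[symmetric])
      next
        case False
        then show ?thesis using x by (simp add: zero_less_mult_iff)
      qed
    qed
    finally show ?thesis .
  qed
  \<comment> \<open>Of the power \<open>s ^ (2 * d)\<close>, one factor s^d is the Jacobian of y = s
    x and the other comes from |x|^d = |y|^d / s^d.\<close>
  have ball_scale: "(\<integral>\<^sup>+x. ennreal (norm x ^ d) * h (s *\<^sub>R x) * indicator (ball 0 1 - {0}) x \<partial>lborel) =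
      (\<integral>\<^sup>+y. ennreal (norm y ^ d / s ^ (2 * d)) * h y * indicator (ball 0 s - {0}) y \<partial>lborel)"
    if s: "s > 0" for s :: real
  proof -
    have "(\<integral>\<^sup>+y. ennreal (norm y ^ d / s ^ (2 * d)) * h y * indicator (ball 0 s - {0}) y \<partial>lborel) =
      ennreal (\<bar>s\<bar> ^ DIM('a)) * (\<integral>\<^sup>+x. ennreal (norm (s *\<^sub>R x) ^ d / s ^ (2 * d)) * h (s *\<^sub>R x) * indicator (ball 0 s - {0}) (s *\<^sub>R x) \<partial>lborel)"
      using s by (intro nn_integral_lborel_scaleR) auto
    also have "\<dots> = (\<integral>\<^sup>+x. ennreal (s ^ d) * (ennreal (norm (s *\<^sub>R x) ^ d / s ^ (2 * d)) * h (s *\<^sub>R x) * indicator (ball 0 s - {0}) (s *\<^sub>R x)) \<partial>lborel)"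
      using s by (subst nn_integral_cmult) (auto simp: d_def)
    also have "\<dots> = (\<integral>\<^sup>+x. ennreal (norm x ^ d) * h (s *\<^sub>R x) * indicator (ball 0 1 - {0}) x \<partial>lborel)"
    proof (rule nn_integral_cong)
      fix x :: 'a
      have i: "indicator (ball 0 s - {0}) (s *\<^sub>R x) = (indicator (ball 0 1 - {0}) x :: ennreal)"
        using s by (auto simp: indicator_def dist_norm)
      have "s ^ d * (norm (s *\<^sub>R x) ^ d / s ^ (2 * d)) = norm x ^ d"
        using s by (simp add: power_mult_distrib power_mult power2_eq_square)
      then have "ennreal (s ^ d) * ennreal (norm (s *\<^sub>R x) ^ d / s ^ (2 * d)) = ennreal (norm x ^ d)"
        using s by (simp add: ennreal_mult[symmetric])
      then show "ennreal (s ^ d) * (ennreal (norm (s *\<^sub>R x) ^ d / s ^ (2 * d)) * h (s *\<^sub>R x) * indicator (ball 0 s - {0}) (s *\<^sub>R x)) =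
          ennreal (norm x ^ d) * h (s *\<^sub>R x) * indicator (ball 0 1 - {0}) x"
        by (simp add: i mult.assoc[symmetric])
    qed
    finally show ?thesis ..
  qed
  have pull: "(\<integral>\<^sup>+x. ennreal (norm x ^ d) * (c * h (s *\<^sub>R x)) * indicator (ball 0 1 - {0}) x \<partial>lborel)
      = c * (\<integral>\<^sup>+x. ennreal (norm x ^ d) * h (s *\<^sub>R x) * indicator (ball 0 1 - {0}) x \<partial>lborel)" for c s
  proof -
    have "(\<lambda>x. ennreal (norm x ^ d) * h (s *\<^sub>R x) * indicator (ball 0 1 - {0}) x) \<in> borel_measurable lborel"
      by measurable
    from nn_integral_cmult[OF this, of c] show ?thesis
      by (simp add: ac_simps)
  qed
  have "(\<integral>\<^sup>+\<omega>. (\<integral>\<^sup>+r. ennreal (r ^ (d - 1)) * indicator {0<..} r * h (r *\<^sub>R \<omega>) \<partial>lborel) \<partial>sphere_measure) =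
    ennreal d * (\<integral>\<^sup>+x. (\<integral>\<^sup>+r. ennreal (r ^ (d - 1)) * indicator {0<..} r * h (r *\<^sub>R (x /\<^sub>R norm x)) \<partial>lborel) * indicator (ball 0 1 - {0}) x \<partial>lborel)"
    unfolding d_def
    by (rule nn_integral_sphere_measure, rule measurable_compose[OF measurable_ident_sphere_borel]) measurable
  also have "\<dots> = ennreal d * (\<integral>\<^sup>+x. (\<integral>\<^sup>+s. ennreal (norm x ^ d) * (ennreal (s ^ (d - 1)) * indicator {0<..} s * h (s *\<^sub>R x)) * indicator (ball 0 1 - {0}) x \<partial>lborel) \<partial>lborel)"
  proof (intro arg_cong2[where f="(*)"] refl, rule nn_integral_cong)
    fix x :: 'a
    show "(\<integral>\<^sup>+r. ennreal (r ^ (d - 1)) * indicator {0<..} r * h (r *\<^sub>R (x /\<^sub>R norm x)) \<partial>lborel) * indicator (ball 0 1 - {0}) x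
      = (\<integral>\<^sup>+s. ennreal (norm x ^ d) * (ennreal (s ^ (d - 1)) * indicator {0<..} s * h (s *\<^sub>R x)) * indicator (ball 0 1 - {0}) x \<partial>lborel)"
    proof (cases "x \<in> ball 0 1 - {0}")
      case True
      then show ?thesis using radial[of x] by (simp only: indicator_simps) simp
    qed simp
  qed
  also have "\<dots> = ennreal d * (\<integral>\<^sup>+s. (\<integral>\<^sup>+x. ennreal (norm x ^ d) * (ennreal (s ^ (d - 1)) * indicator {0<..} s * h (s *\<^sub>R x)) * indicator (ball 0 1 - {0}) x \<partial>lborel) \<partial>lborel)"
    by (subst lborel_pair.Fubini') (auto simp: split_beta')
  also have "\<dots> = (\<integral>\<^sup>+s. ennreal d * (ennreal (s ^ (d - 1)) * indicator {0<..} s * (\<integral>\<^sup>+x. ennreal (norm x ^ d) * h (s *\<^sub>R x) * indicator (ball 0 1 - {0}) x \<partial>lborel)) \<partial>lborel)"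
  proof -
    have "(\<lambda>s. \<integral>\<^sup>+x. ennreal (norm x ^ d) * (ennreal (s ^ (d - 1)) * indicator {0<..} s * h (s *\<^sub>R x)) * indicator (ball 0 1 - {0}) x \<partial>lborel) \<in> borel_measurable lborel"
      by measurable
    from nn_integral_cmult[OF this, of "ennreal d"] show ?thesis
      by (simp only: pull)
  qed
  also have "\<dots> = (\<integral>\<^sup>+s. ennreal d * (ennreal (s ^ (d - 1)) * indicator {0<..} s * (\<integral>\<^sup>+y. ennreal (norm y ^ d / s ^ (2 * d)) * h y * indicator (ball 0 s - {0}) y \<partial>lborel)) \<partial>lborel)"
  proof (rule nn_integral_cong)
    fix s :: real
    show "ennreal d * (ennreal (s ^ (d - 1)) * indicator {0<..} s * (\<integral>\<^sup>+x. ennreal (norm x ^ d) * h (s *\<^sub>R x) * indicator (ball 0 1 - {0}) x \<partial>lborel))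
      = ennreal d * (ennreal (s ^ (d - 1)) * indicator {0<..} s * (\<integral>\<^sup>+y. ennreal (norm y ^ d / s ^ (2 * d)) * h y * indicator (ball 0 s - {0}) y \<partial>lborel))"
      by (cases "s > 0") (simp_all only: ball_scale, simp)
  qed
  also have "\<dots> = (\<integral>\<^sup>+s. (\<integral>\<^sup>+y. (ennreal (real d / s ^ (d + 1)) * indicator {0<..} (s - norm y)) * (h y * ennreal (norm y ^ d)) * indicator (- {0}) y \<partial>lborel) \<partial>lborel)"
  proof (rule nn_integral_cong)
    fix s :: real
    show "ennreal d * (ennreal (s ^ (d - 1)) * indicator {0<..} s * (\<integral>\<^sup>+y. ennreal (norm y ^ d / s ^ (2 * d)) * h y * indicator (ball 0 s - {0}) y \<partial>lborel)) =
      (\<integral>\<^sup>+y. (ennreal (real d / s ^ (d + 1)) * indicator {0<..} (s - norm y)) * (h y * ennreal (norm y ^ d)) * indicator (- {0}) y \<partial>lborel)"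
    proof (cases "s > 0")
      case s: True
      have p: "real d * (s ^ (d - 1) * (norm y ^ d / s ^ (2 * d))) = real d / s ^ (d + 1) * norm y ^ d" for y :: 'a
      proof -
        have "(d - 1) + (d + 1) = 2 * d" using d by simp
        then have "s ^ (d - 1) * s ^ (d + 1) = s ^ (2 * d)"
          by (metis power_add)
        then have "s ^ (d - 1) / s ^ (2 * d) = 1 / s ^ (d + 1)"
          using s by (simp add: field_simps)
        then have "real d * norm y ^ d * (s ^ (d - 1) / s ^ (2 * d)) = real d * norm y ^ d * (1 / s ^ (d + 1))"
          by simp
        then show ?thesis by (simp add: ac_simps)
      qed
      have "ennreal d * (ennreal (s ^ (d - 1)) * ennreal (norm y ^ d / s ^ (2 * d))) = ennreal (real d / s ^ (d + 1)) * ennreal (norm y ^ d)" for y :: 'a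
        using s p[of y] by (simp add: ennreal_mult[symmetric])
      note pe = this
      have "ennreal d * (ennreal (s ^ (d - 1)) * (ennreal (norm y ^ d / s ^ (2 * d)) * h y * indicator (ball 0 s - {0}) y))
        = (ennreal (real d / s ^ (d + 1)) * indicator {0<..} (s - norm y)) * (h y * ennreal (norm y ^ d)) * indicator (- {0}) y" for y
      proof (cases "y \<in> ball 0 s - {0}")
        case True
        then have "indicator {0<..} (s - norm y) = (1::ennreal)" by simp
        then show ?thesis
          using True arg_cong[OF pe[of y], of "\<lambda>z. z * h y"] by (simp add: ac_simps)
      next
        case False
        then have "y = 0 \<or> indicator {0<..} (s - norm y) = (0::ennreal)" by auto
        then show ?thesis using False by auto
      qed
      then show ?thesis
        using s by (simp add: nn_integral_cmult[symmetric])
    next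
      case False
      then have "indicator {0<..} (s - norm y) = (0::ennreal)" for y :: 'a
        using order.strict_trans1[OF norm_ge_zero[of y], of s] by (auto simp: indicator_def)
      then show ?thesis using False by simp
    qed
  qed
  also have "\<dots> = (\<integral>\<^sup>+y. (\<integral>\<^sup>+s. (ennreal (real d / s ^ (d + 1)) * indicator {0<..} (s - norm y)) * (h y * ennreal (norm y ^ d)) * indicator (- {0}) y \<partial>lborel) \<partial>lborel)"
    by (subst lborel_pair.Fubini') (auto simp: split_beta')
  also have "\<dots> = (\<integral>\<^sup>+y. ennreal (1 / norm y ^ d) * (h y * ennreal (norm y ^ d)) * indicator (- {0}) y \<partial>lborel)"
  proof (rule nn_integral_cong)
    fix y :: 'a
    have i: "indicator {0<..} (s - norm y) = (indicator {norm y<..} s :: ennreal)" for s :: real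
      by (simp add: indicator_def)
    show "(\<integral>\<^sup>+s. (ennreal (real d / s ^ (d + 1)) * indicator {0<..} (s - norm y)) * (h y * ennreal (norm y ^ d)) * indicator (- {0}) y \<partial>lborel)
      = ennreal (1 / norm y ^ d) * (h y * ennreal (norm y ^ d)) * indicator (- {0}) y"
    proof (cases "y = 0")
      case False
      then have "(\<integral>\<^sup>+s. ennreal (real d / s ^ (d + 1)) * indicator {norm y<..} s \<partial>lborel) = ennreal (1 / norm y ^ d)"
        using d by (intro nn_integral_inverse_power_tail) auto
      moreover have "(\<integral>\<^sup>+s. (ennreal (real d / s ^ (d + 1)) * indicator {norm y<..} s) * (h y * ennreal (norm y ^ d)) * indicator (- {0}) y \<partial>lborel)
        = (\<integral>\<^sup>+s. ennreal (real d / s ^ (d + 1)) * indicator {norm y<..} s \<partial>lborel) * (h y * ennreal (norm y ^ d)) * indicator (- {0}) y"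
      proof -
        have m: "(\<lambda>s. ennreal (real d / s ^ (d + 1)) * indicator {norm y<..} s) \<in> borel_measurable lborel"
          by measurable
        show ?thesis
          using False nn_integral_multc[OF m, of "h y * ennreal (norm y ^ d)"] by simp
      qed
      ultimately show ?thesis by (simp only: i)
    qed simp
  qed
  also have "\<dots> = (\<integral>\<^sup>+y. h y \<partial>lborel)"
  proof (rule nn_integral_cong_AE, rule AE_mp[OF AE_lborel_singleton[of 0]], intro AE_I2 impI)
    fix y :: 'a assume y: "y \<noteq> 0"
    have "ennreal (1 / norm y ^ d) * ennreal (norm y ^ d) = 1"
      using y by (simp add: ennreal_mult[symmetric])
    from arg_cong[OF this, of "\<lambda>z. z * h y"] y
    show "ennreal (1 / norm y ^ d) * (h y * ennreal (norm y ^ d)) * indicator (- {0}) y = h y"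
      by (simp add: ac_simps)
  qed
  finally show ?thesis by (simp add: d_def)
qed

section \<open>Averaging over collisions\<close>

text \<open>The power -1/2 of |c|, with the singular value set by hand:
  \<open>0 powr (- 1/2)\<close> is 0, whereas \<open>averaging_Young\<close> at c = 0 needs the true
  value infinity.\<close>

definition inv_sqrt_weight :: "real \<Rightarrow> ennreal" where
  "inv_sqrt_weight c = (if c = 0 then \<infinity> else ennreal (\<bar>c\<bar> powr (- 1/2)))"

lemma inv_sqrt_weight_measurable[measurable]: "inv_sqrt_weight \<in> borel_measurable borel"
  unfolding inv_sqrt_weight_def[abs_def] by measurable

lemma inv_sqrt_weight_antimono: "\<bar>a\<bar> \<le> \<bar>b\<bar> \<Longrightarrow> inv_sqrt_weight b \<le> inv_sqrt_weight a"
  by (auto simp: inv_sqrt_weight_def intro!: ennreal_leI powr_mono2')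

lemma nn_integral_inv_sqrt_weight:
  assumes "r \<ge> 0"
  shows "(\<integral>\<^sup>+s. inv_sqrt_weight s * indicator {-r..r} s \<partial>lborel) \<le> ennreal (4 * r powr (1/2))"
proof -
  let ?I = "\<integral>\<^sup>+s. inv_sqrt_weight s * indicator {0..r} s \<partial>lborel"
  have "((\<lambda>x. x powr (-1/2)) has_integral (r powr (-1/2 + 1) / (-1/2 + 1))) {0..r}"
    using assms by (intro has_integral_powr_from_0) auto
  then have "((\<lambda>x. if x \<in> {0..r} then x powr (-1/2) else 0) has_integral (2 * r powr (1/2))) UNIV"
    by (subst has_integral_restrict_UNIV) (simp add: mult.commute)
  then have "(\<integral>\<^sup>+s. ennreal (if s \<in> {0..r} then s powr (-1/2) else 0) \<partial>lborel) = ennreal (2 * r powr (1/2))"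
    by (intro nn_integral_has_integral_lborel) auto
  also have "(\<integral>\<^sup>+s. ennreal (if s \<in> {0..r} then s powr (-1/2) else 0) \<partial>lborel) = ?I"
    by (rule nn_integral_cong_AE, rule AE_mp[OF AE_lborel_singleton[of 0]])
       (auto simp: inv_sqrt_weight_def)
  finally have I: "?I = ennreal (2 * r powr (1/2))" .
  have "(\<integral>\<^sup>+s. inv_sqrt_weight s * indicator {-r..0} s \<partial>lborel) = ?I"
    using nn_integral_lborel_scaleR[of "\<lambda>s::real. inv_sqrt_weight s * indicator {0..r} s" "-1"]
    by (simp add: inv_sqrt_weight_def indicator_def) (auto intro!: nn_integral_cong)
  moreover have "(\<integral>\<^sup>+s. inv_sqrt_weight s * indicator {-r..r} s \<partial>lborel) \<le>
      (\<integral>\<^sup>+s. inv_sqrt_weight s * indicator {-r..0} s + inv_sqrt_weight s * indicator {0..r} s \<partial>lborel)"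
    by (intro nn_integral_mono) (auto simp: indicator_def)
  ultimately show ?thesis
    using I by (simp add: nn_integral_add ennreal_plus[symmetric] del: ennreal_plus)
qed

text \<open>For |x| < 1 the weight at e . x dominates the weight at e . (x / |x|), so the sphere
  integral is at most a multiple of an integral over the ball. There, averaging over the
  translations by s e with s in an interval of length 1 reduces everything to a one-dimensional
  integral along \<open>e\<close>. The bound is uniform in \<open>e\<close> and needs no coordinates
  adapted to it.\<close>

lemma sphere_integral_inv_sqrt_weight:
  "\<exists>K<\<infinity>. \<forall>e::'a::euclidean_space. norm e = 1 \<longrightarrow>
     (\<integral>\<^sup>+\<omega>. inv_sqrt_weight (e \<bullet> \<omega>) \<partial>sphere_measure) \<le> K"
proof -
  \<comment> \<open>The shifted argument e . y + s stays in [-3, 3], because |y| \<le> 2 and |s|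
    \<le> 1/2; the constant is the bound of \<open>nn_integral_inv_sqrt_weight\<close> for r =
    3.\<close>
  define K0 where "K0 = ennreal (4 * 3 powr (1/2))"
  define K where "K = ennreal DIM('a) * (emeasure lborel (cball (0::'a) 2) * K0)"
  have cb: "emeasure lborel (cball (0::'a) 2) < \<infinity>"
    by (rule emeasure_lborel_cball_finite)
  have [measurable]: "cball (0::'a) 2 \<in> sets borel" by simp
  have "K < \<infinity>"
    unfolding K_def K0_def using cb by (simp add: ennreal_mult_less_top)
  moreover have "(\<integral>\<^sup>+\<omega>. inv_sqrt_weight (e \<bullet> \<omega>) \<partial>sphere_measure) \<le> K" if e: "norm e = 1" for e :: 'a
  proof -
    let ?A = "\<integral>\<^sup>+x. inv_sqrt_weight (e \<bullet> x) * indicator (ball 0 1) x \<partial>lborel"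
    have "(\<integral>\<^sup>+\<omega>. inv_sqrt_weight (e \<bullet> \<omega>) \<partial>sphere_measure) =
      ennreal DIM('a) * (\<integral>\<^sup>+x. inv_sqrt_weight (e \<bullet> (x /\<^sub>R norm x)) * indicator (ball 0 1 - {0}) x \<partial>lborel)"
      by (rule nn_integral_sphere_measure, rule measurable_compose[OF measurable_ident_sphere_borel]) measurable
    also have "(\<integral>\<^sup>+x. inv_sqrt_weight (e \<bullet> (x /\<^sub>R norm x)) * indicator (ball 0 1 - {0}) x \<partial>lborel) \<le> ?A"
    proof (rule nn_integral_mono)
      fix x :: 'a
      show "inv_sqrt_weight (e \<bullet> (x /\<^sub>R norm x)) * indicator (ball 0 1 - {0}) x \<le> inv_sqrt_weight (e \<bullet> x) * indicator (ball 0 1) x"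
      proof (cases "x \<in> ball 0 1 - {0}")
        case True
        then have "\<bar>e \<bullet> x\<bar> \<le> \<bar>e \<bullet> (x /\<^sub>R norm x)\<bar>"
          by (simp add: abs_mult field_simps mult_left_le_one_le)
        then show ?thesis using True by (auto simp: inv_sqrt_weight_antimono)
      qed simp
    qed
    also have "?A \<le> emeasure lborel (cball (0::'a) 2) * K0"
    proof -
      have shift: "?A \<le> (\<integral>\<^sup>+y. inv_sqrt_weight (e \<bullet> y + s) * indicator (cball 0 2) y \<partial>lborel)" if s: "s \<in> {-1/2..1/2}" for s
      proof -
        have "?A = (\<integral>\<^sup>+y. inv_sqrt_weight (e \<bullet> (s *\<^sub>R e + y)) * indicator (ball 0 1) (s *\<^sub>R e + y) \<partial>lborel)"
          by (rule nn_integral_lborel_translate[symmetric]) measurable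
        also have "\<dots> \<le> (\<integral>\<^sup>+y. inv_sqrt_weight (e \<bullet> y + s) * indicator (cball 0 2) y \<partial>lborel)"
        proof (rule nn_integral_mono)
          fix y
          have "e \<bullet> (s *\<^sub>R e + y) = e \<bullet> y + s"
            using e by (simp add: inner_add_right norm_eq_1)
          moreover have "norm y \<le> 2" if "norm (s *\<^sub>R e + y) < 1"
          proof -
            have "norm y \<le> norm (s *\<^sub>R e + y) + norm (s *\<^sub>R e)"
              by (metis add_diff_cancel_left' norm_triangle_ineq4)
            also have "\<dots> \<le> 1 + 1" using that s e by (intro add_mono) auto
            finally show ?thesis by simp
          qed
          ultimately show "inv_sqrt_weight (e \<bullet> (s *\<^sub>R e + y)) * indicator (ball 0 1) (s *\<^sub>R e + y) \<le>
              inv_sqrt_weight (e \<bullet> y + s) * indicator (cball 0 2) y"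
            by (auto simp: indicator_def)
        qed
        finally show ?thesis .
      qed
      have "?A = (\<integral>\<^sup>+s. ?A * indicator {-1/2..1/2::real} s \<partial>lborel)"
        by (subst nn_integral_cmult_indicator) auto
      also have "\<dots> \<le> (\<integral>\<^sup>+s. (\<integral>\<^sup>+y. inv_sqrt_weight (e \<bullet> y + s) * indicator (cball 0 2) y \<partial>lborel) * indicator {-1/2..1/2::real} s \<partial>lborel)"
        using shift by (intro nn_integral_mono) (auto simp: indicator_def)
      also have "\<dots> = (\<integral>\<^sup>+s. (\<integral>\<^sup>+y. inv_sqrt_weight (e \<bullet> y + s) * indicator (cball 0 2) y * indicator {-1/2..1/2::real} s \<partial>lborel) \<partial>lborel)"
        by (intro nn_integral_cong nn_integral_multc[symmetric]) measurable
      also have "\<dots> = (\<integral>\<^sup>+y. (\<integral>\<^sup>+s. inv_sqrt_weight (e \<bullet> y + s) * indicator (cball 0 2) y * indicator {-1/2..1/2::real} s \<partial>lborel) \<partial>lborel)"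
        by (rule lborel_pair.Fubini') measurable
      also have "\<dots> \<le> (\<integral>\<^sup>+y. K0 * indicator (cball (0::'a) 2) y \<partial>lborel)"
      proof (rule nn_integral_mono)
        fix y :: 'a
        show "(\<integral>\<^sup>+s. inv_sqrt_weight (e \<bullet> y + s) * indicator (cball 0 2) y * indicator {-1/2..1/2::real} s \<partial>lborel) \<le> K0 * indicator (cball 0 2) y"
        proof (cases "y \<in> cball 0 2")
          case True
          have "\<bar>e \<bullet> y\<bar> \<le> 2"
            using Cauchy_Schwarz_ineq2[of e y] e True by simp
          then have "(\<integral>\<^sup>+s. inv_sqrt_weight (e \<bullet> y + s) * indicator {-1/2..1/2::real} s \<partial>lborel)
             \<le> (\<integral>\<^sup>+s. inv_sqrt_weight (e \<bullet> y + s) * indicator {-3..3::real} (e \<bullet> y + s) \<partial>lborel)"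
            by (intro nn_integral_mono) (auto simp: indicator_def)
          also have "\<dots> = (\<integral>\<^sup>+s. inv_sqrt_weight s * indicator {-3..3::real} s \<partial>lborel)"
            by (rule nn_integral_lborel_translate) measurable
          also have "\<dots> \<le> K0"
            unfolding K0_def by (rule nn_integral_inv_sqrt_weight) simp
          finally show ?thesis using True by simp
        qed simp
      qed
      also have "\<dots> = emeasure lborel (cball (0::'a) 2) * K0"
        by (subst nn_integral_cmult_indicator) (auto simp: mult.commute)
      finally show ?thesis .
    qed
    finally show ?thesis
      unfolding K_def by (simp add: mult_left_mono)
  qed
  ultimately show ?thesis by blast
qed

text \<open>In polar coordinates u = s e, with e and \<omega> fixed, the substitution r = s (e .
  \<omega>) produces |e . \<omega>|^(-d), which the weight cancels. What is left is the polar
  integral of \<open>h\<close> over full lines through 0; it counts every point twice, once for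
  \<omega> and once for -\<omega>. The outer integral over e contributes the area of the
  sphere.\<close>

lemma nn_integral_radial_projection:
  fixes h :: "'a::euclidean_space \<Rightarrow> ennreal"
  assumes [measurable]: "h \<in> borel_measurable borel"
  shows "(\<integral>\<^sup>+u. (\<integral>\<^sup>+\<omega>. h ((u \<bullet> \<omega>) *\<^sub>R \<omega>) * ennreal ((\<bar>u \<bullet> \<omega>\<bar> / norm u) ^ DIM('a)) \<partial>sphere_measure) \<partial>lborel)
     \<le> 2 * emeasure sphere_measure (sphere (0::'a) 1) * (\<integral>\<^sup>+y. h y \<partial>lborel)"
proof -
  define d where "d = DIM('a)"
  have d: "d > 0" by (simp add: d_def)
  define H where "H \<omega> = (\<integral>\<^sup>+r. ennreal (\<bar>r\<bar> ^ (d - 1)) * h (r *\<^sub>R \<omega>) \<partial>lborel)" for \<omega>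
  note sph = measurable_compose[OF measurable_ident_sphere_borel]
  have pairm: "(\<lambda>p. F (fst p) (snd p)) \<in> borel_measurable (N \<Otimes>\<^sub>M sphere_measure)"
    if F: "(\<lambda>p. F (fst p) (snd p)) \<in> borel_measurable (N \<Otimes>\<^sub>M (borel :: 'a measure))" for F :: "'x \<Rightarrow> 'a \<Rightarrow> ennreal" and N
  proof -
    have "(\<lambda>p. (fst p, snd p)) \<in> N \<Otimes>\<^sub>M sphere_measure \<rightarrow>\<^sub>M N \<Otimes>\<^sub>M (borel :: 'a measure)"
      by (intro measurable_Pair measurable_fst measurable_compose[OF measurable_snd measurable_ident_sphere_borel])
    from measurable_compose[OF this F] show ?thesis by simp
  qed
  have Hm: "H \<in> borel_measurable borel" unfolding H_def by measurable
  have H: "(\<integral>\<^sup>+\<omega>. H \<omega> \<partial>sphere_measure) = 2 * (\<integral>\<^sup>+y. h y \<partial>lborel)"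
  proof -
    have neg: "(\<integral>\<^sup>+y. h (- y) \<partial>lborel) = (\<integral>\<^sup>+y. h y \<partial>lborel)"
      using nn_integral_lborel_scaleR[of h "-1"] by simp
    define P where "P \<omega> = (\<integral>\<^sup>+r. ennreal (r ^ (d - 1)) * indicator {0<..} r * h (r *\<^sub>R \<omega>) \<partial>lborel)" for \<omega>
    define Q where "Q \<omega> = (\<integral>\<^sup>+r. ennreal (r ^ (d - 1)) * indicator {0<..} r * h (- (r *\<^sub>R \<omega>)) \<partial>lborel)" for \<omega>
    have PQm: "P \<in> borel_measurable borel" "Q \<in> borel_measurable borel"
      unfolding P_def Q_def by measurable
    have split: "H \<omega> = P \<omega> + Q \<omega>" for \<omega>
    proof -
      define f where "f r = ennreal (\<bar>r\<bar> ^ (d - 1)) * indicator {..<0} r * h (r *\<^sub>R \<omega>)" for r :: real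
      have f: "f \<in> borel_measurable borel" unfolding f_def by measurable
      from nn_integral_lborel_scaleR[OF this, of "-1"]
      have "(\<integral>\<^sup>+r. f r \<partial>lborel) = (\<integral>\<^sup>+r. f (- r) \<partial>lborel)" by simp
      also have "\<dots> = Q \<omega>"
        unfolding Q_def f_def by (intro nn_integral_cong) (auto simp: indicator_def)
      finally have "Q \<omega> = (\<integral>\<^sup>+r. f r \<partial>lborel)" ..
      moreover have "H \<omega> = (\<integral>\<^sup>+r. ennreal (r ^ (d - 1)) * indicator {0<..} r * h (r *\<^sub>R \<omega>) + f r \<partial>lborel)"
        unfolding H_def
        by (rule nn_integral_cong_AE, rule AE_mp[OF AE_lborel_singleton[of 0]])
           (auto simp: indicator_def f_def)
      moreover have "\<dots> = P \<omega> + (\<integral>\<^sup>+r. f r \<partial>lborel)"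
        unfolding P_def using f by (intro nn_integral_add) auto
      ultimately show ?thesis by simp
    qed
    have "(\<integral>\<^sup>+\<omega>. P \<omega> \<partial>sphere_measure) = (\<integral>\<^sup>+y. h y \<partial>lborel)"
      unfolding P_def d_def by (rule nn_integral_polar[symmetric]) measurable
    moreover have "(\<integral>\<^sup>+\<omega>. Q \<omega> \<partial>sphere_measure) = (\<integral>\<^sup>+y. h (- y) \<partial>lborel)"
      unfolding Q_def d_def by (rule nn_integral_polar[symmetric]) measurable
    ultimately show ?thesis
      unfolding split using sph[OF PQm(1)] sph[OF PQm(2)] by (simp add: nn_integral_add neg mult_2)
  qed
  \<comment> \<open>Only the half-line r c > 0 is reached, hence an inequality; for c = 0 the weight
    |c|^d vanishes since d > 0.\<close>
  have inner: "(\<integral>\<^sup>+s. ennreal (s ^ (d - 1)) * indicator {0<..} s * (h ((s * c) *\<^sub>R \<omega>) * ennreal (\<bar>c\<bar> ^ d)) \<partial>lborel) \<le> H \<omega>" for c \<omega>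
  proof (cases "c = 0")
    case True
    then show ?thesis using d by (simp add: zero_power)
  next
    case c: False
    have "(\<integral>\<^sup>+r. ennreal (\<bar>r\<bar> ^ (d - 1)) * indicator {0<..} (r * c) * h (r *\<^sub>R \<omega>) \<partial>lborel)
       = ennreal (\<bar>c\<bar> ^ DIM(real)) * (\<integral>\<^sup>+s. ennreal (\<bar>c *\<^sub>R s\<bar> ^ (d - 1)) * indicator {0<..} ((c *\<^sub>R s) * c) * h ((c *\<^sub>R s) *\<^sub>R \<omega>) \<partial>lborel)"
      by (rule nn_integral_lborel_scaleR[OF _ c]) measurable
    also have "\<dots> = (\<integral>\<^sup>+s. ennreal \<bar>c\<bar> * (ennreal (\<bar>c *\<^sub>R s\<bar> ^ (d - 1)) * indicator {0<..} ((c *\<^sub>R s) * c) * h ((c *\<^sub>R s) *\<^sub>R \<omega>)) \<partial>lborel)"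
      by (subst nn_integral_cmult) auto
    also have "\<dots> = (\<integral>\<^sup>+s. ennreal (s ^ (d - 1)) * indicator {0<..} s * (h ((s * c) *\<^sub>R \<omega>) * ennreal (\<bar>c\<bar> ^ d)) \<partial>lborel)"
    proof (rule nn_integral_cong)
      fix s :: real
      show "ennreal \<bar>c\<bar> * (ennreal (\<bar>c *\<^sub>R s\<bar> ^ (d - 1)) * indicator {0<..} ((c *\<^sub>R s) * c) * h ((c *\<^sub>R s) *\<^sub>R \<omega>))
        = ennreal (s ^ (d - 1)) * indicator {0<..} s * (h ((s * c) *\<^sub>R \<omega>) * ennreal (\<bar>c\<bar> ^ d))"
      proof (cases "s > 0")
        case s: True
        have "(c *\<^sub>R s) * c = c\<^sup>2 * s" by (simp add: power2_eq_square)
        also have "\<dots> > 0" using c s by (intro mult_pos_pos) auto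
        finally have "(c *\<^sub>R s) * c > 0" .
        moreover have "\<bar>c\<bar> * \<bar>c * s\<bar> ^ (d - 1) = s ^ (d - 1) * \<bar>c\<bar> ^ d"
          using s d by (cases d) (auto simp: abs_mult power_mult_distrib)
        then have "ennreal \<bar>c\<bar> * ennreal (\<bar>c * s\<bar> ^ (d - 1)) = ennreal (s ^ (d - 1)) * ennreal (\<bar>c\<bar> ^ d)"
          using s by (simp add: ennreal_mult[symmetric])
        from arg_cong[OF this, of "\<lambda>z. z * h ((s * c) *\<^sub>R \<omega>)"]
        have "ennreal \<bar>c\<bar> * (ennreal (\<bar>c * s\<bar> ^ (d - 1)) * h ((c * s) *\<^sub>R \<omega>)) = ennreal (s ^ (d - 1)) * (h ((s * c) *\<^sub>R \<omega>) * ennreal (\<bar>c\<bar> ^ d))"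
          by (simp add: ac_simps)
        ultimately show ?thesis using s by simp
      next
        case False
        have "(c *\<^sub>R s) * c = c\<^sup>2 * s" by (simp add: power2_eq_square)
        also have "\<dots> \<le> 0" using False by (simp add: mult_nonneg_nonpos)
        finally show ?thesis using False by simp
      qed
    qed
    finally have "(\<integral>\<^sup>+s. ennreal (s ^ (d - 1)) * indicator {0<..} s * (h ((s * c) *\<^sub>R \<omega>) * ennreal (\<bar>c\<bar> ^ d)) \<partial>lborel)
      = (\<integral>\<^sup>+r. ennreal (\<bar>r\<bar> ^ (d - 1)) * indicator {0<..} (r * c) * h (r *\<^sub>R \<omega>) \<partial>lborel)" ..
    also have "\<dots> \<le> H \<omega>"
      unfolding H_def by (intro nn_integral_mono) (auto simp: indicator_def)
    finally show ?thesis .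
  qed
  define F where "F u \<omega> = h ((u \<bullet> \<omega>) *\<^sub>R \<omega>) * ennreal ((\<bar>u \<bullet> \<omega>\<bar> / norm u) ^ d)" for u \<omega> :: 'a
  have Fm: "(\<lambda>p. F (fst p) (snd p)) \<in> borel_measurable (borel \<Otimes>\<^sub>M borel)"
    unfolding F_def by measurable
  have Fms: "(\<lambda>p. F (fst p) (snd p)) \<in> borel_measurable (borel \<Otimes>\<^sub>M sphere_measure)"
    by (rule pairm[OF Fm])
  have FIm: "(\<lambda>u. \<integral>\<^sup>+\<omega>. F u \<omega> \<partial>sphere_measure) \<in> borel_measurable borel"
    using Fms by (intro sphere.borel_measurable_nn_integral) (simp add: split_beta')
  have polar_F: "F (s *\<^sub>R e) \<omega> = h ((s * (e \<bullet> \<omega>)) *\<^sub>R \<omega>) * ennreal (\<bar>e \<bullet> \<omega>\<bar> ^ d)" if "s > 0" "e \<in> sphere 0 1" for s e \<omega>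
    using that by (simp add: F_def abs_mult)
  have "(\<integral>\<^sup>+u. (\<integral>\<^sup>+\<omega>. F u \<omega> \<partial>sphere_measure) \<partial>lborel) =
     (\<integral>\<^sup>+e. (\<integral>\<^sup>+s. ennreal (s ^ (d - 1)) * indicator {0<..} s * (\<integral>\<^sup>+\<omega>. F (s *\<^sub>R e) \<omega> \<partial>sphere_measure) \<partial>lborel) \<partial>sphere_measure)"
    unfolding d_def by (rule nn_integral_polar[OF FIm])
  also have "\<dots> \<le> (\<integral>\<^sup>+e. (\<integral>\<^sup>+\<omega>. H \<omega> \<partial>sphere_measure) \<partial>(sphere_measure :: 'a measure))"
  proof (rule nn_integral_mono)
    fix e :: 'a assume "e \<in> space sphere_measure"
    then have e: "e \<in> sphere 0 1" by (simp add: space_sphere_measure)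
    define K where "K s \<omega> = ennreal (s ^ (d - 1)) * indicator {0<..} s * (h ((s * (e \<bullet> \<omega>)) *\<^sub>R \<omega>) * ennreal (\<bar>e \<bullet> \<omega>\<bar> ^ d))" for s :: real and \<omega>
    have Km: "(\<lambda>p. K (fst p) (snd p)) \<in> borel_measurable (borel \<Otimes>\<^sub>M borel)"
      unfolding K_def by measurable
    have Kms: "(\<lambda>p. K (fst p) (snd p)) \<in> borel_measurable (lborel \<Otimes>\<^sub>M sphere_measure)"
      using pairm[OF Km] by (simp cong: measurable_cong_sets add: sets_pair_measure_cong[OF sets_lborel refl])
    interpret ps: pair_sigma_finite "lborel :: real measure" "sphere_measure :: 'a measure" ..
    have Kc: "(\<lambda>\<omega>. h ((s * (e \<bullet> \<omega>)) *\<^sub>R \<omega>) * ennreal (\<bar>e \<bullet> \<omega>\<bar> ^ d)) \<in> borel_measurable sphere_measure" for s :: real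
      by (rule sph) measurable
    have "(\<integral>\<^sup>+s. ennreal (s ^ (d - 1)) * indicator {0<..} s * (\<integral>\<^sup>+\<omega>. F (s *\<^sub>R e) \<omega> \<partial>sphere_measure) \<partial>lborel)
      = (\<integral>\<^sup>+s. (\<integral>\<^sup>+\<omega>. K s \<omega> \<partial>sphere_measure) \<partial>lborel)"
    proof (rule nn_integral_cong)
      fix s :: real
      show "ennreal (s ^ (d - 1)) * indicator {0<..} s * (\<integral>\<^sup>+\<omega>. F (s *\<^sub>R e) \<omega> \<partial>sphere_measure) = (\<integral>\<^sup>+\<omega>. K s \<omega> \<partial>sphere_measure)"
      proof (cases "s > 0")
        case True
        then show ?thesis unfolding K_def using e Kc[of s] by (simp add: polar_F nn_integral_cmult)
      qed (simp add: K_def)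
    qed
    also have "\<dots> = (\<integral>\<^sup>+\<omega>. (\<integral>\<^sup>+s. K s \<omega> \<partial>lborel) \<partial>sphere_measure)"
      using Kms by (intro ps.Fubini'[symmetric]) (simp add: split_beta')
    also have "\<dots> \<le> (\<integral>\<^sup>+\<omega>. H \<omega> \<partial>sphere_measure)"
      unfolding K_def by (intro nn_integral_mono inner)
    finally show "(\<integral>\<^sup>+s. ennreal (s ^ (d - 1)) * indicator {0<..} s * (\<integral>\<^sup>+\<omega>. F (s *\<^sub>R e) \<omega> \<partial>sphere_measure) \<partial>lborel) \<le> (\<integral>\<^sup>+\<omega>. H \<omega> \<partial>sphere_measure)" .
  qed
  also have "\<dots> = 2 * emeasure sphere_measure (sphere (0::'a) 1) * (\<integral>\<^sup>+y. h y \<partial>lborel)"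
    by (simp add: H space_sphere_measure ac_simps)
  finally show ?thesis by (simp add: F_def d_def)
qed

text \<open>The solution of 2 d l = 1 - l. This relation cancels the angular powers in
  \<open>averaging_Young\<close>, and again splits the velocity weight in
  \<open>powr_le_moment_plus_weight\<close>. It is attached to a type because d is
  \<open>DIM('a)\<close>.\<close>

definition averaging_exponent :: "'a::euclidean_space itself \<Rightarrow> real" where
  "averaging_exponent _ = 1 / (2 * real DIM('a) + 1)"

lemma averaging_exponent_bounds:
  "0 < averaging_exponent TYPE('a::euclidean_space)" "averaging_exponent TYPE('a::euclidean_space) \<le> 1/3"
proof -
  have "real DIM('a) \<ge> 1" by (simp add: Suc_leI)
  then show "0 < averaging_exponent TYPE('a)" "averaging_exponent TYPE('a) \<le> 1/3"
    by (auto simp: averaging_exponent_def field_simps)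
qed

text \<open>Replacing both factors by powers of \<open>max a b\<close> already gives the constant 1,
  which is all that is used.\<close>

lemma weighted_Young_powr:
  fixes a b l :: real
  assumes "0 \<le> a" "0 \<le> b" "0 < l" "l < 1"
  shows "a powr (1 - l) * b powr l \<le> a + b"
proof -
  let ?m = "max a b"
  have "a powr (1 - l) * b powr l \<le> ?m powr (1 - l) * ?m powr l"
    using assms by (intro mult_mono powr_mono2) auto
  also have "\<dots> = ?m" using assms by (simp add: powr_add[symmetric])
  also have "\<dots> \<le> a + b" using assms by auto
  finally show ?thesis .
qed

text \<open>Young's inequality with exponents 1 - l and l, applied to g c^(-1/2) and h c^d: for this
  l the powers of c cancel. The factor c^d is what the radial projection needs to integrate
  \<open>h\<close> at v'; its price c^(-1/2) is integrable over the sphere.\<close>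

lemma averaging_Young:
  fixes g h c :: real
  assumes g: "0 \<le> g" and h: "0 \<le> h" and c: "0 \<le> c"
  defines "l \<equiv> averaging_exponent TYPE('a::euclidean_space)"
  shows "ennreal (g powr (1 - l) * h powr l) \<le> ennreal g * inv_sqrt_weight c + ennreal h * ennreal (c ^ DIM('a))"
proof (cases "c = 0 \<or> g = 0")
  case True
  then show ?thesis using averaging_exponent_bounds[where 'a='a] g
    by (cases "g = 0") (auto simp: l_def inv_sqrt_weight_def ennreal_mult_top ennreal_eq_0_iff)
next
  case False
  then have c: "c > 0" using c by simp
  let ?d = "real DIM('a)"
  have l: "0 < l" "l < 1" using averaging_exponent_bounds[where 'a='a] by (auto simp: l_def)
  have "c powr (- 1/2 * (1 - l)) * c powr (?d * l) = 1"
  proof -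
    have "- 1/2 * (1 - l) + ?d * l = 0"
      by (simp add: l_def averaging_exponent_def field_simps)
    then show ?thesis using c by (simp only: powr_add[symmetric]) simp
  qed
  moreover have "(g * c powr (- 1/2)) powr (1 - l) * (h * c ^ DIM('a)) powr l =
      (g powr (1 - l) * h powr l) * (c powr (- 1/2 * (1 - l)) * c powr (?d * l))"
    using g h c by (simp add: powr_mult powr_powr powr_realpow[symmetric])
  ultimately have "g powr (1 - l) * h powr l = (g * c powr (- 1/2)) powr (1 - l) * (h * c ^ DIM('a)) powr l"
    by simp
  also have "\<dots> \<le> g * c powr (- 1/2) + h * c ^ DIM('a)"
    using g h c l by (intro weighted_Young_powr) auto
  finally show ?thesis
    using g h c by (simp add: inv_sqrt_weight_def ennreal_mult[symmetric] ennreal_plus[symmetric] ennreal_leI del: ennreal_plus)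
qed

text \<open>Take c to be the modulus of the cosine between u = v - vs and \<omega>. In the first
  term of \<open>averaging_Young\<close> the integral over \<omega> is bounded uniformly in the
  direction of u; the second is a radial projection, as v' = v - (u . \<omega>) \<omega>. The
  constant must not depend on v, because the result is later integrated against a density in
  v.\<close>

lemma collision_averaging:
  defines "l \<equiv> averaging_exponent TYPE('a::euclidean_space)"
  shows "\<exists>K<\<infinity>. \<forall>v::'a. \<forall>g h. g \<in> borel_measurable borel \<longrightarrow> h \<in> borel_measurable borel \<longrightarrow>
    (\<forall>x. 0 \<le> g x) \<longrightarrow> (\<forall>x. 0 \<le> h x) \<longrightarrow>
    (\<integral>\<^sup>+vs. (\<integral>\<^sup>+\<omega>. ennreal (g vs powr (1 - l) * h (post v vs \<omega>) powr l) \<partial>sphere_measure) \<partial>lborel)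
     \<le> K * ((\<integral>\<^sup>+x. ennreal (g x) \<partial>lborel) + (\<integral>\<^sup>+x. ennreal (h x) \<partial>lborel))"
proof -
  obtain K1 where K1: "K1 < \<infinity>" "\<And>e::'a. norm e = 1 \<Longrightarrow> (\<integral>\<^sup>+\<omega>. inv_sqrt_weight (e \<bullet> \<omega>) \<partial>sphere_measure) \<le> K1"
    using sphere_integral_inv_sqrt_weight[where 'a='a] by blast
  define K2 where "K2 = 2 * emeasure sphere_measure (sphere (0::'a) 1)"
  have K2: "K2 < \<infinity>"
  proof -
    have "emeasure sphere_measure (sphere (0::'a) 1) \<noteq> top"
      using finite_measure.finite_emeasure_space[OF finite_sphere_measure[where 'a='a]]
      by (simp add: space_sphere_measure)
    then show ?thesis unfolding K2_def infinity_ennreal_def less_top[symmetric]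
      by (simp add: ennreal_mult_eq_top_iff)
  qed
  note sph = measurable_compose[OF measurable_ident_sphere_borel]
  have "(\<integral>\<^sup>+vs. (\<integral>\<^sup>+\<omega>. ennreal (g vs powr (1 - l) * h (post v vs \<omega>) powr l) \<partial>sphere_measure) \<partial>lborel)
     \<le> (K1 + K2) * ((\<integral>\<^sup>+x. ennreal (g x) \<partial>lborel) + (\<integral>\<^sup>+x. ennreal (h x) \<partial>lborel))"
    if gm[measurable]: "g \<in> borel_measurable borel" and hm[measurable]: "h \<in> borel_measurable borel"
      and g: "\<And>x. 0 \<le> g x" and h: "\<And>x. 0 \<le> h x" for v :: 'a and g h :: "'a \<Rightarrow> real"
  proof -
    define J where "J vs = (\<integral>\<^sup>+\<omega>. ennreal (g vs powr (1 - l) * h (post v vs \<omega>) powr l) \<partial>sphere_measure)" for vs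
    define R where "R u = (\<integral>\<^sup>+\<omega>. ennreal (h (v - (u \<bullet> \<omega>) *\<^sub>R \<omega>)) * ennreal ((\<bar>u \<bullet> \<omega>\<bar> / norm u) ^ DIM('a)) \<partial>sphere_measure)" for u
    have J_le: "J vs \<le> K1 * ennreal (g vs) + R (v - vs)" if "vs \<noteq> v" for vs
    proof -
      define u where "u = v - vs"
      have u: "norm u > 0" using that by (simp add: u_def)
      have m1: "(\<lambda>\<omega>. inv_sqrt_weight ((u /\<^sub>R norm u) \<bullet> \<omega>)) \<in> borel_measurable sphere_measure"
        by (rule sph) measurable
      have m2: "(\<lambda>\<omega>. ennreal (h (v - (u \<bullet> \<omega>) *\<^sub>R \<omega>)) * ennreal ((\<bar>u \<bullet> \<omega>\<bar> / norm u) ^ DIM('a))) \<in> borel_measurable sphere_measure"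
        by (rule sph) measurable
      have "J vs \<le> (\<integral>\<^sup>+\<omega>. ennreal (g vs) * inv_sqrt_weight ((u /\<^sub>R norm u) \<bullet> \<omega>) +
          ennreal (h (v - (u \<bullet> \<omega>) *\<^sub>R \<omega>)) * ennreal ((\<bar>u \<bullet> \<omega>\<bar> / norm u) ^ DIM('a)) \<partial>sphere_measure)"
        unfolding J_def
      proof (rule nn_integral_mono)
        fix \<omega> :: 'a
        have w: "inv_sqrt_weight (\<bar>u \<bullet> \<omega>\<bar> / norm u) = inv_sqrt_weight ((u /\<^sub>R norm u) \<bullet> \<omega>)"
        proof -
          have "(u /\<^sub>R norm u) \<bullet> \<omega> = (u \<bullet> \<omega>) / norm u" by (simp add: divide_inverse mult.commute)
          then show ?thesis by (simp only: inv_sqrt_weight_def abs_divide abs_abs abs_norm_cancel divide_eq_0_iff abs_eq_0)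
        qed
        show "ennreal (g vs powr (1 - l) * h (post v vs \<omega>) powr l) \<le> ennreal (g vs) * inv_sqrt_weight ((u /\<^sub>R norm u) \<bullet> \<omega>) +
          ennreal (h (v - (u \<bullet> \<omega>) *\<^sub>R \<omega>)) * ennreal ((\<bar>u \<bullet> \<omega>\<bar> / norm u) ^ DIM('a))"
          using averaging_Young[OF g[of vs] h[of "post v vs \<omega>"], of "\<bar>u \<bullet> \<omega>\<bar> / norm u", where 'a='a]
          by (simp only: w l_def[symmetric]) (simp add: post_def u_def)
      qed
      also have "\<dots> = ennreal (g vs) * (\<integral>\<^sup>+\<omega>. inv_sqrt_weight ((u /\<^sub>R norm u) \<bullet> \<omega>) \<partial>sphere_measure) + R u"
        unfolding R_def using m1 m2 by (simp add: nn_integral_add nn_integral_cmult)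
      also have "\<dots> \<le> ennreal (g vs) * K1 + R u"
        using u by (intro add_mono mult_left_mono K1) auto
      finally show ?thesis by (simp add: u_def mult.commute)
    qed
    have Rm: "R \<in> borel_measurable borel"
    proof -
      have "(\<lambda>p. ennreal (h (v - (fst p \<bullet> snd p) *\<^sub>R snd p)) * ennreal ((\<bar>fst p \<bullet> snd p\<bar> / norm (fst p)) ^ DIM('a))) \<in> borel_measurable (borel \<Otimes>\<^sub>M borel)"
        by measurable
      from measurable_compose[OF measurable_Pair[OF measurable_fst measurable_compose[OF measurable_snd measurable_ident_sphere_borel]] this]
      show ?thesis unfolding R_def
        by (intro sphere.borel_measurable_nn_integral) (simp add: split_beta')
    qed
    have "(\<integral>\<^sup>+vs. J vs \<partial>lborel) \<le> (\<integral>\<^sup>+vs. K1 * ennreal (g vs) + R (v - vs) \<partial>lborel)"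
      by (rule nn_integral_mono_AE, rule AE_mp[OF AE_lborel_singleton[of v]]) (auto intro: J_le)
    also have "\<dots> = K1 * (\<integral>\<^sup>+vs. ennreal (g vs) \<partial>lborel) + (\<integral>\<^sup>+vs. R (v - vs) \<partial>lborel)"
      using Rm by (simp add: nn_integral_add nn_integral_cmult)
    also have "(\<integral>\<^sup>+vs. R (v - vs) \<partial>lborel) = (\<integral>\<^sup>+u. R u \<partial>lborel)"
    proof -
      have "(\<integral>\<^sup>+u. R u \<partial>lborel) = (\<integral>\<^sup>+u. R (v + u) \<partial>lborel)"
        by (rule nn_integral_lborel_translate[OF Rm, symmetric])
      also have "\<dots> = (\<integral>\<^sup>+u. R (v - u) \<partial>lborel)"
        using nn_integral_lborel_scaleR[of "\<lambda>u. R (v + u)" "-1"] Rm by simp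
      finally show ?thesis ..
    qed
    also have "(\<integral>\<^sup>+u. R u \<partial>lborel) \<le> K2 * (\<integral>\<^sup>+x. ennreal (h (v - x)) \<partial>lborel)"
      unfolding R_def K2_def by (rule nn_integral_radial_projection) measurable
    also have "(\<integral>\<^sup>+x. ennreal (h (v - x)) \<partial>lborel) = (\<integral>\<^sup>+x. ennreal (h x) \<partial>lborel)"
    proof -
      have "(\<integral>\<^sup>+u. ennreal (h u) \<partial>lborel) = (\<integral>\<^sup>+u. ennreal (h (v + u)) \<partial>lborel)"
        by (rule nn_integral_lborel_translate[symmetric]) measurable
      also have "\<dots> = (\<integral>\<^sup>+u. ennreal (h (v - u)) \<partial>lborel)"
        using nn_integral_lborel_scaleR[of "\<lambda>u. ennreal (h (v + u))" "-1"] by simp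
      finally show ?thesis ..
    qed
    also have "K1 * (\<integral>\<^sup>+vs. ennreal (g vs) \<partial>lborel) + K2 * (\<integral>\<^sup>+x. ennreal (h x) \<partial>lborel) \<le>
        (K1 + K2) * ((\<integral>\<^sup>+x. ennreal (g x) \<partial>lborel) + (\<integral>\<^sup>+x. ennreal (h x) \<partial>lborel))"
      unfolding distrib_left by (intro add_mono mult_right_mono) auto
    finally show ?thesis by (simp add: J_def add_left_mono)
  qed
  moreover have "K1 + K2 < \<infinity>" using K1 K2 by simp
  ultimately show ?thesis by blast
qed

section \<open>Collisions as isometries of the pair of velocities\<close>

lemma post_involution:
  assumes "norm \<omega> = 1"
  shows "post (post v vs \<omega>) (post_star v vs \<omega>) \<omega> = v" "post_star (post v vs \<omega>) (post_star v vs \<omega>) \<omega> = vs"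
proof -
  have "(post v vs \<omega> - post_star v vs \<omega>) \<bullet> \<omega> = - ((v - vs) \<bullet> \<omega>)"
    using assms by (simp add: post_def post_star_def algebra_simps norm_eq_1)
  then show "post (post v vs \<omega>) (post_star v vs \<omega>) \<omega> = v" "post_star (post v vs \<omega>) (post_star v vs \<omega>) \<omega> = vs"
    by (simp_all only: post_def[of "post v vs \<omega>"] post_star_def[of "post v vs \<omega>"])
       (simp_all add: post_def post_star_def)
qed

lemma post_swap: "post vs v \<omega> = post_star v vs \<omega>" "post_star vs v \<omega> = post v vs \<omega>"
  by (simp_all add: post_def post_star_def algebra_simps)

text \<open>For fixed \<omega> the collision is linear and conserves the kinetic energy |v|^2 +
  |vs|^2. This makes it volume preserving on pairs without a Jacobian computation.\<close>

lemma orthogonal_transformation_collision: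
  assumes "norm \<omega> = 1"
  shows "orthogonal_transformation (\<lambda>(v, vs). (post v vs \<omega>, post_star v vs \<omega>))"
  unfolding orthogonal_transformation
proof
  show "linear (\<lambda>(v, vs). (post v vs \<omega>, post_star v vs \<omega>))"
    by (rule linearI) (auto simp: post_def post_star_def algebra_simps)
  show "\<forall>p. norm (case p of (v, vs) \<Rightarrow> (post v vs \<omega>, post_star v vs \<omega>)) = norm p"
    using assms
    by (auto simp: norm_prod_def norm_eq_sqrt_inner inner_prod_def)
       (auto simp: post_def post_star_def algebra_simps inner_commute norm_eq_1)
qed

lemma nn_integral_collision_lborel:
  fixes F :: "'a::euclidean_space \<times> 'a \<Rightarrow> ennreal"
  assumes [measurable]: "F \<in> borel_measurable borel" and "norm \<omega> = 1"
  shows "(\<integral>\<^sup>+p. F (post (fst p) (snd p) \<omega>, post_star (fst p) (snd p) \<omega>) \<partial>lborel) = (\<integral>\<^sup>+p. F p \<partial>lborel)"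
proof -
  let ?T = "\<lambda>p. (post (fst p) (snd p) \<omega>, post_star (fst p) (snd p) \<omega>) :: 'a \<times> 'a"
  have "?T \<in> borel_measurable borel"
    unfolding post_def post_star_def by (intro borel_measurable_continuous_onI continuous_intros)
  moreover have "distr lborel borel ?T = lborel"
    using distr_lborel_orthogonal[OF orthogonal_transformation_collision[OF assms(2)]]
    by (simp add: split_beta')
  ultimately show ?thesis
    using nn_integral_distr[of ?T lborel borel F] by simp
qed

lemma nn_integral_swap_lborel:
  fixes F :: "'a::euclidean_space \<times> 'a \<Rightarrow> ennreal"
  assumes [measurable]: "F \<in> borel_measurable borel"
  shows "(\<integral>\<^sup>+p. F (snd p, fst p) \<partial>lborel) = (\<integral>\<^sup>+p. F p \<partial>lborel)"
proof -
  let ?T = "\<lambda>p. (snd p, fst p) :: 'a \<times> 'a"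
  have "orthogonal_transformation ?T"
    unfolding orthogonal_transformation
    by (auto intro!: linearI simp: norm_prod_def add.commute)
  moreover have "?T \<in> borel_measurable borel"
    by (intro borel_measurable_continuous_onI continuous_intros)
  ultimately show ?thesis
    using nn_integral_distr[of ?T lborel borel F] distr_lborel_orthogonal[of ?T] by simp
qed

section \<open>Clamped logarithms\<close>

definition clamp_pos :: "real \<Rightarrow> real \<Rightarrow> real" where
  "clamp_pos N s = max (1 / N) (min N s)"

definition ln_clamp :: "real \<Rightarrow> real \<Rightarrow> real" where
  "ln_clamp N s = ln (clamp_pos N s)"

text \<open>The antiderivative of \<open>ln_clamp N\<close> that vanishes at 0, which is why 1/N is
  added. It is affine below 1/N and above N, so its growth is linear and it is integrable along
  densities. On [1/N, N] it contains the term -s, whose integral -1 reappears as the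
  \<open>+ 1\<close> of \<open>entropy_limit\<close>.\<close>

definition trunc_entropy :: "real \<Rightarrow> real \<Rightarrow> real" where
  "trunc_entropy N s = s * ln_clamp N s - clamp_pos N s + 1 / N"

lemma clamp_pos_bounds:
  assumes "N \<ge> 1"
  shows "1 / N \<le> clamp_pos N s" "clamp_pos N s \<le> N" "0 < clamp_pos N s"
proof -
  have "1 / N \<le> N" using assms by (smt (verit) divide_le_eq_1)
  then show 1: "1 / N \<le> clamp_pos N s" "clamp_pos N s \<le> N" by (auto simp: clamp_pos_def)
  show "0 < clamp_pos N s" using assms 1(1) by (smt (verit) divide_pos_pos)
qed

lemma clamp_pos_measurable[measurable]: "clamp_pos N \<in> borel_measurable borel"
  unfolding clamp_pos_def[abs_def] by measurable

lemma ln_clamp_measurable[measurable]: "ln_clamp N \<in> borel_measurable borel"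
  unfolding ln_clamp_def[abs_def] by measurable

lemma trunc_entropy_measurable[measurable]: "trunc_entropy N \<in> borel_measurable borel"
  unfolding trunc_entropy_def[abs_def] by measurable

lemma ln_clamp_abs_le: "N \<ge> 1 \<Longrightarrow> \<bar>ln_clamp N s\<bar> \<le> ln N"
proof -
  assume N: "N \<ge> 1"
  have "ln (1 / N) \<le> ln_clamp N s" "ln_clamp N s \<le> ln N"
    unfolding ln_clamp_def using clamp_pos_bounds[OF N, of s] N by (auto simp: ln_le_cancel_iff)
  then show ?thesis using N by (simp add: ln_div)
qed

lemma ln_clamp_max_zero: "N \<ge> 1 \<Longrightarrow> ln_clamp N (max 0 s) = ln_clamp N s"
proof -
  assume N: "N \<ge> 1"
  define e where "e = 1 / N"
  have "e > 0" using N by (simp add: e_def)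
  then show ?thesis using N unfolding ln_clamp_def clamp_pos_def e_def[symmetric] by (auto simp: max_def min_def)
qed

lemma clamp_pos_diff_le: "\<bar>clamp_pos N x - clamp_pos N y\<bar> \<le> \<bar>x - y\<bar>"
  by (auto simp: clamp_pos_def max_def min_def)

lemma ln_clamp_diff_le:
  assumes "N \<ge> 1"
  shows "\<bar>ln_clamp N x - ln_clamp N y\<bar> \<le> N * \<bar>x - y\<bar>"
proof -
  have "ln_clamp N x - ln_clamp N y \<le> N * \<bar>x - y\<bar>" for x y
  proof -
    let ?a = "clamp_pos N x" and ?b = "clamp_pos N y"
    note b = clamp_pos_bounds[OF assms, of y] and a = clamp_pos_bounds[OF assms, of x]
    have "ln_clamp N x - ln_clamp N y = ln (?a / ?b)"
      using a b by (simp add: ln_clamp_def ln_div)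
    also have "\<dots> \<le> ?a / ?b - 1" using a b by (intro ln_le_minus_one) auto
    also have "\<dots> = (?a - ?b) / ?b" using b by (simp add: field_simps)
    also have "\<dots> \<le> \<bar>?a - ?b\<bar> / ?b" using b by (intro divide_right_mono) auto
    also have "\<dots> \<le> \<bar>?a - ?b\<bar> / (1 / N)" using b assms by (intro divide_left_mono) auto
    also have "\<dots> = N * \<bar>?a - ?b\<bar>" by simp
    also have "\<dots> \<le> N * \<bar>x - y\<bar>" using assms clamp_pos_diff_le[of N x y] by (intro mult_left_mono) auto
    finally show ?thesis .
  qed
  from this[of x y] this[of y x] show ?thesis by (simp add: abs_le_iff abs_minus_commute)
qed

text \<open>After cancellation the claim reads y (ln a - ln b) \<le> a - b for the clamped values a,
  b of x, y. If y differs from b, then b is a threshold, the sign of ln (a / b) is known, and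
  replacing y by b only enlarges the left side; then ln z \<le> z - 1 finishes. No differentiability
  is used at the thresholds.\<close>

lemma trunc_entropy_subgradient:
  assumes "N \<ge> 1"
  shows "trunc_entropy N x + ln_clamp N x * (y - x) \<le> trunc_entropy N y"
proof -
  let ?a = "clamp_pos N x" and ?b = "clamp_pos N y"
  note b = clamp_pos_bounds[OF assms, of y] and a = clamp_pos_bounds[OF assms, of x]
  have N1: "1 / N \<le> N" using a by linarith
  have lnab: "ln ?a - ln ?b = ln (?a / ?b)" using a b by (simp add: ln_div)
  have lin: "ln (?a / ?b) \<le> ?a / ?b - 1" using a b by (intro ln_le_minus_one) auto
  have key: "?b * ln (?a / ?b) \<le> ?a - ?b"
  proof -
    have "?b * ln (?a / ?b) \<le> ?b * (?a / ?b - 1)" using lin b by (intro mult_left_mono) auto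
    also have "\<dots> = ?a - ?b" using b by (simp add: field_simps)
    finally show ?thesis .
  qed
  have "y * (ln ?a - ln ?b) \<le> ?a - ?b"
  proof -
    consider "y < 1 / N" | "1 / N \<le> y" "y \<le> N" | "y > N" by linarith
    then show ?thesis
    proof cases
      case 1
      then have b': "?b = 1 / N" using N1 by (auto simp: clamp_pos_def)
      have "?b \<le> ?a" using b' a(1) by simp
      then have "0 \<le> ln (?a / ?b)" using b by (intro ln_ge_zero) (simp add: le_divide_eq)
      then have "y * ln (?a / ?b) \<le> ?b * ln (?a / ?b)" using 1 b' by (intro mult_right_mono) auto
      then show ?thesis using key lnab by simp
    next
      case 2
      then have "?b = y" by (auto simp: clamp_pos_def)
      then show ?thesis using key lnab by simp
    next
      case 3
      then have b': "?b = N" using N1 by (auto simp: clamp_pos_def)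
      then have "ln (?a / ?b) \<le> 0" using a b by (subst ln_le_zero_iff) auto
      then have "y * ln (?a / ?b) \<le> ?b * ln (?a / ?b)" using 3 b' by (intro mult_right_mono_neg) auto
      then show ?thesis using key lnab by simp
    qed
  qed
  then show ?thesis by (simp add: trunc_entropy_def ln_clamp_def algebra_simps)
qed

text \<open>The two subgradient inequalities put the remainder between 0 and (ln_clamp N y -
  ln_clamp N x) (y - x), and \<open>ln_clamp N\<close> is N-Lipschitz. This replaces a second
  derivative, which does not exist at the thresholds.\<close>

lemma trunc_entropy_taylor:
  assumes "N \<ge> 1"
  shows "\<bar>trunc_entropy N y - trunc_entropy N x - ln_clamp N x * (y - x)\<bar> \<le> N * (y - x)\<^sup>2"
proof -
  have 1: "trunc_entropy N y - trunc_entropy N x - ln_clamp N x * (y - x) \<ge> 0"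
    using trunc_entropy_subgradient[OF assms, of x y] by simp
  have "trunc_entropy N y - trunc_entropy N x - ln_clamp N x * (y - x) \<le> (ln_clamp N y - ln_clamp N x) * (y - x)"
    using trunc_entropy_subgradient[OF assms, of y x] by (simp add: algebra_simps)
  also have "\<dots> \<le> \<bar>ln_clamp N y - ln_clamp N x\<bar> * \<bar>y - x\<bar>"
    by (metis abs_ge_self abs_mult)
  also have "\<dots> \<le> (N * \<bar>y - x\<bar>) * \<bar>y - x\<bar>"
    by (intro mult_right_mono ln_clamp_diff_le assms) auto
  also have "\<dots> = N * (y - x)\<^sup>2" by (simp add: power2_eq_square)
  finally show ?thesis using 1 by simp
qed

lemma trunc_entropy_zero: "N \<ge> 1 \<Longrightarrow> trunc_entropy N 0 = 0"
proof -
  assume "N \<ge> 1"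
  then have "1 / N > 0" by simp
  then show ?thesis using \<open>N \<ge> 1\<close> by (simp add: trunc_entropy_def clamp_pos_def)
qed

lemma trunc_entropy_abs_le:
  assumes "N \<ge> 1"
  shows "\<bar>trunc_entropy N s\<bar> \<le> ln N * \<bar>s\<bar>"
proof -
  have 1: "trunc_entropy N s \<ge> ln_clamp N 0 * s"
    using trunc_entropy_subgradient[OF assms, of 0 s] trunc_entropy_zero[OF assms] by simp
  have 2: "trunc_entropy N s \<le> ln_clamp N s * s"
    using trunc_entropy_subgradient[OF assms, of s 0] trunc_entropy_zero[OF assms] by simp
  have "\<bar>ln_clamp N 0 * s\<bar> \<le> ln N * \<bar>s\<bar>" "\<bar>ln_clamp N s * s\<bar> \<le> ln N * \<bar>s\<bar>"
    unfolding abs_mult by (intro mult_right_mono ln_clamp_abs_le assms; simp)+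
  with 1 2 show ?thesis by linarith
qed

text \<open>
  Clamping the logarithm can increase the collision gradient \<open>D\<close>. If it does, either one of
  \<open>a\<close>, \<open>b\<close> is at the upper threshold, which the other factor compensates, or one of \<open>a'\<close>, \<open>b'\<close> is
  below the lower threshold. In both cases \<open>exp D\<close> is bounded independently of \<open>N\<close>.
\<close>

lemma clamp_gradient_bound:
  fixes a b a' b' l N :: real
  assumes N: "N \<ge> 1" and nn: "0 \<le> a" "0 \<le> b" "0 \<le> a'" "0 \<le> b'" and l: "0 < l" "l < 1"
  defines "D \<equiv> ln_clamp N a' + ln_clamp N b' - ln_clamp N a - ln_clamp N b"
  assumes D: "0 < D" and less: "a * b > 0 \<Longrightarrow> a' * b' < a * b * exp D"
  shows "a * b * exp (l * D) \<le> (a * b) powr (1 - l) + a * b powr (1 - l) * a' powr l + b * a powr (1 - l) * b' powr l"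
proof (cases "a * b = 0")
  case True
  have "0 \<le> a * b powr (1 - l) * a' powr l" "0 \<le> b * a powr (1 - l) * b' powr l" "0 \<le> (a * b) powr (1 - l)"
    using nn by auto
  then show ?thesis using True by (simp only: True mult_zero_left)
next
  case False
  then have pos: "a > 0" "b > 0" using nn by auto
  let ?c = "clamp_pos N"
  have c: "1 / N \<le> ?c s" "?c s \<le> N" "0 < ?c s" for s using clamp_pos_bounds[OF N, of s] by auto
  have ge: "s \<le> ?c s" if "s < N" for s using that by (auto simp: clamp_pos_def)
  have le: "?c s \<le> s" if "1 / N \<le> s" for s using that by (auto simp: clamp_pos_def)
  have low: "?c s = 1 / N" if "s < 1 / N" for s using that c(1)[of s] N by (auto simp: clamp_pos_def)
  have high: "?c s = N" if "N \<le> s" for s using that c(1)[of s] c(2)[of s] by (auto simp: clamp_pos_def)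
  have eD: "exp D = (?c a' * ?c b') / (?c a * ?c b)"
    using c by (simp add: D_def ln_clamp_def exp_diff exp_add field_simps)
  have e1: "exp D > 1" using D by simp
  have powr_l: "exp (l * D) = exp D powr l" by (simp add: powr_def)
  have t: "0 \<le> a * b powr (1 - l) * a' powr l" "0 \<le> b * a powr (1 - l) * b' powr l" "0 \<le> (a * b) powr (1 - l)"
    using nn by auto
  \<comment> \<open>As \<open>?c x = N\<close> dominates \<open>?c w\<close>, exp D \<le>
    \<open>?c z / ?c y\<close>. Since exp D > 1, this forces y < N and z \<ge> 1/N, so clamping can
    only have raised y and lowered z, and exp D \<le> z / y follows. It is used with (y, z) = (b,
    a') and (a, b'): these are the pairings that \<open>collision_averaging\<close> can
    integrate.\<close>
  have upper: "y * exp D powr l \<le> y powr (1 - l) * z powr l"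
    if h: "x \<ge> N" "y > 0" "exp D = (?c z * ?c w) / (?c x * ?c y)" "0 \<le> z" for x y z w
  proof -
    have cx: "?c x = N" using h by (intro high)
    have le1: "exp D \<le> ?c z / ?c y"
    proof -
      have "exp D = (?c z / ?c y) * (?c w / N)" using h cx by simp
      also have "\<dots> \<le> (?c z / ?c y) * 1" using c[of w] c[of z] c[of y] N by (intro mult_left_mono) auto
      finally show ?thesis by simp
    qed
    from order.strict_trans2[OF e1 le1] have "1 < ?c z / ?c y" .
    then have zy: "?c y < ?c z" using c[of y] by (simp add: field_simps)
    then have "y < N" using c(2)[of z] high[of y] by (cases "y < N") auto
    have "\<not> z < 1 / N" using low[of z] zy c(1)[of y] by auto
    then have "?c z \<le> z" by (intro le) simp
    have "exp D \<le> z / y"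
    proof -
      have "?c z / ?c y \<le> z / y" using \<open>?c z \<le> z\<close> ge[OF \<open>y < N\<close>] h c[of y] c[of z]
        by (intro frac_le) auto
      with le1 show ?thesis by simp
    qed
    then have "exp D powr l \<le> (z / y) powr l" using l by (intro powr_mono2) auto
    then have "y * exp D powr l \<le> y * (z / y) powr l" using h by (intro mult_left_mono) auto
    also have "\<dots> = y powr (1 - l) * z powr l"
      using h by (simp add: powr_divide powr_diff)
    finally show ?thesis .
  qed
  consider "a \<ge> N" | "b \<ge> N" | "a < N" "b < N" by linarith
  then show ?thesis
  proof cases
    case 1
    from upper[OF this pos(2) eD nn(3)] have "a * (b * exp D powr l) \<le> a * (b powr (1 - l) * a' powr l)"
      using nn by (intro mult_left_mono) auto
    then show ?thesis using t unfolding powr_l mult.assoc by linarith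
  next
    case 2
    have "exp D = (?c b' * ?c a') / (?c b * ?c a)" using eD by (simp add: ac_simps)
    from upper[OF 2 pos(1) this nn(4)] have "b * (a * exp D powr l) \<le> b * (a powr (1 - l) * b' powr l)"
      using nn by (intro mult_left_mono) auto
    then have "a * (b * exp D powr l) \<le> b * (a powr (1 - l) * b' powr l)" by (simp only: mult.left_commute)
    then show ?thesis using t unfolding powr_l mult.assoc by linarith
  next
    case 3
    then have ab: "a * b \<le> ?c a * ?c b" using ge[of a] ge[of b] 3 pos by (intro mult_mono) auto
    \<comment> \<open>Otherwise clamping would only lower a' and b', while it only raises a and b as
      they are below N; then exp D \<le> a' b' / (a b), against \<open>less\<close>.\<close>
    have "a' < 1 / N \<or> b' < 1 / N"
    proof (rule ccontr)
      assume "\<not> ?thesis"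
      then have "?c a' * ?c b' \<le> a' * b'" using le c nn by (intro mult_mono) (auto intro: less_imp_le)
      then have "(?c a' * ?c b') * (a * b) \<le> (a' * b') * (?c a * ?c b)"
        using nn by (intro mult_mono[OF _ ab]) auto
      moreover have "a' * b' * (?c a * ?c b) < a * b * (?c a' * ?c b')"
        using less pos c[of a] c[of b] by (simp add: eD field_simps)
      ultimately show False by (simp add: ac_simps)
    qed
    \<comment> \<open>One clamped value is exactly 1/N and the other at most N. Hence exp D \<le> 1
      / (a b), which is the source of the term (a b)^(1 - l).\<close>
    then have "?c a' * ?c b' \<le> 1"
    proof
      assume "a' < 1 / N"
      then have "?c a' * ?c b' \<le> 1 / N * N" using low[of a'] c[of b'] N by (intro mult_mono) auto
      then show ?thesis using N by simp
    next
      assume "b' < 1 / N"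
      then have "?c a' * ?c b' \<le> N * (1 / N)" using low[of b'] c[of a'] N by (intro mult_mono) auto
      then show ?thesis using N by simp
    qed
    then have "exp D \<le> 1 / (?c a * ?c b)" unfolding eD using c by (intro divide_right_mono) (auto intro: less_imp_le)
    also have "\<dots> \<le> 1 / (a * b)" using ab pos by (intro divide_left_mono) (auto simp: c)
    finally have "exp D powr l \<le> (1 / (a * b)) powr l" using l by (intro powr_mono2) auto
    then have "a * b * exp D powr l \<le> a * b * (1 / (a * b)) powr l" using pos by (intro mult_left_mono) auto
    also have "\<dots> = (a * b) powr (1 - l)" using pos by (simp add: powr_divide powr_diff)
    finally show ?thesis using t powr_l by simp
  qed
qed

section \<open>Legendre duality\<close>

lemma structural_assumptionsD:
  assumes A: "structural_assumptions \<Psi> \<Psi>s \<theta> G"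
  shows "\<forall>x. 0 \<le> \<Psi>s x" "convex_on UNIV \<Psi>s" "\<Psi>s differentiable_on UNIV"
    "filterlim (\<lambda>x. \<Psi>s x / \<bar>x\<bar>) at_top at_infinity" "\<forall>x. \<Psi>s (- x) = \<Psi>s x" "\<Psi>s 0 = 0"
    "\<Psi> = convex_conjugate \<Psi>s"
    "\<forall>s\<ge>0. \<forall>t\<ge>0. 0 \<le> \<theta> s t"
    "continuous_on ({0..} \<times> {0..}) (\<lambda>(s, t). \<theta> s t)"
    "concave_on ({0..} \<times> {0..}) (\<lambda>(s, t). \<theta> s t)"
    "\<forall>s\<ge>0. \<forall>t\<ge>0. \<theta> s t = \<theta> t s"
    "\<forall>r>0. \<forall>s\<ge>0. \<forall>t\<ge>0. \<theta> (r * s) (r * t) = r * \<theta> s t"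
    "\<forall>t\<ge>0. \<theta> 0 t = 0"
    "\<forall>s>0. \<forall>t>0. deriv \<Psi>s (ln s - ln t) * \<theta> s t = s - t"
    "\<forall>s\<ge>0. \<forall>t\<ge>0. 0 \<le> G s t"
    "lsc_on ({0..} \<times> {0..}) (\<lambda>(s, t). G s t)"
    "\<forall>s>0. \<forall>t>0. 1/4 * \<Psi>s (ln t - ln s) * \<theta> s t = G s t"
    "\<forall>s\<ge>0. \<forall>t\<ge>0. G s t = 0 \<longleftrightarrow> s = t"
  by (insert A, unfold structural_assumptions_def) (elim conjE, assumption)+

section \<open>The mobility \<theta>\<close>

lemma theta_superadditive:
  assumes A: "structural_assumptions \<Psi> \<Psi>s \<theta> G"
    and nn: "0 \<le> s" "0 \<le> t" "0 \<le> s'" "0 \<le> t'"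
  shows "\<theta> s t + \<theta> s' t' \<le> \<theta> (s + s') (t + t')"
proof -
  note conc = structural_assumptionsD(10)[OF A] and hom = structural_assumptionsD(12)[OF A, rule_format]
  have "(1/2) * \<theta> s t + (1/2) * \<theta> s' t' \<le> \<theta> ((1/2) * s + (1/2) * s') ((1/2) * t + (1/2) * t')"
    using concave_onD[OF conc, of "1/2" "(s, t)" "(s', t')"] nn by simp
  also have "\<dots> = \<theta> ((1/2) * (s + s')) ((1/2) * (t + t'))" by (simp add: add_divide_distrib)
  also have "\<dots> = (1/2) * \<theta> (s + s') (t + t')" using nn by (intro hom) auto
  finally show ?thesis by simp
qed

lemma theta_nonneg:
  "structural_assumptions \<Psi> \<Psi>s \<theta> G \<Longrightarrow> 0 \<le> s \<Longrightarrow> 0 \<le> t \<Longrightarrow> 0 \<le> \<theta> s t"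
  by (simp add: structural_assumptionsD(8))

lemma theta_diagonal:
  assumes A: "structural_assumptions \<Psi> \<Psi>s \<theta> G" and "0 < m"
  shows "\<theta> m m = m * \<theta> 1 1"
proof -
  show ?thesis using structural_assumptionsD(12)[OF A, rule_format, of m 1 1] \<open>0 < m\<close> by simp
qed

text \<open>Concavity and 1-homogeneity make \<theta> superadditive, so a nonnegative increment of
  the arguments adds the nonnegative value of \<theta> at the increment.\<close>

lemma theta_mono:
  assumes A: "structural_assumptions \<Psi> \<Psi>s \<theta> G" and "0 \<le> s" "0 \<le> t" "s \<le> s'" "t \<le> t'"
  shows "\<theta> s t \<le> \<theta> s' t'"
  using theta_superadditive[OF A, of s t "s' - s" "t' - t"] theta_nonneg[OF A, of "s' - s" "t' - t"] assms by simp

text \<open>The identity between the derivative of \<open>\<Psi>s\<close> and \<theta> has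
  right-hand side -1 at (1, 2), so \<theta> cannot vanish there; monotonicity and homogeneity carry
  this to the diagonal.\<close>

lemma theta_one_pos:
  assumes A: "structural_assumptions \<Psi> \<Psi>s \<theta> G"
  shows "0 < \<theta> 1 1"
proof -
  have "deriv \<Psi>s (ln 1 - ln 2) * \<theta> 1 2 = (1 - 2 :: real)"
    by (rule structural_assumptionsD(14)[OF A, rule_format]) auto
  then have "\<theta> 1 2 \<noteq> 0" by auto
  then have "\<theta> 1 2 > 0" using theta_nonneg[OF A, of 1 2] by simp
  also have "\<theta> 1 2 \<le> \<theta> 2 2" by (rule theta_mono[OF A]) auto
  also have "\<theta> 2 2 = 2 * \<theta> 1 1" by (rule theta_diagonal[OF A]) simp
  finally show ?thesis by simp
qed

lemma theta_le_max:
  assumes A: "structural_assumptions \<Psi> \<Psi>s \<theta> G" and "0 \<le> s" "0 \<le> t" "s \<le> m" "t \<le> m" "0 < m"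
  shows "\<theta> s t \<le> m * \<theta> 1 1"
  using theta_mono[OF A, of s t m m] theta_diagonal[OF A, of m] assms by simp

lemma theta_eq_0_iff:
  assumes A: "structural_assumptions \<Psi> \<Psi>s \<theta> G" and "0 \<le> s" "0 \<le> t"
  shows "\<theta> s t = 0 \<longleftrightarrow> s = 0 \<or> t = 0"
proof
  note z = structural_assumptionsD(13)[OF A, rule_format] and sym = structural_assumptionsD(11)[OF A, rule_format]
  show "s = 0 \<or> t = 0 \<Longrightarrow> \<theta> s t = 0" using z[of s] z[of t] sym[of s t] assms(2,3) by auto
  show "s = 0 \<or> t = 0" if "\<theta> s t = 0"
  proof (rule ccontr)
    assume "\<not> ?thesis"
    then have m: "min s t > 0" using assms by auto
    then have "0 < min s t * \<theta> 1 1" using theta_one_pos[OF A] by (rule mult_pos_pos)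
    also have "\<dots> = \<theta> (min s t) (min s t)" using theta_diagonal[OF A m] by simp
    also have "\<dots> \<le> \<theta> s t" using m by (intro theta_mono[OF A]) auto
    finally show False using that by simp
  qed
qed

section \<open>The conjugate pair of dissipation functions\<close>

lemma Psi_star_has_derivative:
  assumes A: "structural_assumptions \<Psi> \<Psi>s \<theta> G"
  shows "(\<Psi>s has_real_derivative deriv \<Psi>s x) (at x)"
proof -
  have "\<Psi>s differentiable at x"
    using structural_assumptionsD(3)[OF A] unfolding differentiable_on_def by simp
  then show ?thesis
    by (simp add: DERIV_deriv_iff_real_differentiable)
qed

lemma Psi_star_tangent:
  assumes A: "structural_assumptions \<Psi> \<Psi>s \<theta> G"
  shows "\<Psi>s x + deriv \<Psi>s x * (y - x) \<le> \<Psi>s y"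
proof -
  from convex_on_imp_above_tangent[OF structural_assumptionsD(2)[OF A], of x y "deriv \<Psi>s x"] Psi_star_has_derivative[OF A, of x]
  show ?thesis by simp
qed

text \<open>At (exp r, 1) the compatibility identity expresses the derivative of
  \<open>\<Psi>s\<close> at r as (exp r - 1) / \<theta>(exp r, 1), at most exp r / \<theta>(1, 1).
  The tangent at r, evaluated at 0, bounds \<open>\<Psi>s r\<close> by r times this derivative; r
  \<le> exp r then gives the rate 2.\<close>

lemma Psi_star_le_exp:
  assumes A: "structural_assumptions \<Psi> \<Psi>s \<theta> G"
  shows "\<Psi>s x \<le> exp (2 * \<bar>x\<bar>) / \<theta> 1 1"
proof -
  note even = structural_assumptionsD(5)[OF A, rule_format] and z = structural_assumptionsD(6)[OF A]
  have pos: "\<Psi>s r \<le> exp (2 * r) / \<theta> 1 1" if r: "r \<ge> 0" for r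
  proof -
    have e: "deriv \<Psi>s (ln (exp r) - ln 1) * \<theta> (exp r) 1 = exp r - 1"
      by (rule structural_assumptionsD(14)[OF A, rule_format]) auto
    have th: "\<theta> 1 1 \<le> \<theta> (exp r) 1" using r by (intro theta_mono[OF A]) auto
    have "deriv \<Psi>s r = (exp r - 1) / \<theta> (exp r) 1"
      using e th theta_one_pos[OF A] by (simp add: field_simps)
    also have "\<dots> \<le> exp r / \<theta> 1 1"
      using th theta_one_pos[OF A] r by (intro frac_le) auto
    finally have d: "deriv \<Psi>s r \<le> exp r / \<theta> 1 1" .
    have r_exp: "r \<le> exp r" using exp_ge_add_one_self[of r] by linarith
    have "\<Psi>s r \<le> deriv \<Psi>s r * r"
      using Psi_star_tangent[OF A, of r 0] z by (simp add: algebra_simps)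
    also have "\<dots> \<le> exp r / \<theta> 1 1 * exp r"
      using d r r_exp theta_one_pos[OF A] by (intro mult_mono) (auto intro: less_imp_le)
    also have "\<dots> = exp (2 * r) / \<theta> 1 1" by (simp add: exp_double power2_eq_square)
    finally show ?thesis .
  qed
  show ?thesis using pos[of "\<bar>x\<bar>"] even[of x] by (cases "x \<ge> 0") auto
qed

text \<open>A supremum of reals carries information only for sets that are bounded above.
  Superlinearity provides the bound: beyond some radius \<open>\<Psi>s y\<close> exceeds |x| |y|,
  and inside it \<open>\<Psi>s\<close> is nonnegative.\<close>

lemma bdd_above_conjugate:
  assumes A: "structural_assumptions \<Psi> \<Psi>s \<theta> G"
  shows "bdd_above (range (\<lambda>y. x * y - \<Psi>s y))"
proof -
  note nn = structural_assumptionsD(1)[OF A, rule_format] and sl = structural_assumptionsD(4)[OF A]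
  have "eventually (\<lambda>y. \<bar>x\<bar> \<le> \<Psi>s y / \<bar>y\<bar>) at_infinity"
    using sl by (simp add: filterlim_at_top)
  then obtain b where b: "\<And>y. b \<le> norm y \<Longrightarrow> \<bar>x\<bar> \<le> \<Psi>s y / \<bar>y\<bar>"
    unfolding eventually_at_infinity by blast
  have "x * y - \<Psi>s y \<le> \<bar>x\<bar> * \<bar>b\<bar>" for y
  proof (cases "b \<le> norm y \<and> y \<noteq> 0")
    case True
    then have "\<bar>x\<bar> * \<bar>y\<bar> \<le> \<Psi>s y" using b[of y] by (simp add: field_simps)
    moreover have "x * y \<le> \<bar>x\<bar> * \<bar>y\<bar>" by (metis abs_ge_self abs_mult)
    moreover have "0 \<le> \<bar>x\<bar> * \<bar>b\<bar>" by simp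
    ultimately show ?thesis by linarith
  next
    case False
    then have "\<bar>y\<bar> \<le> \<bar>b\<bar>" by auto
    then have "\<bar>x\<bar> * \<bar>y\<bar> \<le> \<bar>x\<bar> * \<bar>b\<bar>" by (intro mult_left_mono) auto
    moreover have "x * y \<le> \<bar>x\<bar> * \<bar>y\<bar>" by (metis abs_ge_self abs_mult)
    ultimately show ?thesis using nn[of y] by linarith
  qed
  then show ?thesis by (intro bdd_aboveI2[where M="\<bar>x\<bar> * \<bar>b\<bar>"])
qed

lemma Psi_Young:
  assumes A: "structural_assumptions \<Psi> \<Psi>s \<theta> G"
  shows "x * y \<le> \<Psi> x + \<Psi>s y"
proof -
  have "\<Psi> = convex_conjugate \<Psi>s" by (rule structural_assumptionsD(7)[OF A])
  then show ?thesis
    using cSUP_upper[OF _ bdd_above_conjugate[OF A, of x], of y] by (simp add: convex_conjugate_def)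
qed

lemma Psi_nonneg:
  assumes A: "structural_assumptions \<Psi> \<Psi>s \<theta> G"
  shows "0 \<le> \<Psi> x"
proof -
  have "\<Psi>s 0 = 0" by (rule structural_assumptionsD(6)[OF A])
  then show ?thesis using Psi_Young[OF A, of x 0] by simp
qed

lemma Psi_at_deriv:
  assumes A: "structural_assumptions \<Psi> \<Psi>s \<theta> G"
  shows "\<Psi> (deriv \<Psi>s y) = deriv \<Psi>s y * y - \<Psi>s y"
proof (rule antisym)
  have "\<Psi> = convex_conjugate \<Psi>s" by (rule structural_assumptionsD(7)[OF A])
  moreover have "(SUP z. deriv \<Psi>s y * z - \<Psi>s z) \<le> deriv \<Psi>s y * y - \<Psi>s y"
  proof (rule cSUP_least)
    fix z show "deriv \<Psi>s y * z - \<Psi>s z \<le> deriv \<Psi>s y * y - \<Psi>s y"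
      using Psi_star_tangent[OF A, of y z] by (simp add: algebra_simps)
  qed simp
  ultimately show "\<Psi> (deriv \<Psi>s y) \<le> deriv \<Psi>s y * y - \<Psi>s y" by (simp add: convex_conjugate_def)
  show "deriv \<Psi>s y * y - \<Psi>s y \<le> \<Psi> (deriv \<Psi>s y)" using Psi_Young[OF A, of "deriv \<Psi>s y" y] by simp
qed

text \<open>Equality means that z \<mapsto> x z - \<open>\<Psi>s z\<close> attains its maximum at y,
  so its derivative vanishes there.\<close>

lemma Psi_Young_eq:
  assumes A: "structural_assumptions \<Psi> \<Psi>s \<theta> G" and eq: "\<Psi> x + \<Psi>s y = x * y"
  shows "x = deriv \<Psi>s y"
proof -
  have "((\<lambda>z. x * z - \<Psi>s z) has_real_derivative (x - deriv \<Psi>s y)) (at y)"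
    using Psi_star_has_derivative[OF A, of y] by (auto intro!: derivative_eq_intros)
  then have "x - deriv \<Psi>s y = 0"
  proof (rule DERIV_local_max[of _ _ _ 1])
    show "\<forall>z. \<bar>y - z\<bar> < 1 \<longrightarrow> x * z - \<Psi>s z \<le> x * y - \<Psi>s y"
      using Psi_Young[OF A, of x] eq by (smt (verit))
  qed simp
  then show ?thesis by simp
qed

section \<open>Measurability of the dissipation functions\<close>

lemma Psi_measurable:
  assumes A: "structural_assumptions \<Psi> \<Psi>s \<theta> G"
  shows "\<Psi> \<in> borel_measurable borel"
proof -
  have "convex_on UNIV \<Psi>"
  proof (rule convex_onI)
    fix t x y :: real assume t: "0 < t" "t < 1"
    have P: "\<Psi> = convex_conjugate \<Psi>s" by (rule structural_assumptionsD(7)[OF A])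
    have "(SUP z. ((1 - t) *\<^sub>R x + t *\<^sub>R y) * z - \<Psi>s z) \<le> (1 - t) * \<Psi> x + t * \<Psi> y"
    proof (rule cSUP_least)
      fix z
      have "(1 - t) * (x * z) \<le> (1 - t) * (\<Psi> x + \<Psi>s z)" "t * (y * z) \<le> t * (\<Psi> y + \<Psi>s z)"
        using t by (intro mult_left_mono Psi_Young[OF A]; simp)+
      then show "((1 - t) *\<^sub>R x + t *\<^sub>R y) * z - \<Psi>s z \<le> (1 - t) * \<Psi> x + t * \<Psi> y"
        by (simp add: algebra_simps)
    qed simp
    then show "\<Psi> ((1 - t) *\<^sub>R x + t *\<^sub>R y) \<le> (1 - t) * \<Psi> x + t * \<Psi> y"
      using P by (simp add: convex_conjugate_def)
  qed simp
  then have "continuous_on UNIV \<Psi>" by (rule convex_on_continuous[OF open_UNIV])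
  then show ?thesis by (rule borel_measurable_continuous_onI)
qed

lemma theta_measurable:
  assumes A: "structural_assumptions \<Psi> \<Psi>s \<theta> G"
  shows "(\<lambda>p. \<theta> (max 0 (fst p)) (max 0 (snd p))) \<in> borel_measurable borel"
proof -
  have c: "continuous_on ({0..} \<times> {0..}) (\<lambda>(s, t). \<theta> s t)"
    by (rule structural_assumptionsD(9)[OF A])
  have "continuous_on UNIV (\<lambda>p::real \<times> real. (max 0 (fst p), max 0 (snd p)))"
    by (intro continuous_intros)
  then have "continuous_on UNIV ((\<lambda>(s, t). \<theta> s t) \<circ> (\<lambda>p. (max 0 (fst p), max 0 (snd p))))"
    by (rule continuous_on_compose) (rule continuous_on_subset[OF c], auto)
  then show ?thesis by (intro borel_measurable_continuous_onI) (simp add: o_def)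
qed

text \<open>Lower semicontinuity is known only on the closed quadrant, where it makes the sets {G >
  c} relatively open. Composition with the continuous retraction onto the quadrant turns them into
  open sets of the plane. The retraction is invisible later, because the arguments are products of
  nonnegative densities.\<close>

lemma G_measurable:
  assumes A: "structural_assumptions \<Psi> \<Psi>s \<theta> G"
  shows "(\<lambda>p. G (max 0 (fst p)) (max 0 (snd p))) \<in> borel_measurable borel"
proof (rule borel_measurableI_greater)
  fix c
  let ?Q = "{0..} \<times> {0..} :: (real \<times> real) set" and ?m = "\<lambda>p::real \<times> real. (max 0 (fst p), max 0 (snd p))"
  have lsc: "lsc_on ?Q (\<lambda>(s, t). G s t)" by (rule structural_assumptionsD(16)[OF A])
  have "openin (top_of_set ?Q) {x \<in> ?Q. c < (case x of (s, t) \<Rightarrow> G s t)}"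
  proof (subst openin_subopen, intro ballI)
    fix x assume x: "x \<in> {x \<in> ?Q. c < (case x of (s, t) \<Rightarrow> G s t)}"
    then have "eventually (\<lambda>y. c < (case y of (s, t) \<Rightarrow> G s t)) (at x within ?Q)"
      using lsc unfolding lsc_on_def by blast
    then obtain S where S: "open S" "x \<in> S" "\<And>y. y \<in> S \<Longrightarrow> y \<noteq> x \<Longrightarrow> y \<in> ?Q \<Longrightarrow> c < (case y of (s, t) \<Rightarrow> G s t)"
      unfolding eventually_at_topological by blast
    have "openin (top_of_set ?Q) (?Q \<inter> S)" using S(1) by (simp add: openin_open_Int)
    moreover have "?Q \<inter> S \<subseteq> {x \<in> ?Q. c < (case x of (s, t) \<Rightarrow> G s t)}" using S(3) x by blast
    ultimately show "\<exists>T. openin (top_of_set ?Q) T \<and> x \<in> T \<and> T \<subseteq> {x \<in> ?Q. c < (case x of (s, t) \<Rightarrow> G s t)}"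
      using x S(2) by blast
  qed
  then obtain O' where O': "open O'" "{x \<in> ?Q. c < (case x of (s, t) \<Rightarrow> G s t)} = ?Q \<inter> O'"
    unfolding openin_open by blast
  have mem: "?m p \<in> ?Q" for p by auto
  have "{p \<in> space borel. c < G (max 0 (fst p)) (max 0 (snd p))} = ?m -` O'"
  proof -
    have "c < G (max 0 (fst p)) (max 0 (snd p)) \<longleftrightarrow> ?m p \<in> O'" for p
      using mem[of p] arg_cong[OF O'(2), of "\<lambda>S. ?m p \<in> S"] by simp
    then show ?thesis by auto
  qed
  moreover have "?m -` O' \<in> sets borel"
    using O'(1) by (intro borel_open open_vimage continuous_intros)
  ultimately show "{p \<in> space borel. c < G (max 0 (fst p)) (max 0 (snd p))} \<in> sets borel" by simp
qed

section \<open>Distributional derivatives in time\<close>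

lemma Ck_fun_real_Suc:
  fixes f :: "real \<Rightarrow> real"
  shows "Ck_fun (Suc k) f \<longleftrightarrow> (\<exists>f'. (\<forall>x. (f has_real_derivative f' x) (at x)) \<and> Ck_fun k f')"
proof
  assume C: "Ck_fun (Suc k) f"
  have "(f has_real_derivative frechet_derivative f (at x) 1) (at x)" for x
  proof -
    have "f differentiable (at x)" using C by simp
    then have D: "(f has_derivative frechet_derivative f (at x)) (at x)"
      by (simp add: frechet_derivative_works)
    then have "frechet_derivative f (at x) = (*) (frechet_derivative f (at x) 1)"
    proof (intro ext)
      show "frechet_derivative f (at x) y = frechet_derivative f (at x) 1 * y" for y
        using linear_scale[OF has_derivative_linear[OF D], of y 1] by simp
    qed
    with D show ?thesis unfolding has_field_derivative_def by metis
  qed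
  moreover have "Ck_fun k (\<lambda>x. frechet_derivative f (at x) 1)" using C by simp
  ultimately show "\<exists>f'. (\<forall>x. (f has_real_derivative f' x) (at x)) \<and> Ck_fun k f'" by (intro exI[of _ "\<lambda>x. frechet_derivative f (at x) 1"]) auto
next
  assume "\<exists>f'. (\<forall>x. (f has_real_derivative f' x) (at x)) \<and> Ck_fun k f'"
  then obtain f' where f': "\<And>x. (f has_real_derivative f' x) (at x)" "Ck_fun k f'" by blast
  have "f differentiable (at x)" for x
    using f'(1) unfolding has_field_derivative_def differentiable_def by blast
  moreover have "(\<lambda>x. frechet_derivative f (at x) 1) = f'"
    using frechet_derivative_at[OF f'(1)[unfolded has_field_derivative_def], symmetric] by auto
  ultimately show "Ck_fun (Suc k) f" using f'(2) by simp
qed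

lemma Ck_fun_real_lower: "Ck_fun (Suc k) (f :: real \<Rightarrow> real) \<Longrightarrow> Ck_fun k f"
proof (induction k arbitrary: f)
  case 0
  then show ?case
    unfolding Ck_fun_real_Suc by (auto simp: continuous_on_eq_continuous_at intro: DERIV_isCont)
next
  case (Suc k)
  then show ?case by (subst Ck_fun_real_Suc) (use Suc.prems Ck_fun_real_Suc[of "Suc k" f] in blast)
qed

lemma Ck_fun_real_add: "Ck_fun k f \<Longrightarrow> Ck_fun k g \<Longrightarrow> Ck_fun k (\<lambda>x::real. f x + g x)"
proof (induction k arbitrary: f g)
  case (Suc k)
  then obtain f' g' where "\<And>x. (f has_real_derivative f' x) (at x)" "Ck_fun k f'"
    "\<And>x. (g has_real_derivative g' x) (at x)" "Ck_fun k g'"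
    unfolding Ck_fun_real_Suc by blast
  then show ?case
    unfolding Ck_fun_real_Suc by (intro exI[of _ "\<lambda>x. f' x + g' x"] conjI allI DERIV_add Suc.IH)
qed (simp add: continuous_on_add)

lemma Ck_fun_real_cmult: "Ck_fun k f \<Longrightarrow> Ck_fun k (\<lambda>x::real. c * f x)"
proof (induction k arbitrary: f)
  case (Suc k)
  then obtain f' where "\<And>x. (f has_real_derivative f' x) (at x)" "Ck_fun k f'"
    unfolding Ck_fun_real_Suc by blast
  then show ?case
    unfolding Ck_fun_real_Suc by (intro exI[of _ "\<lambda>x. c * f' x"] conjI allI DERIV_cmult Suc.IH)
qed (simp add: continuous_on_mult_left)

lemma Ck_fun_real_mult: "Ck_fun k f \<Longrightarrow> Ck_fun k g \<Longrightarrow> Ck_fun k (\<lambda>x::real. f x * g x)"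
proof (induction k arbitrary: f g)
  case (Suc k)
  then obtain f' g' where D: "\<And>x. (f has_real_derivative f' x) (at x)" "Ck_fun k f'"
    "\<And>x. (g has_real_derivative g' x) (at x)" "Ck_fun k g'"
    unfolding Ck_fun_real_Suc by blast
  show ?case
    unfolding Ck_fun_real_Suc
  proof (intro exI conjI allI)
    show "((\<lambda>x. f x * g x) has_real_derivative f' x * g x + g' x * f x) (at x)" for x
      by (intro DERIV_mult D)
    show "Ck_fun k (\<lambda>x. f' x * g x + g' x * f x)"
      by (rule Ck_fun_real_add[OF Suc.IH[OF D(2) Ck_fun_real_lower[OF Suc.prems(2)]] Suc.IH[OF D(4) Ck_fun_real_lower[OF Suc.prems(1)]]])
  qed
qed (simp add: continuous_on_mult)

lemma Ck_fun_real_affine: "Ck_fun k f \<Longrightarrow> Ck_fun k (\<lambda>x::real. f (a * x + b))"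
proof (induction k arbitrary: f)
  case 0
  then have "continuous_on UNIV f" by simp
  then have "continuous_on UNIV (\<lambda>x. f (a * x + b))"
    by (rule continuous_on_compose2) (auto intro!: continuous_intros)
  then show ?case by simp
next
  case (Suc k)
  then obtain f' where D: "\<And>x. (f has_real_derivative f' x) (at x)" "Ck_fun k f'"
    unfolding Ck_fun_real_Suc by blast
  show ?case
    unfolding Ck_fun_real_Suc
  proof (intro exI conjI allI)
    show "((\<lambda>x. f (a * x + b)) has_real_derivative a * f' (a * x + b)) (at x)" for x
    proof -
      have "((\<lambda>x. a * x + b) has_real_derivative a) (at x)" by (auto intro!: derivative_eq_intros)
      from DERIV_chain2[OF D(1) this] show ?thesis by (simp add: mult.commute)
    qed
    show "Ck_fun k (\<lambda>x. a * f' (a * x + b))" by (intro Ck_fun_real_cmult Suc.IH D)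
  qed
qed

text \<open>The classical flat function exp (-1/x), together with its multiples by powers of 1/x:
  the family is closed under differentiation up to linear combinations, so smoothness is a single
  induction that treats all \<open>n\<close> at once.\<close>

definition exp_flat :: "nat \<Rightarrow> real \<Rightarrow> real" where
  "exp_flat n x = (if x > 0 then (1 / x) ^ n * exp (- (1 / x)) else 0)"

lemma exp_flat_derivative:
  "(exp_flat n has_real_derivative (- real n * exp_flat (Suc n) x + exp_flat (n + 2) x)) (at x)"
proof -
  consider "x > 0" | "x < 0" | "x = 0" by linarith
  then show ?thesis
  proof cases
    case 1
    have ev: "eventually (\<lambda>y. exp_flat n y = (1 / y) ^ n * exp (- (1 / y))) (nhds x)"
      using eventually_nhds_in_open[of "{0<..}" x] 1 by (auto simp: exp_flat_def elim!: eventually_mono)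
    have "((\<lambda>y. (1 / y) ^ n * exp (- (1 / y))) has_real_derivative
        (real n * (1 / x) ^ (n - 1) * (- (1 / x\<^sup>2))) * exp (- (1 / x)) + (1 / x) ^ n * (exp (- (1 / x)) * (1 / x\<^sup>2))) (at x)"
      using 1 by (auto intro!: derivative_eq_intros simp: power2_eq_square)
    also have "(real n * (1 / x) ^ (n - 1) * (- (1 / x\<^sup>2))) * exp (- (1 / x)) + (1 / x) ^ n * (exp (- (1 / x)) * (1 / x\<^sup>2)) =
      - real n * exp_flat (Suc n) x + exp_flat (n + 2) x"
    proof -
      have "real n * (1 / x) ^ (n - 1) * (1 / x\<^sup>2) = real n * (1 / x) ^ Suc n"
        by (cases n) (simp_all add: power2_eq_square)
      moreover have "(1 / x) ^ n * (1 / x\<^sup>2) = (1 / x) ^ (n + 2)" by (simp add: power_add power2_eq_square)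
      ultimately show ?thesis using 1 by (simp add: exp_flat_def)
    qed
    finally show ?thesis using ev by (subst DERIV_cong_ev[OF refl ev refl])
  next
    case 2
    have ev: "eventually (\<lambda>y. exp_flat n y = 0) (nhds x)"
      using eventually_nhds_in_open[of "{..<0}" x] 2 by (auto simp: exp_flat_def elim!: eventually_mono)
    show ?thesis using 2 by (subst DERIV_cong_ev[OF refl ev refl]) (simp add: exp_flat_def)
  next
    case 3
    \<comment> \<open>With z = 1/y the difference quotient at 0 is z^(n+1) / exp z.\<close>
    have "((\<lambda>y. exp_flat n y / y) \<longlongrightarrow> 0) (at_right 0)"
    proof -
      have "((\<lambda>z::real. z ^ Suc n / exp z) \<longlongrightarrow> 0) at_top" by (rule tendsto_power_div_exp_0)
      then have "((\<lambda>y::real. inverse y ^ Suc n / exp (inverse y)) \<longlongrightarrow> 0) (at_right 0)"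
        by (rule filterlim_compose[OF _ filterlim_inverse_at_top_right])
      moreover have "eventually (\<lambda>y. inverse y ^ Suc n / exp (inverse y) = exp_flat n y / y) (at_right (0::real))"
        by (auto simp: exp_flat_def eventually_at_filter exp_minus field_simps)
      ultimately show ?thesis by (rule Lim_transform_eventually)
    qed
    moreover have "((\<lambda>y. exp_flat n y / y) \<longlongrightarrow> 0) (at_left 0)"
      by (rule tendsto_eventually) (auto simp: eventually_at_filter exp_flat_def)
    ultimately have "((\<lambda>y. exp_flat n y / y) \<longlongrightarrow> 0) (at 0)"
      by (simp add: filterlim_at_split)
    then show ?thesis
      using 3 by (simp add: has_field_derivative_iff exp_flat_def)
  qed
qed

lemma exp_flat_Ck: "Ck_fun k (exp_flat n)"
proof (induction k arbitrary: n)
  case 0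
  show ?case
    using exp_flat_derivative by (auto simp: continuous_on_eq_continuous_at intro: DERIV_isCont)
next
  case (Suc k)
  show ?case
    unfolding Ck_fun_real_Suc
    by (intro exI[of _ "\<lambda>x. - real n * exp_flat (Suc n) x + exp_flat (n + 2) x"] conjI allI
        exp_flat_derivative Ck_fun_real_add Ck_fun_real_cmult Suc)
qed

text \<open>\<open>S\<close> is the primitive of the bump exp (-1/x) exp (-1/(1 - x)) on (0, 1). Its
  height \<open>c\<close> is left unnormalized and is divided out at the end of
  \<open>has_dist_deriv_interior\<close>.\<close>

lemma smooth_step_exists:
  "\<exists>(S::real \<Rightarrow> real) \<rho> c. (\<forall>k. Ck_fun k S) \<and> (\<forall>x. (S has_real_derivative \<rho> x) (at x)) \<and> continuous_on UNIV \<rho> \<and>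
     (\<forall>x. 0 \<le> \<rho> x \<and> \<rho> x \<le> 1) \<and> (\<forall>x. x \<notin> {0..1} \<longrightarrow> \<rho> x = 0) \<and> c > 0 \<and>
     (\<forall>x\<le>0. S x = 0) \<and> (\<forall>x\<ge>1. S x = c) \<and> (\<forall>x. 0 \<le> S x \<and> S x \<le> c)"
proof -
  define \<rho> where "\<rho> x = exp_flat 0 x * exp_flat 0 ((-1) * x + 1)" for x
  have Ck: "Ck_fun k \<rho>" for k
    unfolding \<rho>_def by (intro Ck_fun_real_mult Ck_fun_real_affine exp_flat_Ck)
  then have cont: "continuous_on UNIV \<rho>" using Ck[of 0] by simp
  have "\<exists>F. \<forall>x::real. (-\<infinity>::ereal) < x \<longrightarrow> x < (\<infinity>::ereal) \<longrightarrow> (F has_vector_derivative \<rho> x) (at x)"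
    using cont by (intro einterval_antiderivative) (auto simp: continuous_on_eq_continuous_at)
  then obtain F where F: "\<And>x. (F has_real_derivative \<rho> x) (at x)"
    by (auto simp: has_real_derivative_iff_has_vector_derivative)
  define S where "S x = F x - F 0" for x
  have S: "(S has_real_derivative \<rho> x) (at x)" for x
    unfolding S_def using F[of x] by (auto intro!: derivative_eq_intros)
  have \<rho>01: "0 \<le> exp_flat 0 x \<and> exp_flat 0 x \<le> 1" for x by (simp add: exp_flat_def)
  have \<rho>b: "0 \<le> \<rho> x \<and> \<rho> x \<le> 1" for x
    using \<rho>01[of x] \<rho>01[of "(-1) * x + 1"] unfolding \<rho>_def by (auto intro: mult_le_one)
  have \<rho>0: "\<rho> x = 0" if "x \<le> 0 \<or> x \<ge> 1" for x using that by (auto simp: \<rho>_def exp_flat_def)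
  have mono: "S x \<le> S y" if "x \<le> y" for x y
    using that S \<rho>b by (meson DERIV_nonneg_imp_nondecreasing)
  have const: "S x = S y" if "x < y" "\<And>z. x \<le> z \<Longrightarrow> z \<le> y \<Longrightarrow> \<rho> z = 0" for x y
  proof -
    have "\<exists>z>x. z < y \<and> S y - S x = (y - x) * \<rho> z"
      using that(1) S by (rule MVT2)
    then obtain z where "x < z" "z < y" "S y - S x = (y - x) * \<rho> z" by blast
    then show ?thesis using that(2)[of z] by simp
  qed
  have S0: "S x = 0" if "x \<le> 0" for x
    using const[of x 0] \<rho>0 that by (cases "x = 0") (auto simp: S_def)
  have S1: "S x = S 1" if "x \<ge> 1" for x
    using const[of 1 x] \<rho>0 that by (cases "x = 1") auto
  have S1_pos: "S 1 > 0"
  proof -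
    have "\<exists>z>0. z < 1 \<and> S 1 - S 0 = (1 - 0) * \<rho> z"
      using zero_less_one S by (rule MVT2)
    then obtain z where z: "0 < z" "z < 1" "S 1 - S 0 = (1 - 0) * \<rho> z" by blast
    then have "\<rho> z > 0" by (simp add: \<rho>_def exp_flat_def)
    then show ?thesis using z(3) S0[of 0] by simp
  qed
  have CkS: "Ck_fun k S" for k
  proof -
    have "Ck_fun (Suc k) S" unfolding Ck_fun_real_Suc using Ck S by blast
    then show ?thesis by (rule Ck_fun_real_lower)
  qed
  have Sb: "0 \<le> S x \<and> S x \<le> S 1" for x
    using mono[of 0 x] mono[of x 1] S0[of x] S0[of 0] S1[of x] S1_pos by (cases "x \<le> 0"; cases "x \<ge> 1") auto
  have \<rho>0': "\<forall>x. x \<notin> {0..1} \<longrightarrow> \<rho> x = 0" using \<rho>0 by auto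
  show ?thesis
    by (rule exI[of _ S], rule exI[of _ \<rho>], rule exI[of _ "S 1"])
       (intro conjI allI impI CkS S cont \<rho>b[THEN conjunct1] \<rho>b[THEN conjunct2] \<rho>0'[rule_format] S1_pos S0 S1
         Sb[THEN conjunct1] Sb[THEN conjunct2])
qed

text \<open>The test functions are differences of two steep steps, one rising just after s and one
  just after t; they converge to c times the indicator of the interval. Their derivatives are
  mollifiers, which recover g at s and t by continuity, while the side of h converges by dominated
  convergence. Compact support inside the open interval is the reason for the strict inequalities at
  0 and T.\<close>

lemma has_dist_deriv_interior:
  assumes D: "has_dist_deriv T g h" and g: "continuous_on {0..T} g" and h: "set_integrable lborel {0..T} h"
    and st: "0 < s" "s < t" "t < T"
  shows "g t - g s = (LBINT r:{s..t}. h r)"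
proof -
  obtain S \<rho> and c :: real where S: "\<And>k. Ck_fun k S" "\<And>x. (S has_real_derivative \<rho> x) (at x)"
    and \<rho>: "continuous_on UNIV \<rho>" "\<And>x. 0 \<le> \<rho> x" "\<And>x. \<rho> x \<le> 1" "\<And>x. x \<notin> {0..1} \<Longrightarrow> \<rho> x = 0"
    and c: "c > 0" and S0: "\<And>x. x \<le> 0 \<Longrightarrow> S x = 0" and S1: "\<And>x. x \<ge> 1 \<Longrightarrow> S x = c"
    and Sb: "\<And>x. 0 \<le> S x" "\<And>x. S x \<le> c"
    using smooth_step_exists by metis
  have [measurable]: "\<rho> \<in> borel_measurable borel" using \<rho>(1) by (rule borel_measurable_continuous_onI)
  have "continuous_on UNIV S" using S(1)[of 0] by simp
  then have [measurable]: "S \<in> borel_measurable borel" by (rule borel_measurable_continuous_onI)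
  define G where "G r = indicator {0..T} r *\<^sub>R g r" for r
  have Gm[measurable]: "G \<in> borel_measurable borel"
    unfolding G_def by (rule borel_measurable_continuous_on_indicator[OF _ g]) simp
  obtain M where M: "\<And>r. r \<in> {0..T} \<Longrightarrow> \<bar>g r\<bar> \<le> M"
    using compact_imp_bounded[OF compact_continuous_image[OF g compact_Icc]] unfolding bounded_iff by fastforce
  then have GM: "\<bar>G r\<bar> \<le> \<bar>M\<bar>" for r
    unfolding G_def by (auto simp: indicator_def) (meson M abs_ge_self atLeastAtMost_iff order_trans)
  have Gcont: "isCont G x" if "0 < x" "x < T" for x
  proof -
    have "continuous_on {0<..<T} G"
      by (rule continuous_on_cong[THEN iffD2, OF refl _ continuous_on_subset[OF g]]) (auto simp: G_def)
    then show ?thesis using that by (simp add: continuous_on_eq_continuous_at)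
  qed
  have \<rho>int: "integrable lborel \<rho>"
  proof -
    have "set_integrable lborel {0..1} \<rho>"
      using \<rho>(1) by (intro borel_integrable_atLeastAtMost') (auto intro: continuous_on_subset)
    then show ?thesis
      unfolding set_integrable_def
    proof (rule Bochner_Integration.integrable_cong[OF refl, THEN iffD1, rotated])
      show "indicat_real {0..1} y *\<^sub>R \<rho> y = \<rho> y" for y using \<rho>(4)[of y] by (cases "y \<in> {0..1}") auto
    qed
  qed
  have \<rho>c: "(\<integral>y. \<rho> y \<partial>lborel) = c"
  proof -
    have "(\<integral>y. \<rho> y * indicator {0..1} y \<partial>lborel) = S 1 - S 0"
      by (rule integral_FTC_Icc_real) (use S(2) \<rho>(1) in \<open>auto simp: continuous_on_eq_continuous_at\<close>)
    also have "(\<integral>y. \<rho> y * indicator {0..1} y \<partial>lborel) = (\<integral>y. \<rho> y \<partial>lborel)"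
      by (rule Bochner_Integration.integral_cong) (use \<rho>(4) in \<open>auto simp: indicator_def\<close>)
    finally show ?thesis using S0[of 0] S1[of 1] by simp
  qed
  have mollify: "(\<lambda>n. \<integral>r. (real (Suc n) * \<rho> (real (Suc n) * (r - x))) * G r \<partial>lborel) \<longlonglongrightarrow> c * G x"
    and mollify_int: "integrable lborel (\<lambda>r. (real (Suc n) * \<rho> (real (Suc n) * (r - x))) * G r)"
    if x: "0 < x" "x < T" for x n
  proof -
    have eq: "(\<integral>r. (real (Suc n) * \<rho> (real (Suc n) * (r - x))) * G r \<partial>lborel) = (\<integral>y. \<rho> y * G (x + y / real (Suc n)) \<partial>lborel)" for n
    proof -
      have "(\<integral>r. (real (Suc n) * \<rho> (real (Suc n) * (r - x))) * G r \<partial>lborel) =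
        \<bar>1 / real (Suc n)\<bar> *\<^sub>R (\<integral>y. (real (Suc n) * \<rho> (real (Suc n) * ((x + 1 / real (Suc n) * y) - x))) * G (x + 1 / real (Suc n) * y) \<partial>lborel)"
        by (rule lborel_integral_real_affine) simp
      also have "\<dots> = \<bar>1 / real (Suc n)\<bar> *\<^sub>R (\<integral>y. real (Suc n) * (\<rho> y * G (x + y / real (Suc n))) \<partial>lborel)"
        by (simp add: mult.assoc del: of_nat_Suc)
      also have "\<dots> = (\<integral>y. \<rho> y * G (x + y / real (Suc n)) \<partial>lborel)"
        by (subst integral_mult_right_zero) (simp del: of_nat_Suc)
      finally show ?thesis .
    qed
    have "(\<lambda>n. \<integral>y. \<rho> y * G (x + y / real (Suc n)) \<partial>lborel) \<longlonglongrightarrow> (\<integral>y. \<rho> y * G x \<partial>lborel)"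
    proof (rule integral_dominated_convergence[where w="\<lambda>y. \<rho> y * \<bar>M\<bar>"])
      show "AE y in lborel. (\<lambda>n. \<rho> y * G (x + y / real (Suc n))) \<longlonglongrightarrow> \<rho> y * G x"
      proof (rule AE_I2)
        fix y
        have "(\<lambda>n. x + y * inverse (real (Suc n))) \<longlonglongrightarrow> x + y * 0"
          by (intro tendsto_intros LIMSEQ_inverse_real_of_nat)
        then have "(\<lambda>n. G (x + y / real (Suc n))) \<longlonglongrightarrow> G x"
          using isCont_tendsto_compose[OF Gcont[OF x]] by (simp add: divide_inverse)
        then show "(\<lambda>n. \<rho> y * G (x + y / real (Suc n))) \<longlonglongrightarrow> \<rho> y * G x" by (rule tendsto_mult_left)
      qed
      show "AE y in lborel. norm (\<rho> y * G (x + y / real (Suc n))) \<le> \<rho> y * \<bar>M\<bar>" for n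
        using \<rho>(2) GM by (intro AE_I2) (auto simp: abs_mult intro!: mult_left_mono)
      show "integrable lborel (\<lambda>y. \<rho> y * \<bar>M\<bar>)"
        by (intro integrable_mult_left \<rho>int)
    qed measurable
    then show "(\<lambda>n. \<integral>r. (real (Suc n) * \<rho> (real (Suc n) * (r - x))) * G r \<partial>lborel) \<longlonglongrightarrow> c * G x"
      unfolding eq by (simp add: \<rho>c)
    have "integrable lborel (\<lambda>y. \<rho> y * G (x + y / real (Suc n)))"
      by (rule Bochner_Integration.integrable_bound[of _ "\<lambda>y. \<rho> y * \<bar>M\<bar>"])
         (use \<rho>int \<rho>(2) GM in \<open>auto simp: abs_mult intro!: mult_left_mono\<close>)
    then have "integrable lborel (\<lambda>y. real (Suc n) * (\<rho> (real (Suc n) * ((x + (1 / real (Suc n)) * y) - x)) * G (x + (1 / real (Suc n)) * y)))"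
      by simp
    then have "integrable lborel (\<lambda>y. (\<lambda>r. (real (Suc n) * \<rho> (real (Suc n) * (r - x))) * G r) (x + (1 / real (Suc n)) * y))"
      by (simp add: mult.assoc)
    then show "integrable lborel (\<lambda>r. (real (Suc n) * \<rho> (real (Suc n) * (r - x))) * G r)"
      by (subst (asm) lborel_integrable_real_affine_iff) auto
  qed
  define \<eta> where "\<eta> n r = S (real (Suc n) * r + - (real (Suc n) * s)) + (- 1) * S (real (Suc n) * r + - (real (Suc n) * t))" for n r
  have \<eta>_deriv: "(\<eta> n has_real_derivative (real (Suc n) * \<rho> (real (Suc n) * (r - s)) - real (Suc n) * \<rho> (real (Suc n) * (r - t)))) (at r)" for n r
  proof -
    have "((\<lambda>r. S (real (Suc n) * r + - (real (Suc n) * x))) has_real_derivative real (Suc n) * \<rho> (real (Suc n) * (r - x))) (at r)" for x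
    proof -
      have "((\<lambda>r. real (Suc n) * r + - (real (Suc n) * x)) has_real_derivative real (Suc n)) (at r)"
        by (auto intro!: derivative_eq_intros)
      from DERIV_chain2[OF S(2) this] show ?thesis by (simp only: right_diff_distrib mult.commute[of "\<rho> _"]) (simp only: diff_conv_add_uminus)
    qed
    from DERIV_diff[OF this[of s] this[of t]] show ?thesis unfolding \<eta>_def by simp
  qed
  \<comment> \<open>The second step rises on [t, t + 1/(n+1)], which has to end before T.\<close>
  obtain n0 :: nat where n0: "inverse (real (Suc n0)) < T - t"
    using reals_Archimedean[of "T - t"] st by auto
  have id: "- (\<integral>r. (real (Suc n) * \<rho> (real (Suc n) * (r - s))) * G r \<partial>lborel) + (\<integral>r. (real (Suc n) * \<rho> (real (Suc n) * (r - t))) * G r \<partial>lborel)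
     = (LBINT r:{0..T}. \<eta> n r * h r)" if n: "n \<ge> n0" for n
  proof -
    have inv: "1 / real (Suc n) < T - t"
    proof -
      have "inverse (real (Suc n)) \<le> inverse (real (Suc n0))" using n by (intro le_imp_inverse_le) auto
      then show ?thesis using n0 by (simp add: inverse_eq_divide)
    qed
    have out: "\<eta> n r = 0" if "r \<notin> {s..t + 1 / real (Suc n)}" for r
    proof (cases "r < s")
      case True
      have "real (Suc n) * r \<le> real (Suc n) * s" "real (Suc n) * r \<le> real (Suc n) * t"
        using True st by (intro mult_left_mono; simp)+
      then show ?thesis unfolding \<eta>_def by (simp add: S0)
    next
      case False
      then have "r > t + 1 / real (Suc n)" using that by auto
      then have "real (Suc n) * r \<ge> real (Suc n) * (t + 1 / real (Suc n))" by (intro mult_left_mono) auto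
      then have 1: "real (Suc n) * r \<ge> real (Suc n) * t + 1" by (simp add: distrib_left)
      moreover have "real (Suc n) * s \<le> real (Suc n) * t" using st by (intro mult_left_mono) auto
      ultimately have "real (Suc n) * r + - (real (Suc n) * s) \<ge> 1" "real (Suc n) * r + - (real (Suc n) * t) \<ge> 1" by linarith+
      then show ?thesis unfolding \<eta>_def by (simp only: S1)
    qed
    have "test_fun {0<..<T} (\<eta> n)"
      unfolding test_fun_def
    proof (intro conjI allI exI[of _ "{s..t + 1 / real (Suc n)}"])
      show "Ck_fun k (\<eta> n)" for k
        unfolding \<eta>_def by (intro Ck_fun_real_add Ck_fun_real_cmult Ck_fun_real_affine S)
      show "{s..t + 1 / real (Suc n)} \<subseteq> {0<..<T}" using st inv by auto
    qed (use out in auto)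
    then have "- (LBINT r:{0<..<T}. deriv (\<eta> n) r * g r) = (LBINT r:{0<..<T}. \<eta> n r * h r)"
      using D unfolding has_dist_deriv_def by blast
    moreover have "(LBINT r:{0<..<T}. \<eta> n r * h r) = (LBINT r:{0..T}. \<eta> n r * h r)"
      unfolding set_lebesgue_integral_def
    proof (rule Bochner_Integration.integral_cong[OF refl])
      fix r
      have "\<eta> n r = 0" if "r \<notin> {0<..<T}" using that st inv by (intro out) auto
      then show "indicat_real {0<..<T} r *\<^sub>R (\<eta> n r * h r) = indicat_real {0..T} r *\<^sub>R (\<eta> n r * h r)"
        by (cases "r \<in> {0<..<T}") auto
    qed
    moreover have "(LBINT r:{0<..<T}. deriv (\<eta> n) r * g r) =
       (\<integral>r. (real (Suc n) * \<rho> (real (Suc n) * (r - s))) * G r - (real (Suc n) * \<rho> (real (Suc n) * (r - t))) * G r \<partial>lborel)"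
    proof -
      have d: "deriv (\<eta> n) r = real (Suc n) * \<rho> (real (Suc n) * (r - s)) - real (Suc n) * \<rho> (real (Suc n) * (r - t))" for r
        using \<eta>_deriv by (rule DERIV_imp_deriv)
      have "AE r in lborel. indicat_real {0<..<T} r *\<^sub>R (deriv (\<eta> n) r * g r) =
         (real (Suc n) * \<rho> (real (Suc n) * (r - s))) * G r - (real (Suc n) * \<rho> (real (Suc n) * (r - t))) * G r"
        using AE_lborel_singleton[of 0] AE_lborel_singleton[of T]
        by eventually_elim (simp only: d, auto simp: G_def indicator_def left_diff_distrib)
      moreover have "(\<lambda>r. indicat_real {0<..<T} r *\<^sub>R (deriv (\<eta> n) r * g r)) \<in> borel_measurable lborel"
      proof -
        have "indicat_real {0<..<T} r *\<^sub>R (deriv (\<eta> n) r * g r) =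
          indicat_real {0<..<T} r * (real (Suc n) * \<rho> (real (Suc n) * (r - s)) - real (Suc n) * \<rho> (real (Suc n) * (r - t))) * G r" for r
          by (simp only: d, auto simp: G_def indicator_def)
        then show ?thesis by (simp only:) measurable
      qed
      ultimately show ?thesis
        unfolding set_lebesgue_integral_def by (intro integral_cong_AE) auto
    qed
    moreover have "\<dots> = (\<integral>r. (real (Suc n) * \<rho> (real (Suc n) * (r - s))) * G r \<partial>lborel) - (\<integral>r. (real (Suc n) * \<rho> (real (Suc n) * (r - t))) * G r \<partial>lborel)"
      using st by (intro Bochner_Integration.integral_diff mollify_int) auto
    ultimately show ?thesis by simp
  qed
  have rhs: "(\<lambda>n. LBINT r:{0..T}. \<eta> n r * h r) \<longlonglongrightarrow> c * (LBINT r:{s..t}. h r)"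
  proof -
    have hi: "integrable lborel (\<lambda>r. indicator {0..T} r *\<^sub>R h r)" using h unfolding set_integrable_def .
    note hm = borel_measurable_integrable[OF hi]
    have eq: "indicator {0..T} r *\<^sub>R (\<eta> n r * h r) = \<eta> n r * (indicator {0..T} r *\<^sub>R h r)" for n r by simp
    have "(\<lambda>n. \<integral>r. \<eta> n r * (indicator {0..T} r *\<^sub>R h r) \<partial>lborel) \<longlonglongrightarrow> (\<integral>r. (c * indicator {s..t} r) * (indicator {0..T} r *\<^sub>R h r) \<partial>lborel)"
    proof (rule integral_dominated_convergence[where w="\<lambda>r. c * \<bar>indicator {0..T} r *\<^sub>R h r\<bar>"])
      show "AE r in lborel. (\<lambda>n. \<eta> n r * (indicator {0..T} r *\<^sub>R h r)) \<longlonglongrightarrow> (c * indicator {s..t} r) * (indicator {0..T} r *\<^sub>R h r)"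
        \<comment> \<open>At r = s all the test functions vanish, although s belongs to the limiting
          interval; this one point is excluded.\<close>
        using AE_lborel_singleton[of s]
      proof eventually_elim
        fix r assume "r \<noteq> s"
        have Slim: "(\<lambda>n. S (real (Suc n) * r + - (real (Suc n) * x))) \<longlonglongrightarrow> (if r \<le> x then 0 else c)" for x
        proof (cases "r \<le> x")
          case True
          then have "S (real (Suc n) * r + - (real (Suc n) * x)) = 0" for n by (intro S0) (simp add: mult_left_mono)
          then show ?thesis using True by simp
        next
          case False
          obtain m :: nat where m: "inverse (real (Suc m)) < r - x"
            using reals_Archimedean[of "r - x"] False by auto
          have "S (real (Suc n) * r + - (real (Suc n) * x)) = c" if "n \<ge> m" for n
          proof (rule S1)
            have "inverse (real (Suc n)) \<le> inverse (real (Suc m))" using that by (intro le_imp_inverse_le) auto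
            then have "inverse (real (Suc n)) \<le> r - x" using m by linarith
            then have "real (Suc n) * inverse (real (Suc n)) \<le> real (Suc n) * (r - x)" by (intro mult_left_mono) auto
            then show "1 \<le> real (Suc n) * r + - (real (Suc n) * x)" by (simp add: right_diff_distrib)
          qed
          then show ?thesis using False by (intro tendsto_eventually) (auto simp: eventually_sequentially)
        qed
        have "(\<lambda>n. \<eta> n r) \<longlonglongrightarrow> (if r \<le> s then 0 else c) + (- 1) * (if r \<le> t then 0 else c)"
          unfolding \<eta>_def by (intro tendsto_intros Slim)
        also have "(if r \<le> s then 0 else c) + (- 1) * (if r \<le> t then 0 else c) = c * indicator {s..t} r"
          using \<open>r \<noteq> s\<close> st by (auto simp: indicator_def)
        finally show "(\<lambda>n. \<eta> n r * (indicator {0..T} r *\<^sub>R h r)) \<longlonglongrightarrow> (c * indicator {s..t} r) * (indicator {0..T} r *\<^sub>R h r)"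
          by (rule tendsto_mult_right)
      qed
      show "AE r in lborel. norm (\<eta> n r * (indicator {0..T} r *\<^sub>R h r)) \<le> c * \<bar>indicator {0..T} r *\<^sub>R h r\<bar>" for n
      proof (rule AE_I2)
        fix r
        have "\<bar>\<eta> n r\<bar> \<le> c" unfolding \<eta>_def
          using Sb[of "real (Suc n) * r + - (real (Suc n) * s)"] Sb[of "real (Suc n) * r + - (real (Suc n) * t)"] by linarith
        then show "norm (\<eta> n r * (indicator {0..T} r *\<^sub>R h r)) \<le> c * \<bar>indicator {0..T} r *\<^sub>R h r\<bar>"
          unfolding real_norm_def abs_mult by (intro mult_right_mono) auto
      qed
      show "(\<lambda>r. \<eta> n r * (indicator {0..T} r *\<^sub>R h r)) \<in> borel_measurable lborel" for n
        unfolding \<eta>_def by (intro borel_measurable_times hm) measurable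
      show "integrable lborel (\<lambda>r. c * \<bar>indicator {0..T} r *\<^sub>R h r\<bar>)"
        by (intro integrable_mult_right integrable_abs hi)
      show "(\<lambda>r. (c * indicator {s..t} r) * (indicator {0..T} r *\<^sub>R h r)) \<in> borel_measurable lborel"
        by (intro borel_measurable_times hm) simp_all
    qed
    moreover have "(\<integral>r. (c * indicator {s..t} r) * (indicator {0..T} r *\<^sub>R h r) \<partial>lborel) = c * (LBINT r:{s..t}. h r)"
      unfolding set_lebesgue_integral_def
      by (subst Bochner_Integration.integral_mult_right_zero[symmetric], rule Bochner_Integration.integral_cong)
         (use st in \<open>auto simp: indicator_def\<close>)
    ultimately show ?thesis unfolding set_lebesgue_integral_def eq by simp
  qed
  have "(\<lambda>n. - (\<integral>r. (real (Suc n) * \<rho> (real (Suc n) * (r - s))) * G r \<partial>lborel) + (\<integral>r. (real (Suc n) * \<rho> (real (Suc n) * (r - t))) * G r \<partial>lborel))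
      \<longlonglongrightarrow> - (c * G s) + c * G t"
    using st by (intro tendsto_intros mollify) auto
  moreover have "eventually (\<lambda>n. - (\<integral>r. (real (Suc n) * \<rho> (real (Suc n) * (r - s))) * G r \<partial>lborel) + (\<integral>r. (real (Suc n) * \<rho> (real (Suc n) * (r - t))) * G r \<partial>lborel)
     = (LBINT r:{0..T}. \<eta> n r * h r)) sequentially"
    using id by (auto simp: eventually_sequentially)
  ultimately have "(\<lambda>n. LBINT r:{0..T}. \<eta> n r * h r) \<longlonglongrightarrow> - (c * G s) + c * G t"
    by (rule Lim_transform_eventually)
  with rhs have "c * (LBINT r:{s..t}. h r) = - (c * G s) + c * G t" by (rule LIMSEQ_unique)
  then have "c * (LBINT r:{s..t}. h r) = c * (g t - g s)" using st by (simp add: G_def algebra_simps)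
  then show ?thesis using c by simp
qed

lemma has_dist_deriv_FTC:
  assumes D: "has_dist_deriv T g h" and g: "continuous_on {0..T} g" and h: "set_integrable lborel {0..T} h"
    and st: "0 \<le> s" "s \<le> t" "t \<le> T"
  shows "g t - g s = (LBINT r:{s..t}. h r)"
proof (cases "s = t")
  case True
  have "(LBINT r:{t..t}. h r) = 0"
    unfolding set_lebesgue_integral_def
    by (rule integral_eq_zero_AE, rule AE_mp[OF AE_lborel_singleton[of t]]) (auto simp: indicator_def)
  then show ?thesis using True by simp
next
  case False
  then have st': "s < t" using st by simp
  \<comment> \<open>A third of the length at most, so that the shrunken interval keeps a positive
    length for every n.\<close>
  define e where "e n = (t - s) / 3 * inverse (real (Suc n))" for n :: nat
  have e: "0 < e n" "e n \<le> (t - s) / 3" for n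
  proof -
    have "inverse (real (Suc n)) \<le> 1" by (simp add: field_simps)
    then have "(t - s) / 3 * inverse (real (Suc n)) \<le> (t - s) / 3 * 1" using st' by (intro mult_left_mono) auto
    then show "e n \<le> (t - s) / 3" by (simp add: e_def)
    show "0 < e n" using st' by (simp add: e_def)
  qed
  have e0: "e \<longlonglongrightarrow> 0"
    unfolding e_def by (rule tendsto_mult_right_zero) (rule LIMSEQ_inverse_real_of_nat)
  have ineq: "0 < s + e n" "s + e n < t - e n" "t - e n < T" for n
    using e(1)[of n] e(2)[of n] st st' by (auto simp: field_simps)
  have hi: "integrable lborel (\<lambda>r. indicator {0..T} r *\<^sub>R h r)" using h unfolding set_integrable_def .
  note hm = borel_measurable_integrable[OF hi]
  have "(\<lambda>n. g (t - e n) - g (s + e n)) \<longlonglongrightarrow> g t - g s"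
  proof (intro tendsto_diff continuous_on_tendsto_compose[OF g])
    show "(\<lambda>n. t - e n) \<longlonglongrightarrow> t" "(\<lambda>n. s + e n) \<longlonglongrightarrow> s"
      using tendsto_diff[OF tendsto_const e0, of t] tendsto_add[OF tendsto_const e0, of s] by auto
    show "\<forall>\<^sub>F n in sequentially. t - e n \<in> {0..T}" "\<forall>\<^sub>F n in sequentially. s + e n \<in> {0..T}"
      using ineq by (auto intro!: always_eventually) (smt (verit))+
  qed (use st in auto)
  moreover have "(\<lambda>n. LBINT r:{s + e n..t - e n}. h r) \<longlonglongrightarrow> (LBINT r:{s..t}. h r)"
  proof -
    have "(\<lambda>n. \<integral>r. indicator {s + e n..t - e n} r * (indicator {0..T} r *\<^sub>R h r) \<partial>lborel) \<longlonglongrightarrow>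
        (\<integral>r. indicator {s..t} r * (indicator {0..T} r *\<^sub>R h r) \<partial>lborel)"
    proof (rule integral_dominated_convergence[where w="\<lambda>r. \<bar>indicator {0..T} r *\<^sub>R h r\<bar>"])
      show "AE r in lborel. (\<lambda>n. indicator {s + e n..t - e n} r * (indicator {0..T} r *\<^sub>R h r)) \<longlonglongrightarrow> indicator {s..t} r * (indicator {0..T} r *\<^sub>R h r)"
        using AE_lborel_singleton[of s] AE_lborel_singleton[of t]
      proof eventually_elim
        fix r assume r: "r \<noteq> s" "r \<noteq> t"
        have "eventually (\<lambda>n. indicator {s + e n..t - e n} r = (indicator {s..t} r :: real)) sequentially"
        proof (cases "s < r \<and> r < t")
          case True
          then have "eventually (\<lambda>n. e n < min (r - s) (t - r)) sequentially"
            by (intro order_tendstoD(2)[OF e0]) simp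
          then show ?thesis using True by (auto elim!: eventually_mono simp: indicator_def)
        next
          case False
          have "indicator {s + e n..t - e n} r = (indicator {s..t} r :: real)" for n
            using False r e(1)[of n] by (auto simp: indicator_def)
          then show ?thesis by simp
        qed
        then have "(\<lambda>n. indicator {s + e n..t - e n} r :: real) \<longlonglongrightarrow> indicator {s..t} r"
          by (rule tendsto_eventually)
        then show "(\<lambda>n. indicator {s + e n..t - e n} r * (indicator {0..T} r *\<^sub>R h r)) \<longlonglongrightarrow> indicator {s..t} r * (indicator {0..T} r *\<^sub>R h r)"
          by (rule tendsto_mult_right)
      qed
      show "integrable lborel (\<lambda>r. \<bar>indicator {0..T} r *\<^sub>R h r\<bar>)"
        by (intro integrable_abs hi)
      show "AE r in lborel. norm (indicator {s + e n..t - e n} r * (indicator {0..T} r *\<^sub>R h r)) \<le> \<bar>indicator {0..T} r *\<^sub>R h r\<bar>" for n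
        unfolding real_norm_def abs_mult by (rule AE_I2, rule mult_left_le_one_le) (simp_all add: abs_le_iff indicator_le_1)
      show "(\<lambda>r. indicator {s..t} r * (indicator {0..T} r *\<^sub>R h r)) \<in> borel_measurable lborel"
        by (rule borel_measurable_times[OF _ hm]) simp
      show "(\<lambda>r. indicator {s + e n..t - e n} r * (indicator {0..T} r *\<^sub>R h r)) \<in> borel_measurable lborel" for n
        by (rule borel_measurable_times[OF _ hm]) simp
    qed
    moreover have "(\<integral>r. indicator {s + e n..t - e n} r * (indicator {0..T} r *\<^sub>R h r) \<partial>lborel) = (LBINT r:{s + e n..t - e n}. h r)" for n
      unfolding set_lebesgue_integral_def
    proof (rule Bochner_Integration.integral_cong[OF refl])
      show "indicator {s + e n..t - e n} r * (indicator {0..T} r *\<^sub>R h r) = indicator {s + e n..t - e n} r *\<^sub>R h r" for r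
      proof (cases "r \<in> {s + e n..t - e n}")
        case True
        then have "r \<in> {0..T}" using ineq[of n] by auto
        with True show ?thesis by simp
      qed simp
    qed
    moreover have "(\<integral>r. indicator {s..t} r * (indicator {0..T} r *\<^sub>R h r) \<partial>lborel) = (LBINT r:{s..t}. h r)"
      unfolding set_lebesgue_integral_def
    proof (rule Bochner_Integration.integral_cong[OF refl])
      show "indicator {s..t} r * (indicator {0..T} r *\<^sub>R h r) = indicator {s..t} r *\<^sub>R h r" for r
      proof (cases "r \<in> {s..t}")
        case True
        then have "r \<in> {0..T}" using st by auto
        with True show ?thesis by simp
      qed simp
    qed
    ultimately show ?thesis by (simp only:)
  qed
  moreover have "g (t - e n) - g (s + e n) = (LBINT r:{s + e n..t - e n}. h r)" for n
    using ineq by (intro has_dist_deriv_interior[OF D g h])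
  ultimately have "(\<lambda>n. g (t - e n) - g (s + e n)) \<longlonglongrightarrow> g t - g s"
    "(\<lambda>n. g (t - e n) - g (s + e n)) \<longlonglongrightarrow> (LBINT r:{s..t}. h r)"
    by simp_all
  then show ?thesis by (rule LIMSEQ_unique)
qed

section \<open>The collision transformation\<close>

definition coll :: "'a::euclidean_space \<times> 'a \<times> 'a \<Rightarrow> 'a \<times> 'a \<times> 'a" where
  "coll = (\<lambda>(v, vs, \<omega>). (post v vs \<omega>, post_star v vs \<omega>, \<omega>))"

definition exchange :: "'a \<times> 'a \<times> 'b \<Rightarrow> 'a \<times> 'a \<times> 'b" where
  "exchange = (\<lambda>(v, vs, \<omega>). (vs, v, \<omega>))"

section \<open>The measure on \<open>Omega\<close> and its two symmetries\<close>

lemma sigma_finite_lborel_sphere: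
  "sigma_finite_measure (lborel \<Otimes>\<^sub>M sphere_measure :: ('a::euclidean_space \<times> 'a) measure)"
proof -
  interpret pair_sigma_finite "lborel :: 'a measure" "sphere_measure :: 'a measure" ..
  show ?thesis ..
qed

lemma sigma_finite_Omega: "sigma_finite_measure (Omega :: ('a::euclidean_space \<times> 'a \<times> 'a) measure)"
proof -
  interpret S: sigma_finite_measure "lborel \<Otimes>\<^sub>M sphere_measure :: ('a \<times> 'a) measure"
    by (rule sigma_finite_lborel_sphere)
  interpret pair_sigma_finite "lborel :: 'a measure" "lborel \<Otimes>\<^sub>M sphere_measure :: ('a \<times> 'a) measure" ..
  show ?thesis unfolding Omega_def ..
qed

lemma space_Omega: "space Omega = UNIV \<times> UNIV \<times> sphere 0 1"
  by (simp add: Omega_def space_pair_measure space_sphere_measure)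

lemma Omega_components_measurable:
  "fst \<in> Omega \<rightarrow>\<^sub>M (borel :: 'a::euclidean_space measure)"
  "(\<lambda>x. fst (snd x)) \<in> Omega \<rightarrow>\<^sub>M (borel :: 'a measure)"
  "(\<lambda>x. snd (snd x)) \<in> Omega \<rightarrow>\<^sub>M (borel :: 'a measure)"
proof -
  show "fst \<in> Omega \<rightarrow>\<^sub>M (borel :: 'a measure)"
    unfolding Omega_def by measurable
  show "(\<lambda>x. fst (snd x)) \<in> Omega \<rightarrow>\<^sub>M (borel :: 'a measure)"
    unfolding Omega_def by measurable
  show "(\<lambda>x. snd (snd x)) \<in> Omega \<rightarrow>\<^sub>M (borel :: 'a measure)"
    unfolding Omega_def
    by (rule measurable_sphere_measure_borel) (rule measurable_compose[OF measurable_snd measurable_snd])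
qed

lemma measurable_OmegaI:
  assumes "(\<lambda>x. fst (f x)) \<in> M \<rightarrow>\<^sub>M (borel :: 'a::euclidean_space measure)" "(\<lambda>x. fst (snd (f x))) \<in> M \<rightarrow>\<^sub>M (borel :: 'a measure)"
    "(\<lambda>x. snd (snd (f x))) \<in> M \<rightarrow>\<^sub>M (sphere_measure :: 'a measure)"
  shows "f \<in> M \<rightarrow>\<^sub>M (Omega :: ('a \<times> 'a \<times> 'a) measure)"
proof -
  have "(\<lambda>x. (fst (f x), fst (snd (f x)), snd (snd (f x)))) \<in> M \<rightarrow>\<^sub>M Omega"
    unfolding Omega_def using assms by (intro measurable_Pair) (simp_all add: measurable_lborel1)
  then show ?thesis by simp
qed

lemma post_measurable:
  "(\<lambda>x. post (fst x) (fst (snd x)) (snd (snd x))) \<in> Omega \<rightarrow>\<^sub>M (borel :: 'a::euclidean_space measure)"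
  "(\<lambda>x. post_star (fst x) (fst (snd x)) (snd (snd x))) \<in> Omega \<rightarrow>\<^sub>M (borel :: 'a::euclidean_space measure)"
  unfolding post_def post_star_def
  using Omega_components_measurable[where 'a='a]
  by (auto intro!: borel_measurable_diff borel_measurable_add borel_measurable_scaleR borel_measurable_inner)

lemma Omega_sphere_measurable: "(\<lambda>x. snd (snd x)) \<in> Omega \<rightarrow>\<^sub>M sphere_measure"
  unfolding Omega_def by (rule measurable_compose[OF measurable_snd measurable_snd])

lemma coll_measurable: "coll \<in> Omega \<rightarrow>\<^sub>M Omega"
  using post_measurable Omega_sphere_measurable
  by (intro measurable_OmegaI) (auto simp: coll_def split_beta')

lemma exchange_measurable: "exchange \<in> Omega \<rightarrow>\<^sub>M Omega"
  using Omega_components_measurable Omega_sphere_measurable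
  by (intro measurable_OmegaI) (auto simp: exchange_def split_beta')

text \<open>Two orders of integration for two purposes: with \<omega> outermost the collision acts
  as an isometry on pairs of velocities, which gives its invariance; with v outermost the inner
  integrals have the form of \<open>collision_averaging\<close>.\<close>

lemma nn_integral_Omega:
  fixes h :: "'a::euclidean_space \<times> 'a \<times> 'a \<Rightarrow> ennreal"
  assumes h: "h \<in> borel_measurable Omega"
  shows "(\<integral>\<^sup>+x. h x \<partial>Omega) = (\<integral>\<^sup>+\<omega>. (\<integral>\<^sup>+p. h (fst p, snd p, \<omega>) \<partial>lborel) \<partial>sphere_measure)"
    and "(\<integral>\<^sup>+x. h x \<partial>Omega) = (\<integral>\<^sup>+v. (\<integral>\<^sup>+vs. (\<integral>\<^sup>+\<omega>. h (v, vs, \<omega>) \<partial>sphere_measure) \<partial>lborel) \<partial>lborel)"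
proof -
  interpret S: sigma_finite_measure "lborel \<Otimes>\<^sub>M sphere_measure :: ('a \<times> 'a) measure"
    by (rule sigma_finite_lborel_sphere)
  interpret P: pair_sigma_finite "lborel :: 'a measure" "sphere_measure :: 'a measure" ..
  have h': "h \<in> borel_measurable (lborel \<Otimes>\<^sub>M (lborel \<Otimes>\<^sub>M sphere_measure))"
    using h by (simp add: Omega_def)
  have re: "(\<lambda>q. h (fst (fst q), snd q, snd (fst q))) \<in> borel_measurable ((lborel \<Otimes>\<^sub>M sphere_measure) \<Otimes>\<^sub>M lborel)"
    by (rule measurable_compose[OF _ h'])
       (intro measurable_Pair measurable_compose[OF measurable_fst measurable_fst] measurable_snd
         measurable_compose[OF measurable_fst measurable_snd])
  have sec: "(\<lambda>y. h (v, y)) \<in> borel_measurable (lborel \<Otimes>\<^sub>M sphere_measure)" for v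
    by (rule measurable_compose[OF measurable_Pair1' h']) simp
  have sec2: "(\<lambda>p. h (fst p, snd p, \<omega>)) \<in> borel_measurable (lborel \<Otimes>\<^sub>M lborel)" if "\<omega> \<in> space sphere_measure" for \<omega>
    using that by (intro measurable_compose[OF _ h'] measurable_Pair measurable_fst measurable_snd measurable_const)
  have 1: "(\<integral>\<^sup>+x. h x \<partial>Omega) = (\<integral>\<^sup>+v. (\<integral>\<^sup>+y. h (v, y) \<partial>(lborel \<Otimes>\<^sub>M sphere_measure)) \<partial>lborel)"
    unfolding Omega_def by (rule S.nn_integral_fst[OF h', symmetric])
  also have "\<dots> = (\<integral>\<^sup>+v. (\<integral>\<^sup>+\<omega>. (\<integral>\<^sup>+vs. h (v, vs, \<omega>) \<partial>lborel) \<partial>sphere_measure) \<partial>lborel)"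
    by (intro nn_integral_cong P.nn_integral_snd[symmetric] sec)
  also have "\<dots> = (\<integral>\<^sup>+\<omega>. (\<integral>\<^sup>+v. (\<integral>\<^sup>+vs. h (v, vs, \<omega>) \<partial>lborel) \<partial>lborel) \<partial>sphere_measure)"
  proof (rule P.Fubini'[symmetric])
    show "(\<lambda>(v, \<omega>). \<integral>\<^sup>+vs. h (v, vs, \<omega>) \<partial>lborel) \<in> borel_measurable (lborel \<Otimes>\<^sub>M sphere_measure)"
      using lborel.borel_measurable_nn_integral_fst[OF re] by (simp add: split_beta')
  qed
  also have "\<dots> = (\<integral>\<^sup>+\<omega>. (\<integral>\<^sup>+p. h (fst p, snd p, \<omega>) \<partial>lborel) \<partial>sphere_measure)"
  proof (rule nn_integral_cong)
    fix \<omega> :: 'a assume "\<omega> \<in> space sphere_measure"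
    from lborel.nn_integral_fst[OF sec2[OF this]]
    show "(\<integral>\<^sup>+v. (\<integral>\<^sup>+vs. h (v, vs, \<omega>) \<partial>lborel) \<partial>lborel) = (\<integral>\<^sup>+p. h (fst p, snd p, \<omega>) \<partial>lborel)"
      by (simp add: lborel_prod)
  qed
  finally show "(\<integral>\<^sup>+x. h x \<partial>Omega) = (\<integral>\<^sup>+\<omega>. (\<integral>\<^sup>+p. h (fst p, snd p, \<omega>) \<partial>lborel) \<partial>sphere_measure)" .
  show "(\<integral>\<^sup>+x. h x \<partial>Omega) = (\<integral>\<^sup>+v. (\<integral>\<^sup>+vs. (\<integral>\<^sup>+\<omega>. h (v, vs, \<omega>) \<partial>sphere_measure) \<partial>lborel) \<partial>lborel)"
    unfolding 1 by (intro nn_integral_cong sphere.nn_integral_fst[symmetric] sec)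
qed

lemma Omega_section_measurable:
  fixes h :: "'a::euclidean_space \<times> 'a \<times> 'a \<Rightarrow> ennreal"
  assumes "h \<in> borel_measurable Omega" "\<omega> \<in> sphere 0 1"
  shows "(\<lambda>p. h (fst p, snd p, \<omega>)) \<in> borel_measurable (borel :: ('a \<times> 'a) measure)"
proof -
  have "(\<lambda>p. (fst p, snd p, \<omega>)) \<in> (borel :: ('a \<times> 'a) measure) \<rightarrow>\<^sub>M Omega"
  proof (intro measurable_OmegaI)
    show "(\<lambda>p. fst (fst p, snd p, \<omega>)) \<in> borel_measurable (borel :: ('a \<times> 'a) measure)"
      "(\<lambda>p. fst (snd (fst p, snd p, \<omega>))) \<in> borel_measurable (borel :: ('a \<times> 'a) measure)"
      by (simp_all, intro borel_measurable_continuous_onI continuous_intros, intro borel_measurable_continuous_onI continuous_intros)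
    show "(\<lambda>p. snd (snd (fst p, snd p, \<omega>))) \<in> (borel :: ('a \<times> 'a) measure) \<rightarrow>\<^sub>M sphere_measure"
      using assms(2) by (simp add: space_sphere_measure)
  qed
  from measurable_compose[OF this assms(1)] show ?thesis .
qed

lemma nn_integral_coll:
  fixes h :: "'a::euclidean_space \<times> 'a \<times> 'a \<Rightarrow> ennreal"
  assumes h: "h \<in> borel_measurable Omega"
  shows "(\<integral>\<^sup>+x. h (coll x) \<partial>Omega) = (\<integral>\<^sup>+x. h x \<partial>Omega)"
  unfolding nn_integral_Omega(1)[OF h] nn_integral_Omega(1)[OF measurable_compose[OF coll_measurable h]]
proof (rule nn_integral_cong)
  fix \<omega> :: 'a assume "\<omega> \<in> space sphere_measure"
  then have \<omega>: "\<omega> \<in> sphere 0 1" by (simp add: space_sphere_measure)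
  show "(\<integral>\<^sup>+p. h (coll (fst p, snd p, \<omega>)) \<partial>lborel) = (\<integral>\<^sup>+p. h (fst p, snd p, \<omega>) \<partial>lborel)"
    using nn_integral_collision_lborel[OF Omega_section_measurable[OF h \<omega>], of \<omega>] \<omega>
    by (simp add: coll_def)
qed

lemma nn_integral_exchange:
  fixes h :: "'a::euclidean_space \<times> 'a \<times> 'a \<Rightarrow> ennreal"
  assumes h: "h \<in> borel_measurable Omega"
  shows "(\<integral>\<^sup>+x. h (exchange x) \<partial>Omega) = (\<integral>\<^sup>+x. h x \<partial>Omega)"
  unfolding nn_integral_Omega(1)[OF h] nn_integral_Omega(1)[OF measurable_compose[OF exchange_measurable h]]
proof (rule nn_integral_cong)
  fix \<omega> :: 'a assume "\<omega> \<in> space sphere_measure"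
  then have \<omega>: "\<omega> \<in> sphere 0 1" by (simp add: space_sphere_measure)
  show "(\<integral>\<^sup>+p. h (exchange (fst p, snd p, \<omega>)) \<partial>lborel) = (\<integral>\<^sup>+p. h (fst p, snd p, \<omega>) \<partial>lborel)"
    using nn_integral_swap_lborel[OF Omega_section_measurable[OF h \<omega>]] by (simp add: exchange_def)
qed

lemma distr_coll: "distr Omega Omega coll = Omega"
proof (rule measure_eqI)
  fix A :: "('a \<times> 'a \<times> 'a) set" assume "A \<in> sets (distr Omega Omega coll)"
  then have A: "A \<in> sets Omega" by simp
  have "emeasure (distr Omega Omega coll) A = (\<integral>\<^sup>+x. indicator A x \<partial>distr Omega Omega coll)"
    using A by simp
  also have "\<dots> = (\<integral>\<^sup>+x. indicator A (coll x) \<partial>Omega)"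
    using A by (intro nn_integral_distr coll_measurable) simp
  also have "\<dots> = (\<integral>\<^sup>+x. indicator A x \<partial>Omega)" using A by (intro nn_integral_coll) simp
  finally show "emeasure (distr Omega Omega coll) A = emeasure Omega A" using A by simp
qed simp

lemma distr_exchange: "distr Omega Omega exchange = (Omega :: ('a::euclidean_space \<times> 'a \<times> 'a) measure)"
proof (rule measure_eqI)
  fix A :: "('a \<times> 'a \<times> 'a) set" assume "A \<in> sets (distr Omega Omega exchange)"
  then have A: "A \<in> sets Omega" by simp
  have "emeasure (distr Omega Omega exchange) A = (\<integral>\<^sup>+x. indicator A x \<partial>distr Omega Omega exchange)"
    using A by simp
  also have "\<dots> = (\<integral>\<^sup>+x. indicator A (exchange x) \<partial>Omega)"
    using A by (intro nn_integral_distr exchange_measurable) simp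
  also have "\<dots> = (\<integral>\<^sup>+x. indicator A x \<partial>Omega)" using A by (intro nn_integral_exchange) simp
  finally show "emeasure (distr Omega Omega exchange) A = emeasure Omega A" using A by simp
qed simp

lemma coll_coll: "x \<in> space Omega \<Longrightarrow> coll (coll x) = x"
  by (auto simp: space_Omega coll_def post_involution)

lemma coll_exchange: "coll (exchange x) = exchange (coll x)"
proof -
  obtain v vs \<omega> where "x = (v, vs, \<omega>)" by (metis prod_cases3)
  then show ?thesis
    by (simp add: coll_def exchange_def post_swap(1)[of vs v \<omega>] post_swap(2)[of vs v \<omega>])
qed

lemma exchange_exchange: "exchange (exchange x) = x"
  by (auto simp: exchange_def split: prod.split)

lemma integral_coll:
  fixes h :: "'a::euclidean_space \<times> 'a \<times> 'a \<Rightarrow> real"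
  assumes "h \<in> borel_measurable Omega"
  shows "(\<integral>x. h (coll x) \<partial>Omega) = (\<integral>x. h x \<partial>Omega)"
  using integral_distr[OF coll_measurable assms] by (simp add: distr_coll)

lemma integral_exchange:
  fixes h :: "'a::euclidean_space \<times> 'a \<times> 'a \<Rightarrow> real"
  assumes "h \<in> borel_measurable Omega"
  shows "(\<integral>x. h (exchange x) \<partial>Omega) = (\<integral>x. h x \<partial>Omega)"
  using integral_distr[OF exchange_measurable assms] by (simp add: distr_exchange)

lemma AE_Omega_fst:
  assumes "AE v in lborel. P (v :: 'a::euclidean_space)"
  shows "AE x in Omega. P (fst x)"
proof -
  obtain N where N: "{v. \<not> P v} \<subseteq> N" "N \<in> null_sets lborel"
    using assms by (auto simp: eventually_ae_filter)
  then have Nb[measurable]: "N \<in> sets borel" by auto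
  have m: "(\<lambda>x. indicator N (fst x) :: ennreal) \<in> borel_measurable (Omega :: ('a \<times> 'a \<times> 'a) measure)"
    using Omega_components_measurable(1) by measurable
  have "AE v in lborel. v \<notin> N" using N(2) by (rule AE_not_in)
  then have "(\<integral>\<^sup>+v. (\<integral>\<^sup>+vs. (\<integral>\<^sup>+\<omega>. indicator N (fst (v, vs, \<omega>)) \<partial>(sphere_measure :: 'a measure)) \<partial>(lborel :: 'a measure)) \<partial>lborel) = (\<integral>\<^sup>+v. 0 \<partial>(lborel :: 'a measure))"
    by (intro nn_integral_cong_AE, elim eventually_mono) simp
  then have "(\<integral>\<^sup>+x. indicator N (fst x) \<partial>(Omega :: ('a \<times> 'a \<times> 'a) measure)) = 0"
    unfolding nn_integral_Omega(2)[OF m] by simp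
  then have "AE x in (Omega :: ('a \<times> 'a \<times> 'a) measure). indicator N (fst x) = (0::ennreal)"
    using m by (subst (asm) nn_integral_0_iff_AE) auto
  then show ?thesis
  proof eventually_elim
    case (elim x)
    then have "fst x \<notin> N" by (auto simp: indicator_eq_0_iff)
    then show "P (fst x)" using N(1) by blast
  qed
qed

text \<open>A null set of velocities is null in the first slot by Tonelli; invariance under
  \<open>exchange\<close> and \<open>coll\<close> carries this to the remaining three velocities.
  Consequently densities may be changed on null sets inside every integral over
  \<open>Omega\<close>.\<close>

lemma AE_Omega_velocities:
  assumes "AE v in lborel. P (v :: 'a::euclidean_space)"
  shows "AE x in Omega. P (fst x) \<and> P (fst (snd x)) \<and> P (fst (coll x)) \<and> P (fst (snd (coll x)))"
proof -
  note 1 = AE_Omega_fst[OF assms]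
  have 2: "AE x in Omega. P (fst (exchange x))"
    by (rule AE_distrD[OF exchange_measurable], unfold distr_exchange) (rule 1)
  have 3: "AE x in Omega. P (fst x) \<and> P (fst (snd x))"
    using 1 2 by eventually_elim (auto simp: exchange_def split: prod.splits)
  have "AE x in Omega. P (fst (coll x)) \<and> P (fst (snd (coll x)))"
    by (rule AE_distrD[OF coll_measurable], unfold distr_coll) (rule 3)
  with 3 show ?thesis by eventually_elim auto
qed

section \<open>Chain rule for the clamped entropy\<close>

text \<open>The indicator of an open set is the pointwise limit of the bounded continuous functions
  min(1, n dist(x, complement)).\<close>

lemma set_integral_open_eq_0:
  fixes k :: "'a::euclidean_space \<Rightarrow> real"
  assumes k: "integrable lborel k"
    and zero: "\<And>\<phi>. continuous_on UNIV \<phi> \<Longrightarrow> bounded (range \<phi>) \<Longrightarrow> (\<integral>x. \<phi> x * k x \<partial>lborel) = 0"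
    and S: "open S"
  shows "(\<integral>x. indicator S x * k x \<partial>lborel) = 0"
\<comment> \<open>The distance to the empty set is 0 by convention, so the approximation would
  vanish for the whole space; there the constant 1 is a test function.\<close>
proof (cases "S = UNIV")
  case True
  then show ?thesis using zero[of "\<lambda>_. 1"] by simp
next
  case False
  then have ne: "- S \<noteq> {}" by auto
  have km[measurable]: "k \<in> borel_measurable borel" using k by auto
  define \<phi> where "\<phi> n x = min 1 (real n * infdist x (- S))" for n x
  have c: "continuous_on UNIV (\<phi> n)" for n
    unfolding \<phi>_def by (intro continuous_intros continuous_on_infdist)
  have b: "0 \<le> \<phi> n x" "\<phi> n x \<le> 1" for n x
    by (auto simp: \<phi>_def infdist_nonneg)
  have "(\<lambda>n. \<integral>x. \<phi> n x * k x \<partial>lborel) \<longlonglongrightarrow> (\<integral>x. indicator S x * k x \<partial>lborel)"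
  proof (rule integral_dominated_convergence[where w="\<lambda>x. \<bar>k x\<bar>"])
    show "AE x in lborel. (\<lambda>n. \<phi> n x * k x) \<longlonglongrightarrow> indicator S x * k x"
    proof (rule AE_I2, rule tendsto_mult_right)
      fix x
      show "(\<lambda>n. \<phi> n x) \<longlonglongrightarrow> indicator S x"
      proof (cases "x \<in> S")
        case True
        then have d: "infdist x (- S) > 0"
          using in_closed_iff_infdist_zero[OF closed_Compl[OF S] ne, of x] infdist_nonneg[of x "- S"] by auto
        obtain m where m: "1 < real m * infdist x (- S)"
          using reals_Archimedean3[OF d] by blast
        have "\<phi> n x = 1" if "n \<ge> m" for n
        proof -
          have "real m * infdist x (- S) \<le> real n * infdist x (- S)" using that d by (intro mult_right_mono) auto
          then show ?thesis using m by (simp add: \<phi>_def)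
        qed
        then show ?thesis using True by (intro tendsto_eventually) (auto simp: eventually_sequentially)
      next
        case False
        then have "\<phi> n x = 0" for n by (simp add: \<phi>_def)
        then show ?thesis using False by simp
      qed
    qed
    show "AE x in lborel. norm (\<phi> n x * k x) \<le> \<bar>k x\<bar>" for n
      unfolding real_norm_def abs_mult using b[of n] by (intro AE_I2 mult_left_le_one_le) auto
    show "(\<lambda>x. \<phi> n x * k x) \<in> borel_measurable lborel" for n
      using borel_measurable_continuous_onI[OF c[of n]] by measurable
    show "(\<lambda>x. indicator S x * k x) \<in> borel_measurable lborel"
      using S by (intro borel_measurable_times borel_measurable_indicator) simp_all
  qed (use k in simp)
  moreover have "(\<integral>x. \<phi> n x * k x \<partial>lborel) = 0" for n
  proof (rule zero[OF c])
    show "bounded (range (\<phi> n))" unfolding bounded_iff using b[of n] by (intro exI[of _ 1]) auto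
  qed
  ultimately show ?thesis using LIMSEQ_unique[of "\<lambda>n. 0" _ 0] by (simp add: LIMSEQ_const_iff)
qed

text \<open>The sets on which k has integral 0 contain the open sets and are closed under
  complements and countable disjoint unions, so they include all Borel sets, in particular {k > 0}
  and {k < 0}.\<close>

lemma AE_eq_0_if_bounded_continuous:
  fixes k :: "'a::euclidean_space \<Rightarrow> real"
  assumes k: "integrable lborel k"
    and zero: "\<And>\<phi>. continuous_on UNIV \<phi> \<Longrightarrow> bounded (range \<phi>) \<Longrightarrow> (\<integral>x. \<phi> x * k x \<partial>lborel) = 0"
  shows "AE x in lborel. k x = 0"
proof -
  have km[measurable]: "k \<in> borel_measurable borel" using k by auto
  have ki: "integrable lborel (\<lambda>x. indicator A x * k x)" if "A \<in> sets borel" for A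
    using integrable_mult_indicator[of A lborel k] that k by simp
  have all: "(\<integral>x. indicator A x * k x \<partial>lborel) = 0" if "A \<in> sigma_sets UNIV {S. open S}" for A
  proof (rule sigma_sets_induct_disjoint[OF _ _ that])
    show "Int_stable {S :: 'a set. open S}" by (auto simp: Int_stable_def)
    show "{S :: 'a set. open S} \<subseteq> Pow UNIV" by simp
  next
    fix A :: "'a set" assume "A \<in> {S. open S}"
    then show "(\<integral>x. indicator A x * k x \<partial>lborel) = 0"
      using set_integral_open_eq_0[OF k zero] by simp
  next
    show "(\<integral>x. indicator {} x * k x \<partial>lborel) = 0" by simp
  next
    fix A :: "'a set" assume A: "A \<in> sigma_sets UNIV {S. open S}" "(\<integral>x. indicator A x * k x \<partial>lborel) = 0"
    then have Ab: "A \<in> sets borel" by (simp add: borel_def)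
    have "(\<integral>x. indicator (UNIV - A) x * k x \<partial>lborel) = (\<integral>x. k x - indicator A x * k x \<partial>lborel)"
      by (intro Bochner_Integration.integral_cong) (auto simp: indicator_def)
    also have "\<dots> = (\<integral>x. k x \<partial>lborel) - (\<integral>x. indicator A x * k x \<partial>lborel)"
      by (intro Bochner_Integration.integral_diff k ki Ab)
    finally show "(\<integral>x. indicator (UNIV - A) x * k x \<partial>lborel) = 0"
      using A(2) zero[of "\<lambda>_. 1"] by simp
  next
    fix A :: "nat \<Rightarrow> 'a set"
    assume d: "disjoint_family A" and A: "range A \<subseteq> sigma_sets UNIV {S. open S}"
      and z: "\<And>i. (\<integral>x. indicator (A i) x * k x \<partial>lborel) = 0"
    have Ab: "A i \<in> sets lborel" for i using A by (auto simp: borel_def)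
    have "set_integrable lborel (\<Union>i. A i) k"
      unfolding set_integrable_def using ki[of "\<Union>i. A i"] Ab by simp
    moreover have "A i \<inter> A j = {}" if "i \<noteq> j" for i j using d that by (auto simp: disjoint_family_on_def)
    ultimately have "(LINT x:(\<Union>i. A i)|lborel. k x) = (\<Sum>i. LINT x:A i|lborel. k x)"
      using Ab by (intro lebesgue_integral_countable_add) auto
    then
    have "(\<integral>x. indicator (\<Union>i. A i) x * k x \<partial>lborel) = (\<Sum>i. \<integral>x. indicator (A i) x * k x \<partial>lborel)"
      unfolding set_lebesgue_integral_def by simp
    then show "(\<integral>x. indicator (\<Union>i. A i) x * k x \<partial>lborel) = 0" using z by simp
  qed
  have "(\<integral>x. \<bar>k x\<bar> \<partial>lborel) = (\<integral>x. indicator {x. k x > 0} x * k x - indicator {x. k x < 0} x * k x \<partial>lborel)"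
    by (intro Bochner_Integration.integral_cong) (auto simp: indicator_def)
  also have "\<dots> = (\<integral>x. indicator {x. k x > 0} x * k x \<partial>lborel) - (\<integral>x. indicator {x. k x < 0} x * k x \<partial>lborel)"
    by (intro Bochner_Integration.integral_diff ki) measurable
  also have "\<dots> = 0"
  proof -
    have "{x. k x > 0} \<in> sets borel" "{x. k x < 0} \<in> sets borel" by measurable
    then show ?thesis by (simp add: all borel_def)
  qed
  finally have "(\<integral>x. \<bar>k x\<bar> \<partial>lborel) = 0" .
  then have "AE x in lborel. \<bar>k x\<bar> = 0"
    using k by (subst (asm) integral_nonneg_eq_0_iff_AE) auto
  then show ?thesis by simp
qed

text \<open>Neither g nor the truncated entropy is differentiated. The error \<open>E\<close> of the
  formula satisfies |E t - E s| \<le> 2 N e (Q t - Q s) on short intervals, where \<open>Q\<close>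
  is the variation of g; this telescopes to |E T| \<le> 2 N e Q T for every e > 0.\<close>

lemma chain_rule_trunc_entropy:
  fixes g q :: "real \<Rightarrow> real"
  assumes N: "N \<ge> 1" and T: "0 \<le> T" and q: "set_integrable lborel {0..T} q"
    and g: "\<And>t. t \<in> {0..T} \<Longrightarrow> g t = g 0 + (LBINT r:{0..t}. q r)"
  shows "trunc_entropy N (g T) - trunc_entropy N (g 0) = (LBINT r:{0..T}. ln_clamp N (g r) * q r)"
proof -
  have sub: "set_integrable lborel {s..t} q" if "0 \<le> s" "t \<le> T" for s t
    using that by (intro set_integrable_subset[OF q]) auto
  have cont: "continuous_on {0..T} g"
  proof -
    have "q integrable_on {0..T}" using set_borel_integral_eq_integral(1)[OF q] .
    then have c: "continuous_on {0..T} (\<lambda>t. g 0 + integral {0..t} q)"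
      by (intro continuous_intros indefinite_integral_continuous_1)
    have e: "g t = g 0 + integral {0..t} q" if "t \<in> {0..T}" for t
      using g[OF that] set_borel_integral_eq_integral(2)[OF sub[of 0 t]] that by simp
    show ?thesis by (rule continuous_on_eq[OF c e[symmetric]])
  qed
  have diff: "(LBINT r:{0..t}. h r) - (LBINT r:{0..s}. h r) = (LBINT r:{s..t}. h r)"
    if "0 \<le> s" "s \<le> t" "t \<le> T" and h: "set_integrable lborel {0..T} h" for s t and h :: "real \<Rightarrow> real"
  proof -
    have "(LBINT r:{0..t}. h r) = (LBINT r:{0..s} \<union> {s..t}. h r)"
      using that by (simp add: ivl_disj_un_two_touch)
    also have "\<dots> = (LBINT r:{0..s}. h r) + (LBINT r:{s..t}. h r)"
    proof (rule set_integral_Un_AE)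
      show "AE r in lborel. \<not> (r \<in> {0..s} \<and> r \<in> {s..t})"
        using AE_lborel_singleton[of s] by eventually_elim auto
    qed (use that in \<open>auto intro: set_integrable_subset[OF h]\<close>)
    finally show ?thesis by simp
  qed
  define h where "h r = ln_clamp N (g r) * q r" for r
  have gm: "(\<lambda>r. indicator {0..T} r *\<^sub>R g r) \<in> borel_measurable borel"
    by (rule borel_measurable_continuous_on_indicator[OF _ cont]) simp
  have h: "set_integrable lborel {0..T} h"
  proof -
    have qi: "integrable lborel (\<lambda>r. indicator {0..T} r *\<^sub>R q r)" using q unfolding set_integrable_def .
    have "integrable lborel (\<lambda>r. ln_clamp N (indicator {0..T} r *\<^sub>R g r) * (indicator {0..T} r *\<^sub>R q r))"
    proof (rule Bochner_Integration.integrable_bound[of _ "\<lambda>r. ln N * (indicator {0..T} r *\<^sub>R q r)"])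
      show "integrable lborel (\<lambda>r. ln N * (indicator {0..T} r *\<^sub>R q r))" using qi by (rule integrable_mult_right)
      show "(\<lambda>r. ln_clamp N (indicator {0..T} r *\<^sub>R g r) * (indicator {0..T} r *\<^sub>R q r)) \<in> borel_measurable lborel"
        using gm borel_measurable_integrable[OF qi] by (intro borel_measurable_times measurable_compose[OF _ ln_clamp_measurable]) auto
      show "AE r in lborel. norm (ln_clamp N (indicator {0..T} r *\<^sub>R g r) * (indicator {0..T} r *\<^sub>R q r)) \<le> norm (ln N * (indicator {0..T} r *\<^sub>R q r))"
        unfolding real_norm_def abs_mult using N ln_clamp_abs_le[OF N]
        by (intro AE_I2 mult_right_mono) (auto intro: order_trans[OF _ abs_ge_self])
    qed
    moreover have "ln_clamp N (indicator {0..T} r *\<^sub>R g r) * (indicator {0..T} r *\<^sub>R q r) = indicator {0..T} r *\<^sub>R h r" for r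
      by (cases "r \<in> {0..T}") (auto simp: h_def)
    ultimately show ?thesis unfolding set_integrable_def by (simp only:)
  qed
  define Q where "Q t = (LBINT r:{0..t}. \<bar>q r\<bar>)" for t
  have qa: "set_integrable lborel {0..T} (\<lambda>r. \<bar>q r\<bar>)" using q by (rule set_integrable_abs)
  define E where "E t = trunc_entropy N (g t) - trunc_entropy N (g 0) - (LBINT r:{0..t}. h r)" for t
  have Q0: "Q 0 = 0" and E0: "E 0 = 0"
  proof -
    have z: "(LBINT r:{0..0}. k r) = 0" for k :: "real \<Rightarrow> real"
      unfolding set_lebesgue_integral_def
      by (rule integral_eq_zero_AE, rule AE_mp[OF AE_lborel_singleton[of 0]]) (auto simp: indicator_def)
    show "Q 0 = 0" "E 0 = 0" by (simp_all only: Q_def E_def z)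
  qed
  have main: "\<bar>E T\<bar> \<le> 2 * N * e * Q T" if e: "e > 0" for e
  proof -
    from compact_uniformly_continuous[OF cont compact_Icc] e
    obtain \<delta> where \<delta>: "\<delta> > 0" "\<And>s t. s \<in> {0..T} \<Longrightarrow> t \<in> {0..T} \<Longrightarrow> dist t s < \<delta> \<Longrightarrow> dist (g t) (g s) < e"
      unfolding uniformly_continuous_on_def by metis
    \<comment> \<open>Two errors of size N e (Q t - Q s) each: the quadratic Taylor remainder, and
      the freezing of the factor \<open>ln_clamp N (g r)\<close> at the left endpoint. Both use that
      g moves by at most e on the interval.\<close>
    have local: "\<bar>E t - E s\<bar> \<le> 2 * N * e * (Q t - Q s)" if st: "0 \<le> s" "s \<le> t" "t \<le> T" "t - s < \<delta>" for s t
    proof -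
      have gd: "g t - g s = (LBINT r:{s..t}. q r)"
        using g[of t] g[of s] diff[OF st(1-3) q] st by simp
      have Qd: "Q t - Q s = (LBINT r:{s..t}. \<bar>q r\<bar>)" unfolding Q_def by (rule diff[OF st(1-3) qa])
      have gdQ: "\<bar>g t - g s\<bar> \<le> Q t - Q s"
        unfolding gd Qd using set_integral_norm_bound[OF sub[OF st(1,3)]] by simp
      have gde: "\<bar>g t - g s\<bar> \<le> e"
        using \<delta>(2)[of s t] st by (simp add: dist_real_def less_imp_le)
      have 1: "\<bar>trunc_entropy N (g t) - trunc_entropy N (g s) - ln_clamp N (g s) * (g t - g s)\<bar> \<le> N * e * (Q t - Q s)"
      proof -
        have "(g t - g s)\<^sup>2 = \<bar>g t - g s\<bar> * \<bar>g t - g s\<bar>" by (simp add: power2_eq_square)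
        also have "\<dots> \<le> e * (Q t - Q s)" using gdQ gde e by (intro mult_mono) auto
        finally have "N * (g t - g s)\<^sup>2 \<le> N * (e * (Q t - Q s))" using N by (intro mult_left_mono) auto
        then show ?thesis using trunc_entropy_taylor[OF N, of "g t" "g s"] by (simp add: mult.assoc)
      qed
      have hs: "set_integrable lborel {s..t} h" using st by (intro set_integrable_subset[OF h]) auto
      have cs: "set_integrable lborel {s..t} (\<lambda>r. ln_clamp N (g s) * q r)"
        using sub[OF st(1,3)] by (rule set_integrable_mult_right)
      have "\<bar>(LBINT r:{s..t}. h r) - ln_clamp N (g s) * (g t - g s)\<bar> = \<bar>LBINT r:{s..t}. h r - ln_clamp N (g s) * q r\<bar>"
        unfolding gd using set_integral_diff(2)[OF hs cs] by simp
      also have "\<dots> \<le> (LBINT r:{s..t}. \<bar>h r - ln_clamp N (g s) * q r\<bar>)"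
        using set_integral_norm_bound[OF set_integral_diff(1)[OF hs cs]] by simp
      also have "\<dots> \<le> (LBINT r:{s..t}. N * e * \<bar>q r\<bar>)"
      proof (rule set_integral_mono)
        show "set_integrable lborel {s..t} (\<lambda>r. \<bar>h r - ln_clamp N (g s) * q r\<bar>)"
          by (intro set_integrable_abs set_integral_diff(1)[OF hs cs])
        show "set_integrable lborel {s..t} (\<lambda>r. N * e * \<bar>q r\<bar>)"
          by (intro set_integrable_mult_right set_integrable_abs sub st)
        fix r assume r: "r \<in> {s..t}"
        have "\<bar>ln_clamp N (g r) - ln_clamp N (g s)\<bar> \<le> N * \<bar>g r - g s\<bar>" by (rule ln_clamp_diff_le[OF N])
        also have "\<dots> \<le> N * e"
          using \<delta>(2)[of s r] st r N by (intro mult_left_mono) (auto simp: dist_real_def less_imp_le)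
        finally have "\<bar>ln_clamp N (g r) - ln_clamp N (g s)\<bar> * \<bar>q r\<bar> \<le> N * e * \<bar>q r\<bar>" by (rule mult_right_mono) simp
        then show "\<bar>h r - ln_clamp N (g s) * q r\<bar> \<le> N * e * \<bar>q r\<bar>"
          by (simp add: h_def abs_mult[symmetric] left_diff_distrib)
      qed
      also have "\<dots> = N * e * (Q t - Q s)" unfolding Qd by (rule set_integral_mult_right)
      finally have 2: "\<bar>(LBINT r:{s..t}. h r) - ln_clamp N (g s) * (g t - g s)\<bar> \<le> N * e * (Q t - Q s)" .
      have "E t - E s = trunc_entropy N (g t) - trunc_entropy N (g s) - (LBINT r:{s..t}. h r)"
        unfolding E_def diff[OF st(1-3) h, symmetric] by simp
      then show ?thesis using 1 2 by (simp add: abs_le_iff)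
    qed
    obtain n :: nat where n: "T / real (Suc n) < \<delta>"
    proof -
      obtain m :: nat where "T / \<delta> < real m" using reals_Archimedean2 by blast
      then have "T < real m * \<delta>" using \<delta>(1) by (simp add: field_simps)
      also have "\<dots> \<le> real (Suc m) * \<delta>" using \<delta>(1) by simp
      finally have "T / real (Suc m) < \<delta>" by (simp add: field_simps del: of_nat_Suc)
      then show ?thesis using that by blast
    qed
    define tt where "tt i = real i * (T / real (Suc n))" for i
    have tt_Suc: "tt (Suc i) - tt i = T / real (Suc n)" for i
    proof -
      have "real (Suc i) * c - real i * c = c" for c :: real by (simp add: algebra_simps)
      then show ?thesis unfolding tt_def .
    qed
    have tt_range: "0 \<le> tt i" "tt i \<le> T" if "i \<le> Suc n" for i
    proof -
      show "0 \<le> tt i" unfolding tt_def using T by simp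
      have "tt i \<le> real (Suc n) * (T / real (Suc n))" unfolding tt_def using that T by (intro mult_right_mono) auto
      then show "tt i \<le> T" by (simp del: of_nat_Suc)
    qed
    have "E T - E 0 = (\<Sum>i<Suc n. E (tt (Suc i)) - E (tt i))"
      by (subst sum_lessThan_telescope) (simp add: tt_def del: of_nat_Suc)
    then have "\<bar>E T - E 0\<bar> \<le> (\<Sum>i<Suc n. \<bar>E (tt (Suc i)) - E (tt i)\<bar>)" using sum_abs by metis
    also have "\<dots> \<le> (\<Sum>i<Suc n. 2 * N * e * (Q (tt (Suc i)) - Q (tt i)))"
    proof (rule sum_mono)
      fix i assume "i \<in> {..<Suc n}"
      then have i: "i \<le> Suc n" "Suc i \<le> Suc n" by auto
      have "tt i \<le> tt (Suc i)" using tt_Suc[of i] T by (smt (verit) divide_nonneg_nonneg of_nat_0_le_iff)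
      then show "\<bar>E (tt (Suc i)) - E (tt i)\<bar> \<le> 2 * N * e * (Q (tt (Suc i)) - Q (tt i))"
        using tt_range(1)[OF i(1)] tt_range(2)[OF i(2)] tt_Suc[of i] n by (intro local) auto
    qed
    also have "\<dots> = 2 * N * e * (Q T - Q 0)"
      by (subst sum_distrib_left[symmetric], subst sum_lessThan_telescope) (simp add: tt_def del: of_nat_Suc)
    finally show ?thesis using Q0 E0 by simp
  qed
  have "Q T \<ge> 0" unfolding Q_def set_lebesgue_integral_def by (intro Bochner_Integration.integral_nonneg) simp
  have "\<bar>E T\<bar> \<le> 0"
  proof (rule field_le_epsilon)
    fix e :: real assume e: "e > 0"
    \<comment> \<open>The 1 in the divisor covers the case \<open>Q T = 0\<close>.\<close>
    have "\<bar>E T\<bar> \<le> 2 * N * (e / (2 * N * (Q T + 1))) * Q T"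
      using e N \<open>Q T \<ge> 0\<close> by (intro main) auto
    also have "\<dots> = e * (Q T / (Q T + 1))" using N by simp
    also have "\<dots> \<le> e * 1" using e \<open>Q T \<ge> 0\<close> by (intro mult_left_mono) (auto simp: field_simps)
    finally show "\<bar>E T\<bar> \<le> 0 + e" by simp
  qed
  then show ?thesis by (simp add: E_def h_def)
qed

section \<open>Moments and the collision envelope\<close>

lemma prob_density_integrable:
  assumes "prob_density f"
  shows "integrable lborel f" "(\<integral>v. f v \<partial>lborel) = 1" "f \<in> borel_measurable borel" "\<And>v. 0 \<le> f v"
proof -
  show m: "f \<in> borel_measurable borel" and nn: "\<And>v. 0 \<le> f v" using assms by (auto simp: prob_density_def)
  show i: "integrable lborel f"
    using assms m nn by (intro integrableI_nonneg) (auto simp: prob_density_def)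
  show "(\<integral>v. f v \<partial>lborel) = 1"
    using assms nn i by (simp add: integral_eq_nn_integral prob_density_def)
qed

lemma japanese_pos: "japanese v > 0" and japanese_ge_1: "japanese v \<ge> 1"
proof -
  have "1 \<le> 1 + (norm v)\<^sup>2" by simp
  then show "japanese v \<ge> 1" unfolding japanese_def by simp
  then show "japanese v > 0" by linarith
qed

lemma japanese_measurable[measurable]: "japanese \<in> borel_measurable borel"
  unfolding japanese_def[abs_def] by measurable

text \<open>The exponent only has to exceed the dimension; \<open>2 d\<close> is convenient.\<close>

lemma nn_integral_japanese_finite:
  "(\<integral>\<^sup>+v. ennreal (japanese (v :: 'a::euclidean_space) powr (- 2 * real DIM('a))) \<partial>lborel) < \<infinity>"
proof -
  let ?d = "DIM('a)"
  have le: "japanese v powr (- 2 * real ?d) \<le> 1 / (1 + norm v ^ (2 * ?d))" for v :: 'a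
  proof -
    have "japanese v powr (2 * real ?d) = (1 + (norm v)\<^sup>2) ^ ?d"
    proof -
      have "japanese v powr (2 * real ?d) = japanese v ^ (2 * ?d)"
        using powr_realpow[OF japanese_pos[of v], of "2 * ?d"] by simp
      then show ?thesis by (simp add: power_mult japanese_def)
    qed
    moreover have "1 + norm v ^ (2 * ?d) \<le> (1 + (norm v)\<^sup>2) ^ ?d"
    proof -
      have "1 + x ^ n \<le> (1 + x) ^ n" if "x \<ge> 0" "n \<ge> 1" for x :: real and n
        using that(2)
      proof (induction n rule: dec_induct)
        case (step n)
        have "1 + x ^ Suc n \<le> 1 + x ^ n * x + x + x ^ n" using that by simp
        also have "\<dots> = (1 + x ^ n) * (1 + x)" by (simp add: algebra_simps)
        also have "\<dots> \<le> (1 + x) ^ n * (1 + x)" using step.IH that by (intro mult_right_mono) auto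
        finally show ?case by (simp add: mult.commute)
      qed simp
      from this[of "(norm v)\<^sup>2" ?d] show ?thesis by (simp add: power_mult Suc_leI)
    qed
    ultimately have "1 + norm v ^ (2 * ?d) \<le> japanese v powr (2 * real ?d)" by simp
    moreover have "0 < 1 + norm v ^ (2 * ?d)" by (simp add: add_pos_nonneg)
    ultimately have "1 / (japanese v powr (2 * real ?d)) \<le> 1 / (1 + norm v ^ (2 * ?d))"
      using japanese_pos[of v] by (intro divide_left_mono mult_pos_pos) auto
    then show ?thesis by (simp add: powr_minus inverse_eq_divide)
  qed
  let ?h = "\<lambda>y::'a. ennreal (1 / (1 + norm y ^ (2 * ?d)))"
  have "(\<integral>\<^sup>+v. ennreal (japanese (v :: 'a) powr (- 2 * real ?d)) \<partial>lborel) \<le> (\<integral>\<^sup>+v. ?h v \<partial>lborel)"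
    by (intro nn_integral_mono ennreal_leI le)
  also have "\<dots> = (\<integral>\<^sup>+\<omega>. (\<integral>\<^sup>+r. ennreal (r ^ (?d - 1)) * indicator {0<..} r * ?h (r *\<^sub>R \<omega>) \<partial>lborel) \<partial>sphere_measure)"
    by (rule nn_integral_polar) measurable
  also have "\<dots> \<le> (\<integral>\<^sup>+\<omega>. 3 \<partial>(sphere_measure :: 'a measure))"
  proof (rule nn_integral_mono)
    fix \<omega> :: 'a assume "\<omega> \<in> space sphere_measure"
    then have \<omega>: "norm \<omega> = 1" by (simp add: space_sphere_measure)
    have "(\<integral>\<^sup>+r. ennreal (r ^ (?d - 1)) * indicator {0<..} r * ?h (r *\<^sub>R \<omega>) \<partial>lborel) \<le>
      (\<integral>\<^sup>+r. indicator {0..1} r + ennreal (real ?d / r ^ (?d + 1)) * indicator {1<..} r \<partial>lborel)"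
    proof (rule nn_integral_mono)
      fix r :: real
      consider "r \<le> 0" | "0 < r" "r \<le> 1" | "r > 1" by linarith
      then show "ennreal (r ^ (?d - 1)) * indicator {0<..} r * ?h (r *\<^sub>R \<omega>) \<le> indicator {0..1} r + ennreal (real ?d / r ^ (?d + 1)) * indicator {1<..} r"
      proof cases
        case 2
        have "r ^ (?d - 1) * (1 / (1 + norm (r *\<^sub>R \<omega>) ^ (2 * ?d))) \<le> 1 * 1"
          using 2 by (intro mult_mono) (auto simp: power_le_one divide_le_eq add_pos_nonneg)
        then show ?thesis using 2 by (simp add: ennreal_mult[symmetric])
      next
        case 3
        have "r ^ (?d - 1) * (1 / (1 + norm (r *\<^sub>R \<omega>) ^ (2 * ?d))) \<le> r ^ (?d - 1) * (1 / r ^ (2 * ?d))"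
          using 3 \<omega> by (intro mult_left_mono divide_left_mono) (auto intro!: mult_pos_pos add_pos_nonneg)
        also have "\<dots> = 1 / r ^ (?d + 1)"
        proof -
          have "(?d - 1) + (?d + 1) = 2 * ?d" by (simp add: Suc_leI)
          then have "r ^ (2 * ?d) = r ^ (?d - 1) * r ^ (?d + 1)" by (metis power_add)
          then show ?thesis using 3 by simp
        qed
        also have "\<dots> \<le> real ?d / r ^ (?d + 1)"
          using 3 by (intro divide_right_mono) (auto simp: Suc_leI)
        finally show ?thesis using 3 by (simp add: ennreal_mult[symmetric] ennreal_leI)
      qed simp
    qed
    also have "\<dots> = (\<integral>\<^sup>+r. indicator {0..1::real} r \<partial>lborel) + (\<integral>\<^sup>+r. ennreal (real ?d / r ^ (?d + 1)) * indicator {1<..} r \<partial>lborel)"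
      by (rule nn_integral_add) measurable
    also have "\<dots> = 1 + 1"
      by (subst nn_integral_inverse_power_tail) auto
    also have "\<dots> \<le> 3" by simp
    finally show "(\<integral>\<^sup>+r. ennreal (r ^ (?d - 1)) * indicator {0<..} r * ?h (r *\<^sub>R \<omega>) \<partial>lborel) \<le> 3" .
  qed
  also have "\<dots> < \<infinity>"
    using finite_measure.finite_emeasure_space[OF finite_sphere_measure[where 'a='a]]
    by (simp add: ennreal_mult_eq_top_iff less_top[symmetric])
  finally show ?thesis .
qed

lemma moment_japanese:
  assumes "s \<ge> 0" and f: "prob_density (f :: 'a::euclidean_space \<Rightarrow> real)"
  shows "(\<integral>\<^sup>+v. ennreal (japanese v powr (2 + s) * f v) \<partial>lborel) \<le>
    ennreal (2 powr (2 + s)) * (1 + (\<integral>\<^sup>+v. ennreal (norm v powr (2 + s) * f v) \<partial>lborel))"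
proof -
  note fp = prob_density_integrable[OF f]
  have jle: "japanese v powr (2 + s) \<le> 2 powr (2 + s) * (1 + norm v powr (2 + s))" for v :: 'a
  proof -
    have "japanese v \<le> 1 + norm v"
      unfolding japanese_def by (rule real_le_lsqrt) (auto simp: power2_eq_square algebra_simps)
    also have "\<dots> \<le> 2 * max 1 (norm v)" by auto
    finally have "japanese v powr (2 + s) \<le> (2 * max 1 (norm v)) powr (2 + s)"
      using assms japanese_pos[of v] by (intro powr_mono2) auto
    also have "\<dots> = 2 powr (2 + s) * max 1 (norm v) powr (2 + s)" by (simp add: powr_mult)
    also have "\<dots> \<le> 2 powr (2 + s) * (1 + norm v powr (2 + s))"
      by (intro mult_left_mono) (auto simp: max_def)
    finally show ?thesis .
  qed
  have "japanese v powr (2 + s) * f v \<le> 2 powr (2 + s) * (f v + norm v powr (2 + s) * f v)" for v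
    using mult_right_mono[OF jle[of v] fp(4)[of v]] by (simp add: algebra_simps)
  then have "(\<integral>\<^sup>+v. ennreal (japanese v powr (2 + s) * f v) \<partial>lborel) \<le>
      (\<integral>\<^sup>+v. ennreal (2 powr (2 + s)) * (ennreal (f v) + ennreal (norm v powr (2 + s) * f v)) \<partial>lborel)"
    using fp(4) by (intro nn_integral_mono) (simp add: ennreal_plus[symmetric] ennreal_mult[symmetric] ennreal_leI del: ennreal_plus)
  also have "\<dots> = ennreal (2 powr (2 + s)) * ((\<integral>\<^sup>+v. ennreal (f v) \<partial>lborel) + (\<integral>\<^sup>+v. ennreal (norm v powr (2 + s) * f v) \<partial>lborel))"
    using fp(3) by (simp add: nn_integral_cmult nn_integral_add)
  finally show ?thesis using f by (simp add: prob_density_def)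
qed

text \<open>The right-hand side of \<open>clamp_gradient_bound\<close> at the four densities of a
  collision. In each mixed term the exponents are placed so that one velocity carries a full density
  and can be frozen.\<close>

definition collision_envelope :: "('a::euclidean_space \<Rightarrow> real) \<Rightarrow> 'a \<times> 'a \<times> 'a \<Rightarrow> real" where
  "collision_envelope f = (\<lambda>(v, vs, \<omega>). let l = averaging_exponent TYPE('a) in
     (f v * f vs) powr (1 - l) + f v * f vs powr (1 - l) * f (post v vs \<omega>) powr l
       + f vs * f v powr (1 - l) * f (post_star v vs \<omega>) powr l)"

text \<open>Peetre's inequality in the form that bounds the weight of v - vs by twice the product of
  the weights. For \<gamma> < 0 the kernel is bounded, hence the exponent max 0 \<gamma>. Positivity
  comes from the lower bound on the kernel.\<close>

lemma kernel_upper_bound: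
  assumes "collision_kernel \<gamma> (B :: 'a::euclidean_space \<Rightarrow> 'a \<Rightarrow> real)"
  shows "\<exists>c>0. \<forall>v vs \<omega>. \<omega> \<in> sphere 0 1 \<longrightarrow>
    0 < B (v - vs) \<omega> \<and> B (v - vs) \<omega> \<le> c * (japanese v powr max 0 \<gamma> * japanese vs powr max 0 \<gamma>)"
proof -
  obtain c where c: "c > 0" "\<And>k \<omega>. \<omega> \<in> sphere 0 1 \<Longrightarrow> inverse c * japanese k powr \<gamma> \<le> B k \<omega> \<and> B k \<omega> \<le> c * japanese k powr \<gamma>"
    using assms unfolding collision_kernel_def by blast
  let ?s = "max 0 \<gamma>"
  have "0 < B (v - vs) \<omega> \<and> B (v - vs) \<omega> \<le> (c * 2 powr ?s) * (japanese v powr ?s * japanese vs powr ?s)"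
    if "\<omega> \<in> sphere 0 1" for v vs \<omega>
  proof
    have "0 < inverse c * japanese (v - vs) powr \<gamma>" using c(1) japanese_pos[of "v - vs"] by simp
    then show "0 < B (v - vs) \<omega>" using c(2)[OF that, of "v - vs"] by linarith
    have "japanese (v - vs) \<le> 2 * (japanese v * japanese vs)"
    proof -
      have "(norm (v - vs))\<^sup>2 \<le> (norm v + norm vs)\<^sup>2"
        by (intro power_mono norm_triangle_ineq4) simp
      also have "\<dots> \<le> 2 * (norm v)\<^sup>2 + 2 * (norm vs)\<^sup>2"
        using sum_squares_bound[of "norm v" "norm vs"] by (simp add: power2_sum)
      finally have "1 + (norm (v - vs))\<^sup>2 \<le> 4 * ((1 + (norm v)\<^sup>2) * (1 + (norm vs)\<^sup>2))"
        by (simp add: algebra_simps) (smt (verit) mult_nonneg_nonneg zero_le_power2)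
      then have "japanese (v - vs) \<le> sqrt (4 * ((1 + (norm v)\<^sup>2) * (1 + (norm vs)\<^sup>2)))"
        unfolding japanese_def by (rule real_sqrt_le_mono)
      also have "\<dots> = 2 * (japanese v * japanese vs)"
        unfolding japanese_def by (simp add: real_sqrt_mult)
      finally show ?thesis .
    qed
    then have "japanese (v - vs) powr ?s \<le> (2 * (japanese v * japanese vs)) powr ?s"
      using japanese_pos[of "v - vs"] by (intro powr_mono2) auto
    also have "\<dots> = 2 powr ?s * (japanese v powr ?s * japanese vs powr ?s)"
      using japanese_pos[of v] japanese_pos[of vs] by (simp add: powr_mult)
    finally have 1: "japanese (v - vs) powr ?s \<le> 2 powr ?s * (japanese v powr ?s * japanese vs powr ?s)" .
    have "B (v - vs) \<omega> \<le> c * japanese (v - vs) powr \<gamma>" using c(2)[OF that] by simp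
    also have "\<dots> \<le> c * japanese (v - vs) powr ?s"
      using c(1) japanese_ge_1[of "v - vs"] by (intro mult_left_mono powr_mono) auto
    also have "\<dots> \<le> c * (2 powr ?s * (japanese v powr ?s * japanese vs powr ?s))"
      using 1 c(1) by (intro mult_left_mono) auto
    finally show "B (v - vs) \<omega> \<le> (c * 2 powr ?s) * (japanese v powr ?s * japanese vs powr ?s)"
      by (simp add: mult.assoc)
  qed
  then show ?thesis using c(1) by (intro exI[of _ "c * 2 powr ?s"]) auto
qed

text \<open>By 2 d l = 1 - l, the exponent (1 + s)(1 - l) equals (2 + s)(1 - l) - 2 d l, so Young's
  inequality with exponents 1 - l and l applies to the moment density and the integrable weight.
  That s does not exceed (1 + s)(1 - l) follows from l \<le> 1/3 and s \<le> 1.\<close>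

lemma powr_le_moment_plus_weight:
  fixes v :: "'a::euclidean_space"
  defines "l \<equiv> averaging_exponent TYPE('a)"
  assumes s: "0 \<le> s" "s \<le> 1" and r: "0 \<le> (r::real)"
  shows "r powr (1 - l) * japanese v powr s \<le> japanese v powr (2 + s) * r + japanese v powr (- 2 * real DIM('a))"
    and "r powr (1 - l) * japanese v powr s \<le> (japanese v powr (2 + s) * r) powr (1 - l)"
    and "r * japanese v powr s \<le> japanese v powr (2 + s) * r"
proof -
  have l: "0 < l" "l \<le> 1/3" using averaging_exponent_bounds[where 'a='a] by (auto simp: l_def)
  note j = japanese_ge_1[of v] japanese_pos[of v]
  have dl: "2 * real DIM('a) * l = 1 - l"
    by (simp add: l_def averaging_exponent_def field_simps)
  have s1: "s \<le> (1 + s) * (1 - l)"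
  proof -
    have "(1 + s) * (1 - l) \<ge> (1 + s) * (2/3)" using l s by (intro mult_left_mono) auto
    then show ?thesis using s by simp
  qed
  have "r powr (1 - l) * japanese v powr s \<le> r powr (1 - l) * japanese v powr ((1 + s) * (1 - l))"
    using j s1 by (intro mult_left_mono powr_mono) auto
  also have "\<dots> = (japanese v powr (2 + s) * r) powr (1 - l) * (japanese v powr (- 2 * real DIM('a))) powr l"
  proof -
    have "(1 + s) * (1 - l) = (2 + s) * (1 - l) + (- 2 * real DIM('a)) * l"
      using dl by (simp add: algebra_simps)
    then have C: "japanese v powr ((1 + s) * (1 - l)) = japanese v powr ((2 + s) * (1 - l)) * japanese v powr ((- 2 * real DIM('a)) * l)"
      by (simp only: powr_add)
    have A: "(japanese v powr (2 + s) * r) powr (1 - l) = japanese v powr ((2 + s) * (1 - l)) * r powr (1 - l)"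
      using r by (simp only: powr_mult powr_powr)
    show ?thesis unfolding A C powr_powr by (simp only: ac_simps)
  qed
  also have "\<dots> \<le> japanese v powr (2 + s) * r + japanese v powr (- 2 * real DIM('a))"
    using l r by (intro weighted_Young_powr) auto
  finally show "r powr (1 - l) * japanese v powr s \<le> japanese v powr (2 + s) * r + japanese v powr (- 2 * real DIM('a))" .
  have "s \<le> (2 + s) * (1 - l)" using s1 l by (simp add: algebra_simps)
  then have "r powr (1 - l) * japanese v powr s \<le> r powr (1 - l) * japanese v powr ((2 + s) * (1 - l))"
    using j by (intro mult_left_mono powr_mono) auto
  also have "\<dots> = (japanese v powr (2 + s) * r) powr (1 - l)" using j r by (simp add: powr_mult powr_powr)
  finally show "r powr (1 - l) * japanese v powr s \<le> (japanese v powr (2 + s) * r) powr (1 - l)" .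
  have "japanese v powr s \<le> japanese v powr (2 + s)" using j by (intro powr_mono) auto
  from mult_right_mono[OF this r] show "r * japanese v powr s \<le> japanese v powr (2 + s) * r" by (simp add: mult.commute)
qed

text \<open>The kernel is absorbed into weights of v and vs. The term without post-collisional
  velocities then factorizes; in the first mixed term v is frozen and
  \<open>collision_averaging\<close> is applied to the moment density at vs and to f at v'; the
  second mixed term is its mirror image under \<open>exchange\<close>. The bound depends on f only
  through the moment bound \<open>C\<close>, so it will be uniform in time.\<close>

lemma collision_envelope_bound:
  fixes B :: "'a::euclidean_space \<Rightarrow> 'a \<Rightarrow> real"
  assumes B: "collision_kernel \<gamma> B" and C: "C < \<infinity>"
  shows "\<exists>K<\<infinity>. \<forall>f. prob_density f \<longrightarrow>
    (\<integral>\<^sup>+v. ennreal (norm v powr (2 + max 0 \<gamma>) * f v) \<partial>lborel) \<le> C \<longrightarrow>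
    (\<integral>\<^sup>+x. ennreal (collision_envelope f x * kern B x) \<partial>Omega) \<le> K"
proof -
  define s where "s = max 0 \<gamma>"
  define l where "l = averaging_exponent TYPE('a)"
  have \<gamma>1: "\<gamma> \<le> 1" using B unfolding collision_kernel_def by blast
  have s: "0 \<le> s" "s \<le> 1" using \<gamma>1 by (auto simp: s_def)
  have l: "0 < l" "l < 1" using averaging_exponent_bounds[where 'a='a] by (auto simp: l_def)
  obtain c where c: "c > 0" "\<And>v vs \<omega>. \<omega> \<in> sphere 0 1 \<Longrightarrow> 0 < B (v - vs) \<omega>"
    "\<And>v vs \<omega>. \<omega> \<in> sphere 0 1 \<Longrightarrow> B (v - vs) \<omega> \<le> c * (japanese v powr s * japanese vs powr s)"
    using kernel_upper_bound[OF B] unfolding s_def by blast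
  obtain KJ where KJ: "KJ < \<infinity>" "\<And>v::'a. \<And>g h. g \<in> borel_measurable borel \<Longrightarrow> h \<in> borel_measurable borel \<Longrightarrow>
    (\<forall>x. 0 \<le> g x) \<Longrightarrow> (\<forall>x. 0 \<le> h x) \<Longrightarrow>
    (\<integral>\<^sup>+vs. (\<integral>\<^sup>+\<omega>. ennreal (g vs powr (1 - l) * h (post v vs \<omega>) powr l) \<partial>sphere_measure) \<partial>lborel)
     \<le> KJ * ((\<integral>\<^sup>+x. ennreal (g x) \<partial>lborel) + (\<integral>\<^sup>+x. ennreal (h x) \<partial>lborel))"
    using collision_averaging[where 'a='a] unfolding l_def by blast
  define m0 where "m0 = ennreal (2 powr (2 + s)) * (1 + C)"
  define m1 where "m1 = m0 + (\<integral>\<^sup>+v. ennreal (japanese (v :: 'a) powr (- 2 * real DIM('a))) \<partial>lborel)"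
  define \<sigma> where "\<sigma> = emeasure sphere_measure (sphere (0::'a) 1)"
  define K where "K = ennreal c * (m1 * m1 * \<sigma> + 2 * (m0 * (KJ * (m0 + 1))))"
  have \<sigma>: "\<sigma> < \<infinity>"
    using finite_measure.finite_emeasure_space[OF finite_sphere_measure[where 'a='a]]
    unfolding \<sigma>_def infinity_ennreal_def less_top[symmetric] by (simp add: space_sphere_measure)
  have m0: "m0 < \<infinity>" using C by (simp add: m0_def ennreal_mult_less_top)
  then have m1: "m1 < \<infinity>" using nn_integral_japanese_finite[where 'a='a] by (simp add: m1_def)
  have "K < \<infinity>" unfolding K_def using m0 m1 \<sigma> KJ(1) by (simp add: ennreal_mult_less_top)
  moreover have "(\<integral>\<^sup>+x. ennreal (collision_envelope f x * kern B x) \<partial>Omega) \<le> K"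
    if f: "prob_density f" and mom: "(\<integral>\<^sup>+v. ennreal (norm v powr (2 + max 0 \<gamma>) * f v) \<partial>lborel) \<le> C" for f
  proof -
    note fm[measurable] = prob_density_integrable(3)[OF f] and fn = prob_density_integrable(4)[OF f]
    have f1: "(\<integral>\<^sup>+v. ennreal (f v) \<partial>lborel) = 1" using f by (simp add: prob_density_def)
    define m where "m v = japanese v powr (2 + s) * f v" for v
    have mm[measurable]: "m \<in> borel_measurable borel" unfolding m_def by measurable
    have mI: "(\<integral>\<^sup>+v. ennreal (m v) \<partial>lborel) \<le> m0"
    proof -
      have "(\<integral>\<^sup>+v. ennreal (m v) \<partial>lborel) \<le> ennreal (2 powr (2 + s)) * (1 + (\<integral>\<^sup>+v. ennreal (norm v powr (2 + s) * f v) \<partial>lborel))"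
        unfolding m_def by (rule moment_japanese[OF s(1) f])
      also have "\<dots> \<le> m0" unfolding m0_def using mom by (intro mult_left_mono add_left_mono) (auto simp: s_def)
      finally show ?thesis .
    qed
    define a where "a v = f v powr (1 - l) * japanese v powr s" for v
    define b where "b v = f v * japanese v powr s" for v
    have am[measurable]: "a \<in> borel_measurable borel" and bm[measurable]: "b \<in> borel_measurable borel"
      unfolding a_def b_def by measurable
    have ab0: "0 \<le> a v" "0 \<le> b v" for v using fn by (auto simp: a_def b_def)
    have aI: "(\<integral>\<^sup>+v. ennreal (a v) \<partial>lborel) \<le> m1"
    proof -
      have "(\<integral>\<^sup>+v. ennreal (a v) \<partial>lborel) \<le> (\<integral>\<^sup>+v. ennreal (m v) + ennreal (japanese v powr (- 2 * real DIM('a))) \<partial>lborel)"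
        unfolding a_def m_def l_def using powr_le_moment_plus_weight(1)[OF s fn] fn
        by (intro nn_integral_mono) (simp add: ennreal_plus[symmetric] ennreal_leI del: ennreal_plus)
      also have "\<dots> \<le> m1" unfolding m1_def using mI by (simp add: nn_integral_add add_right_mono)
      finally show ?thesis .
    qed
    have bI: "(\<integral>\<^sup>+v. ennreal (b v) \<partial>lborel) \<le> m0"
      using powr_le_moment_plus_weight(3)[OF s fn]
      by (intro order_trans[OF nn_integral_mono mI]) (auto simp: b_def m_def intro!: ennreal_leI)
    note comp = Omega_components_measurable[where 'a='a] and pm = post_measurable[where 'a='a]
    define A1 where "A1 x = ennreal (a (fst x)) * ennreal (a (fst (snd x)))" for x :: "'a \<times> 'a \<times> 'a"
    define A2 where "A2 x = ennreal (b (fst x)) * ennreal (a (fst (snd x)) * f (post (fst x) (fst (snd x)) (snd (snd x))) powr l)" for x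
    have A1m[measurable]: "A1 \<in> borel_measurable Omega"
      unfolding A1_def by (intro borel_measurable_times_ennreal measurable_compose[OF comp(1)] measurable_compose[OF comp(2)]) measurable
    have A2m[measurable]: "A2 \<in> borel_measurable Omega"
    proof -
      note [measurable] = measurable_compose[OF comp(1) bm] measurable_compose[OF comp(2) am] measurable_compose[OF pm(1) fm]
      show ?thesis unfolding A2_def by measurable
    qed
    have I1: "(\<integral>\<^sup>+x. A1 x \<partial>Omega) \<le> m1 * m1 * \<sigma>"
    proof -
      have "(\<integral>\<^sup>+x. A1 x \<partial>Omega) = (\<integral>\<^sup>+v. (\<integral>\<^sup>+vs. ennreal (a v) * (ennreal (a vs) * \<sigma>) \<partial>lborel) \<partial>lborel)"
        unfolding nn_integral_Omega(2)[OF A1m] by (simp add: A1_def \<sigma>_def space_sphere_measure mult.assoc)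
      also have "\<dots> = (\<integral>\<^sup>+v. ennreal (a v) \<partial>lborel) * ((\<integral>\<^sup>+v. ennreal (a v) \<partial>lborel) * \<sigma>)"
        by (simp add: nn_integral_cmult nn_integral_multc)
      also have "\<dots> \<le> m1 * (m1 * \<sigma>)" using aI by (intro mult_mono) auto
      finally show ?thesis by (simp add: mult.assoc)
    qed
    have I2: "(\<integral>\<^sup>+x. A2 x \<partial>Omega) \<le> m0 * (KJ * (m0 + 1))"
    proof -
      have "(\<integral>\<^sup>+x. A2 x \<partial>Omega) = (\<integral>\<^sup>+v. (\<integral>\<^sup>+vs. (\<integral>\<^sup>+\<omega>. A2 (v, vs, \<omega>) \<partial>sphere_measure) \<partial>lborel) \<partial>lborel)"
        by (rule nn_integral_Omega(2)[OF A2m])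
      also have "\<dots> \<le> (\<integral>\<^sup>+v. ennreal (b v) * (KJ * (m0 + 1)) \<partial>lborel)"
      proof (rule nn_integral_mono)
        fix v :: 'a
        have sph: "(\<lambda>\<omega>. ennreal (m vs powr (1 - l) * f (post v vs \<omega>) powr l)) \<in> borel_measurable sphere_measure" for vs
          unfolding post_def by (rule measurable_compose[OF measurable_ident_sphere_borel]) measurable
        have prodm: "(\<lambda>vs. \<integral>\<^sup>+\<omega>. ennreal (m vs powr (1 - l) * f (post v vs \<omega>) powr l) \<partial>sphere_measure) \<in> borel_measurable borel"
        proof -
          have "(\<lambda>p. ennreal (m (fst p) powr (1 - l) * f (post v (fst p) (snd p)) powr l)) \<in> borel_measurable (borel \<Otimes>\<^sub>M borel)"
            unfolding post_def by measurable
          from measurable_compose[OF measurable_Pair[OF measurable_fst measurable_compose[OF measurable_snd measurable_ident_sphere_borel]] this]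
          show ?thesis by (intro sphere.borel_measurable_nn_integral) (simp add: split_beta')
        qed
        have "(\<integral>\<^sup>+vs. (\<integral>\<^sup>+\<omega>. A2 (v, vs, \<omega>) \<partial>sphere_measure) \<partial>lborel) \<le>
            (\<integral>\<^sup>+vs. (\<integral>\<^sup>+\<omega>. ennreal (b v) * ennreal (m vs powr (1 - l) * f (post v vs \<omega>) powr l) \<partial>sphere_measure) \<partial>lborel)"
          unfolding A2_def fst_conv snd_conv a_def m_def
          using powr_le_moment_plus_weight(2)[where 'a='a, OF s fn, folded l_def]
          by (intro nn_integral_mono mult_left_mono ennreal_leI mult_right_mono) auto
        also have "\<dots> = (\<integral>\<^sup>+vs. ennreal (b v) * (\<integral>\<^sup>+\<omega>. ennreal (m vs powr (1 - l) * f (post v vs \<omega>) powr l) \<partial>sphere_measure) \<partial>lborel)"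
          by (intro nn_integral_cong nn_integral_cmult sph)
        also have "\<dots> = ennreal (b v) * (\<integral>\<^sup>+vs. (\<integral>\<^sup>+\<omega>. ennreal (m vs powr (1 - l) * f (post v vs \<omega>) powr l) \<partial>sphere_measure) \<partial>lborel)"
          using prodm by (intro nn_integral_cmult) simp
        also have "\<dots> \<le> ennreal (b v) * (KJ * ((\<integral>\<^sup>+x. ennreal (m x) \<partial>lborel) + (\<integral>\<^sup>+x. ennreal (f x) \<partial>lborel)))"
          using fn by (intro mult_left_mono KJ(2)) (auto simp: m_def)
        also have "\<dots> \<le> ennreal (b v) * (KJ * (m0 + 1))"
          using mI f1 by (intro mult_left_mono add_mono) auto
        finally show "(\<integral>\<^sup>+vs. (\<integral>\<^sup>+\<omega>. A2 (v, vs, \<omega>) \<partial>sphere_measure) \<partial>lborel) \<le> ennreal (b v) * (KJ * (m0 + 1))" .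
      qed
      also have "\<dots> = (\<integral>\<^sup>+v. ennreal (b v) \<partial>lborel) * (KJ * (m0 + 1))" by (simp add: nn_integral_multc)
      also have "\<dots> \<le> m0 * (KJ * (m0 + 1))" using bI by (rule mult_right_mono) simp
      finally show ?thesis .
    qed
    have "(\<integral>\<^sup>+x. ennreal (collision_envelope f x * kern B x) \<partial>Omega) \<le> (\<integral>\<^sup>+x. ennreal c * (A1 x + (A2 x + A2 (exchange x))) \<partial>Omega)"
    proof (rule nn_integral_mono)
      fix x :: "'a \<times> 'a \<times> 'a" assume x: "x \<in> space Omega"
      obtain v vs \<omega> where xe: "x = (v, vs, \<omega>)" by (metis prod_cases3)
      have \<omega>: "\<omega> \<in> sphere 0 1" using x by (simp add: xe space_Omega)
      define E where "E = collision_envelope f x"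
      have E0: "0 \<le> E" using fn by (simp add: E_def collision_envelope_def xe Let_def)
      let ?w = "japanese v powr s * japanese vs powr s"
      have "E * kern B x \<le> E * (c * ?w)"
        using c(3)[OF \<omega>, of v vs] E0 by (intro mult_left_mono) (auto simp: kern_def xe)
      also have "\<dots> = c * (E * ?w)" by (simp add: ac_simps)
      also have "E * ?w = a v * a vs + (b v * (a vs * f (post v vs \<omega>) powr l) + b vs * (a v * f (post_star v vs \<omega>) powr l))"
        using fn by (simp add: E_def collision_envelope_def xe Let_def a_def b_def l_def[symmetric] powr_mult algebra_simps)
      finally have "ennreal (E * kern B x) \<le> ennreal (c * (a v * a vs + (b v * (a vs * f (post v vs \<omega>) powr l) + b vs * (a v * f (post_star v vs \<omega>) powr l))))"
        by (rule ennreal_leI)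
      also have "\<dots> = ennreal c * (A1 x + (A2 x + A2 (exchange x)))"
        using ab0 c(1) by (simp add: A1_def A2_def xe exchange_def post_swap(1)[of vs v \<omega>] ennreal_mult)
      finally show "ennreal (collision_envelope f x * kern B x) \<le> ennreal c * (A1 x + (A2 x + A2 (exchange x)))"
        unfolding E_def .
    qed
    also have "\<dots> = ennreal c * ((\<integral>\<^sup>+x. A1 x \<partial>Omega) + ((\<integral>\<^sup>+x. A2 x \<partial>Omega) + (\<integral>\<^sup>+x. A2 (exchange x) \<partial>Omega)))"
      using measurable_compose[OF exchange_measurable A2m] by (simp add: nn_integral_cmult nn_integral_add)
    also have "(\<integral>\<^sup>+x. A2 (exchange x) \<partial>Omega) = (\<integral>\<^sup>+x. A2 x \<partial>Omega)"
      by (rule nn_integral_exchange[OF A2m])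
    also have "ennreal c * ((\<integral>\<^sup>+x. A1 x \<partial>Omega) + ((\<integral>\<^sup>+x. A2 x \<partial>Omega) + (\<integral>\<^sup>+x. A2 x \<partial>Omega))) \<le> K"
      unfolding K_def mult_2 by (intro mult_left_mono add_mono I1 I2) auto
    finally show ?thesis .
  qed
  ultimately show ?thesis by blast
qed

section \<open>Convergence of the clamped entropy\<close>

text \<open>Once the constant 1/N is removed, the truncations increase with N on s > 1; this yields
  monotone convergence there, where no integrable majorant is at hand. The inequality needed is b -
  a \<le> b ln (b / a) \<le> s ln (b / a) for clamped values a \<le> b \<le> s.\<close>

lemma trunc_entropy_mono:
  assumes "1 \<le> N" "N \<le> M" "1 < s"
  shows "trunc_entropy N s - 1 / N \<le> trunc_entropy M s - 1 / M"
proof -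
  have c: "clamp_pos N s = min N s" "clamp_pos M s = min M s"
    using assms by (auto simp: clamp_pos_def max_def min_def) (smt (verit) divide_le_eq_1)+
  define a b where "a = min N s" and "b = min M s"
  have ab: "1 \<le> a" "a \<le> b" "b \<le> s" using assms by (auto simp: a_def b_def)
  have "1 - a / b \<le> ln (b / a)"
    using ln_le_minus_one[of "a / b"] ab by (simp add: ln_div)
  then have "b * (1 - a / b) \<le> b * ln (b / a)" using ab by (intro mult_left_mono) auto
  also have "\<dots> \<le> s * ln (b / a)" using ab by (intro mult_right_mono ln_ge_zero) auto
  finally have "b * (1 - a / b) \<le> s * ln (b / a)" .
  moreover have "b * (1 - a / b) = b - a" "ln (b / a) = ln b - ln a"
    using ab by (auto simp: right_diff_distrib ln_div)
  ultimately have "b - a \<le> s * (ln b - ln a)" by (simp only:)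
  then show ?thesis by (simp add: trunc_entropy_def ln_clamp_def c a_def[symmetric] b_def[symmetric] algebra_simps)
qed

lemma trunc_entropy_eq: "1 \<le> N \<Longrightarrow> 1 / N \<le> s \<Longrightarrow> s \<le> N \<Longrightarrow> trunc_entropy N s = s * ln s - s + 1 / N"
  by (simp add: trunc_entropy_def ln_clamp_def clamp_pos_def)

text \<open>A majorant independent of N, for dominated convergence on the region where the density
  is at most 1.\<close>

lemma trunc_entropy_small:
  assumes "1 \<le> N" "0 \<le> s" "s \<le> 1"
  shows "\<bar>trunc_entropy N s + s\<bar> \<le> - (s * ln s) + s"
proof -
  have sl: "s * ln s \<le> 0" using assms by (cases "s = 0") (auto simp: mult_nonneg_nonpos)
  show ?thesis
  proof (cases "1 / N \<le> s")
    case True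
    then have "trunc_entropy N s = s * ln s - s + 1 / N" using assms by (intro trunc_entropy_eq) auto
    moreover have "0 \<le> 1 / N" using assms by simp
    ultimately show ?thesis using True sl by (intro abs_leI) linarith+
  next
    case False
    then have c: "clamp_pos N s = 1 / N" using assms by (auto simp: clamp_pos_def)
    then have e: "trunc_entropy N s = s * ln (1 / N)" by (simp add: trunc_entropy_def ln_clamp_def)
    have "s * ln (1 / N) \<le> 0" using assms by (intro mult_nonneg_nonpos) (auto simp: ln_div)
    moreover have "s * ln s \<le> s * ln (1 / N)"
      using False assms by (cases "s = 0") (auto intro!: mult_left_mono simp: ln_le_cancel_iff simp del: ln_div)
    ultimately show ?thesis using e assms by simp
  qed
qed

text \<open>The space is split at f = 1. Where f \<le> 1, - s ln s \<le> s^(1-l) / l makes the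
  negative part integrable and dominated convergence applies; where f > 1, convergence is monotone
  and the limit may be infinite. The summand 1 is the integral of f and compensates the term -s in
  \<open>trunc_entropy\<close>.\<close>

lemma entropy_limit:
  fixes f :: "'a::euclidean_space \<Rightarrow> real"
  assumes f: "prob_density f"
    and neg: "(\<integral>\<^sup>+v. ennreal (f v powr (1 - l)) \<partial>lborel) < \<infinity>" and l: "0 < l" "l < 1"
  shows "(\<lambda>n. ereal ((\<integral>v. trunc_entropy (real (Suc n)) (f v) \<partial>lborel) + 1)) \<longlonglongrightarrow> entropy f"
    and "entropy f \<noteq> - \<infinity>"
proof -
  note fi = prob_density_integrable(1)[OF f] and f1 = prob_density_integrable(2)[OF f]
    and fm[measurable] = prob_density_integrable(3)[OF f] and fn = prob_density_integrable(4)[OF f]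
  define N where "N n = real (Suc n)" for n
  have N1: "N n \<ge> 1" for n by (simp add: N_def)
  let ?L = "indicator {v. f v \<le> 1} :: 'a \<Rightarrow> real"
  let ?U = "indicator {v. 1 < f v} :: 'a \<Rightarrow> real"
  have Nlim: "(\<lambda>n. 1 / N n) \<longlonglongrightarrow> 0" unfolding N_def using LIMSEQ_inverse_real_of_nat by (simp add: inverse_eq_divide)
  have neg_le: "- (s * ln s) \<le> s powr (1 - l) / l" if "0 \<le> s" "s \<le> 1" for s :: real
  proof (cases "s = 0")
    case False
    then have s: "s > 0" using that by simp
    have "l * - ln s = ln (s powr - l)" using s by (simp add: ln_powr)
    also have "\<dots> \<le> s powr - l" using s ln_le_minus_one[of "s powr - l"] by simp
    finally have "- ln s \<le> s powr - l / l" using l by (simp add: field_simps)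
    then have "s * - ln s \<le> s * (s powr - l / l)" using s by (intro mult_left_mono) auto
    also have "s * (s powr - l / l) = s powr (1 - l) / l" using s by (simp add: powr_diff powr_minus field_simps)
    finally show ?thesis by simp
  qed simp
  have Lint: "integrable lborel (\<lambda>v. ?L v * - (f v * ln (f v)))"
  proof (rule integrableI_bounded)
    have "(\<integral>\<^sup>+v. ennreal (norm (?L v * - (f v * ln (f v)))) \<partial>lborel) \<le> (\<integral>\<^sup>+v. ennreal (1 / l) * ennreal (f v powr (1 - l)) \<partial>lborel)"
    proof (rule nn_integral_mono)
      fix v
      have "0 \<le> - (f v * ln (f v))" if "f v \<le> 1"
        using fn[of v] that by (cases "f v = 0") (auto simp: mult_nonneg_nonpos)
      then show "ennreal (norm (?L v * - (f v * ln (f v)))) \<le> ennreal (1 / l) * ennreal (f v powr (1 - l))"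
        using neg_le[OF fn[of v]] l by (cases "f v \<le> 1") (auto simp: ennreal_mult[symmetric] intro!: ennreal_leI)
    qed
    also have "\<dots> = ennreal (1 / l) * (\<integral>\<^sup>+v. ennreal (f v powr (1 - l)) \<partial>lborel)" by (rule nn_integral_cmult) measurable
    also have "\<dots> < \<infinity>" using neg by (simp add: ennreal_mult_less_top)
    finally show "(\<integral>\<^sup>+v. ennreal (norm (?L v * - (f v * ln (f v)))) \<partial>lborel) < \<infinity>" .
  qed measurable
  define b where "b = (\<integral>v. ?L v * - (f v * ln (f v)) \<partial>lborel)"
  have nb: "(\<integral>\<^sup>+v. ennreal (- (f v * ln (f v))) \<partial>lborel) = ennreal b"
  proof -
    have "(\<integral>\<^sup>+v. ennreal (- (f v * ln (f v))) \<partial>lborel) = (\<integral>\<^sup>+v. ennreal (?L v * - (f v * ln (f v))) \<partial>lborel)"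
    proof (rule nn_integral_cong)
      fix v
      have "0 \<le> f v * ln (f v)" if "f v > 1" using that by (intro mult_nonneg_nonneg) auto
      then show "ennreal (- (f v * ln (f v))) = ennreal (?L v * - (f v * ln (f v)))"
        by (cases "f v \<le> 1") (auto simp: ennreal_neg)
    qed
    also have "\<dots> = ennreal b"
      unfolding b_def using Lint
    proof (rule nn_integral_eq_integral)
      show "AE v in lborel. 0 \<le> ?L v * - (f v * ln (f v))"
      proof (rule AE_I2)
        fix v show "0 \<le> ?L v * - (f v * ln (f v))"
          using fn[of v] by (cases "f v = 0"; cases "f v \<le> 1") (auto simp: mult_nonneg_nonpos)
      qed
    qed
    finally show ?thesis .
  qed
  have b0: "0 \<le> b" unfolding b_def
  proof (rule Bochner_Integration.integral_nonneg)
    fix v show "0 \<le> ?L v * - (f v * ln (f v))"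
      using fn[of v] by (cases "f v = 0"; cases "f v \<le> 1") (auto simp: mult_nonneg_nonpos)
  qed
  define A where "A = (\<integral>\<^sup>+v. ennreal (f v * ln (f v)) \<partial>lborel)"
  \<comment> \<open>If the positive part is not integrable, \<open>A\<close> is infinite, and as
    \<open>b\<close> is finite the formula returns the value infinity that the definition
    prescribes; so both branches agree.\<close>
  have ent: "entropy f = enn2ereal A - ereal b"
  proof (cases "integrable lborel (\<lambda>v. max (f v * ln (f v)) 0)")
    case True
    then show ?thesis unfolding entropy_def nb A_def[symmetric] using b0 by simp
  next
    case False
    have "A = \<infinity>"
    proof (rule ccontr)
      assume "A \<noteq> \<infinity>"
      then have "(\<integral>\<^sup>+v. ennreal (max (f v * ln (f v)) 0) \<partial>lborel) < \<infinity>"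
        unfolding A_def by (simp add: ennreal_max_0 less_top max.commute)
      then have "integrable lborel (\<lambda>v. max (f v * ln (f v)) 0)" by (intro integrableI_nonneg) auto
      with False show False by simp
    qed
    then show ?thesis using False unfolding entropy_def by simp
  qed
  then show "entropy f \<noteq> - \<infinity>" by (cases "enn2ereal A") (use enn2ereal_nonneg[of A] in auto)
  define D where "D n v = trunc_entropy (N n) (f v) + f v" for n v
  have Dm[measurable]: "D n \<in> borel_measurable borel" for n unfolding D_def by measurable
  have ti: "integrable lborel (\<lambda>v. trunc_entropy (N n) (f v))" for n
  proof (rule Bochner_Integration.integrable_bound[OF integrable_mult_right[OF fi, of "ln (N n)"]])
    show "AE v in lborel. norm (trunc_entropy (N n) (f v)) \<le> norm (ln (N n) * f v)"
    proof (rule AE_I2)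
      fix v
      have "\<bar>trunc_entropy (N n) (f v)\<bar> \<le> ln (N n) * \<bar>f v\<bar>" by (rule trunc_entropy_abs_le[OF N1])
      then show "norm (trunc_entropy (N n) (f v)) \<le> norm (ln (N n) * f v)"
        using N1[of n] by (simp add: abs_mult)
    qed
  qed measurable
  have Di: "integrable lborel (D n)" for n unfolding D_def by (intro Bochner_Integration.integrable_add ti fi)
  have lower: "(\<lambda>n. \<integral>v. ?L v * D n v \<partial>lborel) \<longlonglongrightarrow> - b"
  proof -
    have "(\<lambda>n. \<integral>v. ?L v * D n v \<partial>lborel) \<longlonglongrightarrow> (\<integral>v. ?L v * (f v * ln (f v)) \<partial>lborel)"
    proof (rule integral_dominated_convergence[where w="\<lambda>v. ?L v * - (f v * ln (f v)) + f v"])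
      show "integrable lborel (\<lambda>v. ?L v * - (f v * ln (f v)) + f v)"
        by (intro Bochner_Integration.integrable_add Lint fi)
      show "AE v in lborel. norm (?L v * D n v) \<le> ?L v * - (f v * ln (f v)) + f v" for n
      proof (rule AE_I2)
        fix v
        show "norm (?L v * D n v) \<le> ?L v * - (f v * ln (f v)) + f v"
          using trunc_entropy_small[OF N1[of n] fn[of v]] fn[of v] by (cases "f v \<le> 1") (auto simp: D_def)
      qed
      show "AE v in lborel. (\<lambda>n. ?L v * D n v) \<longlonglongrightarrow> ?L v * (f v * ln (f v))"
      proof (rule AE_I2)
        fix v
        consider "f v > 1" | "f v = 0" | "0 < f v" "f v \<le> 1" using fn[of v] by fastforce
        then show "(\<lambda>n. ?L v * D n v) \<longlonglongrightarrow> ?L v * (f v * ln (f v))"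
        proof cases
          case 2
          then show ?thesis using trunc_entropy_zero[OF N1] by (simp add: D_def)
        next
          case 3
          have "eventually (\<lambda>n. 1 / N n < f v) sequentially" using order_tendstoD(2)[OF Nlim] 3 by simp
          then have ev: "eventually (\<lambda>n. f v * ln (f v) + 1 / N n = D n v) sequentially"
          proof eventually_elim
            case (elim n)
            have "trunc_entropy (N n) (f v) = f v * ln (f v) - f v + 1 / N n"
              using elim 3 N1[of n] by (intro trunc_entropy_eq) auto
            then show ?case by (simp add: D_def)
          qed
          have "(\<lambda>n. f v * ln (f v) + 1 / N n) \<longlonglongrightarrow> f v * ln (f v) + 0"
            by (rule tendsto_add[OF tendsto_const Nlim])
          from Lim_transform_eventually[OF this ev] show ?thesis using 3 by simp
        qed simp
      qed
    qed measurable
    moreover have "(\<integral>v. ?L v * (f v * ln (f v)) \<partial>lborel) = - b"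
      unfolding b_def by (subst Bochner_Integration.integral_minus[symmetric]) simp
    ultimately show ?thesis by simp
  qed
  define R where "R n v = ?U v * (D n v - 1 / N n)" for n v
  have R0: "0 \<le> R n v" for n v
  proof (cases "f v > 1")
    case True
    have "trunc_entropy 1 (f v) - 1 / 1 \<le> trunc_entropy (N n) (f v) - 1 / N n"
      using True N1 by (intro trunc_entropy_mono) auto
    moreover have "trunc_entropy 1 (f v) = 0" using True by (simp add: trunc_entropy_def ln_clamp_def clamp_pos_def)
    ultimately show ?thesis using True by (simp add: R_def D_def)
  qed (simp add: R_def)
  have Rm[measurable]: "R n \<in> borel_measurable borel" for n unfolding R_def by measurable
  have Rlim: "(\<lambda>n. \<integral>\<^sup>+v. ennreal (R n v) \<partial>lborel) \<longlonglongrightarrow> A"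
  proof -
    have inc: "incseq (\<lambda>n v. ennreal (R n v))"
    proof (intro incseq_SucI le_funI ennreal_leI)
      fix n v
      show "R n v \<le> R (Suc n) v"
        using trunc_entropy_mono[OF N1[of n], of "N (Suc n)" "f v"] by (cases "f v > 1") (auto simp: R_def D_def N_def)
    qed
    have "(\<lambda>n. \<integral>\<^sup>+v. ennreal (R n v) \<partial>lborel) \<longlonglongrightarrow> (\<integral>\<^sup>+v. ennreal (f v * ln (f v)) \<partial>lborel)"
    proof (rule nn_integral_LIMSEQ[OF inc])
      fix v
      show "(\<lambda>n. ennreal (R n v)) \<longlonglongrightarrow> ennreal (f v * ln (f v))"
      proof (cases "f v > 1")
        case True
        have "eventually (\<lambda>n. f v \<le> N n) sequentially"
        proof -
          obtain m :: nat where "f v \<le> real m" using real_arch_simple by blast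
          then show ?thesis unfolding eventually_sequentially N_def by (intro exI[of _ m]) auto
        qed
        then have "eventually (\<lambda>n. R n v = f v * ln (f v)) sequentially"
        proof eventually_elim
          case (elim n)
          have "1 / N n \<le> 1" using N1[of n] by simp
          then have "trunc_entropy (N n) (f v) = f v * ln (f v) - f v + 1 / N n"
            using elim True N1[of n] by (intro trunc_entropy_eq) linarith+
          then show ?case using True by (simp add: R_def D_def)
        qed
        then show ?thesis by (intro tendsto_ennrealI tendsto_eventually)
      next
        case False
        have "f v * ln (f v) \<le> 0" using False fn[of v] by (cases "f v = 0") (auto simp: mult_nonneg_nonpos)
        then show ?thesis using False by (simp add: R_def ennreal_neg)
      qed
    qed measurable
    then show ?thesis by (simp add: A_def)
  qed
  \<comment> \<open>The set where f > 1 has measure at most 1 by Markov's inequality, so the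
    constants 1/N, which are not integrable over the whole space, are harmless on it.\<close>
  have Ui: "integrable lborel ?U"
  proof (rule Bochner_Integration.integrable_bound[OF fi])
    show "AE v in lborel. norm (?U v) \<le> norm (f v)" using fn by (intro AE_I2) (auto simp: indicator_def)
  qed measurable
  have Ri: "integrable lborel (R n)" for n
  proof -
    have "integrable lborel (\<lambda>v. ?U v * D n v - ?U v * (1 / N n))"
      using integrable_mult_indicator[OF _ Di[of n], of "{v. 1 < f v}"] Ui by (intro Bochner_Integration.integrable_diff integrable_mult_left) auto
    then show ?thesis unfolding R_def by (simp add: right_diff_distrib)
  qed
  have split: "(\<integral>v. trunc_entropy (N n) (f v) \<partial>lborel) + 1 = (\<integral>v. ?L v * D n v \<partial>lborel) + ((\<integral>v. R n v \<partial>lborel) + (\<integral>v. ?U v \<partial>lborel) * (1 / N n))" for n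
  proof -
    have "(\<integral>v. trunc_entropy (N n) (f v) \<partial>lborel) + 1 = (\<integral>v. D n v \<partial>lborel)"
      unfolding D_def using ti[of n] fi f1 by simp
    also have "\<dots> = (\<integral>v. ?L v * D n v + (R n v + ?U v * (1 / N n)) \<partial>lborel)"
      by (intro Bochner_Integration.integral_cong) (auto simp: R_def indicator_def)
    also have "\<dots> = (\<integral>v. ?L v * D n v \<partial>lborel) + ((\<integral>v. R n v \<partial>lborel) + (\<integral>v. ?U v * (1 / N n) \<partial>lborel))"
      using integrable_mult_indicator[OF _ Di[of n], of "{v. f v \<le> 1}"] Ri[of n] Ui
      by (subst Bochner_Integration.integral_add) (auto intro!: Bochner_Integration.integrable_add)
    finally show ?thesis by simp
  qed
  have "(\<lambda>n. ereal (\<integral>v. ?L v * D n v \<partial>lborel) + (enn2ereal (\<integral>\<^sup>+v. ennreal (R n v) \<partial>lborel) + ereal ((\<integral>v. ?U v \<partial>lborel) * (1 / N n))))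
      \<longlonglongrightarrow> ereal (- b) + (enn2ereal A + ereal ((\<integral>v. ?U v \<partial>lborel) * 0))"
  proof (intro tendsto_add_ereal_general)
    show "(\<lambda>n. ereal (\<integral>v. ?L v * D n v \<partial>lborel)) \<longlonglongrightarrow> ereal (- b)" using lower by simp
    show "(\<lambda>n. enn2ereal (\<integral>\<^sup>+v. ennreal (R n v) \<partial>lborel)) \<longlonglongrightarrow> enn2ereal A" using Rlim by (rule tendsto_enn2erealI)
    show "(\<lambda>n. ereal ((\<integral>v. ?U v \<partial>lborel) * (1 / N n))) \<longlonglongrightarrow> ereal ((\<integral>v. ?U v \<partial>lborel) * 0)"
      by (intro tendsto_ereal tendsto_mult_left Nlim)
  qed (use enn2ereal_nonneg[of A] in auto)
  moreover have "ereal (\<integral>v. ?L v * D n v \<partial>lborel) + (enn2ereal (\<integral>\<^sup>+v. ennreal (R n v) \<partial>lborel) + ereal ((\<integral>v. ?U v \<partial>lborel) * (1 / N n)))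
     = ereal ((\<integral>v. trunc_entropy (real (Suc n)) (f v) \<partial>lborel) + 1)" for n
  proof -
    have "(\<integral>\<^sup>+v. ennreal (R n v) \<partial>lborel) = ennreal (\<integral>v. R n v \<partial>lborel)"
      using R0 Ri by (intro nn_integral_eq_integral) auto
    moreover have "0 \<le> (\<integral>v. R n v \<partial>lborel)" using R0 by (rule Bochner_Integration.integral_nonneg)
    ultimately show ?thesis using split[of n] by (simp add: N_def)
  qed
  moreover have "ereal (- b) + (enn2ereal A + ereal ((\<integral>v. ?U v \<partial>lborel) * 0)) = entropy f"
    unfolding ent by (cases "enn2ereal A") auto
  ultimately show "(\<lambda>n. ereal ((\<integral>v. trunc_entropy (real (Suc n)) (f v) \<partial>lborel) + 1)) \<longlonglongrightarrow> entropy f"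
    by (simp only:)
qed

section \<open>Densities of weak collision fluxes\<close>

abbreviation time_measure :: "real \<Rightarrow> real measure" where
  "time_measure T \<equiv> restrict_space lborel {0..T}"

lemma finite_time_measure: "finite_measure (time_measure T)"
proof
  show "emeasure (time_measure T) (space (time_measure T)) \<noteq> \<infinity>"
    by (simp add: space_restrict_space emeasure_restrict_space emeasure_lborel_Icc_eq)
qed

lemma sigma_finite_time_measure: "sigma_finite_measure (time_measure T)"
proof -
  interpret finite_measure "time_measure T" by (rule finite_time_measure)
  show ?thesis by (rule sigma_finite_measure_axioms)
qed

lemma space_time_measure: "space (time_measure T) = {0..T}"
  by (simp add: space_restrict_space)

lemma integral_time_measure:
  fixes h :: "real \<Rightarrow> real"
  shows "(\<integral>r. h r \<partial>time_measure T) = (LBINT r:{0..T}. h r)"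
  by (simp add: integral_restrict_space set_lebesgue_integral_def)

lemma integrable_time_measure:
  fixes h :: "real \<Rightarrow> real"
  shows "integrable (time_measure T) h \<longleftrightarrow> set_integrable lborel {0..T} h"
  by (simp add: integrable_restrict_space set_integrable_def)

lemma AE_time_measure: "(AE t in time_measure T. P t) \<longleftrightarrow> (AE t in lborel. t \<in> {0..T} \<longrightarrow> P t)"
  by (simp add: AE_restrict_space_iff)

text \<open>
  Moving the velocity at which a test function is evaluated to the first slot turns
  \<open>\<integral> coll_grad \<phi> u\<close> into the integral of \<open>\<phi>\<close> against a density.
\<close>

definition transposed_flux :: "('a::euclidean_space \<times> 'a \<times> 'a \<Rightarrow> real) \<Rightarrow> 'a \<times> 'a \<times> 'a \<Rightarrow> real" where
  "transposed_flux u x = u (coll x) + u (exchange (coll x)) - u x - u (exchange x)"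

definition production :: "('a::euclidean_space \<times> 'a \<times> 'a \<Rightarrow> real) \<Rightarrow> 'a \<Rightarrow> real" where
  "production u v = 1/4 * (\<integral>y. transposed_flux u (v, y) \<partial>(lborel \<Otimes>\<^sub>M sphere_measure))"

lemma coll_grad_eq:
  "coll_grad \<phi> x = \<phi> (fst (coll x)) + \<phi> (fst (exchange (coll x))) - \<phi> (fst x) - \<phi> (fst (exchange x))"
  by (simp add: coll_grad_def coll_def exchange_def split_beta')

lemma integrable_coll:
  fixes u :: "'a::euclidean_space \<times> 'a \<times> 'a \<Rightarrow> real"
  assumes "integrable Omega u"
  shows "integrable Omega (\<lambda>x. u (coll x))" "integrable Omega (\<lambda>x. u (exchange x))" "integrable Omega (\<lambda>x. u (exchange (coll x)))"
proof -
  have 1: "integrable Omega (\<lambda>x. u (coll x))" if "integrable Omega u" for u :: "'a \<times> 'a \<times> 'a \<Rightarrow> real"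
    using integrable_distr[OF coll_measurable, of u] that by (simp add: distr_coll)
  show "integrable Omega (\<lambda>x. u (coll x))" by (rule 1[OF assms])
  show 2: "integrable Omega (\<lambda>x. u (exchange x))"
    using integrable_distr[OF exchange_measurable, of u] assms by (simp add: distr_exchange)
  from 1[OF 2] show "integrable Omega (\<lambda>x. u (exchange (coll x)))" .
qed

lemma integrable_transposed_flux:
  "integrable Omega u \<Longrightarrow> integrable Omega (transposed_flux u)"
  unfolding transposed_flux_def
  by (intro Bochner_Integration.integrable_diff Bochner_Integration.integrable_add integrable_coll)

text \<open>Changing variables by \<open>coll\<close> and \<open>exchange\<close> in each of the
  four terms moves the argument of \<open>\<phi>\<close> to the first velocity, and both maps
  preserve the measure. The last bound has constant 1 because four copies of u meet the factor 1/4.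
  A bounded Borel \<open>\<phi>\<close> suffices, which later admits clamped logarithms of the
  density itself.\<close>

lemma integral_coll_grad:
  fixes u :: "'a::euclidean_space \<times> 'a \<times> 'a \<Rightarrow> real"
  assumes u: "integrable Omega u" and \<phi>[measurable]: "\<phi> \<in> borel_measurable borel" and C: "\<And>v. \<bar>\<phi> v\<bar> \<le> C"
  shows "1/4 * (\<integral>x. coll_grad \<phi> x * u x \<partial>Omega) = (\<integral>v. \<phi> v * production u v \<partial>lborel)"
    and "integrable Omega (\<lambda>x. coll_grad \<phi> x * u x)"
    and "integrable lborel (production u)"
    and "(\<integral>\<^sup>+v. ennreal \<bar>production u v\<bar> \<partial>lborel) \<le> (\<integral>\<^sup>+x. ennreal \<bar>u x\<bar> \<partial>Omega)"
proof -
  interpret S: sigma_finite_measure "lborel \<Otimes>\<^sub>M sphere_measure :: ('a \<times> 'a) measure"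
    by (rule sigma_finite_lborel_sphere)
  interpret P: pair_sigma_finite "lborel :: 'a measure" "lborel \<Otimes>\<^sub>M sphere_measure :: ('a \<times> 'a) measure" ..
  have um: "u \<in> borel_measurable Omega" using u by auto
  have fm: "(\<lambda>x. \<phi> (fst x)) \<in> borel_measurable Omega" by (rule measurable_compose[OF Omega_components_measurable(1) \<phi>])
  have C0: "0 \<le> C" using C[of 0] by linarith
  have i: "integrable Omega (\<lambda>x. \<phi> (fst (k x)) * w x)" if "integrable Omega w" "k \<in> Omega \<rightarrow>\<^sub>M Omega" for k w
  proof (rule Bochner_Integration.integrable_bound[OF integrable_mult_right[OF that(1), of C]])
    show "(\<lambda>x. \<phi> (fst (k x)) * w x) \<in> borel_measurable Omega"
      using measurable_compose[OF that(2) fm] that(1) by auto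
    show "AE x in Omega. norm (\<phi> (fst (k x)) * w x) \<le> norm (C * w x)"
      using C C0 by (intro AE_I2) (auto simp: abs_mult intro!: mult_right_mono)
  qed
  note cu = integrable_coll[OF u]
  note m1 = coll_measurable[where 'a='a] and m2 = exchange_measurable[where 'a='a]
  note m3 = measurable_compose[OF m1 m2] and m0 = measurable_ident_sets[OF refl, of "Omega :: ('a \<times> 'a \<times> 'a) measure"]
  have expand: "coll_grad \<phi> x * u x = \<phi> (fst (coll x)) * u x + \<phi> (fst (exchange (coll x))) * u x - \<phi> (fst x) * u x - \<phi> (fst (exchange x)) * u x" for x
    by (simp add: coll_grad_eq algebra_simps)
  note ints = i[OF u m1] i[OF u m3] i[OF u m0] i[OF u m2]
  show cgi: "integrable Omega (\<lambda>x. coll_grad \<phi> x * u x)"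
    unfolding expand by (intro Bochner_Integration.integrable_diff Bochner_Integration.integrable_add ints)
  have e1: "(\<integral>x. \<phi> (fst (coll x)) * u x \<partial>Omega) = (\<integral>x. \<phi> (fst x) * u (coll x) \<partial>Omega)"
  proof -
    have "(\<integral>x. \<phi> (fst (coll x)) * u x \<partial>Omega) = (\<integral>x. \<phi> (fst (coll (coll x))) * u (coll x) \<partial>Omega)"
      by (rule integral_coll[symmetric]) (use ints(1) in auto)
    also have "\<dots> = (\<integral>x. \<phi> (fst x) * u (coll x) \<partial>Omega)"
      by (intro Bochner_Integration.integral_cong) (auto simp: coll_coll)
    finally show ?thesis .
  qed
  have e4: "(\<integral>x. \<phi> (fst (exchange x)) * w x \<partial>Omega) = (\<integral>x. \<phi> (fst x) * w (exchange x) \<partial>Omega)"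
    if w: "integrable Omega w" for w
  proof -
    have "(\<integral>x. \<phi> (fst (exchange x)) * w x \<partial>Omega) = (\<integral>x. \<phi> (fst (exchange (exchange x))) * w (exchange x) \<partial>Omega)"
      by (rule integral_exchange[symmetric]) (use i[OF w m2] in auto)
    then show ?thesis by (simp add: exchange_exchange)
  qed
  have e2: "(\<integral>x. \<phi> (fst (exchange (coll x))) * u x \<partial>Omega) = (\<integral>x. \<phi> (fst x) * u (exchange (coll x)) \<partial>Omega)"
  proof -
    have "(\<integral>x. \<phi> (fst (exchange (coll x))) * u x \<partial>Omega) = (\<integral>x. \<phi> (fst (exchange (coll (coll x)))) * u (coll x) \<partial>Omega)"
      by (rule integral_coll[symmetric]) (use ints(2) in auto)
    also have "\<dots> = (\<integral>x. \<phi> (fst (exchange x)) * u (coll x) \<partial>Omega)"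
      by (intro Bochner_Integration.integral_cong) (auto simp: coll_coll)
    also have "\<dots> = (\<integral>x. \<phi> (fst x) * u (coll (exchange x)) \<partial>Omega)" by (rule e4[OF cu(1)])
    finally show ?thesis by (simp add: coll_exchange)
  qed
  have tf: "integrable (lborel \<Otimes>\<^sub>M (lborel \<Otimes>\<^sub>M sphere_measure)) (transposed_flux u)"
    using integrable_transposed_flux[OF u] by (simp add: Omega_def)
  have ptf: "integrable Omega (\<lambda>x. \<phi> (fst x) * transposed_flux u x)"
    by (rule i[OF integrable_transposed_flux[OF u] m0])
  have "(\<integral>x. coll_grad \<phi> x * u x \<partial>Omega) = (\<integral>x. \<phi> (fst x) * u (coll x) \<partial>Omega) + (\<integral>x. \<phi> (fst x) * u (exchange (coll x)) \<partial>Omega)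
       - (\<integral>x. \<phi> (fst x) * u x \<partial>Omega) - (\<integral>x. \<phi> (fst x) * u (exchange x) \<partial>Omega)"
    unfolding expand e1[symmetric] e2[symmetric] e4[OF u, symmetric]
    by (subst Bochner_Integration.integral_diff Bochner_Integration.integral_add,
        (intro Bochner_Integration.integrable_diff Bochner_Integration.integrable_add ints)+)+ simp
  also have "\<dots> = (\<integral>x. \<phi> (fst x) * transposed_flux u x \<partial>Omega)"
  proof -
    have ex: "\<phi> (fst x) * transposed_flux u x = \<phi> (fst x) * u (coll x) + \<phi> (fst x) * u (exchange (coll x)) - \<phi> (fst x) * u x - \<phi> (fst x) * u (exchange x)" for x
      by (simp add: transposed_flux_def algebra_simps)
    note js = i[OF cu(1) m0] i[OF cu(3) m0] i[OF u m0] i[OF cu(2) m0]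
    show ?thesis
      unfolding ex
      by (subst Bochner_Integration.integral_diff Bochner_Integration.integral_add,
        (intro Bochner_Integration.integrable_diff Bochner_Integration.integrable_add js)+)+ simp
  qed
  also have "\<dots> = (\<integral>v. (\<integral>y. \<phi> v * transposed_flux u (v, y) \<partial>(lborel \<Otimes>\<^sub>M sphere_measure)) \<partial>lborel)"
    using P.integral_fst'[of "\<lambda>x. \<phi> (fst x) * transposed_flux u x"] ptf by (simp add: Omega_def)
  also have "\<dots> = (\<integral>v. 4 * (\<phi> v * production u v) \<partial>lborel)"
    by (simp add: production_def)
  finally show "1/4 * (\<integral>x. coll_grad \<phi> x * u x \<partial>Omega) = (\<integral>v. \<phi> v * production u v \<partial>lborel)"
    by simp
  show pi: "integrable lborel (production u)"
    unfolding production_def[abs_def] by (intro integrable_mult_right P.integrable_fst'[OF tf])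
  have "(\<integral>\<^sup>+v. ennreal \<bar>production u v\<bar> \<partial>lborel) \<le> (\<integral>\<^sup>+v. (\<integral>\<^sup>+y. ennreal (1/4) * ennreal \<bar>transposed_flux u (v, y)\<bar> \<partial>(lborel \<Otimes>\<^sub>M sphere_measure)) \<partial>lborel)"
  proof (rule nn_integral_mono)
    fix v
    have m: "(\<lambda>y. transposed_flux u (v, y)) \<in> borel_measurable (lborel \<Otimes>\<^sub>M sphere_measure)"
      by (rule measurable_compose[OF measurable_Pair1' borel_measurable_integrable[OF tf]]) simp
    have "ennreal \<bar>production u v\<bar> = ennreal (1/4) * ennreal \<bar>\<integral>y. transposed_flux u (v, y) \<partial>(lborel \<Otimes>\<^sub>M sphere_measure)\<bar>"
      by (simp add: production_def abs_mult ennreal_mult[symmetric])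
    also have "\<dots> \<le> ennreal (1/4) * (\<integral>\<^sup>+y. ennreal \<bar>transposed_flux u (v, y)\<bar> \<partial>(lborel \<Otimes>\<^sub>M sphere_measure))"
    proof (rule mult_left_mono)
      show "ennreal \<bar>\<integral>y. transposed_flux u (v, y) \<partial>(lborel \<Otimes>\<^sub>M sphere_measure)\<bar> \<le> (\<integral>\<^sup>+y. ennreal \<bar>transposed_flux u (v, y)\<bar> \<partial>(lborel \<Otimes>\<^sub>M sphere_measure))"
      \<comment> \<open>Where the section is not integrable, the Bochner integral is 0 by convention
        and the bound is trivial.\<close>
      proof (cases "integrable (lborel \<Otimes>\<^sub>M sphere_measure) (\<lambda>y. transposed_flux u (v, y))")
        case True
        then show ?thesis using integral_norm_bound_ennreal[OF True] by simp
      qed (simp add: not_integrable_integral_eq)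
    qed simp
    also have "\<dots> = (\<integral>\<^sup>+y. ennreal (1/4) * ennreal \<bar>transposed_flux u (v, y)\<bar> \<partial>(lborel \<Otimes>\<^sub>M sphere_measure))"
      using m by (intro nn_integral_cmult[symmetric]) auto
    finally show "ennreal \<bar>production u v\<bar> \<le> (\<integral>\<^sup>+y. ennreal (1/4) * ennreal \<bar>transposed_flux u (v, y)\<bar> \<partial>(lborel \<Otimes>\<^sub>M sphere_measure))" .
  qed
  also have "\<dots> = (\<integral>\<^sup>+x. ennreal (1/4) * ennreal \<bar>transposed_flux u x\<bar> \<partial>Omega)"
    unfolding Omega_def using borel_measurable_integrable[OF tf] by (intro S.nn_integral_fst) auto
  also have "\<dots> \<le> (\<integral>\<^sup>+x. ennreal (1/4) * ((ennreal \<bar>u (coll x)\<bar> + ennreal \<bar>u (exchange (coll x))\<bar>) + (ennreal \<bar>u x\<bar> + ennreal \<bar>u (exchange x)\<bar>)) \<partial>Omega)"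
    by (intro nn_integral_mono mult_left_mono)
       (auto simp: transposed_flux_def ennreal_plus[symmetric] simp del: ennreal_plus intro!: ennreal_leI)
  also have "\<dots> = ennreal (1/4) * (((\<integral>\<^sup>+x. ennreal \<bar>u (coll x)\<bar> \<partial>Omega) + (\<integral>\<^sup>+x. ennreal \<bar>u (exchange (coll x))\<bar> \<partial>Omega)) + ((\<integral>\<^sup>+x. ennreal \<bar>u x\<bar> \<partial>Omega) + (\<integral>\<^sup>+x. ennreal \<bar>u (exchange x)\<bar> \<partial>Omega)))"
    using borel_measurable_integrable[OF cu(1)] borel_measurable_integrable[OF cu(2)] borel_measurable_integrable[OF cu(3)] um
    by (simp add: nn_integral_cmult nn_integral_add)
  also have "(\<integral>\<^sup>+x. ennreal \<bar>u (exchange (coll x))\<bar> \<partial>Omega) = (\<integral>\<^sup>+x. ennreal \<bar>u (exchange x)\<bar> \<partial>Omega)"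
    using borel_measurable_integrable[OF cu(2)] by (intro nn_integral_coll[of "\<lambda>x. ennreal \<bar>u (exchange x)\<bar>"]) auto
  also have "(\<integral>\<^sup>+x. ennreal \<bar>u (coll x)\<bar> \<partial>Omega) = (\<integral>\<^sup>+x. ennreal \<bar>u x\<bar> \<partial>Omega)"
    using um by (intro nn_integral_coll[of "\<lambda>x. ennreal \<bar>u x\<bar>"]) auto
  also have "(\<integral>\<^sup>+x. ennreal \<bar>u (exchange x)\<bar> \<partial>Omega) = (\<integral>\<^sup>+x. ennreal \<bar>u x\<bar> \<partial>Omega)"
    using um by (intro nn_integral_exchange[of "\<lambda>x. ennreal \<bar>u x\<bar>"]) auto
  also have "ennreal (1/4) * (((\<integral>\<^sup>+x. ennreal \<bar>u x\<bar> \<partial>Omega) + (\<integral>\<^sup>+x. ennreal \<bar>u x\<bar> \<partial>Omega)) + ((\<integral>\<^sup>+x. ennreal \<bar>u x\<bar> \<partial>Omega) + (\<integral>\<^sup>+x. ennreal \<bar>u x\<bar> \<partial>Omega)))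
    = (\<integral>\<^sup>+x. ennreal \<bar>u x\<bar> \<partial>Omega)"
  proof -
    have "ennreal (1/4) * ((z + z) + (z + z)) = (ennreal (1/4) * ennreal 4) * z" for z :: ennreal
      by (simp add: distrib_right[symmetric] mult.assoc) (metis (no_types, lifting) mult_2 mult.assoc numeral_Bit0 distrib_right one_add_one mult_1)
    moreover have "ennreal (1/4) * 4 = 1" using ennreal_mult[of "1/4" 4] by simp
    ultimately show ?thesis by simp
  qed
  finally show "(\<integral>\<^sup>+v. ennreal \<bar>production u v\<bar> \<partial>lborel) \<le> (\<integral>\<^sup>+x. ennreal \<bar>u x\<bar> \<partial>Omega)" .
qed

section \<open>Absolute continuity in time along the collision rate equation\<close>

context
  fixes f :: "real \<Rightarrow> 'a::euclidean_space \<Rightarrow> real" and U :: "real \<Rightarrow> 'a \<times> 'a \<times> 'a \<Rightarrow> real" and T :: real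
  assumes T: "0 < T" and CR: "collision_rate_equation T f U"
begin

lemma CR_density: "t \<in> {0..T} \<Longrightarrow> prob_density (f t)"
  using CR unfolding collision_rate_equation_def by blast

lemma CR_measurable: "(\<lambda>z. U (fst z) (snd z)) \<in> borel_measurable (time_measure T \<Otimes>\<^sub>M Omega)"
  using CR unfolding collision_rate_equation_def by (simp add: split_beta')

lemma CR_integrable: "integrable (time_measure T \<Otimes>\<^sub>M Omega) (\<lambda>z. U (fst z) (snd z))"
proof (rule integrableI_bounded[OF CR_measurable])
  interpret O: sigma_finite_measure "Omega :: ('a \<times> 'a \<times> 'a) measure" by (rule sigma_finite_Omega)
  have "(\<integral>\<^sup>+z. ennreal (norm (U (fst z) (snd z))) \<partial>(time_measure T \<Otimes>\<^sub>M Omega)) = (\<integral>\<^sup>+t. (\<integral>\<^sup>+x. ennreal \<bar>U t x\<bar> \<partial>Omega) \<partial>time_measure T)"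
    using CR_measurable by (subst O.nn_integral_fst[symmetric]) auto
  also have "\<dots> = (\<integral>\<^sup>+t\<in>{0..T}. (\<integral>\<^sup>+x. ennreal \<bar>U t x\<bar> \<partial>Omega) \<partial>lborel)"
    by (simp add: nn_integral_restrict_space)
  also have "\<dots> < \<infinity>" using CR unfolding collision_rate_equation_def by blast
  finally show "(\<integral>\<^sup>+z. ennreal (norm (U (fst z) (snd z))) \<partial>(time_measure T \<Otimes>\<^sub>M Omega)) < \<infinity>" .
qed

lemma CR_AE_integrable: "AE t in time_measure T. integrable Omega (U t)"
proof -
  interpret O: sigma_finite_measure "Omega :: ('a \<times> 'a \<times> 'a) measure" by (rule sigma_finite_Omega)
  interpret t: sigma_finite_measure "time_measure T" by (rule sigma_finite_time_measure)
  interpret P: pair_sigma_finite "time_measure T" "Omega :: ('a \<times> 'a \<times> 'a) measure" ..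
  show ?thesis using P.AE_integrable_fst'[OF CR_integrable] by simp
qed

lemma production_measurable: "(\<lambda>z. production (U (fst z)) (snd z)) \<in> borel_measurable (time_measure T \<Otimes>\<^sub>M lborel)"
proof -
  interpret S: sigma_finite_measure "lborel \<Otimes>\<^sub>M sphere_measure :: ('a \<times> 'a) measure"
    by (rule sigma_finite_lborel_sphere)
  have m: "(\<lambda>z. U (fst z) (k (snd z))) \<in> borel_measurable (time_measure T \<Otimes>\<^sub>M Omega)" if "k \<in> Omega \<rightarrow>\<^sub>M Omega" for k
  proof -
    have "(\<lambda>z. (fst z, k (snd z))) \<in> time_measure T \<Otimes>\<^sub>M Omega \<rightarrow>\<^sub>M time_measure T \<Otimes>\<^sub>M Omega"
      by (intro measurable_Pair measurable_fst measurable_compose[OF measurable_snd that])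
    from measurable_compose[OF this CR_measurable] show ?thesis by simp
  qed
  have tf: "(\<lambda>z. transposed_flux (U (fst z)) (snd z)) \<in> borel_measurable (time_measure T \<Otimes>\<^sub>M Omega)"
    unfolding transposed_flux_def
    by (intro borel_measurable_diff borel_measurable_add m coll_measurable exchange_measurable
        measurable_compose[OF coll_measurable exchange_measurable] CR_measurable)
  have re: "(\<lambda>w. (fst (fst w), snd (fst w), snd w)) \<in> (time_measure T \<Otimes>\<^sub>M lborel) \<Otimes>\<^sub>M (lborel \<Otimes>\<^sub>M sphere_measure) \<rightarrow>\<^sub>M time_measure T \<Otimes>\<^sub>M (Omega :: ('a \<times> 'a \<times> 'a) measure)"
    unfolding Omega_def
    by (intro measurable_Pair measurable_compose[OF measurable_fst measurable_fst] measurable_compose[OF measurable_fst measurable_snd] measurable_snd)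
  from measurable_compose[OF re tf]
  have "(\<lambda>w. transposed_flux (U (fst (fst w))) (snd (fst w), snd w)) \<in> borel_measurable ((time_measure T \<Otimes>\<^sub>M lborel) \<Otimes>\<^sub>M (lborel \<Otimes>\<^sub>M sphere_measure))"
    by simp
  then have "(\<lambda>z. \<integral>y. transposed_flux (U (fst z)) (snd z, y) \<partial>(lborel \<Otimes>\<^sub>M sphere_measure)) \<in> borel_measurable (time_measure T \<Otimes>\<^sub>M lborel)"
    by (intro S.borel_measurable_lebesgue_integral) (simp add: split_beta')
  then show ?thesis unfolding production_def by (intro borel_measurable_times borel_measurable_const)
qed

lemma production_integrable: "integrable (time_measure T \<Otimes>\<^sub>M lborel) (\<lambda>z. production (U (fst z)) (snd z))"
proof (rule integrableI_bounded[OF production_measurable])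
  interpret O: sigma_finite_measure "Omega :: ('a \<times> 'a \<times> 'a) measure" by (rule sigma_finite_Omega)
  have "(\<integral>\<^sup>+z. ennreal (norm (production (U (fst z)) (snd z))) \<partial>(time_measure T \<Otimes>\<^sub>M lborel))
      = (\<integral>\<^sup>+t. (\<integral>\<^sup>+v. ennreal \<bar>production (U t) v\<bar> \<partial>lborel) \<partial>time_measure T)"
    using production_measurable by (subst lborel.nn_integral_fst[symmetric]) auto
  also have "\<dots> \<le> (\<integral>\<^sup>+t. (\<integral>\<^sup>+x. ennreal \<bar>U t x\<bar> \<partial>Omega) \<partial>time_measure T)"
  proof (rule nn_integral_mono_AE)
    show "AE t in time_measure T. (\<integral>\<^sup>+v. ennreal \<bar>production (U t) v\<bar> \<partial>lborel) \<le> (\<integral>\<^sup>+x. ennreal \<bar>U t x\<bar> \<partial>Omega)"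
      using CR_AE_integrable by eventually_elim (rule integral_coll_grad(4)[of _ "\<lambda>_. 0" 0], auto)
  qed
  also have "\<dots> = (\<integral>\<^sup>+z. ennreal (norm (U (fst z) (snd z))) \<partial>(time_measure T \<Otimes>\<^sub>M Omega))"
    using CR_measurable by (subst O.nn_integral_fst[symmetric]) auto
  also have "\<dots> < \<infinity>" using CR_integrable by (simp add: integrable_iff_bounded)
  finally show "(\<integral>\<^sup>+z. ennreal (norm (production (U (fst z)) (snd z))) \<partial>(time_measure T \<Otimes>\<^sub>M lborel)) < \<infinity>" .
qed

text \<open>The integrated form of the equation, taken pointwise in v as the definition of a new
  curve. Its trajectories have an explicit integral representation and it is jointly measurable in
  time and velocity, neither of which is assumed of \<open>f\<close>.\<close>

definition density_flow :: "real \<Rightarrow> 'a \<Rightarrow> real" where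
  "density_flow t v = f 0 v + (\<integral>r. indicator {0..t} r * production (U r) v \<partial>time_measure T)"

lemma zero_in_time: "0 \<in> {0..T}" using T by simp

lemma density_flow_measurable: "(\<lambda>z. density_flow (fst z) (snd z)) \<in> borel_measurable (borel \<Otimes>\<^sub>M borel)"
proof -
  interpret t: sigma_finite_measure "time_measure T" by (rule sigma_finite_time_measure)
  have [measurable]: "f 0 \<in> borel_measurable borel"
    using prob_density_integrable(3)[OF CR_density[OF zero_in_time]] .
  have i: "(\<lambda>w. indicator {0..fst (fst w)} (snd w) :: real) \<in> borel_measurable (((borel \<Otimes>\<^sub>M borel) :: (real \<times> 'a) measure) \<Otimes>\<^sub>M time_measure T)"
  proof -
    have id: "(\<lambda>r. r) \<in> time_measure T \<rightarrow>\<^sub>M (borel :: real measure)" by (rule measurable_restrict_space1) simp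
    have 2: "(\<lambda>w. snd w) \<in> ((borel \<Otimes>\<^sub>M borel) :: (real \<times> 'a) measure) \<Otimes>\<^sub>M time_measure T \<rightarrow>\<^sub>M (borel :: real measure)"
      by (rule measurable_compose[OF measurable_snd id])
    have 1: "(\<lambda>w. fst (fst w)) \<in> ((borel \<Otimes>\<^sub>M borel) :: (real \<times> 'a) measure) \<Otimes>\<^sub>M time_measure T \<rightarrow>\<^sub>M (borel :: real measure)"
      by measurable
    \<comment> \<open>The interval moves with the time variable; as a product of indicators of fixed
      half-lines its joint measurability is immediate.\<close>
    have "(\<lambda>w. indicator {0..} (snd w) * indicator {0..} (fst (fst w) - snd w) :: real) \<in> borel_measurable (((borel \<Otimes>\<^sub>M borel) :: (real \<times> 'a) measure) \<Otimes>\<^sub>M time_measure T)"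
    proof -
      have ind: "(indicator {0::real..} :: real \<Rightarrow> real) \<in> borel_measurable borel" by simp
      show ?thesis
        by (intro borel_measurable_times measurable_compose[OF 2 ind] measurable_compose[OF borel_measurable_diff[OF 1 2] ind])
    qed
    moreover have "indicator {0..} (snd w) * indicator {0..} (fst (fst w) - snd w) = (indicator {0..fst (fst w)} (snd w) :: real)" for w :: "(real \<times> 'a) \<times> real"
      by (auto simp: indicator_def)
    ultimately show ?thesis by (simp only:)
  qed
  have re: "(\<lambda>w. (snd w, snd (fst w))) \<in> (borel \<Otimes>\<^sub>M borel) \<Otimes>\<^sub>M time_measure T \<rightarrow>\<^sub>M time_measure T \<Otimes>\<^sub>M (lborel :: 'a measure)"
    by (intro measurable_Pair measurable_snd) (simp add: measurable_compose[OF measurable_fst measurable_snd])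
  have "(\<lambda>w. indicator {0..fst (fst w)} (snd w) * production (U (snd w)) (snd (fst w))) \<in> borel_measurable ((borel \<Otimes>\<^sub>M borel) \<Otimes>\<^sub>M time_measure T)"
    using i measurable_compose[OF re production_measurable] by (intro borel_measurable_times) auto
  then have "(\<lambda>z. \<integral>r. indicator {0..fst z} r * production (U r) (snd z) \<partial>time_measure T) \<in> borel_measurable (borel \<Otimes>\<^sub>M borel)"
    by (intro t.borel_measurable_lebesgue_integral) (simp add: split_beta')
  then show ?thesis unfolding density_flow_def by measurable
qed

lemma production_set_integrable: "AE v in lborel. set_integrable lborel {0..T} (\<lambda>r. production (U r) v)"
proof -
  interpret t: sigma_finite_measure "time_measure T" by (rule sigma_finite_time_measure)
  interpret P: pair_sigma_finite "time_measure T" "lborel :: 'a measure" ..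
  have "AE v in lborel. integrable (time_measure T) (\<lambda>r. production (U r) v)"
    using P.AE_integrable_snd[of "\<lambda>r v. production (U r) v"] production_integrable by (simp add: split_beta')
  then show ?thesis by (simp add: integrable_time_measure)
qed

lemma density_flow_eq:
  assumes "t \<in> {0..T}"
  shows "density_flow t v = f 0 v + (LBINT r:{0..t}. production (U r) v)"
proof -
  have "(\<integral>r. indicator {0..t} r * production (U r) v \<partial>time_measure T) = (LBINT r:{0..t}. production (U r) v)"
    unfolding integral_time_measure set_lebesgue_integral_def
    using assms by (intro Bochner_Integration.integral_cong) (auto simp: indicator_def)
  then show ?thesis by (simp add: density_flow_def)
qed

lemma production_Fubini:
  assumes \<psi>: "(\<lambda>z. \<psi> (fst z) (snd z)) \<in> borel_measurable (time_measure T \<Otimes>\<^sub>M lborel)" and C: "\<And>r v. \<bar>\<psi> r v\<bar> \<le> C"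
  shows "(\<integral>v. (\<integral>r. \<psi> r v * production (U r) v \<partial>time_measure T) \<partial>lborel) = (\<integral>r. (\<integral>v. \<psi> r v * production (U r) v \<partial>lborel) \<partial>time_measure T)"
    and "integrable (time_measure T) (\<lambda>r. \<integral>v. \<psi> r v * production (U r) v \<partial>lborel)"
    and "integrable lborel (\<lambda>v. \<integral>r. \<psi> r v * production (U r) v \<partial>time_measure T)"
proof -
  interpret t: sigma_finite_measure "time_measure T" by (rule sigma_finite_time_measure)
  interpret P: pair_sigma_finite "time_measure T" "lborel :: 'a measure" ..
  have "integrable (time_measure T \<Otimes>\<^sub>M lborel) (\<lambda>z. \<psi> (fst z) (snd z) * production (U (fst z)) (snd z))"
  proof (rule Bochner_Integration.integrable_bound[OF integrable_mult_right[OF production_integrable, of C]])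
    show "(\<lambda>z. \<psi> (fst z) (snd z) * production (U (fst z)) (snd z)) \<in> borel_measurable (time_measure T \<Otimes>\<^sub>M lborel)"
      using \<psi> production_measurable by (rule borel_measurable_times)
    show "AE z in time_measure T \<Otimes>\<^sub>M lborel. norm (\<psi> (fst z) (snd z) * production (U (fst z)) (snd z)) \<le> norm (C * production (U (fst z)) (snd z))"
    proof (rule AE_I2)
      fix z :: "real \<times> 'a"
      have "\<bar>\<psi> (fst z) (snd z)\<bar> \<le> \<bar>C\<bar>" using C[of "fst z" "snd z"] by linarith
      then show "norm (\<psi> (fst z) (snd z) * production (U (fst z)) (snd z)) \<le> norm (C * production (U (fst z)) (snd z))"
        unfolding real_norm_def abs_mult by (rule mult_right_mono) simp
    qed
  qed
  then have i: "integrable (time_measure T \<Otimes>\<^sub>M lborel) (\<lambda>(r, v). \<psi> r v * production (U r) v)"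
    by (simp add: split_beta')
  show "(\<integral>v. (\<integral>r. \<psi> r v * production (U r) v \<partial>time_measure T) \<partial>lborel) = (\<integral>r. (\<integral>v. \<psi> r v * production (U r) v \<partial>lborel) \<partial>time_measure T)"
    by (rule P.Fubini_integral[OF i])
  show "integrable (time_measure T) (\<lambda>r. \<integral>v. \<psi> r v * production (U r) v \<partial>lborel)"
    using P.integrable_fst[OF i] .
  show "integrable lborel (\<lambda>v. \<integral>r. \<psi> r v * production (U r) v \<partial>time_measure T)"
    using P.integrable_snd[OF i] .
qed

lemma time_interval_measurable:
  "(\<lambda>z. indicator {a..b} (fst z) :: real) \<in> borel_measurable (time_measure T \<Otimes>\<^sub>M N)"
proof -
  have "(\<lambda>r. indicator {a..b} r :: real) \<in> borel_measurable (time_measure T)"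
    by (rule measurable_restrict_space1) simp
  from measurable_compose[OF measurable_fst this] show ?thesis .
qed

text \<open>For each bounded continuous \<phi> the distributional equation integrates to an identity
  between increments, since both sides are regular enough for \<open>has_dist_deriv_FTC\<close>.
  With Fubini, the difference \<open>k\<close> of the two densities annihilates all such \<phi> and
  therefore vanishes. The exceptional null set depends on t.\<close>

lemma density_flow_AE:
  assumes t: "t \<in> {0..T}"
  shows "AE v in lborel. f t v = density_flow t v"
proof -
  define k where "k v = f t v - f 0 v - (\<integral>r. indicator {0..t} r * production (U r) v \<partial>time_measure T)" for v
  note F3 = production_Fubini(3)[OF time_interval_measurable, of 0 t 1]
  have Ft: "integrable lborel (f t)" "integrable lborel (f 0)"
    using prob_density_integrable(1)[OF CR_density] t T by auto
  have Fi: "integrable lborel (\<lambda>v. \<integral>r. indicator {0..t} r * production (U r) v \<partial>time_measure T)"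
    by (rule F3) (simp add: indicator_def)
  have ki: "integrable lborel k"
    unfolding k_def by (intro Bochner_Integration.integrable_diff Ft Fi)
  have "AE v in lborel. k v = 0"
  proof (rule AE_eq_0_if_bounded_continuous[OF ki])
    fix \<phi> :: "'a \<Rightarrow> real" assume c: "continuous_on UNIV \<phi>" and b: "bounded (range \<phi>)"
    have \<phi>m[measurable]: "\<phi> \<in> borel_measurable borel" using c by (rule borel_measurable_continuous_onI)
    obtain C where C: "\<And>v. \<bar>\<phi> v\<bar> \<le> C" using b unfolding bounded_iff by auto
    have C0: "0 \<le> C" using C[of 0] by linarith
    have \<phi>i: "integrable lborel (\<lambda>v. \<phi> v * w v)" if "integrable lborel w" for w
    proof (rule Bochner_Integration.integrable_bound[OF integrable_mult_right[OF that, of C]])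
      show "AE v in lborel. norm (\<phi> v * w v) \<le> norm (C * w v)"
        using C C0 by (intro AE_I2) (auto simp: abs_mult intro!: mult_right_mono)
    qed (use that in auto)
    define h where "h r = 1/4 * (\<integral>x. coll_grad \<phi> x * U r x \<partial>Omega)" for r
    define h' where "h' r = (\<integral>v. \<phi> v * production (U r) v \<partial>lborel)" for r
    \<comment> \<open>The flux at time r is integrable over \<open>Omega\<close> only for almost
      every r, so the two forms of the right-hand side are identified almost everywhere in
      time.\<close>
    have hh': "AE r in time_measure T. h r = h' r"
      using CR_AE_integrable unfolding h_def h'_def by eventually_elim (rule integral_coll_grad(1)[OF _ \<phi>m C])
    have \<psi>m: "(\<lambda>z. \<phi> (snd z)) \<in> borel_measurable (time_measure T \<Otimes>\<^sub>M lborel)" by measurable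
    have h'i: "integrable (time_measure T) h'"
      unfolding h'_def by (rule production_Fubini(2)[OF \<psi>m C])
    interpret O: sigma_finite_measure "Omega :: ('a \<times> 'a \<times> 'a) measure" by (rule sigma_finite_Omega)
    have cgm: "coll_grad \<phi> \<in> borel_measurable Omega"
    proof -
      have "(\<lambda>x. \<phi> (fst x)) \<in> borel_measurable Omega" by (rule measurable_compose[OF Omega_components_measurable(1) \<phi>m])
      note m = this
      have "(\<lambda>x. \<phi> (fst (coll x)) + \<phi> (fst (exchange (coll x))) - \<phi> (fst x) - \<phi> (fst (exchange x))) \<in> borel_measurable Omega"
        using measurable_compose[OF coll_measurable m] measurable_compose[OF exchange_measurable m]
          measurable_compose[OF measurable_compose[OF coll_measurable exchange_measurable] m] m
        by (intro borel_measurable_diff borel_measurable_add) auto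
      then show ?thesis by (simp add: coll_grad_eq[abs_def])
    qed
    have hm: "h \<in> borel_measurable (time_measure T)"
    proof -
      have "(\<lambda>z. coll_grad \<phi> (snd z) * U (fst z) (snd z)) \<in> borel_measurable (time_measure T \<Otimes>\<^sub>M Omega)"
        by (intro borel_measurable_times measurable_compose[OF measurable_snd cgm] CR_measurable)
      then have "(\<lambda>r. \<integral>x. coll_grad \<phi> x * U r x \<partial>Omega) \<in> borel_measurable (time_measure T)"
        by (intro O.borel_measurable_lebesgue_integral) (simp add: split_beta')
      then show ?thesis unfolding h_def by (intro borel_measurable_times borel_measurable_const)
    qed
    have hi: "integrable (time_measure T) h"
      using integrable_cong_AE[OF hm borel_measurable_integrable[OF h'i] hh'] h'i by simp
    have "has_dist_deriv T (\<lambda>t. \<integral>v. \<phi> v * f t v \<partial>lborel) h"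
      using CR c b unfolding collision_rate_equation_def h_def by blast
    moreover have "continuous_on {0..T} (\<lambda>t. \<integral>v. \<phi> v * f t v \<partial>lborel)"
      using CR c b unfolding collision_rate_equation_def by blast
    ultimately have "(\<integral>v. \<phi> v * f t v \<partial>lborel) - (\<integral>v. \<phi> v * f 0 v \<partial>lborel) = (LBINT r:{0..t}. h r)"
      using hi t by (intro has_dist_deriv_FTC[of T]) (auto simp: integrable_time_measure)
    also have "\<dots> = (\<integral>r. indicator {0..t} r * h r \<partial>time_measure T)"
      unfolding integral_time_measure set_lebesgue_integral_def
      using t by (intro Bochner_Integration.integral_cong) (auto simp: indicator_def)
    also have "\<dots> = (\<integral>r. indicator {0..t} r * h' r \<partial>time_measure T)"
    proof (rule integral_cong_AE)
      have "(\<lambda>r. indicator {0..t} r :: real) \<in> borel_measurable (time_measure T)"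
        by (rule measurable_restrict_space1) simp
      then show "(\<lambda>r. indicator {0..t} r * h r) \<in> borel_measurable (time_measure T)" "(\<lambda>r. indicator {0..t} r * h' r) \<in> borel_measurable (time_measure T)"
        using hm borel_measurable_integrable[OF h'i] by (auto intro: borel_measurable_times)
      show "AE r in time_measure T. indicator {0..t} r * h r = indicator {0..t} r * h' r"
        using hh' by eventually_elim simp
    qed
    also have "\<dots> = (\<integral>r. (\<integral>v. (indicator {0..t} r * \<phi> v) * production (U r) v \<partial>lborel) \<partial>time_measure T)"
      unfolding h'_def by (simp add: mult.assoc)
    also have "\<dots> = (\<integral>v. (\<integral>r. (indicator {0..t} r * \<phi> v) * production (U r) v \<partial>time_measure T) \<partial>lborel)"
    proof (rule production_Fubini(1)[symmetric])
      show "(\<lambda>z. indicator {0..t} (fst z) * \<phi> (snd z)) \<in> borel_measurable (time_measure T \<Otimes>\<^sub>M lborel)"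
        by (intro borel_measurable_times time_interval_measurable \<psi>m)
      show "\<bar>indicator {0..t} r * \<phi> v\<bar> \<le> C" for r v using C[of v] C0 by (simp add: indicator_def)
    qed
    also have "\<dots> = (\<integral>v. \<phi> v * (\<integral>r. indicator {0..t} r * production (U r) v \<partial>time_measure T) \<partial>lborel)"
    proof (rule Bochner_Integration.integral_cong[OF refl])
      fix v
      have "indicator {0..t} r * \<phi> v * production (U r) v = \<phi> v * (indicator {0..t} r * production (U r) v)" for r by simp
      then show "(\<integral>r. (indicator {0..t} r * \<phi> v) * production (U r) v \<partial>time_measure T) = \<phi> v * (\<integral>r. indicator {0..t} r * production (U r) v \<partial>time_measure T)"
        by (simp only: integral_mult_right_zero)
    qed
    finally have e: "(\<integral>v. \<phi> v * f t v \<partial>lborel) - (\<integral>v. \<phi> v * f 0 v \<partial>lborel) = (\<integral>v. \<phi> v * (\<integral>r. indicator {0..t} r * production (U r) v \<partial>time_measure T) \<partial>lborel)" .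
    have "(\<integral>v. \<phi> v * k v \<partial>lborel) = (\<integral>v. \<phi> v * f t v - \<phi> v * f 0 v - \<phi> v * (\<integral>r. indicator {0..t} r * production (U r) v \<partial>time_measure T) \<partial>lborel)"
      by (simp add: k_def right_diff_distrib)
    also have "\<dots> = (\<integral>v. \<phi> v * f t v \<partial>lborel) - (\<integral>v. \<phi> v * f 0 v \<partial>lborel) - (\<integral>v. \<phi> v * (\<integral>r. indicator {0..t} r * production (U r) v \<partial>time_measure T) \<partial>lborel)"
      using \<phi>i[OF Ft(1)] \<phi>i[OF Ft(2)] \<phi>i[OF Fi]
      by (subst Bochner_Integration.integral_diff; (subst Bochner_Integration.integral_diff)?; auto intro: Bochner_Integration.integrable_diff)
    finally show "(\<integral>v. \<phi> v * k v \<partial>lborel) = 0" using e by simp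
  qed
  then show ?thesis by eventually_elim (simp add: k_def density_flow_def)
qed

lemma density_flow_diff_le:
  assumes st: "0 \<le> s" "s \<le> t" "t \<le> T"
  shows "AE v in lborel. \<bar>f t v - f s v\<bar> \<le> (LBINT r:{s..t}. \<bar>production (U r) v\<bar>)"
proof -
  have tT: "t \<in> {0..T}" "s \<in> {0..T}" using st by auto
  show ?thesis
    using density_flow_AE[OF tT(1)] density_flow_AE[OF tT(2)] production_set_integrable
  proof eventually_elim
    case (elim v)
    have i: "set_integrable lborel {a..b} (\<lambda>r. production (U r) v)" if "0 \<le> a" "b \<le> T" for a b
      using that by (intro set_integrable_subset[OF elim(3)]) auto
    have "(LBINT r:{0..t}. production (U r) v) = (LBINT r:{0..s} \<union> {s..t}. production (U r) v)"
      using st by (simp add: ivl_disj_un_two_touch)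
    also have "\<dots> = (LBINT r:{0..s}. production (U r) v) + (LBINT r:{s..t}. production (U r) v)"
    proof (rule set_integral_Un_AE)
      show "AE r in lborel. \<not> (r \<in> {0..s} \<and> r \<in> {s..t})"
        using AE_lborel_singleton[of s] by eventually_elim auto
    qed (use i st in auto)
    finally have "f t v - f s v = (LBINT r:{s..t}. production (U r) v)"
      using elim(1,2) density_flow_eq[OF tT(1)] density_flow_eq[OF tT(2)] by simp
    then show ?case using set_integral_norm_bound[OF i[OF st(1,3)]] by simp
  qed
qed

end

context
  fixes f :: "real \<Rightarrow> 'a::euclidean_space \<Rightarrow> real" and U :: "real \<Rightarrow> 'a \<times> 'a \<times> 'a \<Rightarrow> real" and T :: real
  assumes T: "0 < T" and CR: "collision_rate_equation T f U"
begin

text \<open>A jointly measurable version of \<open>f\<close>, which itself is only measurable for each fixed time.\<close>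

definition flow_version :: "real \<Rightarrow> 'a \<Rightarrow> real" where
  "flow_version t v = max 0 (density_flow f U T t v)"

lemma flow_version_nonneg: "0 \<le> flow_version t v"
  by (simp add: flow_version_def)

lemma flow_version_AE:
  assumes t: "t \<in> {0..T}"
  shows "AE v in lborel. f t v = flow_version t v"
  using density_flow_AE[OF T CR t]
proof eventually_elim
  case (elim v)
  have "0 \<le> f t v" by (rule prob_density_integrable(4)[OF CR_density[OF T CR t]])
  then show ?case using elim by (simp add: flow_version_def)
qed

lemma flow_version_measurable: "(\<lambda>z. flow_version (fst z) (snd z)) \<in> borel_measurable (borel \<Otimes>\<^sub>M borel)"
  unfolding flow_version_def using density_flow_measurable[OF T CR] by measurable

lemma flow_version_measurable_section: "flow_version t \<in> borel_measurable borel"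
  using measurable_compose[OF measurable_Pair1'[of t borel borel] flow_version_measurable] by simp

lemma time_measure_borel: "(\<lambda>r. r) \<in> time_measure T \<rightarrow>\<^sub>M (borel :: real measure)"
  by (rule measurable_restrict_space1) simp

lemma flow_version_measurable_comp:
  assumes "k \<in> N \<rightarrow>\<^sub>M (borel :: 'a measure)"
  shows "(\<lambda>z. flow_version (fst z) (k (snd z))) \<in> borel_measurable (time_measure T \<Otimes>\<^sub>M N)"
proof -
  have "(\<lambda>z. (fst z, k (snd z))) \<in> time_measure T \<Otimes>\<^sub>M N \<rightarrow>\<^sub>M borel \<Otimes>\<^sub>M borel"
    by (intro measurable_Pair measurable_compose[OF measurable_fst time_measure_borel] measurable_compose[OF measurable_snd assms])
  from measurable_compose[OF this flow_version_measurable] show ?thesis by simp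
qed

lemma flow_version_AE_Omega:
  assumes t: "t \<in> {0..T}"
  shows "AE x in Omega. f t (fst x) = flow_version t (fst x) \<and> f t (fst (snd x)) = flow_version t (fst (snd x)) \<and>
    f t (fst (coll x)) = flow_version t (fst (coll x)) \<and> f t (fst (snd (coll x))) = flow_version t (fst (snd (coll x)))"
  by (rule AE_Omega_velocities[OF flow_version_AE[OF t]])

lemma integrable_trunc_entropy:
  assumes "1 \<le> N" and g: "prob_density (g :: 'a \<Rightarrow> real)"
  shows "integrable lborel (\<lambda>v. trunc_entropy N (g v))"
proof (rule Bochner_Integration.integrable_bound[OF integrable_mult_right[OF prob_density_integrable(1)[OF g], of "ln N"]])
  show "AE v in lborel. norm (trunc_entropy N (g v)) \<le> norm (ln N * g v)"
  proof (rule AE_I2)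
    fix v
    have "\<bar>trunc_entropy N (g v)\<bar> \<le> ln N * \<bar>g v\<bar>" by (rule trunc_entropy_abs_le[OF assms(1)])
    then show "norm (trunc_entropy N (g v)) \<le> norm (ln N * g v)"
      using assms(1) by (simp add: abs_mult)
  qed
  show "(\<lambda>v. trunc_entropy N (g v)) \<in> borel_measurable lborel"
    using prob_density_integrable(3)[OF g] by measurable
qed

text \<open>For almost every v the scalar chain rule holds along t \<mapsto>
  \<open>density_flow\<close>. After integration in v and Fubini, \<open>integral_coll_grad\<close>
  is read backwards with the clamped logarithm as test function, which is bounded and Borel but
  neither continuous nor independent of time. Joint measurability of the version is what makes
  Fubini available.\<close>

lemma chain_rule_flow:
  assumes N: "1 \<le> N"
  shows "(\<integral>v. trunc_entropy N (f T v) \<partial>lborel) - (\<integral>v. trunc_entropy N (f 0 v) \<partial>lborel) =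
      1/4 * (\<integral>z. coll_grad (\<lambda>v. ln_clamp N (flow_version (fst z) v)) (snd z) * U (fst z) (snd z) \<partial>(time_measure T \<Otimes>\<^sub>M Omega))"
    and "integrable (time_measure T \<Otimes>\<^sub>M Omega) (\<lambda>z. coll_grad (\<lambda>v. ln_clamp N (flow_version (fst z) v)) (snd z) * U (fst z) (snd z))"
proof -
  interpret O: sigma_finite_measure "Omega :: ('a \<times> 'a \<times> 'a) measure" by (rule sigma_finite_Omega)
  interpret t: sigma_finite_measure "time_measure T" by (rule sigma_finite_time_measure)
  interpret P: pair_sigma_finite "time_measure T" "Omega :: ('a \<times> 'a \<times> 'a) measure" ..
  have tT: "T \<in> {0..T}" "0 \<in> {0..T}" using T by auto
  define \<psi> where "\<psi> r v = ln_clamp N (flow_version r v)" for r v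
  have \<psi>m: "(\<lambda>z. \<psi> (fst z) (k (snd z))) \<in> borel_measurable (time_measure T \<Otimes>\<^sub>M M)" if "k \<in> M \<rightarrow>\<^sub>M borel" for M k
    unfolding \<psi>_def by (rule measurable_compose[OF flow_version_measurable_comp[OF that] ln_clamp_measurable])
  have \<psi>C: "\<bar>\<psi> r v\<bar> \<le> ln N" for r v unfolding \<psi>_def by (rule ln_clamp_abs_le[OF N])
  have \<psi>s: "\<psi> r \<in> borel_measurable borel" for r
    unfolding \<psi>_def by (rule measurable_compose[OF flow_version_measurable_section ln_clamp_measurable])
  have cgm: "(\<lambda>z. coll_grad (\<psi> (fst z)) (snd z)) \<in> borel_measurable (time_measure T \<Otimes>\<^sub>M Omega)"
    unfolding coll_grad_eq
    by (intro borel_measurable_diff borel_measurable_add \<psi>m Omega_components_measurable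
        measurable_compose[OF coll_measurable Omega_components_measurable(1)]
        measurable_compose[OF exchange_measurable Omega_components_measurable(1)]
        measurable_compose[OF measurable_compose[OF coll_measurable exchange_measurable] Omega_components_measurable(1)])
  have cgi: "integrable (time_measure T \<Otimes>\<^sub>M Omega) (\<lambda>z. coll_grad (\<psi> (fst z)) (snd z) * U (fst z) (snd z))"
  proof (rule Bochner_Integration.integrable_bound[OF integrable_mult_right[OF CR_integrable[OF T CR], of "4 * ln N"]])
    show "(\<lambda>z. coll_grad (\<psi> (fst z)) (snd z) * U (fst z) (snd z)) \<in> borel_measurable (time_measure T \<Otimes>\<^sub>M Omega)"
      using cgm CR_measurable[OF T CR] by (rule borel_measurable_times)
    show "AE z in time_measure T \<Otimes>\<^sub>M Omega. norm (coll_grad (\<psi> (fst z)) (snd z) * U (fst z) (snd z)) \<le> norm (4 * ln N * U (fst z) (snd z))"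
    proof (rule AE_I2)
      fix z :: "real \<times> 'a \<times> 'a \<times> 'a"
      have "\<bar>coll_grad (\<psi> (fst z)) (snd z)\<bar> \<le> 4 * ln N"
        unfolding coll_grad_eq
        using \<psi>C[of "fst z" "fst (coll (snd z))"] \<psi>C[of "fst z" "fst (exchange (coll (snd z)))"]
          \<psi>C[of "fst z" "fst (snd z)"] \<psi>C[of "fst z" "fst (exchange (snd z))"] by linarith
      also have "\<dots> \<le> \<bar>4 * ln N\<bar>" by simp
      finally show "norm (coll_grad (\<psi> (fst z)) (snd z) * U (fst z) (snd z)) \<le> norm (4 * ln N * U (fst z) (snd z))"
        unfolding real_norm_def abs_mult[of "coll_grad (\<psi> (fst z)) (snd z)"] abs_mult[of "4 * ln N"]
        by (rule mult_right_mono) simp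
    qed
  qed
  have "(\<integral>v. trunc_entropy N (f T v) \<partial>lborel) - (\<integral>v. trunc_entropy N (f 0 v) \<partial>lborel) =
      (\<integral>v. trunc_entropy N (f T v) - trunc_entropy N (f 0 v) \<partial>lborel)"
    using tT by (intro Bochner_Integration.integral_diff[symmetric] integrable_trunc_entropy N CR_density[OF T CR])
  also have "\<dots> = (\<integral>v. (\<integral>r. \<psi> r v * production (U r) v \<partial>time_measure T) \<partial>lborel)"
  proof (rule integral_cong_AE)
    show "(\<lambda>v. trunc_entropy N (f T v) - trunc_entropy N (f 0 v)) \<in> borel_measurable lborel"
      using prob_density_integrable(3)[OF CR_density[OF T CR tT(1)]] prob_density_integrable(3)[OF CR_density[OF T CR tT(2)]]
      by measurable
    show "(\<lambda>v. \<integral>r. \<psi> r v * production (U r) v \<partial>time_measure T) \<in> borel_measurable lborel"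
      using production_Fubini(3)[OF T CR \<psi>m[of "\<lambda>v. v" lborel] \<psi>C] by auto
    show "AE v in lborel. trunc_entropy N (f T v) - trunc_entropy N (f 0 v) = (\<integral>r. \<psi> r v * production (U r) v \<partial>time_measure T)"
      using production_set_integrable[OF T CR] density_flow_AE[OF T CR tT(1)]
    proof eventually_elim
      case (elim v)
      let ?g = "\<lambda>t. density_flow f U T t v"
      have "(LBINT r:{0..0}. production (U r) v) = 0"
        unfolding set_lebesgue_integral_def
        by (rule integral_eq_zero_AE, rule AE_mp[OF AE_lborel_singleton[of 0]]) (auto simp: indicator_def)
      then have g0: "?g 0 = f 0 v" using density_flow_eq[OF T CR tT(2)] by simp
      have "trunc_entropy N (?g T) - trunc_entropy N (?g 0) = (LBINT r:{0..T}. ln_clamp N (?g r) * production (U r) v)"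
      proof (rule chain_rule_trunc_entropy[OF N _ elim(1)])
        show "?g t = ?g 0 + (LBINT r:{0..t}. production (U r) v)" if "t \<in> {0..T}" for t
          unfolding g0 by (rule density_flow_eq[OF T CR that])
      qed (use T in simp)
      then show ?case
        using elim(2) g0 by (simp add: integral_time_measure \<psi>_def flow_version_def ln_clamp_max_zero[OF N])
    qed
  qed
  also have "\<dots> = (\<integral>r. (\<integral>v. \<psi> r v * production (U r) v \<partial>lborel) \<partial>time_measure T)"
    by (rule production_Fubini(1)[OF T CR \<psi>m[of "\<lambda>v. v" lborel] \<psi>C]) simp
  also have "\<dots> = (\<integral>r. 1/4 * (\<integral>x. coll_grad (\<psi> r) x * U r x \<partial>Omega) \<partial>time_measure T)"
  proof (rule integral_cong_AE)
    show "(\<lambda>r. \<integral>v. \<psi> r v * production (U r) v \<partial>lborel) \<in> borel_measurable (time_measure T)"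
      using production_Fubini(2)[OF T CR \<psi>m[of "\<lambda>v. v" lborel] \<psi>C] by auto
    have "(\<lambda>r. \<integral>x. coll_grad (\<psi> r) x * U r x \<partial>Omega) \<in> borel_measurable (time_measure T)"
      using borel_measurable_integrable[OF cgi] by (intro O.borel_measurable_lebesgue_integral) (simp add: split_beta')
    then show "(\<lambda>r. 1/4 * (\<integral>x. coll_grad (\<psi> r) x * U r x \<partial>Omega)) \<in> borel_measurable (time_measure T)"
      by (intro borel_measurable_times borel_measurable_const)
    show "AE r in time_measure T. (\<integral>v. \<psi> r v * production (U r) v \<partial>lborel) = 1/4 * (\<integral>x. coll_grad (\<psi> r) x * U r x \<partial>Omega)"
      using CR_AE_integrable[OF T CR] by eventually_elim (rule integral_coll_grad(1)[symmetric, OF _ \<psi>s \<psi>C])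
  qed
  also have "\<dots> = 1/4 * (\<integral>r. (\<integral>x. coll_grad (\<psi> r) x * U r x \<partial>Omega) \<partial>time_measure T)"
    by (rule integral_mult_right_zero)
  also have "(\<integral>r. (\<integral>x. coll_grad (\<psi> r) x * U r x \<partial>Omega) \<partial>time_measure T) =
      (\<integral>z. coll_grad (\<psi> (fst z)) (snd z) * U (fst z) (snd z) \<partial>(time_measure T \<Otimes>\<^sub>M Omega))"
    using P.integral_fst'[OF cgi] by simp
  finally show "(\<integral>v. trunc_entropy N (f T v) \<partial>lborel) - (\<integral>v. trunc_entropy N (f 0 v) \<partial>lborel) =
      1/4 * (\<integral>z. coll_grad (\<lambda>v. ln_clamp N (flow_version (fst z) v)) (snd z) * U (fst z) (snd z) \<partial>(time_measure T \<Otimes>\<^sub>M Omega))"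
    unfolding \<psi>_def .
  show "integrable (time_measure T \<Otimes>\<^sub>M Omega) (\<lambda>z. coll_grad (\<lambda>v. ln_clamp N (flow_version (fst z) v)) (snd z) * U (fst z) (snd z))"
    using cgi unfolding \<psi>_def .
qed

text \<open>Weak continuity improves to continuity in L1 because the L1 distance of f at two times
  is at most the integral of the L1 norm of the production between them, an absolutely continuous
  function of time.\<close>

lemma flow_L1_continuous:
  assumes s: "s \<in> {0..T}"
  shows "((\<lambda>t. \<integral>v. \<bar>f t v - f s v\<bar> \<partial>lborel) \<longlongrightarrow> 0) (at s within {0..T})"
proof -
  interpret t: sigma_finite_measure "time_measure T" by (rule sigma_finite_time_measure)
  interpret P: pair_sigma_finite "time_measure T" "lborel :: 'a measure" ..
  define Q where "Q r = (\<integral>v. \<bar>production (U r) v\<bar> \<partial>lborel)" for r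
  define \<Theta> where "\<Theta> t = (LBINT r:{0..t}. Q r)" for t
  have pi: "integrable (time_measure T \<Otimes>\<^sub>M lborel) (\<lambda>z. \<bar>production (U (fst z)) (snd z)\<bar>)"
    by (rule integrable_abs[OF production_integrable[OF T CR]])
  have Qi: "set_integrable lborel {0..T} Q"
    using P.integrable_fst'[OF pi] unfolding Q_def integrable_time_measure[symmetric] by simp
  have mono: "(\<integral>v. \<bar>f b v - f a v\<bar> \<partial>lborel) \<le> \<Theta> b - \<Theta> a" if ab: "0 \<le> a" "a \<le> b" "b \<le> T" for a b
  proof -
    have ind: "integrable (time_measure T \<Otimes>\<^sub>M lborel) (\<lambda>(r, v). indicator {a..b} r * \<bar>production (U r) v\<bar>)"
    proof (rule Bochner_Integration.integrable_bound[OF pi])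
      show "(\<lambda>(r, v). indicator {a..b} r * \<bar>production (U r) v\<bar>) \<in> borel_measurable (time_measure T \<Otimes>\<^sub>M lborel)"
        using borel_measurable_times[OF time_interval_measurable[OF T CR, where a=a and b=b] borel_measurable_integrable[OF pi]]
        by (simp add: split_beta')
    qed (auto simp: indicator_def)
    have eq: "(LBINT r:{a..b}. h r) = (\<integral>r. indicator {a..b} r * h r \<partial>time_measure T)" for h :: "real \<Rightarrow> real"
      unfolding integral_time_measure set_lebesgue_integral_def
      using ab by (intro Bochner_Integration.integral_cong) (auto simp: indicator_def)
    have "(\<integral>v. \<bar>f b v - f a v\<bar> \<partial>lborel) \<le> (\<integral>v. (LBINT r:{a..b}. \<bar>production (U r) v\<bar>) \<partial>lborel)"
    proof (rule integral_mono_AE)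
      show "integrable lborel (\<lambda>v. \<bar>f b v - f a v\<bar>)"
        using ab by (intro integrable_abs Bochner_Integration.integrable_diff prob_density_integrable(1) CR_density[OF T CR]) auto
      show "integrable lborel (\<lambda>v. LBINT r:{a..b}. \<bar>production (U r) v\<bar>)"
        unfolding eq using P.integrable_snd[OF ind] by simp
    qed (rule density_flow_diff_le[OF T CR ab])
    also have "\<dots> = (\<integral>r. (\<integral>v. indicator {a..b} r * \<bar>production (U r) v\<bar> \<partial>lborel) \<partial>time_measure T)"
      unfolding eq by (rule P.Fubini_integral[OF ind])
    also have "\<dots> = (LBINT r:{a..b}. Q r)"
      unfolding eq Q_def by simp
    also have "\<dots> = \<Theta> b - \<Theta> a"
    proof -
      have "(LBINT r:{0..b}. Q r) = (LBINT r:{0..a} \<union> {a..b}. Q r)"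
        using ab by (simp add: ivl_disj_un_two_touch)
      also have "\<dots> = (LBINT r:{0..a}. Q r) + (LBINT r:{a..b}. Q r)"
      proof (rule set_integral_Un_AE)
        show "AE r in lborel. \<not> (r \<in> {0..a} \<and> r \<in> {a..b})"
          using AE_lborel_singleton[of a] by eventually_elim auto
      qed (use ab in \<open>auto intro: set_integrable_subset[OF Qi]\<close>)
      finally show ?thesis unfolding \<Theta>_def by simp
    qed
    finally show ?thesis .
  qed
  have cont: "continuous_on {0..T} \<Theta>"
  proof -
    have "Q integrable_on {0..T}" using set_borel_integral_eq_integral(1)[OF Qi] .
    then have c: "continuous_on {0..T} (\<lambda>t. integral {0..t} Q)" by (rule indefinite_integral_continuous_1)
    have e: "integral {0..t} Q = \<Theta> t" if "t \<in> {0..T}" for t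
      unfolding \<Theta>_def using that
      by (intro set_borel_integral_eq_integral(2)[symmetric] set_integrable_subset[OF Qi]) auto
    show ?thesis by (rule continuous_on_eq[OF c e])
  qed
  have bound: "(\<integral>v. \<bar>f t v - f s v\<bar> \<partial>lborel) \<le> \<bar>\<Theta> t - \<Theta> s\<bar>" if "t \<in> {0..T}" for t
  proof (cases "s \<le> t")
    case True
    then show ?thesis using mono[of s t] s that by simp
  next
    case False
    have "(\<integral>v. \<bar>f t v - f s v\<bar> \<partial>lborel) = (\<integral>v. \<bar>f s v - f t v\<bar> \<partial>lborel)" by (simp add: abs_minus_commute)
    then show ?thesis using False mono[of t s] s that by simp
  qed
  have "(\<Theta> \<longlongrightarrow> \<Theta> s) (at s within {0..T})" using cont s by (simp add: continuous_on_def)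
  then have "((\<lambda>t. \<bar>\<Theta> t - \<Theta> s\<bar>) \<longlongrightarrow> \<bar>\<Theta> s - \<Theta> s\<bar>) (at s within {0..T})"
    by (intro tendsto_rabs tendsto_diff tendsto_const)
  then have lim: "((\<lambda>t. \<bar>\<Theta> t - \<Theta> s\<bar>) \<longlongrightarrow> 0) (at s within {0..T})" by simp
  show ?thesis
  proof (rule tendsto_sandwich[OF _ _ tendsto_const lim])
    show "\<forall>\<^sub>F t in at s within {0..T}. 0 \<le> (\<integral>v. \<bar>f t v - f s v\<bar> \<partial>lborel)"
      by (intro always_eventually allI Bochner_Integration.integral_nonneg) simp
    show "\<forall>\<^sub>F t in at s within {0..T}. (\<integral>v. \<bar>f t v - f s v\<bar> \<partial>lborel) \<le> \<bar>\<Theta> t - \<Theta> s\<bar>"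
      using bound by (auto simp: eventually_at_filter)
  qed
qed

end

section \<open>Young bounds for the clamped gradient\<close>

definition gradient_envelope :: "real \<Rightarrow> real \<Rightarrow> real \<Rightarrow> real \<Rightarrow> real \<Rightarrow> real" where
  "gradient_envelope l a b a' b' =
     (a * b) powr (1 - l) + a * b powr (1 - l) * a' powr l + b * a powr (1 - l) * b' powr l"

definition clamped_gradient :: "real \<Rightarrow> real \<Rightarrow> real \<Rightarrow> real \<Rightarrow> real \<Rightarrow> real" where
  "clamped_gradient N a b a' b' = ln_clamp N a' + ln_clamp N b' - ln_clamp N a - ln_clamp N b"

lemma gradient_envelope_nonneg:
  "0 \<le> a \<Longrightarrow> 0 \<le> b \<Longrightarrow> 0 \<le> a' \<Longrightarrow> 0 \<le> b' \<Longrightarrow> 0 \<le> gradient_envelope l a b a' b'"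
  by (simp add: gradient_envelope_def)

lemma clamped_gradient_swap: "clamped_gradient N a' b' a b = - clamped_gradient N a b a' b'"
  by (simp add: clamped_gradient_def)

text \<open>
  Either the clamped gradient is controlled by \<open>ln (a' b') - ln (a b)\<close>, or \<open>a b\<close> and \<open>a' b'\<close>
  are comparable up to a small exponential of the clamped gradient; in the second case the
  envelope absorbs the term \<open>\<Psi>\<^sup>*\<close> of Young's inequality because \<open>\<Psi>\<^sup>*\<close> grows at most exponentially.
\<close>

lemma gradient_flux_bound_pos:
  assumes A: "structural_assumptions \<Psi> \<Psi>s \<theta> G" and N: "N \<ge> 1" and l: "0 < l" "l < 1" and k: "0 < k"
    and nn: "0 \<le> a" "0 \<le> b" "0 \<le> a'" "0 \<le> b'" and F: "0 < a * b" "0 < a' * b'"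
    and pos: "0 \<le> clamped_gradient N a b a' b'"
  defines "m \<equiv> \<theta> (a * b) (a' * b')"
  shows "\<bar>clamped_gradient N a b a' b' * u\<bar> \<le>
    3 / l * (4 * G (a * b) (a' * b') * k + 2 * (\<Psi> (u / (m * k)) * m * k) + (gradient_envelope l a b a' b') * k)"
proof -
  define D where "D = clamped_gradient N a b a' b'"
  define \<Delta> where "\<Delta> = ln (a' * b') - ln (a * b)"
  define w where "w = u / (m * k)"
  \<comment> \<open>In the second case \<open>\<Psi>s\<close> at \<kappa> D costs exp (2 \<kappa> D)
    and the mobility another exp (\<kappa> D); a third of l makes the product exp (l D), the
    quantity bounded by \<open>clamp_gradient_bound\<close>.\<close>
  define \<kappa> where "\<kappa> = l / 3"
  have \<kappa>: "0 < \<kappa>" "\<kappa> < 1" using l by (auto simp: \<kappa>_def)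
  have m: "m > 0"
    using theta_eq_0_iff[OF A, of "a * b" "a' * b'"] theta_nonneg[OF A, of "a * b" "a' * b'"] F unfolding m_def by auto
  have u: "u = w * m * k" using m k by (simp add: w_def)
  have au: "\<bar>u\<bar> = \<bar>w\<bar> * m * k" using m k by (simp add: u abs_mult)
  have G: "4 * G (a * b) (a' * b') = \<Psi>s \<Delta> * m"
    using structural_assumptionsD(17)[OF A, rule_format, OF F] by (simp add: \<Delta>_def m_def)
  have even: "\<Psi>s (- x) = \<Psi>s x" for x using structural_assumptionsD(5)[OF A] by blast
  have Ps0: "0 \<le> \<Psi>s x" for x using structural_assumptionsD(1)[OF A] by blast
  have P0: "0 \<le> \<Psi> x" for x by (rule Psi_nonneg[OF A])
  have Young: "\<bar>y\<bar> * \<bar>w\<bar> \<le> \<Psi> w + \<Psi>s y" for y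
  proof -
    have "\<bar>y\<bar> * \<bar>w\<bar> = w * y \<or> \<bar>y\<bar> * \<bar>w\<bar> = w * (- y)" by (auto simp: abs_if)
    then show ?thesis using Psi_Young[OF A, of w y] Psi_Young[OF A, of w "- y"] even[of y] by auto
  qed
  have env0: "0 \<le> gradient_envelope l a b a' b'" using nn by (rule gradient_envelope_nonneg)
  have D0: "D \<ge> 0" using pos by (simp add: D_def)
  have terms0: "0 \<le> \<Psi> w * m * k" "0 \<le> \<Psi>s \<Delta> * m * k" "0 \<le> gradient_envelope l a b a' b' * k"
    using P0[of w] Ps0[of \<Delta>] env0 m k by simp_all
  have "\<kappa> * \<bar>D * u\<bar> \<le> \<Psi>s \<Delta> * m * k + 2 * (\<Psi> w * m * k) + gradient_envelope l a b a' b' * k"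
  proof (cases "\<kappa> * D \<le> \<bar>\<Delta>\<bar>")
    case True
    have "\<kappa> * \<bar>D * u\<bar> = (\<kappa> * D) * \<bar>w\<bar> * m * k" using D0 by (simp add: abs_mult au)
    also have "\<dots> \<le> \<bar>\<Delta>\<bar> * \<bar>w\<bar> * m * k" using True m k by (intro mult_right_mono) auto
    also have "\<dots> \<le> (\<Psi> w + \<Psi>s \<Delta>) * m * k" using Young[of \<Delta>] m k by (intro mult_right_mono) auto
    also have "\<dots> = \<Psi>s \<Delta> * m * k + \<Psi> w * m * k" by (simp add: algebra_simps)
    finally show ?thesis using terms0 by linarith
  next
    case False
    then have \<Delta>D: "\<bar>\<Delta>\<bar> < \<kappa> * D" by simp
    then have Dpos: "D > 0" using \<kappa> by (smt (verit) zero_less_mult_iff)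
    have "t = s * exp (ln t - ln s)" if "s > 0" "t > 0" for s t :: real
      using that by (simp add: exp_diff)
    from this[OF F] have F'e: "a' * b' = a * b * exp \<Delta>" unfolding \<Delta>_def .
    have "\<kappa> * D < D" using \<kappa> Dpos by simp
    \<comment> \<open>As \<kappa> < 1, the clamped gradient strictly exceeds the unclamped one here,
      which is the hypothesis under which \<open>clamp_gradient_bound\<close> applies.\<close>
    then have "a' * b' < a * b * exp D" unfolding F'e using \<Delta>D F by (intro mult_strict_left_mono) auto
    then have env: "a * b * exp (l * D) \<le> gradient_envelope l a b a' b'"
      unfolding gradient_envelope_def using clamp_gradient_bound[OF N nn l] Dpos
      by (simp add: D_def clamped_gradient_def)
    have mle: "m \<le> (a * b * exp (\<kappa> * D)) * \<theta> 1 1"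
      unfolding m_def
    proof (rule theta_le_max[OF A])
      have "1 \<le> exp (\<kappa> * D)" using \<kappa> Dpos by simp
      then show "a * b \<le> a * b * exp (\<kappa> * D)" using F by (simp add: mult_le_cancel_left1)
      show "a' * b' \<le> a * b * exp (\<kappa> * D)" unfolding F'e using \<Delta>D F by (intro mult_left_mono) auto
    qed (use F in auto)
    have "\<Psi>s (\<kappa> * D) * m \<le> (exp (2 * (\<kappa> * D)) / \<theta> 1 1) * ((a * b * exp (\<kappa> * D)) * \<theta> 1 1)"
      using Psi_star_le_exp[OF A, of "\<kappa> * D"] mle m theta_one_pos[OF A] \<kappa> Dpos by (intro mult_mono) auto
    also have "\<dots> = a * b * (exp (2 * (\<kappa> * D)) * exp (\<kappa> * D))" using theta_one_pos[OF A] by simp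
    also have "exp (2 * (\<kappa> * D)) * exp (\<kappa> * D) = exp (l * D)"
      unfolding exp_add[symmetric] by (simp add: \<kappa>_def)
    finally have Pm: "\<Psi>s (\<kappa> * D) * m \<le> gradient_envelope l a b a' b'" using env by simp
    have "\<kappa> * \<bar>D * u\<bar> = \<bar>\<kappa> * D\<bar> * \<bar>w\<bar> * m * k" using D0 \<kappa> by (simp add: abs_mult au)
    also have "\<dots> \<le> (\<Psi> w + \<Psi>s (\<kappa> * D)) * m * k" using Young[of "\<kappa> * D"] m k by (intro mult_right_mono) auto
    also have "\<dots> = \<Psi> w * m * k + (\<Psi>s (\<kappa> * D) * m) * k" by (simp add: algebra_simps)
    also have "\<dots> \<le> \<Psi> w * m * k + gradient_envelope l a b a' b' * k" using Pm k by (intro add_left_mono mult_right_mono) auto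
    finally show ?thesis using terms0 by linarith
  qed
  also have "\<dots> = 4 * G (a * b) (a' * b') * k + 2 * (\<Psi> (u / (m * k)) * m * k) + gradient_envelope l a b a' b' * k"
    unfolding G w_def ..
  finally have "\<bar>D * u\<bar> \<le> 1 / \<kappa> * (4 * G (a * b) (a' * b') * k + 2 * (\<Psi> (u / (m * k)) * m * k) + gradient_envelope l a b a' b' * k)"
    using \<kappa> by (simp add: field_simps)
  then show ?thesis unfolding D_def \<kappa>_def by simp
qed

text \<open>A negative gradient becomes positive when the pre- and post-collisional pairs are
  exchanged; \<theta> and G are symmetric, but the envelope is not, so both of its versions
  enter.\<close>

lemma gradient_flux_bound:
  assumes A: "structural_assumptions \<Psi> \<Psi>s \<theta> G" and N: "N \<ge> 1" and l: "0 < l" "l < 1" and k: "0 < k"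
    and nn: "0 \<le> a" "0 \<le> b" "0 \<le> a'" "0 \<le> b'" and F: "0 < a * b" "0 < a' * b'"
  defines "m \<equiv> \<theta> (a * b) (a' * b')"
  shows "\<bar>clamped_gradient N a b a' b' * u\<bar> \<le>
    3 / l * (4 * G (a * b) (a' * b') * k + 2 * (\<Psi> (u / (m * k)) * m * k) + (gradient_envelope l a b a' b' + gradient_envelope l a' b' a b) * k)"
proof -
  have sym: "\<theta> (a' * b') (a * b) = \<theta> (a * b) (a' * b')"
    using structural_assumptionsD(11)[OF A] F by (simp add: less_imp_le)
  have Gsym: "G (a' * b') (a * b) = G (a * b) (a' * b')"
  proof -
    have "1/4 * \<Psi>s (ln (a * b) - ln (a' * b')) * \<theta> (a' * b') (a * b) = G (a' * b') (a * b)"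
      by (rule structural_assumptionsD(17)[OF A, rule_format, OF F(2) F(1)])
    moreover have "1/4 * \<Psi>s (ln (a' * b') - ln (a * b)) * \<theta> (a * b) (a' * b') = G (a * b) (a' * b')"
      by (rule structural_assumptionsD(17)[OF A, rule_format, OF F])
    moreover have "\<Psi>s (ln (a * b) - ln (a' * b')) = \<Psi>s (ln (a' * b') - ln (a * b))"
      using structural_assumptionsD(5)[OF A, rule_format, of "ln (a * b) - ln (a' * b')"] by simp
    ultimately show ?thesis using sym by simp
  qed
  have e: "0 \<le> gradient_envelope l a b a' b' * k" "0 \<le> gradient_envelope l a' b' a b * k"
    using gradient_envelope_nonneg nn k by simp_all
  have l3: "0 \<le> 3 / l" using l by simp
  show ?thesis
  proof (cases "0 \<le> clamped_gradient N a b a' b'")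
    case True
    show ?thesis unfolding m_def
      by (rule order_trans[OF gradient_flux_bound_pos[OF A N l k nn F True] mult_left_mono[OF _ l3]])
         (use e in \<open>simp add: distrib_right\<close>)
  next
    case False
    then have p: "0 \<le> clamped_gradient N a' b' a b" by (simp add: clamped_gradient_swap[of N a b])
    have "\<bar>clamped_gradient N a b a' b' * u\<bar> = \<bar>clamped_gradient N a' b' a b * u\<bar>"
      by (simp add: clamped_gradient_swap[of N a b])
    also have "\<dots> \<le> 3 / l * (4 * G (a' * b') (a * b) * k + 2 * (\<Psi> (u / (\<theta> (a' * b') (a * b) * k)) * \<theta> (a' * b') (a * b) * k) + gradient_envelope l a' b' a b * k)"
      by (rule gradient_flux_bound_pos[OF A N l k nn(3,4,1,2) F(2,1) p])
    also have "\<dots> \<le> 3 / l * (4 * G (a * b) (a' * b') * k + 2 * (\<Psi> (u / (m * k)) * m * k) + (gradient_envelope l a b a' b' + gradient_envelope l a' b' a b) * k)"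
      unfolding m_def Gsym sym using e by (intro mult_left_mono[OF _ l3]) (simp add: distrib_right)
    finally show ?thesis .
  qed
qed

text \<open>With w = u / (m k) and y = ln s - ln t, \<open>d\<close> is m k / 4 times the gap
  \<open>\<Psi> w + \<Psi>s y - w * y\<close> in Young's inequality. The gap closes exactly when w
  is the derivative of \<open>\<Psi>s\<close> at y, and the compatibility identity turns this into w
  m = s - t.\<close>

lemma dissipation_defect:
  fixes u :: real
  assumes A: "structural_assumptions \<Psi> \<Psi>s \<theta> G" and k: "0 < k" and s: "0 < s" and t: "0 < t"
  defines "m \<equiv> \<theta> s t"
  defines "d \<equiv> 1/4 * ((ln t - ln s) * u) + (G s t * k + 1/4 * (\<Psi> (u / (m * k)) * m * k))"
  shows "0 \<le> d" "d = 0 \<longleftrightarrow> u = (s - t) * k"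
proof -
  define w where "w = u / (m * k)"
  define y where "y = ln s - ln t"
  have m: "m > 0"
    using theta_eq_0_iff[OF A, of s t] theta_nonneg[OF A, of s t] s t unfolding m_def by auto
  have u: "u = w * m * k" using m k by (simp add: w_def)
  have even: "\<Psi>s (ln t - ln s) = \<Psi>s y"
    using structural_assumptionsD(5)[OF A, rule_format, of y] by (simp add: y_def)
  have G: "G s t = 1/4 * \<Psi>s y * m"
    using structural_assumptionsD(17)[OF A, rule_format, OF s t] by (simp add: even m_def)
  have d: "d = 1/4 * (m * k) * (\<Psi> w + \<Psi>s y - w * y)"
    unfolding d_def G w_def[symmetric] u y_def by (simp add: algebra_simps)
  show "0 \<le> d" unfolding d using m k Psi_Young[OF A, of w y] by (intro mult_nonneg_nonneg) auto
  have mk: "1/4 * (m * k) \<noteq> 0" using m k by simp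
  have der: "deriv \<Psi>s y * m = s - t"
    using structural_assumptionsD(14)[OF A, rule_format, OF s t] by (simp add: y_def m_def)
  have "d = 0 \<longleftrightarrow> \<Psi> w + \<Psi>s y = w * y" unfolding d using mk by auto
  also have "\<dots> \<longleftrightarrow> w = deriv \<Psi>s y"
    using Psi_Young_eq[OF A, of w y] Psi_at_deriv[OF A, of y] by auto
  also have "\<dots> \<longleftrightarrow> w * m = s - t" unfolding der[symmetric] using m by simp
  also have "\<dots> \<longleftrightarrow> u = (s - t) * k" unfolding u using k by simp
  finally show "d = 0 \<longleftrightarrow> u = (s - t) * k" .
qed

text \<open>If a' b' \<ge> a b, the left side has the wrong sign to be large. Otherwise a b exp D
  exceeds a' b', so \<open>clamp_gradient_bound\<close> applies, and D \<le> exp (l D) / l. Read for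
  the negative of the product, this is the lower bound required by Fatou's lemma, and it involves no
  dissipation term.\<close>

lemma clamped_gradient_lower_bound_pos:
  assumes N: "N \<ge> 1" and l: "0 < l" "l < 1" and nn: "0 \<le> a" "0 \<le> b" "0 \<le> a'" "0 \<le> b'"
    and D: "0 < clamped_gradient N a b a' b'"
  shows "clamped_gradient N a b a' b' * (a * b - a' * b') \<le> gradient_envelope l a b a' b' / l"
proof (cases "a' * b' < a * b")
  case True
  let ?D = "clamped_gradient N a b a' b'"
  have "a * b < a * b * exp ?D" if "a * b > 0"
    using mult_strict_left_mono[of 1 "exp ?D" "a * b"] D that by simp
  then have "a * b * exp (l * ?D) \<le> gradient_envelope l a b a' b'"
    unfolding gradient_envelope_def clamped_gradient_def
    using D True by (intro clamp_gradient_bound[OF N nn l]) (auto simp: clamped_gradient_def)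
  moreover have "l * ?D \<le> exp (l * ?D)" using exp_ge_add_one_self[of "l * ?D"] by linarith
  then have "?D * l \<le> exp (l * ?D)" by (simp only: mult.commute)
  then have "a * b * (?D * l) \<le> a * b * exp (l * ?D)" using nn by (intro mult_left_mono) auto
  ultimately have "a * b * ?D \<le> gradient_envelope l a b a' b' / l" using l by (simp add: field_simps)
  moreover have "?D * (a * b - a' * b') \<le> ?D * (a * b)" using D nn by (intro mult_left_mono) auto
  ultimately show ?thesis by (simp add: mult.commute)
next
  case False
  then have "clamped_gradient N a b a' b' * (a * b - a' * b') \<le> 0" using D by (intro mult_nonneg_nonpos) auto
  also have "0 \<le> gradient_envelope l a b a' b' / l" using gradient_envelope_nonneg[OF nn] l by simp
  finally show ?thesis .
qed

text \<open>Exchanging the two pairs changes the sign of both factors, so the product is unchanged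
  and the positive case can be used.\<close>

lemma clamped_gradient_lower_bound:
  assumes N: "N \<ge> 1" and l: "0 < l" "l < 1" and nn: "0 \<le> a" "0 \<le> b" "0 \<le> a'" "0 \<le> b'"
  shows "clamped_gradient N a b a' b' * (a * b - a' * b') \<le>
    (gradient_envelope l a b a' b' + gradient_envelope l a' b' a b) / l"
proof -
  have e: "0 \<le> gradient_envelope l a b a' b' / l" "0 \<le> gradient_envelope l a' b' a b / l"
    using gradient_envelope_nonneg nn l by simp_all
  consider "0 < clamped_gradient N a b a' b'" | "0 < clamped_gradient N a' b' a b" | "clamped_gradient N a b a' b' = 0"
    using clamped_gradient_swap[of N a b a' b'] by linarith
  then show ?thesis
  proof cases
    case 1
    then show ?thesis using clamped_gradient_lower_bound_pos[OF N l nn] e by (simp add: add_divide_distrib)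
  next
    case 2
    have "clamped_gradient N a b a' b' * (a * b - a' * b') = clamped_gradient N a' b' a b * (a' * b' - a * b)"
      unfolding clamped_gradient_swap[of N a b] by (simp add: algebra_simps)
    then show ?thesis using clamped_gradient_lower_bound_pos[OF N l nn(3,4,1,2) 2] e by (simp add: add_divide_distrib)
  next
    case 3
    then show ?thesis using e by (simp add: add_divide_distrib)
  qed
qed

lemma ln_clamp_eventually: "0 < s \<Longrightarrow> eventually (\<lambda>n. ln_clamp (real (Suc n)) s = ln s) sequentially"
proof -
  assume s: "0 < s"
  obtain m :: nat where m: "max s (1 / s) \<le> real m" using real_arch_simple by blast
  have "ln_clamp (real (Suc n)) s = ln s" if "n \<ge> m" for n
  proof -
    have "s \<le> real (Suc n)" "1 / s \<le> real (Suc n)" using m that by auto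
    then have "1 / real (Suc n) \<le> s" using s by (simp add: field_simps)
    then show ?thesis using \<open>s \<le> real (Suc n)\<close> by (simp add: ln_clamp_def clamp_pos_def)
  qed
  then show ?thesis by (auto simp: eventually_sequentially)
qed

lemma clamped_gradient_eventually:
  assumes "0 < a" "0 < b" "0 < a'" "0 < b'"
  shows "eventually (\<lambda>n. clamped_gradient (real (Suc n)) a b a' b' = ln (a' * b') - ln (a * b)) sequentially"
  using ln_clamp_eventually[OF assms(1)] ln_clamp_eventually[OF assms(2)] ln_clamp_eventually[OF assms(3)] ln_clamp_eventually[OF assms(4)]
  by eventually_elim (use assms in \<open>simp add: clamped_gradient_def ln_mult\<close>)

lemma ln_clamp_le_abs_ln:
  assumes "1 \<le> N" "0 \<le> s"
  shows "ln_clamp N s \<le> \<bar>ln s\<bar>" "0 < s \<Longrightarrow> - \<bar>ln s\<bar> \<le> ln_clamp N s"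
proof -
  note c = clamp_pos_bounds[OF assms(1), of s]
  have N1: "1 / N \<le> 1" using assms by simp
  show "ln_clamp N s \<le> \<bar>ln s\<bar>"
  proof (cases "s \<le> 1")
    case True
    then have "clamp_pos N s \<le> 1" using N1 by (auto simp: clamp_pos_def)
    then have "ln_clamp N s \<le> 0" unfolding ln_clamp_def using c by (subst ln_le_zero_iff) auto
    then show ?thesis by linarith
  next
    case False
    then have "clamp_pos N s \<le> s" using N1 by (auto simp: clamp_pos_def)
    then have "ln_clamp N s \<le> ln s" unfolding ln_clamp_def using c False by (subst ln_le_cancel_iff) auto
    then show ?thesis by linarith
  qed
  show "- \<bar>ln s\<bar> \<le> ln_clamp N s" if s: "0 < s"
  proof (cases "s \<le> 1")
    case True
    then have "s \<le> clamp_pos N s" using assms by (auto simp: clamp_pos_def)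
    then have "ln s \<le> ln_clamp N s" unfolding ln_clamp_def using c s by (subst ln_le_cancel_iff) auto
    then show ?thesis by linarith
  next
    case False
    then have "1 \<le> clamp_pos N s" using assms by (auto simp: clamp_pos_def)
    then have "0 \<le> ln_clamp N s" unfolding ln_clamp_def by (rule ln_ge_zero)
    then show ?thesis by linarith
  qed
qed

text \<open>At least one post-collisional density is 0 and contributes - ln N; the other is bounded
  above, and the pre-collisional terms are bounded below, all independently of N. This divergence
  matches the infinite value that the dissipation takes where a nonzero flux meets zero
  mobility.\<close>

lemma clamped_gradient_at_bot:
  assumes nn: "0 \<le> a'" "0 \<le> b'" and ab: "0 < a" "0 < b" and z: "a' * b' = 0"
  shows "filterlim (\<lambda>n. - clamped_gradient (real (Suc n)) a b a' b') at_top sequentially"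
proof -
  define c where "c = \<bar>ln a'\<bar> + \<bar>ln b'\<bar> + \<bar>ln a\<bar> + \<bar>ln b\<bar>"
  have L0: "ln_clamp (real (Suc n)) 0 = - ln (real (Suc n))" for n
    by (simp add: ln_clamp_def clamp_pos_def ln_div del: of_nat_Suc)
  have le: "- clamped_gradient (real (Suc n)) a b a' b' \<ge> - c + ln (real (Suc n))" for n
  proof -
    have N: "1 \<le> real (Suc n)" by simp
    note upper = ln_clamp_le_abs_ln(1)[OF N nn(1)] ln_clamp_le_abs_ln(1)[OF N nn(2)]
    note lower = ln_clamp_le_abs_ln(2)[OF N _ ab(1)] ln_clamp_le_abs_ln(2)[OF N _ ab(2)]
    have la: "- \<bar>ln a\<bar> \<le> ln_clamp (real (Suc n)) a" "- \<bar>ln b\<bar> \<le> ln_clamp (real (Suc n)) b"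
      using lower ab by auto
    from z have "a' = 0 \<or> b' = 0" by simp
    then have "ln_clamp (real (Suc n)) a' + ln_clamp (real (Suc n)) b' \<le> - ln (real (Suc n)) + \<bar>ln a'\<bar> + \<bar>ln b'\<bar>"
    proof
      assume "a' = 0"
      then have "ln_clamp (real (Suc n)) a' = - ln (real (Suc n))" using L0 by simp
      then show ?thesis using upper(2) abs_ge_zero[of "ln a'"] by linarith
    next
      assume "b' = 0"
      then have "ln_clamp (real (Suc n)) b' = - ln (real (Suc n))" using L0 by simp
      then show ?thesis using upper(1) abs_ge_zero[of "ln b'"] by linarith
    qed
    then show ?thesis using la unfolding clamped_gradient_def c_def by linarith
  qed
  have "filterlim (\<lambda>n. ln (real (Suc n))) at_top sequentially"
    by (rule filterlim_compose[OF ln_at_top filterlim_compose[OF filterlim_real_sequentially filterlim_Suc]])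
  then have "filterlim (\<lambda>n. - c + ln (real (Suc n))) at_top sequentially"
    by (rule filterlim_tendsto_add_at_top[OF tendsto_const])
  then show ?thesis by (rule filterlim_at_top_mono) (intro always_eventually allI le)
qed

section \<open>Entropy dissipation\<close>

text \<open>The four densities of a collision are treated as functions on time times
  \<open>Omega\<close>, so that all limits are taken in one product space. The curve is a parameter,
  since \<open>f\<close> and its jointly measurable version are compared through the same
  expressions.\<close>

definition dens :: "(real \<Rightarrow> 'a::euclidean_space \<Rightarrow> real) \<Rightarrow> real \<times> 'a \<times> 'a \<times> 'a \<Rightarrow> real" where
  "dens p z = p (fst z) (fst (snd z))"

definition dens_star :: "(real \<Rightarrow> 'a::euclidean_space \<Rightarrow> real) \<Rightarrow> real \<times> 'a \<times> 'a \<times> 'a \<Rightarrow> real" where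
  "dens_star p z = p (fst z) (fst (snd (snd z)))"

definition dens' :: "(real \<Rightarrow> 'a::euclidean_space \<Rightarrow> real) \<Rightarrow> real \<times> 'a \<times> 'a \<times> 'a \<Rightarrow> real" where
  "dens' p z = p (fst z) (fst (coll (snd z)))"

definition dens_star' :: "(real \<Rightarrow> 'a::euclidean_space \<Rightarrow> real) \<Rightarrow> real \<times> 'a \<times> 'a \<times> 'a \<Rightarrow> real" where
  "dens_star' p z = p (fst z) (fst (snd (coll (snd z))))"

lemma pre_prod_dens: "pre_prod (p t) x = dens p (t, x) * dens_star p (t, x)"
  by (simp add: pre_prod_def dens_def dens_star_def split_beta')

lemma post_prod_dens: "post_prod (p t) x = dens' p (t, x) * dens_star' p (t, x)"
  by (simp add: post_prod_def dens'_def dens_star'_def coll_def split_beta')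

lemma coll_grad_dens:
  "coll_grad (\<lambda>v. ln_clamp N (p (fst z) v)) (snd z) = clamped_gradient N (dens p z) (dens_star p z) (dens' p z) (dens_star' p z)"
  by (simp add: coll_grad_def clamped_gradient_def dens_def dens_star_def dens'_def dens_star'_def coll_def split_beta')

lemma collision_envelope_dens:
  "collision_envelope (p t :: 'a::euclidean_space \<Rightarrow> real) x =
    gradient_envelope (averaging_exponent TYPE('a)) (dens p (t, x)) (dens_star p (t, x)) (dens' p (t, x)) (dens_star' p (t, x))"
  by (simp add: collision_envelope_def gradient_envelope_def Let_def dens_def dens_star_def dens'_def dens_star'_def coll_def split_beta')

lemma kern_measurable:
  assumes "collision_kernel \<gamma> (B :: 'a::euclidean_space \<Rightarrow> 'a \<Rightarrow> real)"
  shows "kern B \<in> borel_measurable Omega"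
proof -
  have Bm: "(\<lambda>(k, \<omega>). B k \<omega>) \<in> borel_measurable (borel \<Otimes>\<^sub>M restrict_space borel (sphere 0 1))"
    using assms unfolding collision_kernel_def by blast
  have s: "(\<lambda>x. snd (snd x)) \<in> Omega \<rightarrow>\<^sub>M restrict_space (borel :: 'a measure) (sphere 0 1)"
    using Omega_sphere_measurable[where 'a='a] by (simp add: sets_sphere_measure cong: measurable_cong_sets)
  have "(\<lambda>x. (fst x - fst (snd x), snd (snd x))) \<in> Omega \<rightarrow>\<^sub>M borel \<Otimes>\<^sub>M restrict_space (borel :: 'a measure) (sphere 0 1)"
    by (intro measurable_Pair s borel_measurable_diff Omega_components_measurable)
  from measurable_compose[OF this Bm] show ?thesis by (simp add: kern_def split_beta' cong: measurable_cong_sets)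
qed

lemma kern_coll:
  assumes "collision_kernel \<gamma> B" "x \<in> space Omega"
  shows "kern B (coll x) = kern B x"
proof -
  have "\<forall>v vs. \<forall>\<omega>\<in>sphere 0 1. B (post v vs \<omega> - post_star v vs \<omega>) \<omega> = B (v - vs) \<omega>"
    using assms(1) unfolding collision_kernel_def by blast
  then show ?thesis using assms(2) by (auto simp: kern_def coll_def space_Omega)
qed

lemma kern_pos: "collision_kernel \<gamma> B \<Longrightarrow> x \<in> space Omega \<Longrightarrow> 0 < kern B x"
  using kernel_upper_bound[of \<gamma> B] by (auto simp: kern_def space_Omega)

lemma has_dist_deriv_cong_AE:
  assumes D: "has_dist_deriv T g h" and h: "set_integrable lborel {0..T} h" and h': "set_integrable lborel {0..T} h'"
    and eq: "AE t in lborel. t \<in> {0..T} \<longrightarrow> h t = h' t"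
  shows "has_dist_deriv T g h'"
  unfolding has_dist_deriv_def
proof (intro conjI allI impI)
  fix a b :: real assume "0 < a \<and> b < T"
  then show "set_integrable lborel {a..b} g" "set_integrable lborel {a..b} h'"
    using D set_integrable_subset[OF h', of "{a..b}"] unfolding has_dist_deriv_def by auto
next
  fix \<eta> :: "real \<Rightarrow> real" assume \<eta>: "test_fun {0<..<T} \<eta>"
  then have "continuous_on UNIV \<eta>" unfolding test_fun_def by (metis Ck_fun.simps(1))
  then have \<eta>m: "\<eta> \<in> borel_measurable borel" by (rule borel_measurable_continuous_onI)
  have m: "(\<lambda>t. indicator {0<..<T} t *\<^sub>R (\<eta> t * k t)) \<in> borel_measurable lborel" if k: "set_integrable lborel {0..T} k" for k
  proof -
    have "(\<lambda>t. (indicator {0<..<T} t * \<eta> t) * (indicator {0..T} t *\<^sub>R k t)) \<in> borel_measurable lborel"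
      using borel_measurable_integrable[OF k[unfolded set_integrable_def]] \<eta>m by measurable
    also have "(\<lambda>t. (indicator {0<..<T} t * \<eta> t) * (indicator {0..T} t *\<^sub>R k t)) = (\<lambda>t. indicator {0<..<T} t *\<^sub>R (\<eta> t * k t))"
      by (auto simp: indicator_def)
    finally show ?thesis .
  qed
  have "(LBINT t:{0<..<T}. \<eta> t * h t) = (LBINT t:{0<..<T}. \<eta> t * h' t)"
    unfolding set_lebesgue_integral_def
  proof (rule integral_cong_AE[OF m[OF h] m[OF h']])
    show "AE t in lborel. indicator {0<..<T} t *\<^sub>R (\<eta> t * h t) = indicator {0<..<T} t *\<^sub>R (\<eta> t * h' t)"
      using eq by eventually_elim (auto simp: indicator_def)
  qed
  then show "- (LBINT t:{0<..<T}. deriv \<eta> t * g t) = (LBINT t:{0<..<T}. \<eta> t * h' t)"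
    using D \<eta> unfolding has_dist_deriv_def by metis
qed

lemma test_fun_continuous_bounded:
  assumes "test_fun S \<phi>"
  shows "continuous_on UNIV \<phi>" "bounded (range \<phi>)"
proof -
  show c: "continuous_on UNIV \<phi>" using assms unfolding test_fun_def by (metis Ck_fun.simps(1))
  obtain K where K: "compact K" "\<And>x. x \<notin> K \<Longrightarrow> \<phi> x = 0" using assms unfolding test_fun_def by blast
  have "bounded (insert 0 (\<phi> ` K))"
    using compact_imp_bounded[OF compact_continuous_image[OF continuous_on_subset[OF c subset_UNIV] K(1)]] by simp
  then show "bounded (range \<phi>)" by (rule bounded_subset) (use K(2) in auto)
qed

section \<open>Dissipation integrands on the product of time and \<open>Omega\<close>\<close>

context
  fixes B :: "'a::euclidean_space \<Rightarrow> 'a \<Rightarrow> real" and \<Psi> \<Psi>s :: "real \<Rightarrow> real" and \<theta> G :: "real \<Rightarrow> real \<Rightarrow> real"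
    and f :: "real \<Rightarrow> 'a \<Rightarrow> real" and U :: "real \<Rightarrow> 'a \<times> 'a \<times> 'a \<Rightarrow> real" and T \<gamma> :: real
  assumes T: "0 < T" and B: "collision_kernel \<gamma> B" and A: "structural_assumptions \<Psi> \<Psi>s \<theta> G"
    and moment: "(SUP t\<in>{0..T}. \<integral>\<^sup>+v. ennreal (norm v powr (2 + max 0 \<gamma>) * f t v) \<partial>lborel) < \<infinity>"
    and CR: "collision_rate_equation T f U"
begin

abbreviation (input) "p \<equiv> flow_version f U T"
abbreviation (input) "M \<equiv> time_measure T \<Otimes>\<^sub>M (Omega :: ('a \<times> 'a \<times> 'a) measure)"

lemma dens_nonneg: "0 \<le> dens p z" "0 \<le> dens_star p z" "0 \<le> dens' p z" "0 \<le> dens_star' p z"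
  by (simp_all add: dens_def dens_star_def dens'_def dens_star'_def flow_version_nonneg[OF T CR])

lemma dens_measurable:
  "dens p \<in> borel_measurable M" "dens_star p \<in> borel_measurable M" "dens' p \<in> borel_measurable M" "dens_star' p \<in> borel_measurable M"
  unfolding dens_def dens_star_def dens'_def dens_star'_def
  using flow_version_measurable_comp[OF T CR Omega_components_measurable(1)]
    flow_version_measurable_comp[OF T CR Omega_components_measurable(2)]
    flow_version_measurable_comp[OF T CR measurable_compose[OF coll_measurable Omega_components_measurable(1)]]
    flow_version_measurable_comp[OF T CR measurable_compose[OF coll_measurable Omega_components_measurable(2)]]
  by simp_all

lemma dens_AE:
  assumes "t \<in> {0..T}"
  shows "AE x in Omega. dens f (t, x) = dens p (t, x) \<and> dens_star f (t, x) = dens_star p (t, x) \<and>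
    dens' f (t, x) = dens' p (t, x) \<and> dens_star' f (t, x) = dens_star' p (t, x)"
  using flow_version_AE_Omega[OF T CR assms] by (simp add: dens_def dens_star_def dens'_def dens_star'_def)

lemma kern_measurable_M: "(\<lambda>z. kern B (snd z)) \<in> borel_measurable M"
  by (rule measurable_compose[OF measurable_snd kern_measurable[OF B]])

lemma kern_pos_M: "z \<in> space M \<Longrightarrow> 0 < kern B (snd z)"
  by (rule kern_pos[OF B]) (auto simp: space_pair_measure)

text \<open>Symmetrized under the collision, because the clamped gradient may have either
  sign.\<close>

definition envelope :: "real \<times> 'a \<times> 'a \<times> 'a \<Rightarrow> real" where
  "envelope z = (gradient_envelope (averaging_exponent TYPE('a)) (dens p z) (dens_star p z) (dens' p z) (dens_star' p z) +
     gradient_envelope (averaging_exponent TYPE('a)) (dens' p z) (dens_star' p z) (dens p z) (dens_star p z)) * kern B (snd z)"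

lemma gradient_envelope_measurable:
  assumes "a \<in> borel_measurable N" "b \<in> borel_measurable N" "a' \<in> borel_measurable N" "b' \<in> borel_measurable N"
  shows "(\<lambda>z. gradient_envelope r (a z) (b z) (a' z) (b' z)) \<in> borel_measurable N"
  unfolding gradient_envelope_def using assms by measurable

lemma envelope_nonneg: "z \<in> space M \<Longrightarrow> 0 \<le> envelope z"
  unfolding envelope_def using kern_pos_M[of z] dens_nonneg[of z]
  by (intro mult_nonneg_nonneg add_nonneg_nonneg gradient_envelope_nonneg) auto

lemma envelope_measurable: "envelope \<in> borel_measurable M"
  unfolding envelope_def
  by (intro borel_measurable_times borel_measurable_add gradient_envelope_measurable dens_measurable kern_measurable_M)

text \<open>The moment bound is uniform in time, so the time integral costs only the factor T. The
  transposed half of the envelope is the first half composed with \<open>coll\<close>, which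
  preserves both the measure and the kernel.\<close>

lemma envelope_integrable: "integrable M envelope"
proof -
  interpret O: sigma_finite_measure "Omega :: ('a \<times> 'a \<times> 'a) measure" by (rule sigma_finite_Omega)
  define C where "C = (SUP t\<in>{0..T}. \<integral>\<^sup>+v. ennreal (norm v powr (2 + max 0 \<gamma>) * f t v) \<partial>lborel)"
  have C: "C < \<infinity>" using moment by (simp add: C_def)
  obtain K where K: "K < \<infinity>" "\<And>f :: 'a \<Rightarrow> real. prob_density f \<Longrightarrow>
    (\<integral>\<^sup>+v. ennreal (norm v powr (2 + max 0 \<gamma>) * f v) \<partial>lborel) \<le> C \<Longrightarrow>
    (\<integral>\<^sup>+x. ennreal (collision_envelope f x * kern B x) \<partial>Omega) \<le> K"
    using collision_envelope_bound[OF B C] by blast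
  define X where "X z = gradient_envelope (averaging_exponent TYPE('a)) (dens p z) (dens_star p z) (dens' p z) (dens_star' p z) * kern B (snd z)" for z
  define X' where "X' z = gradient_envelope (averaging_exponent TYPE('a)) (dens' p z) (dens_star' p z) (dens p z) (dens_star p z) * kern B (snd z)" for z
  have Xm: "X \<in> borel_measurable M" "X' \<in> borel_measurable M"
    unfolding X_def X'_def
    by (intro borel_measurable_times gradient_envelope_measurable dens_measurable kern_measurable_M)+
  have X0: "0 \<le> X z" "0 \<le> X' z" if "z \<in> space M" for z
    unfolding X_def X'_def using kern_pos_M[OF that] dens_nonneg[of z]
    by (auto intro!: mult_nonneg_nonneg gradient_envelope_nonneg)
  have sec: "(\<lambda>x. X (t, x)) \<in> borel_measurable Omega" if "t \<in> {0..T}" for t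
    by (rule measurable_compose[OF measurable_Pair1' Xm(1)]) (use that in \<open>simp add: space_time_measure\<close>)
  have XK: "(\<integral>\<^sup>+x. ennreal (X (t, x)) \<partial>Omega) \<le> K" if t: "t \<in> {0..T}" for t
  proof -
    have "(\<integral>\<^sup>+x. ennreal (X (t, x)) \<partial>Omega) = (\<integral>\<^sup>+x. ennreal (collision_envelope (f t) x * kern B x) \<partial>Omega)"
    proof (rule nn_integral_cong_AE)
      show "AE x in Omega. ennreal (X (t, x)) = ennreal (collision_envelope (f t) x * kern B x)"
        using dens_AE[OF t] by eventually_elim (simp add: X_def collision_envelope_dens)
    qed
    also have "\<dots> \<le> K"
      using t by (intro K(2) CR_density[OF T CR]) (auto simp: C_def intro!: SUP_upper)
    finally show ?thesis .
  qed
  have X'K: "(\<integral>\<^sup>+x. ennreal (X' (t, x)) \<partial>Omega) \<le> K" if t: "t \<in> {0..T}" for t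
  proof -
    have "(\<integral>\<^sup>+x. ennreal (X' (t, x)) \<partial>Omega) = (\<integral>\<^sup>+x. ennreal (X (t, coll x)) \<partial>Omega)"
      by (intro nn_integral_cong)
         (simp add: X_def X'_def dens_def dens_star_def dens'_def dens_star'_def coll_coll kern_coll[OF B])
    also have "\<dots> = (\<integral>\<^sup>+x. ennreal (X (t, x)) \<partial>Omega)"
      using sec[OF t] by (intro nn_integral_coll[of "\<lambda>x. ennreal (X (t, x))"]) measurable
    finally show ?thesis using XK[OF t] by simp
  qed
  have "(\<integral>\<^sup>+z. ennreal (X z) \<partial>M) + (\<integral>\<^sup>+z. ennreal (X' z) \<partial>M) \<le> 2 * (K * ennreal T)"
  proof -
    have I: "(\<integral>\<^sup>+z. ennreal (Y z) \<partial>M) \<le> K * ennreal T" if Ym: "Y \<in> borel_measurable M" and Y: "\<And>t. t \<in> {0..T} \<Longrightarrow> (\<integral>\<^sup>+x. ennreal (Y (t, x)) \<partial>Omega) \<le> K" for Y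
    proof -
      have "(\<integral>\<^sup>+z. ennreal (Y z) \<partial>M) = (\<integral>\<^sup>+t. (\<integral>\<^sup>+x. ennreal (Y (t, x)) \<partial>Omega) \<partial>time_measure T)"
        using Ym by (subst O.nn_integral_fst[symmetric]) auto
      also have "\<dots> \<le> (\<integral>\<^sup>+t. K \<partial>time_measure T)"
        using Y by (intro nn_integral_mono) (simp add: space_time_measure)
      also have "\<dots> = K * ennreal T"
        using T by (simp add: space_time_measure emeasure_restrict_space)
      finally show ?thesis .
    qed
    show ?thesis unfolding mult_2 by (intro add_mono I Xm XK X'K)
  qed
  also have "\<dots> < \<infinity>" using K(1) by (simp add: ennreal_mult_less_top)
  finally have fin: "(\<integral>\<^sup>+z. ennreal (X z) \<partial>M) + (\<integral>\<^sup>+z. ennreal (X' z) \<partial>M) < \<infinity>" .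
  show ?thesis
  proof (rule integrableI_nonneg[OF envelope_measurable])
    show "AE z in M. 0 \<le> envelope z" by (rule AE_I2) (rule envelope_nonneg)
    have "(\<integral>\<^sup>+z. ennreal (envelope z) \<partial>M) = (\<integral>\<^sup>+z. ennreal (X z) + ennreal (X' z) \<partial>M)"
      using X0 by (intro nn_integral_cong) (simp add: envelope_def X_def X'_def distrib_right ennreal_plus[symmetric] del: ennreal_plus)
    also have "\<dots> = (\<integral>\<^sup>+z. ennreal (X z) \<partial>M) + (\<integral>\<^sup>+z. ennreal (X' z) \<partial>M)"
      using Xm by (intro nn_integral_add) auto
    finally show "(\<integral>\<^sup>+z. ennreal (envelope z) \<partial>M) < \<infinity>" using fin by simp
  qed
qed

definition primal_rate :: "real \<times> 'a \<times> 'a \<times> 'a \<Rightarrow> real" where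
  "primal_rate z = G (dens p z * dens_star p z) (dens' p z * dens_star' p z) * kern B (snd z)"

text \<open>In contrast to \<open>primal_rate\<close>, where G already contains it, the factor 1/4
  is not included here.\<close>

definition dual_rate :: "real \<times> 'a \<times> 'a \<times> 'a \<Rightarrow> ennreal" where
  "dual_rate z = dual_integrand \<Psi> \<theta> B (p (fst z)) (U (fst z)) (snd z)"

lemma primal_rate_nonneg: "z \<in> space M \<Longrightarrow> 0 \<le> primal_rate z"
  unfolding primal_rate_def using structural_assumptionsD(15)[OF A] dens_nonneg[of z] kern_pos_M[of z]
  by (simp add: less_imp_le)

lemma primal_rate_measurable: "primal_rate \<in> borel_measurable M"
proof -
  have "(\<lambda>z. (dens p z * dens_star p z, dens' p z * dens_star' p z)) \<in> M \<rightarrow>\<^sub>M (borel :: (real \<times> real) measure)"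
    unfolding borel_prod[symmetric] by (intro measurable_Pair borel_measurable_times dens_measurable)
  from measurable_compose[OF this G_measurable[OF A]]
  have "(\<lambda>z. G (dens p z * dens_star p z) (dens' p z * dens_star' p z)) \<in> borel_measurable M"
    using dens_nonneg by simp
  then show ?thesis unfolding primal_rate_def by (intro borel_measurable_times kern_measurable_M)
qed

definition mobility :: "real \<times> 'a \<times> 'a \<times> 'a \<Rightarrow> real" where
  "mobility z = \<theta> (dens p z * dens_star p z) (dens' p z * dens_star' p z)"

lemma mobility_measurable: "mobility \<in> borel_measurable M"
proof -
  have "(\<lambda>z. (dens p z * dens_star p z, dens' p z * dens_star' p z)) \<in> M \<rightarrow>\<^sub>M (borel :: (real \<times> real) measure)"
    unfolding borel_prod[symmetric] by (intro measurable_Pair borel_measurable_times dens_measurable)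
  from measurable_compose[OF this theta_measurable[OF A]]
  show ?thesis using dens_nonneg unfolding mobility_def by simp
qed

lemma mobility_eq_0_iff: "mobility z = 0 \<longleftrightarrow> dens p z * dens_star p z = 0 \<or> dens' p z * dens_star' p z = 0"
  unfolding mobility_def using dens_nonneg[of z] by (intro theta_eq_0_iff[OF A]) auto

lemma mobility_nonneg: "0 \<le> mobility z"
  unfolding mobility_def using dens_nonneg[of z] by (intro theta_nonneg[OF A]) auto

lemma dual_rate_eq:
  "dual_rate z = (if mobility z = 0 then (if U (fst z) (snd z) = 0 then 0 else \<infinity>)
     else ennreal (\<Psi> (U (fst z) (snd z) / (mobility z * kern B (snd z))) * mobility z * kern B (snd z)))"
  unfolding dual_rate_def dual_integrand_def mobility_def pre_prod_dens post_prod_dens Let_def by simp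

lemma dual_rate_measurable: "dual_rate \<in> borel_measurable M"
  unfolding dual_rate_eq
proof (intro measurable_If)
  have P: "(\<lambda>z. \<Psi> (U (fst z) (snd z) / (mobility z * kern B (snd z)))) \<in> borel_measurable M"
    by (rule measurable_compose[OF _ Psi_measurable[OF A]])
       (intro borel_measurable_divide CR_measurable[OF T CR] borel_measurable_times mobility_measurable kern_measurable_M)
  show "(\<lambda>z. ennreal (\<Psi> (U (fst z) (snd z) / (mobility z * kern B (snd z))) * mobility z * kern B (snd z))) \<in> borel_measurable M"
    by (rule measurable_compose[OF _ measurable_ennreal])
       (intro borel_measurable_times P mobility_measurable kern_measurable_M)
  have "Measurable.pred M (\<lambda>z. mobility z = 0)" using mobility_measurable by measurable
  then show "{z \<in> space M. mobility z = 0} \<in> sets M" by (simp add: pred_def)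
  have "Measurable.pred M (\<lambda>z. U (fst z) (snd z) = 0)" using CR_measurable[OF T CR] by measurable
  then show "{z \<in> space M. U (fst z) (snd z) = 0} \<in> sets M" by (simp add: pred_def)
qed simp_all

text \<open>At each single time, f and its version agree off a null set of \<open>Omega\<close>, so
  both dissipation integrals are unchanged; the version makes the integrand jointly measurable, and
  Tonelli merges the integrals.\<close>

lemma dissipation_eq:
  "(\<integral>\<^sup>+t\<in>{0..T}. (dissipation_D G B (f t) + dissipation_R \<Psi> \<theta> B (f t) (U t)) \<partial>lborel) =
   (\<integral>\<^sup>+z. ennreal (primal_rate z) + ennreal (1/4) * dual_rate z \<partial>M)"
proof -
  interpret O: sigma_finite_measure "Omega :: ('a \<times> 'a \<times> 'a) measure" by (rule sigma_finite_Omega)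
  have "(\<integral>\<^sup>+t\<in>{0..T}. (dissipation_D G B (f t) + dissipation_R \<Psi> \<theta> B (f t) (U t)) \<partial>lborel) =
    (\<integral>\<^sup>+t. (dissipation_D G B (f t) + dissipation_R \<Psi> \<theta> B (f t) (U t)) \<partial>time_measure T)"
    by (simp add: nn_integral_restrict_space)
  also have "\<dots> = (\<integral>\<^sup>+t. (\<integral>\<^sup>+x. ennreal (primal_rate (t, x)) + ennreal (1/4) * dual_rate (t, x) \<partial>Omega) \<partial>time_measure T)"
  proof (rule nn_integral_cong)
    fix t assume "t \<in> space (time_measure T)"
    then have t: "t \<in> {0..T}" by (simp add: space_time_measure)
    have Dm: "(\<lambda>x. ennreal (primal_rate (t, x))) \<in> borel_measurable Omega"
      by (rule measurable_compose[OF measurable_compose[OF measurable_Pair1' primal_rate_measurable] measurable_ennreal])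
         (use t in \<open>simp add: space_time_measure\<close>)
    have Rm: "(\<lambda>x. dual_rate (t, x)) \<in> borel_measurable Omega"
      by (rule measurable_compose[OF measurable_Pair1' dual_rate_measurable]) (use t in \<open>simp add: space_time_measure\<close>)
    have D: "dissipation_D G B (f t) = (\<integral>\<^sup>+x. ennreal (primal_rate (t, x)) \<partial>Omega)"
      unfolding dissipation_D_def
    proof (rule nn_integral_cong_AE)
      show "AE x in Omega. ennreal (G (pre_prod (f t) x) (post_prod (f t) x) * kern B x) = ennreal (primal_rate (t, x))"
        using dens_AE[OF t] by eventually_elim (simp add: primal_rate_def pre_prod_dens post_prod_dens)
    qed
    have "(\<integral>\<^sup>+x. dual_integrand \<Psi> \<theta> B (f t) (U t) x \<partial>Omega) = (\<integral>\<^sup>+x. dual_rate (t, x) \<partial>Omega)"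
    proof (rule nn_integral_cong_AE)
      show "AE x in Omega. dual_integrand \<Psi> \<theta> B (f t) (U t) x = dual_rate (t, x)"
        using dens_AE[OF t] by eventually_elim (simp add: dual_rate_def dual_integrand_def pre_prod_dens post_prod_dens)
    qed
    then show "dissipation_D G B (f t) + dissipation_R \<Psi> \<theta> B (f t) (U t) =
        (\<integral>\<^sup>+x. ennreal (primal_rate (t, x)) + ennreal (1/4) * dual_rate (t, x) \<partial>Omega)"
      unfolding D dissipation_R_def using Dm Rm by (simp add: nn_integral_add nn_integral_cmult)
  qed
  also have "\<dots> = (\<integral>\<^sup>+z. ennreal (primal_rate z) + ennreal (1/4) * dual_rate z \<partial>M)"
    by (intro O.nn_integral_fst borel_measurable_add borel_measurable_times_ennreal borel_measurable_const
        measurable_compose[OF primal_rate_measurable measurable_ennreal] dual_rate_measurable)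
  finally show ?thesis .
qed

definition flux_formula :: "real \<times> 'a \<times> 'a \<times> 'a \<Rightarrow> bool" where
  "flux_formula z \<longleftrightarrow> U (fst z) (snd z) = (dens p z * dens_star p z - dens' p z * dens_star' p z) * kern B (snd z)"

lemma flux_formula_AE:
  "(AE t in lborel. t \<in> {0..T} \<longrightarrow> (AE x in Omega. U t x = (pre_prod (f t) x - post_prod (f t) x) * kern B x))
   \<longleftrightarrow> (AE z in M. flux_formula z)"
proof -
  interpret O: sigma_finite_measure "Omega :: ('a \<times> 'a \<times> 'a) measure" by (rule sigma_finite_Omega)
  interpret t: sigma_finite_measure "time_measure T" by (rule sigma_finite_time_measure)
  interpret P: pair_sigma_finite "time_measure T" "Omega :: ('a \<times> 'a \<times> 'a) measure" ..
  have "(AE t in lborel. t \<in> {0..T} \<longrightarrow> (AE x in Omega. U t x = (pre_prod (f t) x - post_prod (f t) x) * kern B x)) \<longleftrightarrow>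
    (AE t in lborel. t \<in> {0..T} \<longrightarrow> (AE x in Omega. flux_formula (t, x)))"
  proof (rule AE_cong, rule imp_cong[OF refl])
    fix t assume t: "t \<in> {0..T}"
    show "(AE x in Omega. U t x = (pre_prod (f t) x - post_prod (f t) x) * kern B x) \<longleftrightarrow> (AE x in Omega. flux_formula (t, x))"
    proof
      assume "AE x in Omega. U t x = (pre_prod (f t) x - post_prod (f t) x) * kern B x"
      with dens_AE[OF t] show "AE x in Omega. flux_formula (t, x)"
        by eventually_elim (simp add: flux_formula_def pre_prod_dens post_prod_dens)
    next
      assume "AE x in Omega. flux_formula (t, x)"
      with dens_AE[OF t] show "AE x in Omega. U t x = (pre_prod (f t) x - post_prod (f t) x) * kern B x"
        by eventually_elim (simp add: flux_formula_def pre_prod_dens post_prod_dens)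
    qed
  qed
  also have "\<dots> \<longleftrightarrow> (AE t in time_measure T. AE x in Omega. flux_formula (t, x))"
    by (simp add: AE_time_measure)
  also have "\<dots> \<longleftrightarrow> (AE z in M. flux_formula (fst z, snd z))"
  proof (rule P.AE_pair_iff)
    have "(\<lambda>z. (dens p z * dens_star p z - dens' p z * dens_star' p z) * kern B (snd z)) \<in> borel_measurable M"
      by (intro borel_measurable_times borel_measurable_diff dens_measurable kern_measurable_M)
    then have "Measurable.pred M flux_formula"
      unfolding flux_formula_def[abs_def] using CR_measurable[OF T CR] by measurable
    then show "{z \<in> space M. flux_formula (fst z, snd z)} \<in> sets M" by (simp add: pred_def)
  qed
  finally show ?thesis by simp
qed

text \<open>The moment of order 2 + max 0 \<gamma> makes f^(1-l) integrable. Hence the negative part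
  of f ln f is integrable and the entropy never takes the value minus infinity.\<close>

lemma entropy_limit_time:
  assumes t: "t \<in> {0..T}"
  shows "(\<lambda>n. ereal ((\<integral>v. trunc_entropy (real (Suc n)) (f t v) \<partial>lborel) + 1)) \<longlonglongrightarrow> entropy (f t)"
    and "entropy (f t) \<noteq> - \<infinity>"
proof -
  define s where "s = max 0 \<gamma>"
  have \<gamma>1: "\<gamma> \<le> 1" using B unfolding collision_kernel_def by blast
  have s: "0 \<le> s" "s \<le> 1" using \<gamma>1 by (auto simp: s_def)
  note d = CR_density[OF T CR t]
  note fn = prob_density_integrable(4)[OF d] and fm[measurable] = prob_density_integrable(3)[OF d]
  define l where "l = averaging_exponent TYPE('a)"
  have l: "0 < l" "l < 1" using averaging_exponent_bounds[where 'a='a] by (auto simp: l_def)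
  have "(\<integral>\<^sup>+v. ennreal (f t v powr (1 - l)) \<partial>lborel) \<le>
      (\<integral>\<^sup>+v. ennreal (japanese v powr (2 + s) * f t v) + ennreal (japanese v powr (- 2 * real DIM('a))) \<partial>lborel)"
  proof (rule nn_integral_mono)
    fix v :: 'a
    have "1 \<le> japanese v powr s" using japanese_ge_1[of v] s by (intro ge_one_powr_ge_zero) auto
    then have "f t v powr (1 - l) * 1 \<le> f t v powr (1 - l) * japanese v powr s" by (intro mult_left_mono) auto
    also have "\<dots> \<le> japanese v powr (2 + s) * f t v + japanese v powr (- 2 * real DIM('a))"
      unfolding l_def by (rule powr_le_moment_plus_weight(1)[OF s fn])
    finally show "ennreal (f t v powr (1 - l)) \<le> ennreal (japanese v powr (2 + s) * f t v) + ennreal (japanese v powr (- 2 * real DIM('a)))"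
      using fn[of v] by (simp add: ennreal_plus[symmetric] ennreal_leI del: ennreal_plus)
  qed
  also have "\<dots> = (\<integral>\<^sup>+v. ennreal (japanese v powr (2 + s) * f t v) \<partial>lborel) + (\<integral>\<^sup>+v. ennreal (japanese (v :: 'a) powr (- 2 * real DIM('a))) \<partial>lborel)"
    by (rule nn_integral_add) measurable
  also have "\<dots> < \<infinity>"
  proof -
    have "(\<integral>\<^sup>+v. ennreal (norm v powr (2 + s) * f t v) \<partial>lborel) < \<infinity>"
      using t by (intro order.strict_trans1[OF _ moment]) (auto simp: s_def intro!: SUP_upper)
    then have "ennreal (2 powr (2 + s)) * (1 + (\<integral>\<^sup>+v. ennreal (norm v powr (2 + s) * f t v) \<partial>lborel)) < \<infinity>"
      by (simp add: ennreal_mult_less_top)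
    from order.strict_trans1[OF moment_japanese[OF s(1) d] this]
    show ?thesis using nn_integral_japanese_finite[where 'a='a] by simp
  qed
  finally have fin: "(\<integral>\<^sup>+v. ennreal (f t v powr (1 - l)) \<partial>lborel) < \<infinity>" .
  show "(\<lambda>n. ereal ((\<integral>v. trunc_entropy (real (Suc n)) (f t v) \<partial>lborel) + 1)) \<longlonglongrightarrow> entropy (f t)"
    and "entropy (f t) \<noteq> - \<infinity>"
    by (rule entropy_limit[OF d fin l])+
qed

abbreviation (input) "flux z \<equiv> U (fst z) (snd z)"

definition truncated_gradient :: "nat \<Rightarrow> real \<times> 'a \<times> 'a \<times> 'a \<Rightarrow> real" where
  "truncated_gradient n z = clamped_gradient (real (Suc n)) (dens p z) (dens_star p z) (dens' p z) (dens_star' p z)"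

lemma truncated_gradient_flux:
  "integrable M (\<lambda>z. truncated_gradient n z * flux z)"
  "(\<integral>v. trunc_entropy (real (Suc n)) (f T v) \<partial>lborel) - (\<integral>v. trunc_entropy (real (Suc n)) (f 0 v) \<partial>lborel) =
    1/4 * (\<integral>z. truncated_gradient n z * flux z \<partial>M)"
  unfolding truncated_gradient_def coll_grad_dens[symmetric]
  by (rule chain_rule_flow[OF T CR], simp)+

text \<open>The value 0 on zero mobility is a convention for a region where the logarithms are
  meaningless. When the dissipation is finite, the flux vanishes there almost everywhere, so the
  product with the flux is still the limit of the truncated products. \<open>dual_density\<close>
  follows the same convention.\<close>

definition log_gradient :: "real \<times> 'a \<times> 'a \<times> 'a \<Rightarrow> real" where
  "log_gradient z = (if mobility z = 0 then 0 else ln (dens' p z * dens_star' p z) - ln (dens p z * dens_star p z))"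

definition dual_density :: "real \<times> 'a \<times> 'a \<times> 'a \<Rightarrow> real" where
  "dual_density z = (if mobility z = 0 then 0 else \<Psi> (flux z / (mobility z * kern B (snd z))) * mobility z * kern B (snd z))"

lemma mobility_neq_0D:
  assumes "mobility z \<noteq> 0"
  shows "0 < dens p z" "0 < dens_star p z" "0 < dens' p z" "0 < dens_star' p z"
  using assms dens_nonneg[of z] unfolding mobility_eq_0_iff by (auto simp: less_le)

lemma dual_density_nonneg: "z \<in> space M \<Longrightarrow> 0 \<le> dual_density z"
  unfolding dual_density_def using Psi_nonneg[OF A] mobility_nonneg[of z] kern_pos_M[of z]
  by (simp add: less_imp_le)

lemma dual_density_measurable: "dual_density \<in> borel_measurable M"
  unfolding dual_density_def[abs_def]
proof (intro measurable_If)
  have P: "(\<lambda>z. \<Psi> (flux z / (mobility z * kern B (snd z)))) \<in> borel_measurable M"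
    by (rule measurable_compose[OF _ Psi_measurable[OF A]])
       (intro borel_measurable_divide CR_measurable[OF T CR] borel_measurable_times mobility_measurable kern_measurable_M)
  show "(\<lambda>z. \<Psi> (flux z / (mobility z * kern B (snd z))) * mobility z * kern B (snd z)) \<in> borel_measurable M"
    by (intro borel_measurable_times P mobility_measurable kern_measurable_M)
  have "Measurable.pred M (\<lambda>z. mobility z = 0)" using mobility_measurable by measurable
  then show "{z \<in> space M. mobility z = 0} \<in> sets M" by (simp add: pred_def)
qed simp

lemma log_gradient_measurable: "log_gradient \<in> borel_measurable M"
  unfolding log_gradient_def[abs_def]
proof (intro measurable_If borel_measurable_diff borel_measurable_const)
  show "(\<lambda>z. ln (dens' p z * dens_star' p z)) \<in> borel_measurable M" "(\<lambda>z. ln (dens p z * dens_star p z)) \<in> borel_measurable M"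
    by (intro borel_measurable_ln borel_measurable_times dens_measurable)+
  have "Measurable.pred M (\<lambda>z. mobility z = 0)" using mobility_measurable by measurable
  then show "{z \<in> space M. mobility z = 0} \<in> sets M" by (simp add: pred_def)
qed

text \<open>The gap in Young's inequality as a real-valued density, with the entropy production in
  its first summand.\<close>

definition defect :: "real \<times> 'a \<times> 'a \<times> 'a \<Rightarrow> real" where
  "defect z = 1/4 * (log_gradient z * flux z) + (primal_rate z + 1/4 * dual_density z)"

lemma defect_nonneg:
  assumes z: "z \<in> space M"
  shows "0 \<le> defect z"
proof (cases "mobility z = 0")
  case True
  then show ?thesis using primal_rate_nonneg[OF z] by (simp add: defect_def log_gradient_def dual_density_def)
next
  case False
  note pos = mobility_neq_0D[OF False]
  show ?thesis
    using dissipation_defect(1)[OF A kern_pos_M[OF z] mult_pos_pos[OF pos(1,2)] mult_pos_pos[OF pos(3,4)], of "flux z"] False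
    by (simp add: defect_def log_gradient_def dual_density_def primal_rate_def mobility_def)
qed

text \<open>Where the mobility vanishes, only \<open>primal_rate\<close> survives in the defect, and
  G vanishes only on the diagonal; together with zero flux this is the flux formula with both
  products equal. Elsewhere it is the equality case of \<open>dissipation_defect\<close>.\<close>

lemma defect_eq_0_iff:
  assumes z: "z \<in> space M" and flux: "mobility z = 0 \<longrightarrow> flux z = 0"
  shows "defect z = 0 \<longleftrightarrow> flux_formula z"
proof (cases "mobility z = 0")
  case True
  have "defect z = 0 \<longleftrightarrow> primal_rate z = 0" using True by (simp add: defect_def log_gradient_def dual_density_def)
  also have "\<dots> \<longleftrightarrow> dens p z * dens_star p z = dens' p z * dens_star' p z"
    using structural_assumptionsD(18)[OF A, rule_format, of "dens p z * dens_star p z" "dens' p z * dens_star' p z"]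
      dens_nonneg[of z] kern_pos_M[OF z] by (simp add: primal_rate_def)
  also have "\<dots> \<longleftrightarrow> flux_formula z" using True flux kern_pos_M[OF z] by (simp add: flux_formula_def)
  finally show ?thesis .
next
  case False
  note pos = mobility_neq_0D[OF False]
  show ?thesis
    using dissipation_defect(2)[OF A kern_pos_M[OF z] mult_pos_pos[OF pos(1,2)] mult_pos_pos[OF pos(3,4)], of "flux z"] False
    by (simp add: defect_def log_gradient_def dual_density_def primal_rate_def mobility_def flux_formula_def)
qed

lemma truncated_gradient_tendsto:
  assumes "mobility z = 0 \<longrightarrow> flux z = 0"
  shows "(\<lambda>n. truncated_gradient n z * flux z) \<longlonglongrightarrow> log_gradient z * flux z"
proof (cases "mobility z = 0")
  case True
  then show ?thesis using assms by simp
next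
  case False
  have "\<forall>\<^sub>F n in sequentially. truncated_gradient n z * flux z = log_gradient z * flux z"
    using clamped_gradient_eventually[OF mobility_neq_0D[OF False]]
    by eventually_elim (use False in \<open>simp add: truncated_gradient_def log_gradient_def\<close>)
  then show ?thesis by (rule tendsto_eventually)
qed

lemma truncated_gradient_bound:
  assumes z: "z \<in> space M" and flux: "mobility z = 0 \<longrightarrow> flux z = 0"
  shows "\<bar>truncated_gradient n z * flux z\<bar> \<le>
    3 / averaging_exponent TYPE('a) * (4 * primal_rate z + 2 * dual_density z + envelope z)"
proof (cases "mobility z = 0")
  case True
  then show ?thesis
    using flux averaging_exponent_bounds[where 'a='a] primal_rate_nonneg[OF z] dual_density_nonneg[OF z] envelope_nonneg[OF z] by simp
next
  case False
  note pos = mobility_neq_0D[OF False]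
  have l: "0 < averaging_exponent TYPE('a)" "averaging_exponent TYPE('a) < 1"
    using averaging_exponent_bounds[where 'a='a] by auto
  have "1 \<le> real (Suc n)" by simp
  from gradient_flux_bound[OF A this l kern_pos_M[OF z] dens_nonneg[of z] mult_pos_pos[OF pos(1,2)] mult_pos_pos[OF pos(3,4)], of "flux z"]
  show ?thesis
    using False by (simp add: truncated_gradient_def primal_rate_def dual_density_def envelope_def mobility_def mult.assoc)
qed

section \<open>Representation of the functional by the integrated defect\<close>

abbreviation (input) "total_dissipation \<equiv> \<integral>\<^sup>+z. ennreal (primal_rate z) + ennreal (1/4) * dual_rate z \<partial>M"

text \<open>The value infinity of \<open>dual_rate\<close> at a nonzero flux with zero mobility can
  occur only on a null set once the integral is finite. From there on, real-valued integrable
  densities replace extended ones.\<close>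

lemma finite_dissipation:
  assumes fin: "total_dissipation < \<infinity>"
  shows "integrable M primal_rate" "integrable M dual_density" "AE z in M. mobility z = 0 \<longrightarrow> flux z = 0"
    "total_dissipation = ennreal (\<integral>z. primal_rate z + 1/4 * dual_density z \<partial>M)"
proof -
  have pm: "(\<lambda>z. ennreal (primal_rate z)) \<in> borel_measurable M"
    by (rule measurable_compose[OF primal_rate_measurable measurable_ennreal])
  have dm: "(\<lambda>z. ennreal (1/4) * dual_rate z) \<in> borel_measurable M"
    by (intro borel_measurable_times_ennreal borel_measurable_const dual_rate_measurable)
  have split: "total_dissipation = (\<integral>\<^sup>+z. ennreal (primal_rate z) \<partial>M) + ennreal (1/4) * (\<integral>\<^sup>+z. dual_rate z \<partial>M)"
    by (simp add: nn_integral_add[OF pm dm] nn_integral_cmult[OF dual_rate_measurable])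
  show ip: "integrable M primal_rate"
    using fin split by (intro integrableI_nonneg primal_rate_measurable AE_I2 primal_rate_nonneg) auto
  have dfin: "(\<integral>\<^sup>+z. dual_rate z \<partial>M) < \<infinity>"
    using fin unfolding split by (auto simp: ennreal_mult_less_top less_top[symmetric] ennreal_mult_eq_top_iff)
  have "AE z in M. dual_rate z \<noteq> \<infinity>"
    using dfin by (intro nn_integral_PInf_AE dual_rate_measurable) auto
  then show supp: "AE z in M. mobility z = 0 \<longrightarrow> flux z = 0"
    by eventually_elim (auto simp: dual_rate_eq split: if_splits)
  have eq: "AE z in M. dual_rate z = ennreal (dual_density z)"
    using supp by eventually_elim (auto simp: dual_rate_eq dual_density_def)
  show id: "integrable M dual_density"
    using dfin nn_integral_cong_AE[OF eq] by (intro integrableI_nonneg dual_density_measurable AE_I2 dual_density_nonneg) auto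
  have nn: "AE z in M. 0 \<le> primal_rate z + 1/4 * dual_density z"
    by (rule AE_I2) (simp add: primal_rate_nonneg dual_density_nonneg)
  have "AE z in M. ennreal (primal_rate z) + ennreal (1/4) * dual_rate z = ennreal (primal_rate z + 1/4 * dual_density z)"
    using eq AE_space
  proof eventually_elim
    case (elim z)
    then show ?case
      using primal_rate_nonneg[of z] dual_density_nonneg[of z] ennreal_mult[of "1/4" "dual_density z"] by simp
  qed
  from nn_integral_cong_AE[OF this]
  show "total_dissipation = ennreal (\<integral>z. primal_rate z + 1/4 * dual_density z \<partial>M)"
    using nn_integral_eq_integral[OF Bochner_Integration.integrable_add[OF ip integrable_mult_right[OF id]] nn] by simp
qed

lemma L_functional_eq: "L_functional \<Psi> \<theta> G B T f U = entropy (f T) - entropy (f 0) + enn2ereal total_dissipation"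
  unfolding L_functional_def dissipation_eq ..

lemma entropy_finite_limit:
  assumes "entropy (f 0) < \<infinity>"
  obtains r where "entropy (f 0) = ereal r"
    "(\<lambda>n. (\<integral>v. trunc_entropy (real (Suc n)) (f 0 v) \<partial>lborel) + 1) \<longlonglongrightarrow> r"
proof -
  have t0: "0 \<in> {0..T}" using T by simp
  obtain r where r: "entropy (f 0) = ereal r"
    using assms entropy_limit_time(2)[OF t0] by (cases "entropy (f 0)") auto
  show ?thesis using entropy_limit_time(1)[OF t0] that[OF r] unfolding r by simp
qed

text \<open>Dominated convergence in the truncated chain rule; the majorant is the one of
  \<open>truncated_gradient_bound\<close>, integrable because the dissipation is finite and the
  envelope is integrable.\<close>

lemma L_functional_finite:
  assumes E: "entropy (f 0) < \<infinity>" and fin: "total_dissipation < \<infinity>"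
  shows "integrable M defect" "L_functional \<Psi> \<theta> G B T f U = ereal (\<integral>z. defect z \<partial>M)"
proof -
  note F = finite_dissipation[OF fin]
  define e where "e t n = (\<integral>v. trunc_entropy (real (Suc n)) (f t v) \<partial>lborel) + 1" for t n
  define w where "w z = 3 / averaging_exponent TYPE('a) * (4 * primal_rate z + 2 * dual_density z + envelope z)" for z
  have w: "integrable M w"
    unfolding w_def by (intro integrable_mult_right Bochner_Integration.integrable_add F(1,2) envelope_integrable)
  have lgm: "(\<lambda>z. log_gradient z * flux z) \<in> borel_measurable M"
    by (intro borel_measurable_times log_gradient_measurable CR_measurable[OF T CR])
  have tgm: "(\<lambda>z. truncated_gradient n z * flux z) \<in> borel_measurable M" for n
    by (rule borel_measurable_integrable[OF truncated_gradient_flux(1)])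
  have lim: "AE z in M. (\<lambda>n. truncated_gradient n z * flux z) \<longlonglongrightarrow> log_gradient z * flux z"
    using F(3) by eventually_elim (rule truncated_gradient_tendsto)
  have bound: "AE z in M. norm (truncated_gradient n z * flux z) \<le> w z" for n
    using F(3) AE_space by eventually_elim (use truncated_gradient_bound in \<open>simp only: w_def real_norm_def\<close>)
  have ilg: "integrable M (\<lambda>z. log_gradient z * flux z)"
    by (rule integrable_dominated_convergence[OF lgm tgm w lim bound])
  have "(\<lambda>n. \<integral>z. truncated_gradient n z * flux z \<partial>M) \<longlonglongrightarrow> (\<integral>z. log_gradient z * flux z \<partial>M)"
    by (rule integral_dominated_convergence[OF lgm tgm w lim bound])
  then have "(\<lambda>n. 1/4 * (\<integral>z. truncated_gradient n z * flux z \<partial>M)) \<longlonglongrightarrow> 1/4 * (\<integral>z. log_gradient z * flux z \<partial>M)"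
    by (intro tendsto_mult tendsto_const)
  moreover have "e T n - e 0 n = 1/4 * (\<integral>z. truncated_gradient n z * flux z \<partial>M)" for n
    unfolding e_def using truncated_gradient_flux(2)[of n] by simp
  ultimately have d: "(\<lambda>n. e T n - e 0 n) \<longlonglongrightarrow> 1/4 * (\<integral>z. log_gradient z * flux z \<partial>M)" by (simp only:)
  obtain r where r: "entropy (f 0) = ereal r" "e 0 \<longlonglongrightarrow> r"
    using entropy_finite_limit[OF E] unfolding e_def by metis
  have "(\<lambda>n. (e T n - e 0 n) + e 0 n) \<longlonglongrightarrow> 1/4 * (\<integral>z. log_gradient z * flux z \<partial>M) + r"
    by (rule tendsto_add[OF d r(2)])
  then have "(\<lambda>n. ereal (e T n)) \<longlonglongrightarrow> ereal (1/4 * (\<integral>z. log_gradient z * flux z \<partial>M) + r)" by simp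
  moreover have "(\<lambda>n. ereal (e T n)) \<longlonglongrightarrow> entropy (f T)"
    unfolding e_def using T by (intro entropy_limit_time(1)) simp
  \<comment> \<open>Finiteness of the final entropy is an outcome here: two limits of the same
    sequence are compared, and one of them is real.\<close>
  ultimately have ET: "entropy (f T) = ereal (1/4 * (\<integral>z. log_gradient z * flux z \<partial>M) + r)"
    by (rule LIMSEQ_unique[symmetric])
  have ipd: "integrable M (\<lambda>z. primal_rate z + 1/4 * dual_density z)"
    by (intro Bochner_Integration.integrable_add integrable_mult_right F(1,2))
  show "integrable M defect"
    unfolding defect_def[abs_def] by (intro Bochner_Integration.integrable_add integrable_mult_right ilg ipd F(1,2))
  have "(\<integral>z. defect z \<partial>M) = (\<integral>z. 1/4 * (log_gradient z * flux z) \<partial>M) + (\<integral>z. primal_rate z + 1/4 * dual_density z \<partial>M)"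
    unfolding defect_def by (rule Bochner_Integration.integral_add[OF integrable_mult_right[OF ilg] ipd])
  moreover have "0 \<le> (\<integral>z. primal_rate z + 1/4 * dual_density z \<partial>M)"
    by (intro Bochner_Integration.integral_nonneg_AE AE_I2) (simp add: primal_rate_nonneg dual_density_nonneg)
  ultimately show "L_functional \<Psi> \<theta> G B T f U = ereal (\<integral>z. defect z \<partial>M)"
    unfolding L_functional_eq ET r(1) F(4) by simp
qed

text \<open>The initial entropy is real and the final one is not minus infinity, so the infinite
  dissipation meets no indeterminate difference.\<close>

lemma L_functional_infinite:
  assumes E: "entropy (f 0) < \<infinity>" and fin: "\<not> total_dissipation < \<infinity>"
  shows "L_functional \<Psi> \<theta> G B T f U = \<infinity>"
proof -
  have "total_dissipation = \<infinity>" using fin by (simp add: less_top[symmetric])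
  then have top: "enn2ereal total_dissipation = \<infinity>" by simp
  obtain r where r: "entropy (f 0) = ereal r" using entropy_finite_limit[OF E] by metis
  have "T \<in> {0..T}" using T by simp
  then have "entropy (f T) \<noteq> - \<infinity>" by (rule entropy_limit_time(2))
  then show ?thesis unfolding L_functional_eq top r by (cases "entropy (f T)") auto
qed

text \<open>On positive mobility the truncated products converge and the equality case of Young's
  inequality identifies the limit. If exactly one of the two products of densities vanishes, the
  flux is nonzero and the truncated products diverge with the sign that matches the infinite left
  side; if both vanish, the left side is 0.\<close>

lemma flux_formula_liminf:
  assumes z: "z \<in> space M" and ff: "flux_formula z"
  shows "ennreal (primal_rate z) + ennreal (1/4) * dual_rate z \<le>
    liminf (\<lambda>n. ennreal (- (truncated_gradient n z * flux z) + envelope z / averaging_exponent TYPE('a)))"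
proof -
  define c where "c = envelope z / averaging_exponent TYPE('a)"
  have c: "0 \<le> c" using envelope_nonneg[OF z] averaging_exponent_bounds[where 'a='a] by (simp add: c_def)
  note k = kern_pos_M[OF z] and nn = dens_nonneg[of z]
  have u: "flux z = (dens p z * dens_star p z - dens' p z * dens_star' p z) * kern B (snd z)"
    using ff by (simp add: flux_formula_def)
  have blow_up: "?thesis" if "filterlim (\<lambda>n. - (truncated_gradient n z * flux z)) at_top sequentially"
  proof -
    have "filterlim (\<lambda>n. c + - (truncated_gradient n z * flux z)) at_top sequentially"
      by (rule filterlim_tendsto_add_at_top[OF tendsto_const that])
    then have "filterlim (\<lambda>n. - (truncated_gradient n z * flux z) + c) at_top sequentially" by (simp add: add.commute)
    then have "(\<lambda>n. ennreal (- (truncated_gradient n z * flux z) + c)) \<longlonglongrightarrow> \<infinity>"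
      by (simp add: ennreal_tendsto_top_eq_at_top)
    from lim_imp_Liminf[OF _ this] show ?thesis by (simp add: c_def)
  qed
  consider "mobility z \<noteq> 0" | "dens p z * dens_star p z = 0" "dens' p z * dens_star' p z = 0"
    | "dens p z * dens_star p z > 0" "dens' p z * dens_star' p z = 0"
    | "dens p z * dens_star p z = 0" "dens' p z * dens_star' p z > 0"
    using nn unfolding mobility_eq_0_iff by (metis less_eq_real_def mult_nonneg_nonneg)
  then show ?thesis
  proof cases
    case 1
    have "(\<lambda>n. - (truncated_gradient n z * flux z) + c) \<longlonglongrightarrow> - (log_gradient z * flux z) + c"
      using 1 by (intro tendsto_add tendsto_minus tendsto_const truncated_gradient_tendsto) simp
    then have "(\<lambda>n. ennreal (- (truncated_gradient n z * flux z) + c)) \<longlonglongrightarrow> ennreal (- (log_gradient z * flux z) + c)"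
      by (rule tendsto_ennrealI)
    from lim_imp_Liminf[OF _ this]
    have lim: "liminf (\<lambda>n. ennreal (- (truncated_gradient n z * flux z) + c)) = ennreal (- (log_gradient z * flux z) + c)" by simp
    \<comment> \<open>A vanishing defect makes minus the log gradient times the flux equal to four
      times the dissipation density, so the required inequality has room to spare.\<close>
    have "defect z = 0" using defect_eq_0_iff[OF z] ff 1 by simp
    then have d: "- (log_gradient z * flux z) = 4 * primal_rate z + dual_density z" unfolding defect_def by linarith
    have "ennreal (primal_rate z) + ennreal (1/4) * dual_rate z = ennreal (primal_rate z + 1/4 * dual_density z)"
    proof -
      have "dual_rate z = ennreal (dual_density z)" using 1 by (simp add: dual_rate_eq dual_density_def)
      then show ?thesis
        using primal_rate_nonneg[OF z] dual_density_nonneg[OF z] ennreal_mult[of "1/4" "dual_density z"] by simp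
    qed
    also have "\<dots> \<le> ennreal (- (log_gradient z * flux z) + c)"
      unfolding d using c primal_rate_nonneg[OF z] dual_density_nonneg[OF z] by (intro ennreal_leI) linarith
    finally show ?thesis using lim by (simp add: c_def)
  next
    case 2
    have "primal_rate z = 0"
      using structural_assumptionsD(18)[OF A, rule_format, of 0 0] by (simp add: primal_rate_def 2)
    moreover have "dual_rate z = 0" using u 2 by (simp add: dual_rate_eq mobility_eq_0_iff)
    ultimately show ?thesis by simp
  next
    case 3
    then have ab: "0 < dens p z" "0 < dens_star p z" using nn by (auto simp: less_le)
    have pos: "0 < dens p z * dens_star p z * kern B (snd z)" using 3 k by simp
    have "filterlim (\<lambda>n. (dens p z * dens_star p z * kern B (snd z)) * - truncated_gradient n z) at_top sequentially"
      unfolding truncated_gradient_def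
      by (rule filterlim_tendsto_pos_mult_at_top[OF tendsto_const pos clamped_gradient_at_bot[OF nn(3,4) ab 3(2)]])
    then show ?thesis by (intro blow_up) (simp add: u 3 mult.commute)
  next
    case 4
    then have ab: "0 < dens' p z" "0 < dens_star' p z" using nn by (auto simp: less_le)
    have pos: "0 < dens' p z * dens_star' p z * kern B (snd z)" using 4 k by simp
    have "filterlim (\<lambda>n. (dens' p z * dens_star' p z * kern B (snd z)) * truncated_gradient n z) at_top sequentially"
      unfolding truncated_gradient_def clamped_gradient_swap[of _ "dens p z"]
      by (rule filterlim_tendsto_pos_mult_at_top[OF tendsto_const pos clamped_gradient_at_bot[OF nn(1,2) ab 4(1)]])
    then show ?thesis by (intro blow_up) (simp add: u 4 mult.commute)
  qed
qed

text \<open>Adding the envelope makes the negated truncated products nonnegative, so Fatou's lemma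
  applies without any prior control of the dissipation. Their integrals are the truncated entropy
  differences plus a constant, and these are eventually bounded above.\<close>

lemma flux_formula_finite_dissipation:
  assumes E: "entropy (f 0) < \<infinity>" and ff: "AE z in M. flux_formula z"
  shows "total_dissipation < \<infinity>"
proof -
  define l where "l = averaging_exponent TYPE('a)"
  have l: "0 < l" "l < 1" using averaging_exponent_bounds[where 'a='a] by (auto simp: l_def)
  define e where "e t n = (\<integral>v. trunc_entropy (real (Suc n)) (f t v) \<partial>lborel) + 1" for t n
  define h where "h n z = - (truncated_gradient n z * flux z) + envelope z / l" for n z
  have hi: "integrable M (h n)" for n
    unfolding h_def by (intro Bochner_Integration.integrable_add integrable_minus integrable_divide truncated_gradient_flux(1) envelope_integrable)
  have h0: "AE z in M. 0 \<le> h n z" for n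
    using ff AE_space
  proof eventually_elim
    case (elim z)
    have k: "0 \<le> kern B (snd z)" using kern_pos_M[OF elim(2)] by simp
    have "1 \<le> real (Suc n)" by simp
    from mult_right_mono[OF clamped_gradient_lower_bound[OF this l dens_nonneg[of z]] k]
    show ?case using elim(1) by (simp add: h_def flux_formula_def truncated_gradient_def envelope_def l_def mult.assoc)
  qed
  have hint: "(\<integral>\<^sup>+z. ennreal (h n z) \<partial>M) = ennreal (4 * (e 0 n - e T n) + (\<integral>z. envelope z \<partial>M) / l)" for n
  proof -
    have "(\<integral>z. h n z \<partial>M) = - (\<integral>z. truncated_gradient n z * flux z \<partial>M) + (\<integral>z. envelope z \<partial>M) / l"
      unfolding h_def using truncated_gradient_flux(1)[of n] envelope_integrable by simp
    also have "(\<integral>z. truncated_gradient n z * flux z \<partial>M) = 4 * (e T n - e 0 n)"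
      using truncated_gradient_flux(2)[of n] by (simp add: e_def)
    finally have "(\<integral>z. h n z \<partial>M) = 4 * (e 0 n - e T n) + (\<integral>z. envelope z \<partial>M) / l" by simp
    then show ?thesis using nn_integral_eq_integral[OF hi h0] by simp
  qed
  obtain r where r: "entropy (f 0) = ereal r" "e 0 \<longlonglongrightarrow> r"
    using entropy_finite_limit[OF E] unfolding e_def by metis
  have tT: "T \<in> {0..T}" using T by simp
  \<comment> \<open>At this stage the final entropy may still be infinite; a real number strictly
    below it is enough to bound the truncated entropies at time T from below.\<close>
  obtain s where s: "ereal s < entropy (f T)"
    using entropy_limit_time(2)[OF tT] ereal_dense2[of "- \<infinity>" "entropy (f T)"] by auto
  have limT: "(\<lambda>n. ereal (e T n)) \<longlonglongrightarrow> entropy (f T)"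
    unfolding e_def by (rule entropy_limit_time(1)[OF tT])
  have "\<forall>\<^sub>F n in sequentially. e 0 n < r + 1" by (rule order_tendstoD(2)[OF r(2)]) simp
  with order_tendstoD(1)[OF limT s]
  have ev: "\<forall>\<^sub>F n in sequentially. (\<integral>\<^sup>+z. ennreal (h n z) \<partial>M) \<le> ennreal (4 * (r + 1 - s) + (\<integral>z. envelope z \<partial>M) / l)"
    by eventually_elim (auto simp: hint intro!: ennreal_leI)
  have "total_dissipation \<le> (\<integral>\<^sup>+z. liminf (\<lambda>n. ennreal (h n z)) \<partial>M)"
    using ff AE_space
    by (intro nn_integral_mono_AE, eventually_elim) (simp only: h_def l_def flux_formula_liminf)
  also have "\<dots> \<le> liminf (\<lambda>n. \<integral>\<^sup>+z. ennreal (h n z) \<partial>M)"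
    by (intro nn_integral_liminf measurable_compose[OF borel_measurable_integrable[OF hi] measurable_ennreal])
  also have "\<dots> \<le> limsup (\<lambda>n. \<integral>\<^sup>+z. ennreal (h n z) \<partial>M)" by (rule Liminf_le_Limsup) simp
  also have "\<dots> \<le> ennreal (4 * (r + 1 - s) + (\<integral>z. envelope z \<partial>M) / l)" by (rule Limsup_bounded[OF ev])
  also have "\<dots> < \<infinity>" by simp
  finally show ?thesis .
qed

lemma L_functional_nonneg:
  assumes E: "entropy (f 0) < \<infinity>"
  shows "0 \<le> L_functional \<Psi> \<theta> G B T f U"
proof (cases "total_dissipation < \<infinity>")
  case True
  have "0 \<le> (\<integral>z. defect z \<partial>M)" by (intro Bochner_Integration.integral_nonneg_AE AE_I2 defect_nonneg)
  then show ?thesis using L_functional_finite(2)[OF E True] by simp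
qed (simp add: L_functional_infinite[OF E])

lemma L_functional_eq_0_iff:
  assumes E: "entropy (f 0) < \<infinity>"
  shows "L_functional \<Psi> \<theta> G B T f U = 0 \<longleftrightarrow> (AE z in M. flux_formula z)"
proof (cases "total_dissipation < \<infinity>")
  case True
  note L = L_functional_finite[OF E True]
  have "L_functional \<Psi> \<theta> G B T f U = 0 \<longleftrightarrow> (\<integral>z. defect z \<partial>M) = 0" unfolding L(2) by simp
  also have "\<dots> \<longleftrightarrow> (AE z in M. defect z = 0)"
    by (rule integral_nonneg_eq_0_iff_AE[OF L(1)]) (rule AE_I2, rule defect_nonneg)
  also have "\<dots> \<longleftrightarrow> (AE z in M. flux_formula z)"
  proof
    assume "AE z in M. defect z = 0"
    with finite_dissipation(3)[OF True] AE_space show "AE z in M. flux_formula z"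
      by eventually_elim (simp add: defect_eq_0_iff)
  next
    assume "AE z in M. flux_formula z"
    with finite_dissipation(3)[OF True] AE_space show "AE z in M. defect z = 0"
      by eventually_elim (simp add: defect_eq_0_iff)
  qed
  finally show ?thesis .
next
  \<comment> \<open>Both sides fail: the functional is infinite, and the flux formula would force
    the dissipation to be finite.\<close>
  case False
  then show ?thesis using L_functional_infinite[OF E False] flux_formula_finite_dissipation[OF E] by auto
qed

section \<open>From the flux formula to the Boltzmann equation\<close>

lemma second_moment_bound:
  "\<exists>C. \<forall>t\<in>{0..T}. (\<integral>\<^sup>+v. ennreal ((japanese v)\<^sup>2 * f t v) \<partial>lborel) \<le> ennreal C"
proof -
  define s where "s = max 0 \<gamma>"
  have s: "0 \<le> s" by (simp add: s_def)
  define S where "S = (SUP t\<in>{0..T}. \<integral>\<^sup>+v. ennreal (norm v powr (2 + s) * f t v) \<partial>lborel)"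
  define K where "K = ennreal (2 powr (2 + s)) * (1 + S)"
  have "K < \<infinity>" using moment by (simp add: K_def S_def s_def ennreal_mult_less_top)
  then have K: "K = ennreal (enn2real K)" by simp
  have "(\<integral>\<^sup>+v. ennreal ((japanese v)\<^sup>2 * f t v) \<partial>lborel) \<le> K" if t: "t \<in> {0..T}" for t
  proof -
    note d = CR_density[OF T CR t]
    have "(japanese v)\<^sup>2 \<le> japanese v powr (2 + s)" for v :: 'a
    proof -
      have "(japanese v)\<^sup>2 = japanese v powr 2" using japanese_pos[of v] by simp
      also have "\<dots> \<le> japanese v powr (2 + s)" using japanese_ge_1[of v] s by (intro powr_mono) auto
      finally show ?thesis .
    qed
    then have "(\<integral>\<^sup>+v. ennreal ((japanese v)\<^sup>2 * f t v) \<partial>lborel) \<le> (\<integral>\<^sup>+v. ennreal (japanese v powr (2 + s) * f t v) \<partial>lborel)"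
      using prob_density_integrable(4)[OF d] by (intro nn_integral_mono ennreal_leI mult_right_mono)
    also have "\<dots> \<le> ennreal (2 powr (2 + s)) * (1 + (\<integral>\<^sup>+v. ennreal (norm v powr (2 + s) * f t v) \<partial>lborel))"
      by (rule moment_japanese[OF s d])
    also have "\<dots> \<le> K"
      unfolding K_def S_def using t by (intro mult_left_mono add_left_mono SUP_upper) auto
    finally show ?thesis .
  qed
  then show ?thesis using K by metis
qed

text \<open>The flux formula holds only almost everywhere in time and collision, and for the version
  of \<open>f\<close>. The right-hand sides therefore agree for almost every time, which a
  distributional derivative does not notice; the passage from the version back to \<open>f\<close>
  is made at each fixed time.\<close>

lemma boltzmann_weak_form:
  assumes ff: "AE z in M. flux_formula z" and \<phi>: "continuous_on UNIV \<phi>" "bounded (range \<phi>)"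
  shows "has_dist_deriv T (\<lambda>t. \<integral>v. \<phi> v * f t v \<partial>lborel)
    (\<lambda>t. - (1/4) * (\<integral>x. coll_grad \<phi> x * (post_prod (f t) x - pre_prod (f t) x) * kern B x \<partial>Omega))"
proof -
  interpret O: sigma_finite_measure "Omega :: ('a \<times> 'a \<times> 'a) measure" by (rule sigma_finite_Omega)
  interpret t: sigma_finite_measure "time_measure T" by (rule sigma_finite_time_measure)
  interpret P: pair_sigma_finite "time_measure T" "Omega :: ('a \<times> 'a \<times> 'a) measure" ..
  have \<phi>m: "\<phi> \<in> borel_measurable borel" by (rule borel_measurable_continuous_onI[OF \<phi>(1)])
  obtain C where C: "\<And>v. \<bar>\<phi> v\<bar> \<le> C" using \<phi>(2) by (auto simp: bounded_iff)
  have C0: "0 \<le> C" using C[of 0] by simp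
  have cgm: "coll_grad \<phi> \<in> borel_measurable Omega"
    unfolding coll_grad_eq[abs_def]
    by (intro borel_measurable_diff borel_measurable_add measurable_compose[OF _ \<phi>m] Omega_components_measurable
        measurable_compose[OF coll_measurable Omega_components_measurable(1)]
        measurable_compose[OF exchange_measurable Omega_components_measurable(1)]
        measurable_compose[OF measurable_compose[OF coll_measurable exchange_measurable] Omega_components_measurable(1)])
  have cgC: "\<bar>coll_grad \<phi> x\<bar> \<le> 4 * C" for x
    unfolding coll_grad_eq
    using C[of "fst (coll x)"] C[of "fst (exchange (coll x))"] C[of "fst x"] C[of "fst (exchange x)"] by linarith
  define W where "W z = (dens p z * dens_star p z - dens' p z * dens_star' p z) * kern B (snd z)" for z
  have Wm: "W \<in> borel_measurable M"
    unfolding W_def by (intro borel_measurable_times borel_measurable_diff dens_measurable kern_measurable_M)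
  have UW: "AE z in M. flux z = W z" using ff by (simp add: flux_formula_def W_def)
  have cgM: "(\<lambda>z. coll_grad \<phi> (snd z)) \<in> borel_measurable M" by (rule measurable_compose[OF measurable_snd cgm])
  have Ui: "integrable M (\<lambda>z. coll_grad \<phi> (snd z) * flux z)"
  proof (rule Bochner_Integration.integrable_bound[OF integrable_mult_right[OF CR_integrable[OF T CR], of "4 * C"]])
    show "(\<lambda>z. coll_grad \<phi> (snd z) * flux z) \<in> borel_measurable M"
      using cgM CR_measurable[OF T CR] by (rule borel_measurable_times)
    show "AE z in M. norm (coll_grad \<phi> (snd z) * flux z) \<le> norm (4 * C * flux z)"
      using cgC C0 by (intro AE_I2) (simp add: abs_mult mult_right_mono)
  qed
  have Wi: "integrable M (\<lambda>z. coll_grad \<phi> (snd z) * W z)"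
  proof (rule iffD1[OF integrable_cong_AE Ui])
    show "AE z in M. coll_grad \<phi> (snd z) * flux z = coll_grad \<phi> (snd z) * W z"
      using UW by eventually_elim simp
  qed (use borel_measurable_integrable[OF Ui] borel_measurable_times[OF cgM Wm] in auto)
  define h where "h t = 1/4 * (\<integral>x. coll_grad \<phi> x * U t x \<partial>Omega)" for t
  define h' where "h' t = 1/4 * (\<integral>x. coll_grad \<phi> x * W (t, x) \<partial>Omega)" for t
  have hi: "set_integrable lborel {0..T} h"
    using integrable_mult_right[OF P.integrable_fst'[OF Ui], of "1/4"] unfolding h_def integrable_time_measure[symmetric] by simp
  have hi': "set_integrable lborel {0..T} h'"
    using integrable_mult_right[OF P.integrable_fst'[OF Wi], of "1/4"] unfolding h'_def integrable_time_measure[symmetric] by simp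
  have sec: "(\<lambda>x. g (t, x)) \<in> borel_measurable Omega" if "g \<in> borel_measurable M" "t \<in> {0..T}" for g :: "real \<times> 'a \<times> 'a \<times> 'a \<Rightarrow> real" and t
    by (rule measurable_compose[OF measurable_Pair1' that(1)]) (use that(2) in \<open>simp add: space_time_measure\<close>)
  have "AE t in time_measure T. AE x in Omega. flux (t, x) = W (t, x)" using P.AE_pair[OF UW] .
  then have "AE t in time_measure T. h t = h' t"
    using AE_space
  proof eventually_elim
    case (elim t)
    then have t: "t \<in> {0..T}" by (simp add: space_time_measure)
    have "(\<integral>x. coll_grad \<phi> x * U t x \<partial>Omega) = (\<integral>x. coll_grad \<phi> x * W (t, x) \<partial>Omega)"
    proof (rule integral_cong_AE)
      show "(\<lambda>x. coll_grad \<phi> x * U t x) \<in> borel_measurable Omega"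
        using borel_measurable_times[OF cgm sec[OF CR_measurable[OF T CR] t]] by simp
      show "(\<lambda>x. coll_grad \<phi> x * W (t, x)) \<in> borel_measurable Omega"
        by (rule borel_measurable_times[OF cgm sec[OF Wm t]])
      show "AE x in Omega. coll_grad \<phi> x * U t x = coll_grad \<phi> x * W (t, x)" using elim(1) by eventually_elim simp
    qed
    then show ?case by (simp add: h_def h'_def)
  qed
  then have hh': "AE t in lborel. t \<in> {0..T} \<longrightarrow> h t = h' t" by (simp add: AE_time_measure)
  define h'' where "h'' t = - (1/4) * (\<integral>x. coll_grad \<phi> x * (post_prod (f t) x - pre_prod (f t) x) * kern B x \<partial>Omega)" for t
  have h'': "h' t = h'' t" if t: "t \<in> {0..T}" for t
  proof -
    note fm = prob_density_integrable(3)[OF CR_density[OF T CR t]]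
    have "(\<integral>x. coll_grad \<phi> x * W (t, x) \<partial>Omega) = (\<integral>x. - (coll_grad \<phi> x * (post_prod (f t) x - pre_prod (f t) x) * kern B x) \<partial>Omega)"
    proof (rule integral_cong_AE)
      show "(\<lambda>x. coll_grad \<phi> x * W (t, x)) \<in> borel_measurable Omega"
        by (rule borel_measurable_times[OF cgm sec[OF Wm t]])
      have "pre_prod (f t) \<in> borel_measurable Omega" "post_prod (f t) \<in> borel_measurable Omega"
        unfolding pre_prod_dens[abs_def] post_prod_dens[abs_def] dens_def dens_star_def dens'_def dens_star'_def
        by (auto intro!: borel_measurable_times measurable_compose[OF _ fm] Omega_components_measurable
            measurable_compose[OF coll_measurable Omega_components_measurable(1)] measurable_compose[OF coll_measurable Omega_components_measurable(2)])
      then show "(\<lambda>x. - (coll_grad \<phi> x * (post_prod (f t) x - pre_prod (f t) x) * kern B x)) \<in> borel_measurable Omega"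
        by (intro borel_measurable_uminus borel_measurable_times borel_measurable_diff cgm kern_measurable[OF B])
      show "AE x in Omega. coll_grad \<phi> x * W (t, x) = - (coll_grad \<phi> x * (post_prod (f t) x - pre_prod (f t) x) * kern B x)"
        using dens_AE[OF t] by eventually_elim (simp add: W_def pre_prod_dens post_prod_dens algebra_simps)
    qed
    then show ?thesis by (simp add: h'_def h''_def)
  qed
  have hi'': "set_integrable lborel {0..T} h''"
    using hi' h'' by (subst set_integrable_cong[OF refl refl, of _ _ h']) auto
  have "has_dist_deriv T (\<lambda>t. \<integral>v. \<phi> v * f t v \<partial>lborel) h"
    using CR \<phi> unfolding collision_rate_equation_def h_def by blast
  then have "has_dist_deriv T (\<lambda>t. \<integral>v. \<phi> v * f t v \<partial>lborel) h''"
    using hh' h'' by (intro has_dist_deriv_cong_AE[OF _ hi hi'']) auto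
  then show ?thesis unfolding h''_def .
qed

lemma flux_formula_boltzmann_solution:
  assumes ff: "AE z in M. flux_formula z"
  shows "boltzmann_solution B T f"
  unfolding boltzmann_solution_def
proof (intro conjI ballI allI impI)
  show "prob_density (f t)" if "t \<in> {0..T}" for t by (rule CR_density[OF T CR that])
  show "((\<lambda>t. \<integral>v. \<bar>f t v - f s v\<bar> \<partial>lborel) \<longlongrightarrow> 0) (at s within {0..T})" if "s \<in> {0..T}" for s
    by (rule flow_L1_continuous[OF T CR that])
  show "\<exists>C. AE t in lborel. t \<in> {0..T} \<longrightarrow> (\<integral>\<^sup>+v. ennreal ((japanese v)\<^sup>2 * f t v) \<partial>lborel) \<le> ennreal C"
  proof -
    obtain C where "\<forall>t\<in>{0..T}. (\<integral>\<^sup>+v. ennreal ((japanese v)\<^sup>2 * f t v) \<partial>lborel) \<le> ennreal C"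
      using second_moment_bound by blast
    then have "AE t in lborel. t \<in> {0..T} \<longrightarrow> (\<integral>\<^sup>+v. ennreal ((japanese v)\<^sup>2 * f t v) \<partial>lborel) \<le> ennreal C"
      by (intro AE_I2) blast
    then show ?thesis ..
  qed
  show "has_dist_deriv T (\<lambda>t. \<integral>v. \<phi> v * f t v \<partial>lborel)
      (\<lambda>t. - (1/4) * (\<integral>x. coll_grad \<phi> x * (post_prod (f t) x - pre_prod (f t) x) * kern B x \<partial>Omega))" if "test_fun UNIV \<phi>" for \<phi>
    by (rule boltzmann_weak_form[OF ff test_fun_continuous_bounded[OF that]])
qed

end

theorem theorem1p2:
  fixes B :: "'a::euclidean_space \<Rightarrow> 'a \<Rightarrow> real"
    and \<Psi> \<Psi>s :: "real \<Rightarrow> real"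
    and \<theta> G :: "real \<Rightarrow> real \<Rightarrow> real"
    and f :: "real \<Rightarrow> 'a \<Rightarrow> real"
    and U :: "real \<Rightarrow> 'a \<times> 'a \<times> 'a \<Rightarrow> real"
    and T \<gamma> :: real
  assumes "DIM('a) \<ge> 3"
    and "T > 0"
    and "collision_kernel \<gamma> B"
    and "structural_assumptions \<Psi> \<Psi>s \<theta> G"
    and "\<And>t. t \<in> {0..T} \<Longrightarrow> prob_density (f t)"
    and "entropy (f 0) < \<infinity>"
    and "(SUP t\<in>{0..T}. \<integral>\<^sup>+v. ennreal (norm v powr (2 + max 0 \<gamma>) * f t v) \<partial>lborel) < \<infinity>"
    and "collision_rate_equation T f U"
  shows "0 \<le> L_functional \<Psi> \<theta> G B T f U \<and>
    (L_functional \<Psi> \<theta> G B T f U = 0 \<longleftrightarrow>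
       boltzmann_solution B T f \<and>
       (AE t in lborel. t \<in> {0..T} \<longrightarrow>
          (AE x in Omega. U t x = (pre_prod (f t) x - post_prod (f t) x) * kern B x)))"
proof -
  note ctx = assms(2,3,4,7,8)
  show ?thesis
    \<comment> \<open>Given the collision rate equation, the flux formula implies the Boltzmann
      equation, so the vanishing of the functional has to be compared only with the flux
      formula.\<close>
    using L_functional_nonneg[OF ctx assms(6)] L_functional_eq_0_iff[OF ctx assms(6)] flux_formula_AE[OF ctx]
      flux_formula_boltzmann_solution[OF ctx] by blast
qed

end
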